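(* Let $\mathcal{A},\mathcal{A}'$ be order preserving systems of finite dimensional nest algebras (direct systems whose embeddings are star extendible and order preserving) and let $A_0,A_0'$ be their algebraic direct limits. Then $A_0$ and $A_0'$ are star extendibly isomorphic if, and only if, there is an isomorphism $\gamma\colon\mathrm{Inv}(A_0)\to\mathrm{Inv}(A_0')$ such that $\gamma(\Sigma_{\mathrm{op}}(A_0))=\Sigma_{\mathrm{op}}(A_0')$.
   Context: A finite dimensional nest algebra is a unital algebra $A\subseteq M_n(\mathbb{C})$ (or an operator algebra star extendibly isomorphic to one) associated with an ordered decomposition $1=q_1+\dots+q_l$ of the identity into nonzero orthogonal projections: $A$ consists of all $a\in M_n(\mathbb{C})$ with $(1-f)af=0$ for every $f=q_1+\dots+q_k$, $1\le k\le l$. The $q_i$ are the atoms of $A$; $A$ is the algebra of block upper triangular matrices for the block structure $v=(q_ivq_j)$, and $C^*(A)=M_n(\mathbb{C})$. A homomorphism (embedding) $\phi\colon A_1\to A_2$ is star extendible if it is the restriction of a $*$-homomorphism $C^*(A_1)\to C^*(A_2)$. $\mathrm{Pisom}_{\mathrm{reg}}(A)$ is the set of partial isometries $v\in A$ all of whose blocks $q_ivq_j$ are partial isometries. $\mathrm{Pisom}_{\mathrm{op}}(A)$ is the set of $v\in \mathrm{Pisom}_{\mathrm{reg}}(A)$ such that $q_ivq_j\neq 0$ implies $q_svq_t=0$ for all $(s,t)\neq(i,j)$ with $s\le i$, $t\ge j$. The embedding $\phi$ is order preserving if it maps $\mathrm{Pisom}_{\mathrm{op}}(A_1)$ into $\mathrm{Pisom}_{\mathrm{op}}(A_2)$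 (such $\phi$ maps regular partial isometries to regular partial isometries). Dimension distribution group of a nest algebra: $\mathcal{G}(A)$ is the free abelian group generated by the classes $[v]$ of rank one $v\in\mathrm{Pisom}_{\mathrm{reg}}(A)$, where $v\sim w$ iff $v=u_1wu_2$ for unitaries $u_1,u_2\in A$. It is identified with the group $T_l(\mathbb{Z})$ of upper triangular integer matrices (the class of a rank one $v=q_ivq_j$ is the matrix unit $(i,j)$). A general $v\in\mathrm{Pisom}_{\mathrm{reg}}(A)$ has class $[v]=(\operatorname{rank} q_ivq_j)_{i,j}$. $\Sigma(A)=\{[v]:v\in\mathrm{Pisom}_{\mathrm{reg}}(A)\}$, $\Sigma_{\mathrm{op}}(A)=\{[v]:v\in\mathrm{Pisom}_{\mathrm{op}}(A)\}$. $K_0(A)\cong\mathbb{Z}^l$ is identified with the subgroup of $\mathcal{G}(A)$ generated by classes of projections (diagonal matrices), with scale $\Sigma_0(A)=\{[p]:p\text{ a projection in }A\}$. $\pi_f,\pi_i\colon\mathcal{G}(A)\to K_0(A)$ are determined by $[v]\mapsto[vv^*]$ and $[v]\mapsto[v^*v]$ respectively. $\mathcal{G}(\phi)$ is determined by $[v]\mapsto[\phi(v)]$. Systems: $\mathcal{A}=\{A_k,\alpha_k\}$ with star extendible (injective) embeddings $\alpha_k\colon A_k\to A_{k+1}$. $\mathcal{G}(\mathcal{A})=\varinjlim(\mathcal{G}(A_k),\mathcal{G}(\alpha_k))$; $K_0(\mathcal{A})\subseteq\mathcal{G}(\mathcal{A})$ is the limit of the $K_0(A_k)$; $\Sigma(\mathcal{A})$,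 $\Sigma_0(\mathcal{A})$ are the unions of the images of the $\Sigma(A_k)$, $\Sigma_0(A_k)$; $\pi_f,\pi_i\colon\mathcal{G}(\mathcal{A})\to K_0(\mathcal{A})$ are the limit maps. $\mathrm{Inv}(\mathcal{A})=((\mathcal{G}(\mathcal{A}),\Sigma(\mathcal{A})),(K_0(\mathcal{A}),\Sigma_0(\mathcal{A})),\pi_f,\pi_i)$. $\Sigma_{\mathrm{op}}(\mathcal{A})\subseteq\mathcal{G}(\mathcal{A})$ consists of the images of those classes $[v]$ in $\mathcal{G}(A_k)$ (any $k$) for which $[i(v)]\in\Sigma_{\mathrm{op}}(A_n)$ for all system maps $i\colon A_k\to A_n$, $n>k$. An isomorphism of $\mathrm{Inv}$'s is a group isomorphism $\gamma\colon\mathcal{G}(\mathcal{A})\to\mathcal{G}(\mathcal{A}')$ with $\gamma(\Sigma(\mathcal{A}))=\Sigma(\mathcal{A}')$, $\gamma(K_0(\mathcal{A}))=K_0(\mathcal{A}')$, $\gamma(\Sigma_0(\mathcal{A}))=\Sigma_0(\mathcal{A}')$, $\gamma\circ\pi_i=\pi_i\circ\gamma$, $\gamma\circ\pi_f=\pi_f\circ\gamma$. For the algebraic limit $A_0$ of $\mathcal{A}$ one sets $\mathrm{Inv}(A_0)=\mathrm{Inv}(\mathcal{A})$ and $\Sigma_{\mathrm{op}}(A_0)=\Sigma_{\mathrm{op}}(\mathcal{A})$ (and likewise for $A_0'$). $A_0$ and $A_0'$ are star extendibly isomorphic if there is an algebra isomorphism $A_0\to A_0'$ which extends to a $*$-algebra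 isomorphism between the generated C*-algebras (the C*-algebra generated by $A_0$ being the C*-direct limit of the $C^*(A_k)$). *)

theory Defs
  imports
    Complex_Main
    "HOL-Algebra.Generated_Groups"
    "Jordan_Normal_Form.DL_Rank"
    "Jordan_Normal_Form.Schur_Decomposition"
begin

section \<open>Finite dimensional nest algebras\<close>

text \<open>A nest algebra in \<open>M\<^sub>n(\<complex>)\<close> is given by \<open>n\<close> and the ordered list of its atoms
  \<open>q\<^sub>1, \<dots>, q\<^sub>l\<close>.  List positions, and hence all block indices below, start at 0.
  The atoms are arbitrary (not necessarily diagonal) orthogonal projections.\<close>

record nest =
  msize :: nat
  atoms :: "complex mat list"

abbreviation full :: "nest \<Rightarrow> complex mat set" where
  "full A \<equiv> carrier_mat (msize A) (msize A)"

abbreviation natoms :: "nest \<Rightarrow> nat" where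
  "natoms A \<equiv> length (atoms A)"

definition is_projection :: "complex mat \<Rightarrow> bool" where
  "is_projection p \<longleftrightarrow> p * p = p \<and> mat_adjoint p = p"

definition nest_proj :: "nest \<Rightarrow> nat \<Rightarrow> complex mat" where
  "nest_proj A k = foldr (+) (take k (atoms A)) (0\<^sub>m (msize A) (msize A))"

definition is_nest :: "nest \<Rightarrow> bool" where
  "is_nest A \<longleftrightarrow> 0 < msize A
     \<and> (\<forall>q \<in> set (atoms A). q \<in> full A \<and> is_projection q \<and> q \<noteq> 0\<^sub>m (msize A) (msize A))
     \<and> (\<forall>i < natoms A. \<forall>j < natoms A. i \<noteq> j \<longrightarrow>
          atoms A ! i * atoms A ! j = 0\<^sub>m (msize A) (msize A))
     \<and> nest_proj A (natoms A) = 1\<^sub>m (msize A)"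

definition nest_alg :: "nest \<Rightarrow> complex mat set" where
  "nest_alg A = {a \<in> full A. \<forall>k \<in> {1..natoms A}.
     (1\<^sub>m (msize A) - nest_proj A k) * a * nest_proj A k = 0\<^sub>m (msize A) (msize A)}"

definition block :: "nest \<Rightarrow> nat \<Rightarrow> nat \<Rightarrow> complex mat \<Rightarrow> complex mat" where
  "block A i j v = atoms A ! i * v * atoms A ! j"

definition partial_isometry :: "complex mat \<Rightarrow> bool" where
  "partial_isometry v \<longleftrightarrow> v * mat_adjoint v * v = v"

definition Pisom_reg :: "nest \<Rightarrow> complex mat set" where
  "Pisom_reg A = {v \<in> nest_alg A. partial_isometry v \<and>
     (\<forall>i < natoms A. \<forall>j < natoms A. partial_isometry (block A i j v))}"

definition Pisom_op :: "nest \<Rightarrow> complex mat set" where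
  "Pisom_op A = {v \<in> Pisom_reg A. \<forall>i < natoms A. \<forall>j < natoms A.
     block A i j v \<noteq> 0\<^sub>m (msize A) (msize A) \<longrightarrow>
       (\<forall>s \<le> i. \<forall>t \<in> {j..<natoms A}. (s, t) \<noteq> (i, j) \<longrightarrow>
          block A s t v = 0\<^sub>m (msize A) (msize A))}"

section \<open>Star extendible embeddings and order preserving systems\<close>

text \<open>Homomorphisms are not required to be unital.\<close>

definition matrix_star_hom :: "nat \<Rightarrow> nat \<Rightarrow> (complex mat \<Rightarrow> complex mat) \<Rightarrow> bool" where
  "matrix_star_hom n m \<psi> \<longleftrightarrow>
     (\<forall>a \<in> carrier_mat n n. \<psi> a \<in> carrier_mat m m)
     \<and> (\<forall>a \<in> carrier_mat n n. \<forall>b \<in> carrier_mat n n. \<psi> (a + b) = \<psi> a + \<psi> b \<and> \<psi> (a * b) = \<psi> a * \<psi> b)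
     \<and> (\<forall>c. \<forall>a \<in> carrier_mat n n. \<psi> (c \<cdot>\<^sub>m a) = c \<cdot>\<^sub>m \<psi> a)
     \<and> (\<forall>a \<in> carrier_mat n n. \<psi> (mat_adjoint a) = mat_adjoint (\<psi> a))"

text \<open>\<open>C\<^sup>*(A)\<close> is the full matrix algebra, so extensions are defined on \<open>full A\<close>;
  since \<open>A\<close> generates \<open>full A\<close>, an extension is unique there.\<close>

definition extends_to :: "nest \<Rightarrow> nest \<Rightarrow> (complex mat \<Rightarrow> complex mat) \<Rightarrow> (complex mat \<Rightarrow> complex mat) \<Rightarrow> bool" where
  "extends_to A B \<phi> \<psi> \<longleftrightarrow> matrix_star_hom (msize A) (msize B) \<psi> \<and> (\<forall>a \<in> nest_alg A. \<psi> a = \<phi> a)"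

definition star_extendible_embedding :: "nest \<Rightarrow> nest \<Rightarrow> (complex mat \<Rightarrow> complex mat) \<Rightarrow> bool" where
  "star_extendible_embedding A B \<phi> \<longleftrightarrow>
     \<phi> ` nest_alg A \<subseteq> nest_alg B \<and> inj_on \<phi> (nest_alg A) \<and> (\<exists>\<psi>. extends_to A B \<phi> \<psi>)"

definition star_extension :: "nest \<Rightarrow> nest \<Rightarrow> (complex mat \<Rightarrow> complex mat) \<Rightarrow> complex mat \<Rightarrow> complex mat" where
  "star_extension A B \<phi> = (SOME \<psi>. extends_to A B \<phi> \<psi>)"

definition order_preserving :: "nest \<Rightarrow> nest \<Rightarrow> (complex mat \<Rightarrow> complex mat) \<Rightarrow> bool" where
  "order_preserving A B \<phi> \<longleftrightarrow> \<phi> ` Pisom_op A \<subseteq> Pisom_op B"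

definition order_preserving_system :: "(nat \<Rightarrow> nest) \<Rightarrow> (nat \<Rightarrow> complex mat \<Rightarrow> complex mat) \<Rightarrow> bool" where
  "order_preserving_system A \<alpha> \<longleftrightarrow> (\<forall>k. is_nest (A k)
     \<and> star_extendible_embedding (A k) (A (Suc k)) (\<alpha> k)
     \<and> order_preserving (A k) (A (Suc k)) (\<alpha> k))"

section \<open>Direct limits of sequences\<close>

text \<open>For \<open>k \<le> n\<close> this is \<open>f (n - 1) \<circ> \<dots> \<circ> f k\<close>, and the identity for \<open>k = n\<close>.\<close>

definition sys_map :: "(nat \<Rightarrow> 'a \<Rightarrow> 'a) \<Rightarrow> nat \<Rightarrow> nat \<Rightarrow> 'a \<Rightarrow> 'a" where
  "sys_map f k n = fold f [k..<n]"

definition dlim_rel :: "(nat \<Rightarrow> 'a set) \<Rightarrow> (nat \<Rightarrow> 'a \<Rightarrow> 'a) \<Rightarrow> ((nat \<times> 'a) \<times> (nat \<times> 'a)) set" where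
  "dlim_rel D f = {((k, a), (m, b)). a \<in> D k \<and> b \<in> D m \<and>
     (\<exists>n \<ge> max k m. sys_map f k n a = sys_map f m n b)}"

definition dlim :: "(nat \<Rightarrow> 'a set) \<Rightarrow> (nat \<Rightarrow> 'a \<Rightarrow> 'a) \<Rightarrow> (nat \<times> 'a) set set" where
  "dlim D f = (SIGMA k:UNIV. D k) // dlim_rel D f"

definition dlim_in :: "(nat \<Rightarrow> 'a set) \<Rightarrow> (nat \<Rightarrow> 'a \<Rightarrow> 'a) \<Rightarrow> nat \<Rightarrow> 'a \<Rightarrow> (nat \<times> 'a) set" where
  "dlim_in D f k a = dlim_rel D f `` {(k, a)}"

text \<open>Operations on the limit induced by levelwise operations; the unions are over
  representatives, as usual for functions on quotients.\<close>

definition dlim_map :: "(nat \<Rightarrow> 'a set) \<Rightarrow> (nat \<Rightarrow> 'a \<Rightarrow> 'a) \<Rightarrow> (nat \<Rightarrow> 'a \<Rightarrow> 'a)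
    \<Rightarrow> (nat \<times> 'a) set \<Rightarrow> (nat \<times> 'a) set" where
  "dlim_map D f g X = (\<Union>(k, a) \<in> X. dlim_in D f k (g k a))"

definition dlim_map2 :: "(nat \<Rightarrow> 'a set) \<Rightarrow> (nat \<Rightarrow> 'a \<Rightarrow> 'a) \<Rightarrow> (nat \<Rightarrow> 'a \<Rightarrow> 'a \<Rightarrow> 'a)
    \<Rightarrow> (nat \<times> 'a) set \<Rightarrow> (nat \<times> 'a) set \<Rightarrow> (nat \<times> 'a) set" where
  "dlim_map2 D f g X Y = (\<Union>(k, a) \<in> X. \<Union>(m, b) \<in> Y.
     dlim_in D f (max k m) (g (max k m) (sys_map f k (max k m) a) (sys_map f m (max k m) b)))"

section \<open>The dimension distribution group of a nest algebra\<close>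

text \<open>The free abelian group on the classes of rank one regular partial isometries is taken
  in its form \<open>T\<^sub>l(\<int>)\<close>, a rank one \<open>v = q\<^sub>i v q\<^sub>j\<close> corresponding to the \<open>(i,j)\<close> matrix unit.
  The group operation is written multiplicatively in HOL-Algebra but is matrix addition.\<close>

definition dist_group :: "nest \<Rightarrow> int mat monoid" where
  "dist_group A = \<lparr>carrier = {X \<in> carrier_mat (natoms A) (natoms A). upper_triangular X},
     monoid.mult = (+), one = 0\<^sub>m (natoms A) (natoms A)\<rparr>"

definition pclass :: "nest \<Rightarrow> complex mat \<Rightarrow> int mat" where
  "pclass A v = mat (natoms A) (natoms A)
     (\<lambda>(i, j). int (vec_space.rank (msize A) (block A i j v)))"

text \<open>The choice of representative is immaterial: any two are related by \<open>v = u\<^sub>1 w u\<^sub>2\<close> with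
  unitaries of \<open>A\<close>.\<close>

definition generator :: "nest \<Rightarrow> nat \<Rightarrow> nat \<Rightarrow> complex mat" where
  "generator A i j = (SOME v. v \<in> Pisom_reg A \<and> vec_space.rank (msize A) v = 1 \<and> block A i j v = v)"

text \<open>The homomorphism from \<open>dist_group A\<close> to \<open>dist_group B\<close> determined by \<open>[v] \<mapsto> [F v]\<close>
  on the free generators.\<close>

definition induced_hom :: "nest \<Rightarrow> nest \<Rightarrow> (complex mat \<Rightarrow> complex mat) \<Rightarrow> int mat \<Rightarrow> int mat" where
  "induced_hom A B F X = mat (natoms B) (natoms B)
     (\<lambda>(s, t). \<Sum>j < natoms A. \<Sum>i \<le> j. X $$ (i, j) * pclass B (F (generator A i j)) $$ (s, t))"

definition Sigma_reg :: "nest \<Rightarrow> int mat set" where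
  "Sigma_reg A = pclass A ` Pisom_reg A"

definition Sigma_op :: "nest \<Rightarrow> int mat set" where
  "Sigma_op A = pclass A ` Pisom_op A"

definition Sigma_0 :: "nest \<Rightarrow> int mat set" where
  "Sigma_0 A = pclass A ` {p \<in> nest_alg A. is_projection p}"

definition K0 :: "nest \<Rightarrow> int mat set" where
  "K0 A = generate (dist_group A) (Sigma_0 A)"

definition pi_f :: "nest \<Rightarrow> int mat \<Rightarrow> int mat" where
  "pi_f A = induced_hom A A (\<lambda>v. v * mat_adjoint v)"

definition pi_i :: "nest \<Rightarrow> int mat \<Rightarrow> int mat" where
  "pi_i A = induced_hom A A (\<lambda>v. mat_adjoint v * v)"

section \<open>The invariants of a system\<close>

context
  fixes A :: "nat \<Rightarrow> nest" and \<alpha> :: "nat \<Rightarrow> complex mat \<Rightarrow> complex mat"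
begin

definition Gsets :: "nat \<Rightarrow> int mat set" where
  "Gsets k = carrier (dist_group (A k))"

definition Gmaps :: "nat \<Rightarrow> int mat \<Rightarrow> int mat" where
  "Gmaps k = induced_hom (A k) (A (Suc k)) (\<alpha> k)"

definition lim_group :: "(nat \<times> int mat) set monoid" where
  "lim_group = \<lparr>carrier = dlim Gsets Gmaps,
     monoid.mult = dlim_map2 Gsets Gmaps (\<lambda>_. (+)),
     monoid.one = dlim_in Gsets Gmaps 0 (0\<^sub>m (natoms (A 0)) (natoms (A 0)))\<rparr>"

definition lim_union :: "(nat \<Rightarrow> int mat set) \<Rightarrow> (nat \<times> int mat) set set" where
  "lim_union S = (\<Union>k. dlim_in Gsets Gmaps k ` S k)"

definition lim_Sigma :: "(nat \<times> int mat) set set" where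
  "lim_Sigma = lim_union (\<lambda>k. Sigma_reg (A k))"

definition lim_K0 :: "(nat \<times> int mat) set set" where
  "lim_K0 = lim_union (\<lambda>k. K0 (A k))"

definition lim_Sigma_0 :: "(nat \<times> int mat) set set" where
  "lim_Sigma_0 = lim_union (\<lambda>k. Sigma_0 (A k))"

definition lim_pi_f :: "(nat \<times> int mat) set \<Rightarrow> (nat \<times> int mat) set" where
  "lim_pi_f = dlim_map Gsets Gmaps (\<lambda>k. pi_f (A k))"

definition lim_pi_i :: "(nat \<times> int mat) set \<Rightarrow> (nat \<times> int mat) set" where
  "lim_pi_i = dlim_map Gsets Gmaps (\<lambda>k. pi_i (A k))"

definition lim_Sigma_op :: "(nat \<times> int mat) set set" where
  "lim_Sigma_op = lim_union (\<lambda>k. pclass (A k) ` {v \<in> Pisom_reg (A k).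
     \<forall>n > k. pclass (A n) (sys_map \<alpha> k n v) \<in> Sigma_op (A n)})"

end

definition Inv_iso :: "(nat \<Rightarrow> nest) \<Rightarrow> (nat \<Rightarrow> complex mat \<Rightarrow> complex mat)
    \<Rightarrow> (nat \<Rightarrow> nest) \<Rightarrow> (nat \<Rightarrow> complex mat \<Rightarrow> complex mat)
    \<Rightarrow> ((nat \<times> int mat) set \<Rightarrow> (nat \<times> int mat) set) \<Rightarrow> bool" where
  "Inv_iso A \<alpha> A' \<alpha>' \<gamma> \<longleftrightarrow> \<gamma> \<in> iso (lim_group A \<alpha>) (lim_group A' \<alpha>')
     \<and> \<gamma> ` lim_Sigma A \<alpha> = lim_Sigma A' \<alpha>'
     \<and> \<gamma> ` lim_K0 A \<alpha> = lim_K0 A' \<alpha>'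
     \<and> \<gamma> ` lim_Sigma_0 A \<alpha> = lim_Sigma_0 A' \<alpha>'
     \<and> (\<forall>x \<in> carrier (lim_group A \<alpha>). \<gamma> (lim_pi_i A \<alpha> x) = lim_pi_i A' \<alpha>' (\<gamma> x))
     \<and> (\<forall>x \<in> carrier (lim_group A \<alpha>). \<gamma> (lim_pi_f A \<alpha> x) = lim_pi_f A' \<alpha>' (\<gamma> x))"

section \<open>The limit algebras\<close>

text \<open>No unit is part of the structure: the embeddings need not be unital, so the limits need
  not have one.  This is why \<open>ring_hom\<close> of HOL-Algebra, which preserves \<open>\<one>\<close>, is not used.\<close>

record 'a calgebra =
  acarrier :: "'a set"
  aplus :: "'a \<Rightarrow> 'a \<Rightarrow> 'a"
  atimes :: "'a \<Rightarrow> 'a \<Rightarrow> 'a"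
  ascale :: "complex \<Rightarrow> 'a \<Rightarrow> 'a"

record 'a star_calgebra = "'a calgebra" +
  astar :: "'a \<Rightarrow> 'a"

definition alg_iso :: "('a, 'x) calgebra_scheme \<Rightarrow> ('b, 'y) calgebra_scheme \<Rightarrow> ('a \<Rightarrow> 'b) \<Rightarrow> bool" where
  "alg_iso R S h \<longleftrightarrow> bij_betw h (acarrier R) (acarrier S)
     \<and> (\<forall>x \<in> acarrier R. \<forall>y \<in> acarrier R. h (aplus R x y) = aplus S (h x) (h y)
          \<and> h (atimes R x y) = atimes S (h x) (h y))
     \<and> (\<forall>c. \<forall>x \<in> acarrier R. h (ascale R c x) = ascale S c (h x))"

definition star_alg_iso :: "'a star_calgebra \<Rightarrow> 'b star_calgebra \<Rightarrow> ('a \<Rightarrow> 'b) \<Rightarrow> bool" where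
  "star_alg_iso R S h \<longleftrightarrow> alg_iso R S h \<and> (\<forall>x \<in> acarrier R. h (astar R x) = astar S (h x))"

definition l2norm :: "complex vec \<Rightarrow> real" where
  "l2norm x = sqrt (\<Sum>i < dim_vec x. (cmod (x $ i))\<^sup>2)"

definition opnorm :: "complex mat \<Rightarrow> real" where
  "opnorm a = Sup {l2norm (a *\<^sub>v x) | x. x \<in> carrier_vec (dim_col a) \<and> l2norm x \<le> 1}"

context
  fixes A :: "nat \<Rightarrow> nest" and \<alpha> :: "nat \<Rightarrow> complex mat \<Rightarrow> complex mat"
begin

definition lim_alg :: "(nat \<times> complex mat) set calgebra" where
  "lim_alg = (let D = (\<lambda>k. nest_alg (A k)) in
     \<lparr>acarrier = dlim D \<alpha>,
      aplus = dlim_map2 D \<alpha> (\<lambda>_. (+)),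
      atimes = dlim_map2 D \<alpha> (\<lambda>_. (*)),
      ascale = (\<lambda>c. dlim_map D \<alpha> (\<lambda>_ a. c \<cdot>\<^sub>m a))\<rparr>)"

definition star_maps :: "nat \<Rightarrow> complex mat \<Rightarrow> complex mat" where
  "star_maps k = star_extension (A k) (A (Suc k)) (\<alpha> k)"

text \<open>The C*-direct limit of the full matrix algebras \<open>C\<^sup>*(A\<^sub>k)\<close>, as the closure in
  \<open>\<Prod> C\<^sup>*(A\<^sub>k) / \<Oplus> C\<^sup>*(A\<^sub>k)\<close> of the eventually coherent sequences: \<open>approx_coherent\<close> consists of
  the sequences whose class lies in that closure, and two of them are identified when
  their difference tends to 0 in operator norm.\<close>

definition approx_coherent :: "(nat \<Rightarrow> complex mat) set" where
  "approx_coherent = {x. (\<forall>n. x n \<in> full (A n)) \<and>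
     (\<forall>\<epsilon> > 0. \<exists>k. \<exists>a \<in> full (A k).
        \<forall>\<^sub>F n in sequentially. opnorm (x n - sys_map star_maps k n a) \<le> \<epsilon>)}"

definition asymp_eq :: "((nat \<Rightarrow> complex mat) \<times> (nat \<Rightarrow> complex mat)) set" where
  "asymp_eq = {(x, y). x \<in> approx_coherent \<and> y \<in> approx_coherent \<and>
     (\<lambda>n. opnorm (x n - y n)) \<longlonglongrightarrow> 0}"

definition lim_cstar :: "(nat \<Rightarrow> complex mat) set star_calgebra" where
  "lim_cstar =
     \<lparr>acarrier = approx_coherent // asymp_eq,
      aplus = (\<lambda>X Y. \<Union>x \<in> X. \<Union>y \<in> Y. asymp_eq `` {\<lambda>n. x n + y n}),
      atimes = (\<lambda>X Y. \<Union>x \<in> X. \<Union>y \<in> Y. asymp_eq `` {\<lambda>n. x n * y n}),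
      ascale = (\<lambda>c X. \<Union>x \<in> X. asymp_eq `` {\<lambda>n. c \<cdot>\<^sub>m x n}),
      astar = (\<lambda>X. \<Union>x \<in> X. asymp_eq `` {\<lambda>n. mat_adjoint (x n)})\<rparr>"

text \<open>The image of the class of \<open>(k, a)\<close> is represented by the coherent sequence starting with
  \<open>a\<close> at position \<open>k\<close>; the earlier entries are immaterial.\<close>

definition lim_embed :: "(nat \<times> complex mat) set \<Rightarrow> (nat \<Rightarrow> complex mat) set" where
  "lim_embed X = (\<Union>(k, a) \<in> X. asymp_eq ``
     {\<lambda>n. if n < k then 0\<^sub>m (msize (A n)) (msize (A n)) else sys_map star_maps k n a})"

end

definition star_extendibly_isomorphic :: "(nat \<Rightarrow> nest) \<Rightarrow> (nat \<Rightarrow> complex mat \<Rightarrow> complex mat)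
    \<Rightarrow> (nat \<Rightarrow> nest) \<Rightarrow> (nat \<Rightarrow> complex mat \<Rightarrow> complex mat) \<Rightarrow> bool" where
  "star_extendibly_isomorphic A \<alpha> A' \<alpha>' \<longleftrightarrow>
     (\<exists>\<Phi> \<Psi>. alg_iso (lim_alg A \<alpha>) (lim_alg A' \<alpha>') \<Phi>
        \<and> star_alg_iso (lim_cstar A \<alpha>) (lim_cstar A' \<alpha>') \<Psi>
        \<and> (\<forall>x \<in> acarrier (lim_alg A \<alpha>). \<Psi> (lim_embed A \<alpha> x) = lim_embed A' \<alpha>' (\<Phi> x)))"

end

theory Submission
  imports Defs "HOL-Analysis.L2_Norm"
begin

text \<open>
  Call two systems intertwined if there are star homomorphisms \<open>\<theta> k\<close> from \<open>C\<^sup>*(A k)\<close> to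
  \<open>C\<^sup>*(A' (\<mu> k))\<close>, and \<open>\<eta> m\<close> in the other direction, which map nest algebras into nest algebras and
  invert each other up to the system maps.  A star extendible isomorphism of the limits yields an
  intertwining since the \<open>A k\<close> are finite dimensional; conversely an intertwining passes to the
  C*-limits since star homomorphisms of matrix algebras are contractive.

  The \<open>\<theta> k\<close> need not be order preserving, nor even regular, but they become so after composition with
  sufficiently many system maps: order preserving elements normalise the block diagonal, and by finite
  dimensionality the elements of \<open>A' m\<close> that become block diagonal at some level all do so at a
  common one.  Hence an intertwining induces an isomorphism of the invariants.

  For the converse, \<open>\<gamma>\<close> sends the classes of the matrix units of \<open>A k\<close> to classes of order preserving
  partial isometries.  The nonzero blocks of such an element form a strictly increasing matching,
  so its class is determined by the classes of its initial and final projections; this makes the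
  chosen partial isometries fit together to a system of matrix units, i.e. to an embedding of \<open>A k\<close>
  lifting \<open>\<gamma>\<close>.  Embeddings with equal classes differ by a block diagonal unitary, and a back and
  forth argument produces an intertwining.\<close>

section \<open>Finitely supported infinite matrices\<close>

text \<open>A star extendible isomorphism only sees the triangular algebras, whereas regularity and
  order preservation are conditions on single levels. What it does transport is the block diagonal
  \<open>DA\<close>, which is \<open>NA\<close> intersected with its adjoints, and so every
  statement about normalising \<open>DA\<close>. Regularity is such a statement
  (\<open>normal_PR\<close>). A violation of the order at a finite level is an artefact: the
  elements that link the two conflicting blocks already lie in the diagonal of the limit
  (\<open>conflict_collapses\<close>), and the conflict disappears at a later level.

  For the converse, partial isometries with equal initial and final classes can match the atoms in
  different ways. Increasing matchings cannot: they are monotone couplings and hence determined by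
  their marginals (\<open>coupling_unique\<close>). The marginals are controlled by
  \<open>pi_f\<close> and \<open>pi_i\<close>, and \<open>Sigma_0\<close> yields a projection with
  exactly enough room for the image of the unit.\<close>

text \<open>Matrices of all sizes live in one ring without unit, which avoids dimension side conditions;
  \<open>em\<close> and \<open>me n\<close> below translate from and to matrices with carriers.\<close>

typedef fmat = "{f :: nat \<Rightarrow> nat \<Rightarrow> complex. \<exists>n. \<forall>i j. n \<le> i \<or> n \<le> j \<longrightarrow> f i j = 0}"
  morphisms ent Abs_fmat
  by (rule exI[of _ "\<lambda>_ _. 0"]) simp

setup_lifting type_definition_fmat

lemma fmat_eqI: "(\<And>i j. ent a i j = ent b i j) \<Longrightarrow> a = b"
  by (metis ent_inject ext)

definition bnd :: "nat \<Rightarrow> fmat \<Rightarrow> bool" where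
  "bnd n a \<longleftrightarrow> (\<forall>i j. n \<le> i \<or> n \<le> j \<longrightarrow> ent a i j = 0)"

lemma bnd_ex: "\<exists>n. bnd n a"
  using ent[of a] by (simp add: bnd_def)

lemma bnd_mono: "bnd n a \<Longrightarrow> n \<le> m \<Longrightarrow> bnd m a"
  unfolding bnd_def by (meson order_trans)

lemma bnd_ex2: "\<exists>n. bnd n a \<and> bnd n b"
  by (metis bnd_ex bnd_mono max.cobounded1 max.cobounded2)

lemma bnd_ex3: "\<exists>n. bnd n a \<and> bnd n b \<and> bnd n c"
  by (metis bnd_ex bnd_ex2 bnd_mono max.cobounded1 max.cobounded2)

instantiation fmat :: ring
begin

lift_definition zero_fmat :: fmat is "\<lambda>_ _. 0" by simp

lift_definition plus_fmat :: "fmat \<Rightarrow> fmat \<Rightarrow> fmat" is "\<lambda>f g i j. f i j + g i j"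
proof -
  fix f g :: "nat \<Rightarrow> nat \<Rightarrow> complex"
  assume "\<exists>n. \<forall>i j. n \<le> i \<or> n \<le> j \<longrightarrow> f i j = 0" "\<exists>n. \<forall>i j. n \<le> i \<or> n \<le> j \<longrightarrow> g i j = 0"
  then obtain n m where "\<And>i j. n \<le> i \<or> n \<le> j \<Longrightarrow> f i j = 0" "\<And>i j. m \<le> i \<or> m \<le> j \<Longrightarrow> g i j = 0" by blast
  then show "\<exists>n. \<forall>i j. n \<le> i \<or> n \<le> j \<longrightarrow> f i j + g i j = 0"
    by (intro exI[of _ "max n m"]) simp
qed

lift_definition uminus_fmat :: "fmat \<Rightarrow> fmat" is "\<lambda>f i j. - f i j" by auto

lift_definition minus_fmat :: "fmat \<Rightarrow> fmat \<Rightarrow> fmat" is "\<lambda>f g i j. f i j - g i j"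
proof -
  fix f g :: "nat \<Rightarrow> nat \<Rightarrow> complex"
  assume "\<exists>n. \<forall>i j. n \<le> i \<or> n \<le> j \<longrightarrow> f i j = 0" "\<exists>n. \<forall>i j. n \<le> i \<or> n \<le> j \<longrightarrow> g i j = 0"
  then obtain n m where "\<And>i j. n \<le> i \<or> n \<le> j \<Longrightarrow> f i j = 0" "\<And>i j. m \<le> i \<or> m \<le> j \<Longrightarrow> g i j = 0" by blast
  then show "\<exists>n. \<forall>i j. n \<le> i \<or> n \<le> j \<longrightarrow> f i j - g i j = 0"
    by (intro exI[of _ "max n m"]) simp
qed

text \<open>Summing over the nonzero entries of row \<open>i\<close> keeps the index set finite
  without a choice of size. \<open>ent_mult\<close> replaces it by any bound on the left
  factor.\<close>

lift_definition times_fmat :: "fmat \<Rightarrow> fmat \<Rightarrow> fmat" is "\<lambda>f g i j. \<Sum>k | f i k \<noteq> 0. f i k * g k j"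
proof -
  fix f g :: "nat \<Rightarrow> nat \<Rightarrow> complex"
  assume "\<exists>n. \<forall>i j. n \<le> i \<or> n \<le> j \<longrightarrow> f i j = 0" "\<exists>n. \<forall>i j. n \<le> i \<or> n \<le> j \<longrightarrow> g i j = 0"
  then obtain n m where "\<And>i j. n \<le> i \<or> n \<le> j \<Longrightarrow> f i j = 0" "\<And>i j. m \<le> i \<or> m \<le> j \<Longrightarrow> g i j = 0" by blast
  then show "\<exists>n. \<forall>i j. n \<le> i \<or> n \<le> j \<longrightarrow> (\<Sum>k | f i k \<noteq> 0. f i k * g k j) = 0"
    by (intro exI[of _ "max n m"]) auto
qed

lemma ent_mult:
  assumes "bnd n a"
  shows "ent (a * b) i j = (\<Sum>k<n. ent a i k * ent b k j)"
proof -
  have "{k. ent a i k \<noteq> 0} \<subseteq> {..<n}" using assms by (auto simp: bnd_def not_le[symmetric])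
  then show ?thesis unfolding times_fmat.rep_eq
    by (intro sum.mono_neutral_left) auto
qed

lemma bnd_mult: "bnd n a \<Longrightarrow> bnd n b \<Longrightarrow> bnd n (a * b)"
  unfolding bnd_def[of n "a * b"] by (auto simp: ent_mult bnd_def)

instance
proof
  fix a b c :: fmat
  show "a + b + c = a + (b + c)" "a + b = b + a" "0 + a = a" "- a + a = 0" "a - b = a + - b"
    by (transfer, simp add: fun_eq_iff add.assoc add.commute)+
  obtain n where n: "bnd n a" "bnd n b" "bnd n c" using bnd_ex3 by blast
  show "a * b * c = a * (b * c)"
  proof (rule fmat_eqI)
    fix i j
    show "ent (a * b * c) i j = ent (a * (b * c)) i j"
      unfolding ent_mult[OF bnd_mult[OF n(1,2)]] ent_mult[OF n(1)] ent_mult[OF n(2)]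
        sum_distrib_left sum_distrib_right
      by (subst sum.swap) (simp add: mult.assoc)
  qed
  obtain m where m: "bnd m (a + b)" "bnd m a" "bnd m b" using bnd_ex3 by blast
  show "(a + b) * c = a * c + b * c"
    by (rule fmat_eqI) (simp add: ent_mult[OF m(1)] plus_fmat.rep_eq ent_mult[OF m(2)] ent_mult[OF m(3)] distrib_right sum.distrib)
  show "a * (b + c) = a * b + a * c"
    by (rule fmat_eqI) (simp add: plus_fmat.rep_eq ent_mult[OF n(1)] distrib_left sum.distrib)
qed

end

lift_definition scl :: "complex \<Rightarrow> fmat \<Rightarrow> fmat" (infixr "\<odot>" 75) is "\<lambda>c f i j. c * f i j"
  by (metis mult_zero_right)

lift_definition adj :: "fmat \<Rightarrow> fmat" is "\<lambda>f i j. cnj (f j i)"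
  by (metis complex_cnj_zero)

lift_definition tr :: "fmat \<Rightarrow> complex" is "\<lambda>f. \<Sum>i | f i i \<noteq> 0. f i i" .

lift_definition mu :: "nat \<Rightarrow> nat \<Rightarrow> fmat" is "\<lambda>x y i j. if i = x \<and> j = y then 1 else 0"
proof -
  fix x y :: nat
  show "\<exists>n. \<forall>i j. n \<le> i \<or> n \<le> j \<longrightarrow> (if i = x \<and> j = y then 1 else 0) = (0::complex)"
    by (rule exI[of _ "Suc (max x y)"]) auto
qed

lemmas ent_simps = zero_fmat.rep_eq plus_fmat.rep_eq minus_fmat.rep_eq uminus_fmat.rep_eq scl.rep_eq
  adj.rep_eq mu.rep_eq

lemma bnd_adj [simp]: "bnd n (adj a) \<longleftrightarrow> bnd n a"
  by (auto simp: bnd_def ent_simps)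

lemma bnd_add: "bnd n a \<Longrightarrow> bnd n b \<Longrightarrow> bnd n (a + b)"
  by (auto simp: bnd_def ent_simps)

lemma bnd_diff: "bnd n a \<Longrightarrow> bnd n b \<Longrightarrow> bnd n (a - b)"
  by (auto simp: bnd_def ent_simps)

lemma bnd_scl: "bnd n a \<Longrightarrow> bnd n (c \<odot> a)"
  by (auto simp: bnd_def ent_simps)

lemma bnd_0 [simp]: "bnd n 0"
  by (auto simp: bnd_def ent_simps)

lemma adj_adj [simp]: "adj (adj a) = a"
  by (rule fmat_eqI) (simp add: ent_simps)

lemma adj_eq_iff [simp]: "adj a = adj b \<longleftrightarrow> a = b"
  by (metis adj_adj)

lemma adj_mult [simp]: "adj (a * b) = adj b * adj a"
proof -
  obtain n where n: "bnd n a" "bnd n (adj b)" using bnd_ex2 by blast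
  show ?thesis
    by (rule fmat_eqI) (simp add: ent_mult[OF n(1)] ent_mult[OF n(2)] adj.rep_eq mult.commute)
qed

lemma adj_add [simp]: "adj (a + b) = adj a + adj b"
  by (rule fmat_eqI) (simp add: ent_simps)
lemma adj_diff [simp]: "adj (a - b) = adj a - adj b"
  by (rule fmat_eqI) (simp add: ent_simps)
lemma adj_minus [simp]: "adj (- a) = - adj a"
  by (rule fmat_eqI) (simp add: ent_simps)
lemma adj_scl [simp]: "adj (c \<odot> a) = cnj c \<odot> adj a"
  by (rule fmat_eqI) (simp add: ent_simps)
lemma adj_0 [simp]: "adj 0 = 0"
  by (rule fmat_eqI) (simp add: ent_simps)
lemma adj_eq_0 [simp]: "adj a = 0 \<longleftrightarrow> a = 0"
  by (metis adj_adj adj_0)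
lemma adj_sum [simp]: "adj (sum f S) = (\<Sum>x\<in>S. adj (f x))"
  by (induction S rule: infinite_finite_induct) simp_all
lemma adj_mu [simp]: "adj (mu x y) = mu y x"
  by (rule fmat_eqI) (auto simp: ent_simps)

lemma scl_mult_left [simp]: "(c \<odot> a) * b = c \<odot> (a * b)"
proof -
  obtain n where n: "bnd n a" "bnd n (c \<odot> a)" using bnd_ex2 by blast
  show ?thesis
    by (rule fmat_eqI) (simp add: ent_mult[OF n(1)] ent_mult[OF n(2)] scl.rep_eq sum_distrib_left mult.assoc)
qed

lemma scl_mult_right [simp]: "a * (c \<odot> b) = c \<odot> (a * b)"
proof -
  obtain n where n: "bnd n a" using bnd_ex by blast
  show ?thesis
    by (rule fmat_eqI) (simp add: ent_mult[OF n(1)] scl.rep_eq sum_distrib_left mult_ac)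
qed

lemma scl_add: "c \<odot> (a + b) = c \<odot> a + c \<odot> b"
  by (rule fmat_eqI) (simp add: ent_simps distrib_left)
lemma scl_diff: "c \<odot> (a - b) = c \<odot> a - c \<odot> b"
  by (rule fmat_eqI) (simp add: ent_simps right_diff_distrib)
lemma scl_add_left: "(c + d) \<odot> a = c \<odot> a + d \<odot> a"
  by (rule fmat_eqI) (simp add: ent_simps distrib_right)
lemma scl_scl [simp]: "c \<odot> d \<odot> a = (c * d) \<odot> a"
  by (rule fmat_eqI) (simp add: ent_simps)
lemma scl_1 [simp]: "1 \<odot> a = a"
  by (rule fmat_eqI) (simp add: ent_simps)
lemma scl_m1: "(- 1) \<odot> a = - a"
  by (rule fmat_eqI) (simp add: ent_simps)
lemma scl_0 [simp]: "0 \<odot> a = 0" "c \<odot> 0 = 0"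
  by (rule fmat_eqI, simp add: ent_simps)+
lemma scl_eq_0 [simp]: "c \<odot> a = 0 \<longleftrightarrow> c = 0 \<or> a = 0"
  by (metis scl_0 scl_1 scl_scl left_inverse)
lemma scl_sum: "c \<odot> sum f S = (\<Sum>x\<in>S. c \<odot> f x)"
  by (induction S rule: infinite_finite_induct) (simp_all add: scl_add)

lemma ent_sum: "ent (sum f S) i j = (\<Sum>x\<in>S. ent (f x) i j)"
  by (induction S rule: infinite_finite_induct) (simp_all add: ent_simps)

lemma tr_bnd: "bnd n a \<Longrightarrow> tr a = (\<Sum>i<n. ent a i i)"
  unfolding tr.rep_eq by (rule sum.mono_neutral_left) (auto simp: bnd_def not_le[symmetric])

lemma tr_add [simp]: "tr (a + b) = tr a + tr b"
proof -
  obtain n where n: "bnd n a" "bnd n b" using bnd_ex2 by blast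
  show ?thesis unfolding tr_bnd[OF bnd_add[OF n]] tr_bnd[OF n(1)] tr_bnd[OF n(2)]
    by (simp add: ent_simps sum.distrib)
qed
lemma tr_diff [simp]: "tr (a - b) = tr a - tr b"
proof -
  obtain n where n: "bnd n a" "bnd n b" using bnd_ex2 by blast
  show ?thesis unfolding tr_bnd[OF bnd_diff[OF n]] tr_bnd[OF n(1)] tr_bnd[OF n(2)]
    by (simp add: ent_simps sum_subtractf)
qed
lemma tr_scl [simp]: "tr (c \<odot> a) = c * tr a"
proof -
  obtain n where n: "bnd n a" using bnd_ex by blast
  show ?thesis unfolding tr_bnd[OF bnd_scl[OF n]] tr_bnd[OF n]
    by (simp add: ent_simps sum_distrib_left)
qed
lemma tr_0 [simp]: "tr 0 = 0"
  using tr_scl[of 0 0] by simp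
lemma tr_sum [simp]: "tr (sum f S) = (\<Sum>x\<in>S. tr (f x))"
  by (induction S rule: infinite_finite_induct) simp_all
lemma tr_adj [simp]: "tr (adj a) = cnj (tr a)"
  using bnd_ex[of a] by (auto simp: tr_bnd ent_simps)

lemma tr_comm: "tr (a * b) = tr (b * a)"
proof -
  obtain n where n: "bnd n a" "bnd n b" using bnd_ex2 by blast
  show ?thesis
    unfolding tr_bnd[OF bnd_mult[OF n]] tr_bnd[OF bnd_mult[OF n(2,1)]] ent_mult[OF n(1)] ent_mult[OF n(2)]
    by (subst sum.swap) (simp add: mult.commute)
qed

text \<open>The squared Hilbert-Schmidt norm. That it vanishes only at 0 is the positivity fact from
  which the calculus of projections is derived.\<close>

definition hs :: "fmat \<Rightarrow> real" where
  "hs a = Re (tr (adj a * a))"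

lemma tr_adj_mult: "bnd n a \<Longrightarrow> tr (adj a * a) = of_real (\<Sum>j<n. \<Sum>i<n. (cmod (ent a i j))\<^sup>2)"
  by (simp add: tr_bnd[OF bnd_mult[of n "adj a" a]] ent_mult[of n "adj a"] ent_simps
      complex_norm_square mult.commute del: of_real_power)

lemma hs_bnd: "bnd n a \<Longrightarrow> hs a = (\<Sum>j<n. \<Sum>i<n. (cmod (ent a i j))\<^sup>2)"
  by (simp add: hs_def tr_adj_mult del: of_real_sum of_real_power)

lemma tr_hs: "tr (adj a * a) = of_real (hs a)"
  using bnd_ex[of a] by (auto simp: hs_bnd tr_adj_mult simp del: of_real_sum of_real_power)

lemma hs_ge_0 [simp]: "0 \<le> hs a"
  using bnd_ex[of a] by (auto simp: hs_bnd intro!: sum_nonneg)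

lemma hs_adj [simp]: "hs (adj a) = hs a"
  unfolding hs_def by (metis adj_adj tr_comm)

lemma hs_0_iff [simp]: "hs a = 0 \<longleftrightarrow> a = 0"
proof
  assume *: "hs a = 0"
  obtain n where n: "bnd n a" using bnd_ex by blast
  have "ent a i j = 0" for i j
  proof (cases "i < n \<and> j < n")
    case True
    have "(\<Sum>i<n. (cmod (ent a i j))\<^sup>2) = 0"
      using *[unfolded hs_bnd[OF n]] True
      by (subst (asm) sum_nonneg_eq_0_iff) (auto intro!: sum_nonneg)
    then show ?thesis using True by (subst (asm) sum_nonneg_eq_0_iff) auto
  qed (use n in \<open>auto simp: bnd_def\<close>)
  then show "a = 0" by (intro fmat_eqI) (simp add: ent_simps)
qed (simp add: hs_def)

lemma adj_mult_self_0 [simp]: "adj a * a = 0 \<longleftrightarrow> a = 0"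
  by (metis hs_0_iff hs_def mult_zero_right tr_0 zero_complex.sel(1))

lemma mult_adj_self_0 [simp]: "a * adj a = 0 \<longleftrightarrow> a = 0"
  by (metis adj_adj adj_mult_self_0 adj_eq_0)

lemma bnd_mu: "x < n \<Longrightarrow> y < n \<Longrightarrow> bnd n (mu x y)"
  by (auto simp: bnd_def ent_simps)

lemma ent_mu_mult: "ent (mu x y * a) i j = (if i = x then ent a y j else 0)"
proof -
  have "bnd (Suc (max x y)) (mu x y)" by (rule bnd_mu) auto
  then have "ent (mu x y * a) i j = (\<Sum>k<Suc (max x y). if k = y then (if i = x then ent a y j else 0) else 0)"
    unfolding ent_mult[OF \<open>bnd _ _\<close>] by (intro sum.cong) (auto simp: ent_simps)
  then show ?thesis by (simp add: sum.delta)
qed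

lemma ent_mult_mu: "ent (a * mu x y) i j = (if j = y then ent a i x else 0)"
proof -
  have "ent (a * mu x y) i j = cnj (ent (adj (a * mu x y)) j i)" by (simp add: adj.rep_eq del: adj_mult)
  also have "\<dots> = (if j = y then ent a i x else 0)" by (simp add: ent_mu_mult adj.rep_eq)
  finally show ?thesis .
qed

lemma mu_mult: "mu x y * mu z w = (if y = z then mu x w else 0)"
  by (rule fmat_eqI) (auto simp: ent_mu_mult ent_simps)

lemma mu_sandwich: "mu x y * a * mu z w = ent a y z \<odot> mu x w"
  by (rule fmat_eqI) (auto simp: ent_mu_mult ent_mult_mu ent_simps)

lemma tr_mu: "tr (mu x y) = (if x = y then 1 else 0)"
proof -
  have "bnd (Suc (max x y)) (mu x y)" by (rule bnd_mu) auto
  then have "tr (mu x y) = (\<Sum>i<Suc (max x y). if i = x then (if x = y then 1 else 0) else 0)"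
    unfolding tr_bnd[OF \<open>bnd _ _\<close>] by (intro sum.cong) (auto simp: ent_simps)
  then show ?thesis by (simp add: sum.delta)
qed

lemma tr_mu_mult: "tr (mu x y * a) = ent a y x"
proof -
  have "tr (mu x y * a) = tr (mu x x * (mu x y * a))" by (simp add: mu_mult flip: mult.assoc)
  also have "\<dots> = tr (mu x y * a * mu x x)" by (rule tr_comm)
  finally show ?thesis by (simp add: mu_sandwich tr_mu)
qed

lemma fmat_expand: "bnd n a \<Longrightarrow> a = (\<Sum>i<n. \<Sum>j<n. ent a i j \<odot> mu i j)"
proof (rule fmat_eqI)
  fix x y assume n: "bnd n a"
  have "ent (\<Sum>i<n. \<Sum>j<n. ent a i j \<odot> mu i j) x y = (\<Sum>i<n. \<Sum>j<n. if j = y then (if i = x then ent a i j else 0) else 0)"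
    unfolding ent_sum by (intro sum.cong) (auto simp: ent_simps)
  also have "\<dots> = (if y < n then \<Sum>i<n. if i = x then ent a i y else 0 else 0)" by (simp add: sum.delta)
  also have "\<dots> = ent a x y" using n by (auto simp: sum.delta bnd_def)
  finally show "ent a x y = ent (\<Sum>i<n. \<Sum>j<n. ent a i j \<odot> mu i j) x y" by simp
qed

subsection \<open>Passage from and to matrices with carriers\<close>

lift_definition em :: "complex mat \<Rightarrow> fmat" is
  "\<lambda>M i j. if i < dim_row M \<and> j < dim_col M then M $$ (i, j) else 0"
proof -
  fix M :: "complex mat"
  show "\<exists>n. \<forall>i j. n \<le> i \<or> n \<le> j \<longrightarrow> (if i < dim_row M \<and> j < dim_col M then M $$ (i, j) else 0) = 0"
    by (rule exI[of _ "max (dim_row M) (dim_col M)"]) auto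
qed

definition me :: "nat \<Rightarrow> fmat \<Rightarrow> complex mat" where
  "me n a = mat n n (\<lambda>(i, j). ent a i j)"

definition un :: "nat \<Rightarrow> fmat" where "un n = em (1\<^sub>m n)"

lemma me_carrier [simp]: "me n a \<in> carrier_mat n n" by (simp add: me_def)

lemma em_inj: "A \<in> carrier_mat n m \<Longrightarrow> B \<in> carrier_mat n m \<Longrightarrow> em A = em B \<Longrightarrow> A = B"
proof (rule eq_matI)
  fix i j assume *: "A \<in> carrier_mat n m" "B \<in> carrier_mat n m" "em A = em B" "i < dim_row B" "j < dim_col B"
  then have "ent (em A) i j = ent (em B) i j" by simp
  then show "A $$ (i, j) = B $$ (i, j)"
    using *(1,2,4,5) unfolding em.rep_eq by simp
qed auto

lemma em_bnd: "A \<in> carrier_mat n n \<Longrightarrow> bnd n (em A)"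
  by (auto simp: bnd_def em.rep_eq)

lemma me_em [simp]: "A \<in> carrier_mat n n \<Longrightarrow> me n (em A) = A"
  by (rule eq_matI) (auto simp: me_def em.rep_eq)

lemma em_me: "bnd n a \<Longrightarrow> em (me n a) = a"
  by (rule fmat_eqI) (auto simp: me_def em.rep_eq bnd_def not_less)

lemma em_mult: "A \<in> carrier_mat n m \<Longrightarrow> B \<in> carrier_mat m k \<Longrightarrow> em (A * B) = em A * em B"
proof (rule fmat_eqI)
  fix i j assume A: "A \<in> carrier_mat n m" "B \<in> carrier_mat m k"
  have b: "bnd (max n m) (em A)" using A by (auto simp: bnd_def em.rep_eq)
  have "ent (em A * em B) i j = (\<Sum>l<max n m. ent (em A) i l * ent (em B) l j)" by (rule ent_mult[OF b])
  also have "\<dots> = (\<Sum>l<m. ent (em A) i l * ent (em B) l j)"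
    by (rule sum.mono_neutral_right) (use A in \<open>auto simp: em.rep_eq\<close>)
  also have "\<dots> = ent (em (A * B)) i j"
    using A by (auto simp: em.rep_eq scalar_prod_def lessThan_atLeast0)
  finally show "ent (em (A * B)) i j = ent (em A * em B) i j" by simp
qed

lemma em_add: "A \<in> carrier_mat n m \<Longrightarrow> B \<in> carrier_mat n m \<Longrightarrow> em (A + B) = em A + em B"
  by (rule fmat_eqI) (auto simp: em.rep_eq ent_simps)

lemma em_diff: "A \<in> carrier_mat n m \<Longrightarrow> B \<in> carrier_mat n m \<Longrightarrow> em (A - B) = em A - em B"
  by (rule fmat_eqI) (auto simp: em.rep_eq ent_simps)

lemma em_smult: "em (c \<cdot>\<^sub>m A) = c \<odot> em A"
  by (rule fmat_eqI) (auto simp: em.rep_eq ent_simps)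

lemma em_zero [simp]: "em (0\<^sub>m n m) = 0"
  by (rule fmat_eqI) (auto simp: em.rep_eq ent_simps)

lemma em_0_iff: "A \<in> carrier_mat n m \<Longrightarrow> em A = 0 \<longleftrightarrow> A = 0\<^sub>m n m"
  using em_inj[of A n m "0\<^sub>m n m"] by auto

lemma mat_adjoint_dim [simp]: "dim_row (mat_adjoint A) = dim_col A" "dim_col (mat_adjoint A) = dim_row A"
  by (auto simp: mat_adjoint_def)

lemma mat_adjoint_carrier [simp]: "A \<in> carrier_mat n m \<Longrightarrow> mat_adjoint A \<in> carrier_mat m n"
  by (metis carrier_matD carrier_matI mat_adjoint_dim)

lemma mat_adjoint_index: "i < dim_col A \<Longrightarrow> j < dim_row A \<Longrightarrow> mat_adjoint A $$ (i, j) = cnj (A $$ (j, i))"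
  by (simp add: mat_adjoint_def mat_of_rows_index)

lemma em_adj: "em (mat_adjoint A) = adj (em A)"
  by (rule fmat_eqI) (auto simp: em.rep_eq ent_simps mat_adjoint_index)

lemma ent_un: "ent (un n) i j = (if i = j \<and> i < n then 1 else 0)"
  by (auto simp: un_def em.rep_eq)

lemma bnd_un [simp]: "bnd n (un n)"
  by (auto simp: bnd_def ent_un)

lemma ent_un_mult: "ent (un n * a) i j = (if i < n then ent a i j else 0)"
proof -
  have "ent (un n * a) i j = (\<Sum>k<n. if k = i then ent a i j else 0)"
    unfolding ent_mult[OF bnd_un] by (intro sum.cong) (auto simp: ent_un)
  then show ?thesis by (simp add: sum.delta)
qed

lemma un_mult: "bnd n a \<Longrightarrow> un n * a = a"
  by (rule fmat_eqI) (auto simp: ent_un_mult bnd_def)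

lemma adj_un [simp]: "adj (un n) = un n"
  by (rule fmat_eqI) (auto simp: ent_un ent_simps)

lemma mult_un: "bnd n a \<Longrightarrow> a * un n = a"
  by (metis adj_adj adj_mult adj_un bnd_adj un_mult)

lemma ent_mult_un: "ent (a * un n) i j = (if j < n then ent a i j else 0)"
proof -
  have "ent (a * un n) i j = cnj (ent (un n * adj a) j i)"
    by (metis adj.rep_eq adj_mult adj_un complex_cnj_cnj)
  then show ?thesis by (simp add: ent_un_mult adj.rep_eq)
qed

text \<open>Lying in the corner cut out by \<open>un n\<close> becomes two equations, so that size
  bounds follow by ring manipulation.\<close>

lemma bnd_iff: "bnd n a \<longleftrightarrow> un n * a = a \<and> a * un n = a"
proof
  assume *: "un n * a = a \<and> a * un n = a"
  then show "bnd n a" unfolding bnd_def by (metis ent_un_mult ent_mult_un not_less)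
qed (simp add: un_mult mult_un)

lemma tr_un: "tr (un n) = of_nat n"
  by (simp add: tr_bnd[OF bnd_un] ent_un)

section \<open>Projections and partial isometries\<close>

definition pj :: "fmat \<Rightarrow> bool" where "pj p \<longleftrightarrow> p * p = p \<and> adj p = p"

definition pim :: "fmat \<Rightarrow> bool" where "pim v \<longleftrightarrow> v * adj v * v = v"

text \<open>Rank one projections without vectors: the corner at \<open>e\<close> is one-dimensional,
  and the trace reads off the scalar.\<close>

definition mn :: "fmat \<Rightarrow> bool" where
  "mn e \<longleftrightarrow> pj e \<and> tr e = 1 \<and> (\<forall>a. e * a * e = tr (e * a) \<odot> e)"

lemma pjD: "pj p \<Longrightarrow> p * p = p" "pj p \<Longrightarrow> adj p = p" "pj p \<Longrightarrow> p * (p * x) = p * x"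
  by (auto simp: pj_def simp flip: mult.assoc)

lemma pj_0 [simp]: "pj 0" by (simp add: pj_def)

lemma mn_pj: "mn e \<Longrightarrow> pj e" by (simp add: mn_def)
lemma mn_tr: "mn e \<Longrightarrow> tr e = 1" by (simp add: mn_def)
lemma mn_cut: "mn e \<Longrightarrow> e * a * e = tr (e * a) \<odot> e" by (simp add: mn_def)
lemma mn_neq_0: "mn e \<Longrightarrow> e \<noteq> 0" by (auto simp: mn_def)

lemma sub_flip: "pj p \<Longrightarrow> pj e \<Longrightarrow> p * e = e \<longleftrightarrow> e * p = e"
  by (metis adj_mult pj_def)

lemma pj_hs: "pj p \<Longrightarrow> tr p = of_real (hs p)"
  by (metis pj_def tr_hs)

lemma pj_diff: "pj p \<Longrightarrow> pj e \<Longrightarrow> p * e = e \<Longrightarrow> pj (p - e)"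
  using sub_flip[of p e] by (simp add: pj_def algebra_simps)

lemma pj_add: "pj p \<Longrightarrow> pj q \<Longrightarrow> p * q = 0 \<Longrightarrow> pj (p + q)"
proof -
  assume *: "pj p" "pj q" "p * q = 0"
  then have "adj (p * q) = 0" by simp
  then have "q * p = 0" using *(1,2) by (metis adj_mult pj_def)
  then show ?thesis using * by (simp add: pj_def algebra_simps)
qed

lemma pj_comm_mult: "pj p \<Longrightarrow> pj q \<Longrightarrow> p * q = q * p \<Longrightarrow> pj (p * q)"
  unfolding pj_def by (metis adj_mult mult.assoc)

lemma pj_sum:
  "finite K \<Longrightarrow> (\<And>k. k \<in> K \<Longrightarrow> pj (f k)) \<Longrightarrow> (\<And>k l. k \<in> K \<Longrightarrow> l \<in> K \<Longrightarrow> k \<noteq> l \<Longrightarrow> f k * f l = 0) \<Longrightarrow> pj (sum f K)"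
proof (induction K rule: finite_induct)
  case (insert x F)
  have "f x * sum f F = 0" unfolding sum_distrib_left using insert by (intro sum.neutral) auto
  then show ?case using insert by (simp add: pj_add)
qed simp

lemma orth_sum_mult:
  assumes "finite K" "\<And>k l. k \<in> K \<Longrightarrow> l \<in> K \<Longrightarrow> k \<noteq> l \<Longrightarrow> f k * g l = (0 :: fmat)" "k \<in> K"
  shows "f k * sum g K = f k * g k" "sum f K * g k = f k * g k"
proof -
  have "(\<Sum>l\<in>K. f k * g l) = (\<Sum>l\<in>{k}. f k * g l)" by (rule sum.mono_neutral_right) (use assms in auto)
  then show "f k * sum g K = f k * g k" by (simp add: sum_distrib_left)
  have "(\<Sum>l\<in>K. f l * g k) = (\<Sum>l\<in>{k}. f l * g k)" by (rule sum.mono_neutral_right) (use assms in auto)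
  then show "sum f K * g k = f k * g k" by (simp add: sum_distrib_right)
qed

lemma orth_sum_sum:
  assumes "finite K" "\<And>k l. k \<in> K \<Longrightarrow> l \<in> K \<Longrightarrow> k \<noteq> l \<Longrightarrow> f k * g l = (0 :: fmat)"
  shows "sum f K * sum g K = (\<Sum>k\<in>K. f k * g k)"
  unfolding sum_distrib_right by (intro sum.cong refl orth_sum_mult(1)) (use assms in auto)

lemma mn_exists:
  assumes "pj p" "p \<noteq> 0"
  shows "\<exists>e. mn e \<and> p * e = e"
proof -
  obtain n where n: "bnd n p" using bnd_ex by blast
  have "tr p \<noteq> 0" using pj_hs[OF assms(1)] assms(2) by simp
  then obtain j where j: "ent p j j \<noteq> 0" unfolding tr_bnd[OF n] by (meson sum.neutral)
  define l where "l = ent p j j"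
  have l: "l \<noteq> 0" "cnj l = l" using j arg_cong[OF pjD(2)[OF assms(1)], of "\<lambda>x. ent x j j"] by (auto simp: l_def adj.rep_eq)
  \<comment> \<open>The projection onto the line spanned by column \<open>j\<close> of
    \<open>p\<close>; the diagonal entry \<open>l\<close> of a projection is the squared length of
    that column.\<close>
  define e where "e = (1 / l) \<odot> (p * mu j j * p)"
  note p = pjD[OF assms(1)]
  have pe: "p * e = e" "e * p = e" by (simp_all add: e_def p mult.assoc)
  have tre: "tr (e * a) = ent (p * a * p) j j / l" for a
  proof -
    have "tr (p * mu j j * p * a) = tr (mu j j * (p * a * p))"
      by (metis mult.assoc tr_comm)
    then show ?thesis by (simp add: e_def tr_mu_mult)
  qed
  have cut: "e * a * e = tr (e * a) \<odot> e" for a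
  proof -
    have "p * mu j j * p * a * (p * mu j j * p) = p * (mu j j * (p * a * p) * mu j j) * p" by (simp add: mult.assoc)
    also have "\<dots> = ent (p * a * p) j j \<odot> (p * mu j j * p)" by (simp add: mu_sandwich)
    finally show ?thesis unfolding tre using l by (simp add: e_def field_simps)
  qed
  have t1: "tr e = 1" using tre[of p] l by (simp add: pe p l_def)
  have "e * e = e" using cut[of p] by (simp add: pe t1)
  moreover have "adj e = e" using l by (simp add: e_def p mult.assoc)
  ultimately show ?thesis using cut t1 pe by (auto simp: mn_def pj_def)
qed

text \<open>Rank one projections are split off one at a time, and each lowers the trace by 1. The
  induction measure takes the floor of \<open>hs p\<close> because integrality of the trace is
  itself a consequence of the decomposition.\<close>

lemma pj_decomp:
  assumes "pj p"
  shows "\<exists>r f. tr p = of_nat r \<and> p = (\<Sum>k<r. f k) \<and> (\<forall>k<r. mn (f k)) \<and> (\<forall>k<r. \<forall>l<r. k \<noteq> l \<longrightarrow> f k * f l = 0)"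
  using assms
proof (induction "nat \<lfloor>hs p\<rfloor>" arbitrary: p rule: less_induct)
  case less
  show ?case
  proof (cases "p = 0")
    case True
    then show ?thesis by (intro exI[of _ 0]) simp
  next
    case False
    then obtain e where e: "mn e" "p * e = e" using mn_exists less by blast
    have pj: "pj (p - e)" using e less by (simp add: pj_diff mn_pj)
    have "of_real (hs (p - e)) = (of_real (hs p - 1) :: complex)"
      using pj_hs[OF pj] pj_hs[OF less(2)] e by (simp add: mn_tr)
    then have h: "hs (p - e) = hs p - 1" by (simp only: of_real_eq_iff)
    then have "nat \<lfloor>hs (p - e)\<rfloor> < nat \<lfloor>hs p\<rfloor>"
      using hs_ge_0[of "p - e"] by linarith
    from less(1)[OF this pj] obtain r f where f: "tr (p - e) = of_nat r" "p - e = (\<Sum>k<r. f k)"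
      "\<And>k. k < r \<Longrightarrow> mn (f k)" "\<And>k l. k < r \<Longrightarrow> l < r \<Longrightarrow> k \<noteq> l \<Longrightarrow> f k * f l = 0" by blast
    have ee: "e * e = e" using e by (simp add: mn_pj pjD)
    have fe: "f k * e = 0" "e * f k = 0" if "k < r" for k
    proof -
      have "f k = f k * (p - e)" unfolding f(2)
        using orth_sum_mult(1)[of "{..<r}" f f k] f that by (simp add: mn_pj pjD)
      then have "f k * e = f k * ((p - e) * e)" by (metis mult.assoc)
      then show *: "f k * e = 0" by (simp add: algebra_simps e ee)
      have "adj (f k * e) = 0" using * by simp
      then show "e * f k = 0" using e f(3)[OF that] by (simp add: mn_pj pjD)
    qed
    define g where "g k = (if k = r then e else f k)" for k
    have "(\<Sum>k<r. g k) = (\<Sum>k<r. f k)" by (intro sum.cong) (auto simp: g_def)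
    then have "p = (\<Sum>k<Suc r. g k)" using f(2) by (simp add: g_def algebra_simps)
    moreover have "tr p = of_nat (Suc r)" using f(1) e by (simp add: mn_tr algebra_simps)
    ultimately show ?thesis
      using f e fe by (intro exI[of _ "Suc r"] exI[of _ g]) (auto simp: g_def less_Suc_eq)
  qed
qed

lemma pj_tr_nat: "pj p \<Longrightarrow> \<exists>r. tr p = of_nat r"
  using pj_decomp by blast

lemma pj_imp_pim: "pj (v * adj v) \<Longrightarrow> pim v"
proof -
  assume "pj (v * adj v)"
  \<comment> \<open>If \<open>v * adj v\<close> is a projection, then the defect
    \<open>v * adj v * v - v\<close> times its adjoint expands to 0, and positivity kills the
    defect.\<close>
  then have "(v * adj v * v - v) * adj (v * adj v * v - v) = 0"
    by (simp add: pj_def algebra_simps)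
  then have "v * adj v * v - v = 0" by (simp only: mult_adj_self_0)
  then show ?thesis by (simp add: pim_def)
qed

lemma pim_adj: "pim v \<Longrightarrow> pim (adj v)"
  unfolding pim_def by (metis adj_adj adj_mult mult.assoc)

lemma pim_pj: "pim v \<Longrightarrow> pj (v * adj v)" "pim v \<Longrightarrow> pj (adj v * v)"
  by (simp_all add: pim_def pj_def mult.assoc[symmetric]) (simp add: mult.assoc)

lemma pj_pim: "pj p \<Longrightarrow> pim p" by (simp add: pj_def pim_def)

lemma pj_mult_adj_iff: "pj (v * adj v) \<longleftrightarrow> pim v" "pj (adj v * v) \<longleftrightarrow> pim v"
  using pj_imp_pim pim_pj pim_adj by (auto, metis adj_adj)

lemma pimD: "pim v \<Longrightarrow> v * adj v * v = v" "pim v \<Longrightarrow> v * (adj v * v) = v"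
  "pim v \<Longrightarrow> adj v * v * adj v = adj v" "pim v \<Longrightarrow> adj v * (v * adj v) = adj v"
  "pim v \<Longrightarrow> v * (adj v * (v * x)) = v * x" "pim v \<Longrightarrow> adj v * (v * (adj v * x)) = adj v * x"
  using pim_adj[of v] by (auto simp: pim_def mult.assoc) (metis mult.assoc)+

section \<open>Rank one partial isometries\<close>

definition mi :: "fmat \<Rightarrow> bool" where "mi v \<longleftrightarrow> mn (v * adj v)"

lemma mi_pim: "mi v \<Longrightarrow> pim v"
  by (simp add: mi_def mn_pj pj_imp_pim)

lemma mi_adj: "mi v \<Longrightarrow> mi (adj v)"
proof -
  assume v: "mi v"
  note p = pimD[OF mi_pim[OF v]]
  have "adj v * v * a * (adj v * v) = tr (adj v * v * a) \<odot> (adj v * v)" for a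
  proof -
    have "adj v * v * a * (adj v * v) = adj v * ((v * adj v) * (v * a * adj v) * (v * adj v)) * v"
      by (simp add: mult.assoc p)
    also have "(v * adj v) * (v * a * adj v) * (v * adj v) = tr ((v * adj v) * (v * a * adj v)) \<odot> (v * adj v)"
      using v by (simp only: mi_def mn_cut)
    also have "adj v * \<dots> * v = tr ((v * adj v) * (v * a * adj v)) \<odot> (adj v * v)"
      by (simp add: mult.assoc p)
    also have "tr ((v * adj v) * (v * a * adj v)) = tr (adj v * v * a)"
      using tr_comm[of v "a * adj v"] tr_comm[of "adj v * v" a] by (simp add: mult.assoc p)
    finally show ?thesis .
  qed
  moreover have "tr (adj v * v) = 1" using v by (simp add: mi_def mn_def tr_comm)
  ultimately show ?thesis using mi_pim[OF v] by (simp add: mi_def mn_def pim_pj)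
qed

lemma mi_mn: "mi v \<Longrightarrow> mn (adj v * v)" "mi v \<Longrightarrow> mn (v * adj v)"
  using mi_adj[of v] by (simp_all add: mi_def)

lemma mi_neq_0: "mi v \<Longrightarrow> v \<noteq> 0"
  using mn_neq_0[of "v * adj v"] by (auto simp: mi_def)

lemma mn_mi: "mn e \<Longrightarrow> mi e"
  by (simp add: mi_def mn_pj pjD)

text \<open>For \<open>w = e * a * f\<close> both \<open>w * adj w\<close> and
  \<open>adj w * w\<close> are multiples of minimal projections, with the same factor
  \<open>hs w\<close> since their traces agree. Division by its square root makes \<open>w\<close> a
  partial isometry.\<close>

lemma mn_link_through:
  assumes "mn e" "mn f" "e * a * f \<noteq> 0"
  shows "\<exists>c v. c \<noteq> 0 \<and> v = c \<odot> (e * a * f) \<and> v * adj v = e \<and> adj v * v = f"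
proof -
  define w where "w = e * a * f"
  have e: "e * e = e" "adj e = e" "f * f = f" "adj f = f" using assms by (auto simp: mn_pj pjD)
  have "w * adj w = e * (a * f * adj a) * e" by (simp add: w_def e mult.assoc) (simp add: e flip: mult.assoc)
  then obtain c where c: "w * adj w = c \<odot> e" using mn_cut[OF assms(1)] by metis
  have "adj w * w = f * (adj a * e * a) * f" by (simp add: w_def e mult.assoc) (simp add: e flip: mult.assoc)
  then obtain d where d: "adj w * w = d \<odot> f" using mn_cut[OF assms(2)] by metis
  have ch: "c = of_real (hs w)" using arg_cong[OF c, of tr] assms tr_hs[of w] by (simp add: mn_tr tr_comm)
  have dh: "d = of_real (hs w)" using arg_cong[OF d, of tr] assms tr_hs[of w] by (simp add: mn_tr)
  have "hs w \<noteq> 0" using assms(3) by (simp add: w_def)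
  then have hp: "hs w > 0" using hs_ge_0[of w] by linarith
  have w0: "w \<noteq> 0" using assms(3) by (simp add: w_def)
  define k :: complex where "k = of_real (1 / sqrt (hs w))"
  have k: "k * (k * of_real (hs w)) = 1"
    unfolding k_def of_real_mult[symmetric] using hp w0 by (simp add: field_simps)
  have "cnj k = k" by (simp add: k_def)
  moreover have "k \<noteq> 0" using w0 by (simp add: k_def)
  ultimately show ?thesis unfolding w_def[symmetric]
    by (intro exI[of _ k] exI[of _ "k \<odot> w"]) (simp add: c d ch dh k mult.assoc)
qed

text \<open>A matrix unit placed between a nonzero column of \<open>e\<close> and a nonzero row of
  \<open>f\<close> survives the cut by both.\<close>

lemma mn_link: assumes "mn e" "mn f" shows "\<exists>v. v * adj v = e \<and> adj v * v = f"
proof -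
  obtain i x where ix: "ent e i x \<noteq> 0" using mn_neq_0[OF assms(1)] fmat_eqI[of e 0] by (auto simp: ent_simps)
  obtain y j where yj: "ent f y j \<noteq> 0" using mn_neq_0[OF assms(2)] fmat_eqI[of f 0] by (auto simp: ent_simps)
  have "mu i i * (e * mu x y * f) * mu j j = mu i i * e * mu x x * (mu x y * (mu y y * f * mu j j))"
    by (simp add: mult.assoc) (simp add: mu_mult flip: mult.assoc)
  also have "\<dots> = (ent e i x * ent f y j) \<odot> mu i j" by (simp add: mu_sandwich mu_mult mult.commute)
  also have "\<dots> \<noteq> 0" using ix yj tr_mu[of i i] by (auto dest!: arg_cong[where f="\<lambda>z. ent z i j"] simp: ent_simps)
  finally have "e * mu x y * f \<noteq> 0" by auto
  then show ?thesis using mn_link_through[OF assms] by blast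
qed

text \<open>Right multiplication by \<open>adj v\<close> moves this corner into the one of the
  minimal projection \<open>v * adj v\<close>, where \<open>mn_cut\<close> applies.\<close>

lemma mi_span:
  assumes "mi v" shows "(v * adj v) * a * (adj v * v) = tr (a * adj v) \<odot> v"
proof -
  note p = pimD[OF mi_pim[OF assms]]
  have "(v * adj v) * a * (adj v * v) = (v * adj v) * (a * adj v) * (v * adj v) * v" by (simp add: mult.assoc p)
  also have "\<dots> = tr ((v * adj v) * (a * adj v)) \<odot> (v * adj v * v)"
    using assms by (simp add: mi_def mn_cut)
  also have "tr ((v * adj v) * (a * adj v)) = tr (a * adj v)"
    using tr_comm[of "v * adj v" "a * adj v"] by (simp add: mult.assoc p)
  finally show ?thesis by (simp add: p)
qed

lemma pim_sum:
  assumes "finite K" "\<And>k. k \<in> K \<Longrightarrow> pim (u k)"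
    "\<And>k l. k \<in> K \<Longrightarrow> l \<in> K \<Longrightarrow> k \<noteq> l \<Longrightarrow> u k * adj (u l) = 0"
    "\<And>k l. k \<in> K \<Longrightarrow> l \<in> K \<Longrightarrow> k \<noteq> l \<Longrightarrow> adj (u k) * u l = 0"
  shows "pim (sum u K)" "sum u K * adj (sum u K) = (\<Sum>k\<in>K. u k * adj (u k))"
    "adj (sum u K) * sum u K = (\<Sum>k\<in>K. adj (u k) * u k)"
proof -
  show 1: "sum u K * adj (sum u K) = (\<Sum>k\<in>K. u k * adj (u k))"
    unfolding adj_sum by (rule orth_sum_sum) (use assms in auto)
  show "adj (sum u K) * sum u K = (\<Sum>k\<in>K. adj (u k) * u k)"
    unfolding adj_sum by (rule orth_sum_sum) (use assms in auto)
  have "pj (\<Sum>k\<in>K. u k * adj (u k))"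
  proof (rule pj_sum)
    fix k l assume "k \<in> K" "l \<in> K" "k \<noteq> l"
    then have "adj (u k) * u l = 0" by (rule assms)
    then show "u k * adj (u k) * (u l * adj (u l)) = 0" by (metis mult.assoc mult_zero_left mult_zero_right)
  qed (use assms in \<open>auto simp: pim_pj\<close>)
  then show "pim (sum u K)" using 1 pj_imp_pim by metis
qed

text \<open>Murray-von Neumann equivalence: the rank one summands of both projections are linked in
  pairs, and the links are orthogonal enough to be added up.\<close>

lemma pj_equiv:
  assumes "pj p" "pj q" "tr p = tr q"
  shows "\<exists>u. u * adj u = p \<and> adj u * u = q"
proof -
  obtain r f where f: "tr p = of_nat r" "p = (\<Sum>k<r. f k)"
      "\<And>k. k < r \<Longrightarrow> mn (f k)" "\<And>k l. k < r \<Longrightarrow> l < r \<Longrightarrow> k \<noteq> l \<Longrightarrow> f k * f l = 0" using pj_decomp[OF assms(1)] by blast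
  obtain s g where g: "tr q = of_nat s" "q = (\<Sum>k<s. g k)"
      "\<And>k. k < s \<Longrightarrow> mn (g k)" "\<And>k l. k < s \<Longrightarrow> l < s \<Longrightarrow> k \<noteq> l \<Longrightarrow> g k * g l = 0" using pj_decomp[OF assms(2)] by blast
  have rs: "s = r" using f g assms by simp
  have "\<exists>v. v * adj v = f k \<and> adj v * v = g k" if "k < r" for k using mn_link f g that rs by blast
  then obtain v where v: "\<And>k. k < r \<Longrightarrow> v k * adj (v k) = f k" "\<And>k. k < r \<Longrightarrow> adj (v k) * v k = g k" by metis
  have pv: "pim (v k)" if "k < r" for k using v f that pj_imp_pim mn_pj by metis
  have "v k * adj (v l) = 0" if "k < r" "l < r" "k \<noteq> l" for k l
  proof -
    have "v k * adj (v l) = v k * (adj (v k) * v k) * ((adj (v l) * v l) * adj (v l))" using pv that by (simp add: pimD)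
    also have "\<dots> = v k * (g k * g l) * adj (v l)" using v that by (simp add: mult.assoc)
    finally show ?thesis using g that rs by simp
  qed
  moreover have "adj (v k) * v l = 0" if "k < r" "l < r" "k \<noteq> l" for k l
  proof -
    have "adj (v k) * v l = adj (v k) * (v k * adj (v k)) * ((v l * adj (v l)) * v l)" using pv that by (simp add: pimD)
    also have "\<dots> = adj (v k) * (f k * f l) * v l" using v that by (simp add: mult.assoc)
    finally show ?thesis using f that by simp
  qed
  ultimately show ?thesis using pim_sum[of "{..<r}" v] pv v f g rs
    by (intro exI[of _ "sum v {..<r}"]) auto
qed

lemma pj_sub_exists:
  assumes "pj R" "tr R = of_nat r" "d \<le> r"
  shows "\<exists>Q. pj Q \<and> R * Q = Q \<and> tr Q = of_nat d"
proof -
  obtain r' f where f: "tr R = of_nat r'" "R = (\<Sum>k<r'. f k)"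
      "\<And>k. k < r' \<Longrightarrow> mn (f k)" "\<And>k l. k < r' \<Longrightarrow> l < r' \<Longrightarrow> k \<noteq> l \<Longrightarrow> f k * f l = 0" using pj_decomp[OF assms(1)] by blast
  have r: "r' = r" using f assms by simp
  have "R * (\<Sum>k<d. f k) = (\<Sum>k<d. R * f k)" by (simp add: sum_distrib_left)
  also have "\<dots> = (\<Sum>k<d. f k)"
  proof (intro sum.cong refl)
    fix k assume "k \<in> {..<d}"
    then show "R * f k = f k" unfolding f(2)
      using orth_sum_mult(2)[of "{..<r'}" f f k] f assms r by (simp add: mn_pj pjD)
  qed
  finally have "R * (\<Sum>k<d. f k) = (\<Sum>k<d. f k)" .
  moreover have "pj (\<Sum>k<d. f k)" using f assms r by (intro pj_sum) (auto simp: mn_pj)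
  moreover have "tr (\<Sum>k<d. f k) = of_nat d" using f assms r by (simp add: mn_tr)
  ultimately show ?thesis by blast
qed

lemma pim_decomp:
  assumes "pim v"
  shows "\<exists>r u. tr (v * adj v) = of_nat r \<and> v = (\<Sum>k<r. u k) \<and> (\<forall>k<r. mi (u k) \<and> (v * adj v) * u k = u k \<and> u k = u k * adj (u k) * v)
    \<and> (\<forall>k<r. \<forall>l<r. k \<noteq> l \<longrightarrow> u k * adj (u l) = 0 \<and> adj (u k) * u l = 0)"
proof -
  obtain r f where f: "tr (v * adj v) = of_nat r" "v * adj v = (\<Sum>k<r. f k)"
      "\<And>k. k < r \<Longrightarrow> mn (f k)" "\<And>k l. k < r \<Longrightarrow> l < r \<Longrightarrow> k \<noteq> l \<Longrightarrow> f k * f l = 0" using pj_decomp[OF pim_pj(1)[OF assms]] by blast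
  note p = pimD[OF assms]
  have fp: "(v * adj v) * f k = f k" "f k * (v * adj v) = f k" "adj (f k) = f k" "f k * f k = f k" if "k < r" for k
    unfolding f(2)
    using orth_sum_mult[of "{..<r}" f f k] f that by (simp_all add: mn_pj pjD)
  \<comment> \<open>\<open>v\<close> is cut by the rank one summands of its range
    projection.\<close>
  define u where "u k = f k * v" for k
  have "v = v * adj v * v" by (simp add: p)
  then have "v = (\<Sum>k<r. u k)" unfolding f(2) u_def by (simp add: sum_distrib_right)
  moreover have uu: "u k * adj (u l) = (f k * (v * adj v)) * f l" if "k < r" "l < r" for k l
    using fp(1,3)[OF that(2)] by (simp add: u_def mult.assoc)
  moreover have "adj (u k) * u l = 0" if "k < r" "l < r" "k \<noteq> l" for k l
  proof -
    have "adj (u k) * u l = adj v * (f k * f l) * v" using that by (simp add: u_def fp mult.assoc)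
    then show ?thesis using that f by simp
  qed
  moreover have "(v * adj v) * u k = u k" if "k < r" for k
    unfolding u_def mult.assoc[symmetric] using fp(1)[OF that] by (simp add: mult.assoc)
  ultimately show ?thesis using f fp
    by (intro exI[of _ r] exI[of _ u]) (auto simp: mi_def uu u_def[of k for k] mult.assoc[symmetric])
qed

section \<open>Rank and trace\<close>

lemma rank_le_sum:
  assumes "\<And>k. k < r \<Longrightarrow> M k \<in> carrier_mat n n \<and> vec_space.rank n (M k) \<le> (1 :: nat)"
  shows "em N = (\<Sum>k<r. em (M k)) \<Longrightarrow> N \<in> carrier_mat n n \<Longrightarrow> vec_space.rank n (N :: complex mat) \<le> r"
  using assms
proof (induction r arbitrary: N)
  case 0
  then have "N = 0\<^sub>m n n" by (simp add: em_0_iff)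
  then show ?case by (simp add: vec_space.rank_0I)
next
  case (Suc r)
  define N' where "N' = N - M r"
  have c: "M r \<in> carrier_mat n n" "N' \<in> carrier_mat n n" using Suc.prems(3)[of r] by (auto simp: N'_def intro!: minus_carrier_mat)
  have "em N' = (\<Sum>k<r. em (M k))" using Suc c by (simp add: N'_def em_diff)
  then have "vec_space.rank n N' \<le> r" using Suc c by auto
  moreover have "N = N' + M r" using Suc.prems(2) c(1) by (intro eq_matI) (auto simp: N'_def)
  ultimately show ?case using vec_space.rank_subadditive[OF c(2,1)] Suc by (metis add_le_mono le_trans lessI Suc_eq_plus1)
qed

lemma rank_mi_le:
  assumes "M \<in> carrier_mat n n" "mi (em M)"
  shows "vec_space.rank n M \<le> 1"
proof -
  define u where "u = em M"
  define e where "e = u * adj u"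
  have e: "mn e" "e * u = u" using assms by (auto simp: e_def u_def mi_def mi_pim pimD)
  have "tr e = (\<Sum>i<n. ent e i i)" using assms em_bnd by (intro tr_bnd) (auto simp: e_def u_def bnd_mult)
  then have "(\<Sum>i<n. ent e i i) \<noteq> 0" using mn_tr[OF e(1)] by simp
  then obtain j where j: "ent e j j \<noteq> 0" by (meson sum.neutral)
  \<comment> \<open>Since \<open>e\<close> is minimal, \<open>u\<close> is recovered from its row
    \<open>j\<close>; its entries factor into a row part and a column part.\<close>
  have "e * mu j j * e = ent e j j \<odot> e" using e by (simp add: mn_cut tr_comm[of e] tr_mu_mult)
  then have "e = (1 / ent e j j) \<odot> (e * mu j j * e)" using j by simp
  then have "u = (1 / ent e j j) \<odot> (e * (mu j j * u))" by (metis e(2) mult.assoc scl_mult_left)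
  then have h1: "ent u x y = (1 / ent e j j) * ent (e * (mu j j * u)) x y" for x y by (metis scl.rep_eq)
  have h2: "ent (e * (mu j j * u)) x y = ent e x j * ent u j y" for x y
  proof -
    have "e * (mu j j * u) = (e * mu j j) * (mu j j * u)" by (simp add: mu_mult mult.assoc) (simp add: mu_mult flip: mult.assoc)
    then have "mu x x * (e * (mu j j * u)) * mu y y = (mu x x * e * mu j j) * (mu j j * u * mu y y)" by (simp add: mult.assoc)
    also have "\<dots> = (ent e x j * ent u j y) \<odot> mu x y" by (simp add: mu_sandwich mu_mult mult.commute)
    finally have *: "ent (e * (mu j j * u)) x y \<odot> mu x y = (ent e x j * ent u j y) \<odot> mu x y"
      unfolding mu_sandwich .
    show ?thesis using arg_cong[OF *, of "\<lambda>z. ent z x y"] by (simp add: ent_simps)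
  qed
  have *: "ent u x y = (ent e x j / ent e j j) * ent u j y" for x y
    using h1[of x y] unfolding h2[of x y] by simp
  have "M $$ (x, y) = (ent e x j / ent e j j) * ent u j y" if "x < n" "y < n" for x y
  proof -
    have "M $$ (x, y) = ent u x y" using assms(1) that unfolding u_def em.rep_eq by simp
    then show ?thesis using *[of x y] by simp
  qed
  then show ?thesis using assms
    by (intro vec_space.rank_le_1_product_entries[where f="\<lambda>x. ent e x j / ent e j j" and g="\<lambda>y. ent u j y"]) auto
qed

lemma rank_pim_le:
  assumes "M \<in> carrier_mat n n" "pim (em M)" "tr (em M * adj (em M)) = of_nat r"
  shows "vec_space.rank n M \<le> r"
proof -
  obtain r' u where u: "tr (em M * adj (em M)) = of_nat r'" "em M = (\<Sum>k<r'. u k)"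
    "\<And>k. k < r' \<Longrightarrow> mi (u k) \<and> em M * adj (em M) * u k = u k \<and> u k = u k * adj (u k) * em M" using pim_decomp[OF assms(2)] by metis
  have r: "r' = r" using u assms by simp
  have b: "bnd n (u k)" if "k < r" for k
  proof -
    have M: "bnd n (em M)" by (rule em_bnd[OF assms(1)])
    have "em M * adj (em M) * u k = u k" "u k = u k * adj (u k) * em M" using u(3)[of k] that r by auto
    then show ?thesis using un_mult[OF M] mult_un[OF M] unfolding bnd_iff by (metis mult.assoc)
  qed
  show ?thesis
  proof (rule rank_le_sum[of r "\<lambda>k. me n (u k)"])
    show "em M = (\<Sum>k<r. em (me n (u k)))" using u(2) r b by (simp add: em_me)
    show "me n (u k) \<in> carrier_mat n n \<and> vec_space.rank n (me n (u k)) \<le> 1" if "k < r" for k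
      using rank_mi_le[of "me n (u k)" n] u(3)[of k] b[OF that] that r by (simp add: em_me)
  qed (rule assms)
qed

text \<open>Subadditivity bounds the rank from above. For the lower bound \<open>v\<close> is
  completed to a unitary by a partial isometry \<open>w\<close> of complementary trace; the unitary
  has rank \<open>n\<close>, so neither summand can fall short of its bound.\<close>

lemma rank_pim:
  assumes "M \<in> carrier_mat n n" "pim (em M)"
  shows "of_nat (vec_space.rank n M) = tr (em M * adj (em M))"
proof -
  define v where "v = em M"
  have b: "bnd n v" using assms by (simp add: v_def em_bnd)
  obtain r where r: "tr (v * adj v) = of_nat r" using pj_tr_nat pim_pj assms v_def by metis
  have p: "pj (un n - v * adj v)" "pj (un n - adj v * v)"
    using assms b by (auto intro!: pj_diff simp: v_def[symmetric] pim_pj un_mult bnd_mult) (auto simp: pj_def un_mult)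
  have "tr (un n - v * adj v) = tr (un n - adj v * v)" by (simp add: tr_comm[of v])
  then obtain w where w: "w * adj w = un n - v * adj v" "adj w * w = un n - adj v * v" using pj_equiv[OF p] by auto
  have pw: "pim w" using w p pj_imp_pim by metis
  have trw: "tr (w * adj w) = of_nat n - of_nat r" by (simp add: w r tr_un)
  then obtain s where s: "tr (w * adj w) = of_nat s" using pj_tr_nat pim_pj pw by metis
  have ns: "n = r + s" using s trw by (metis add_diff_cancel_left' diff_add_cancel of_nat_add of_nat_eq_iff add.commute)
  have bw: "bnd n w"
  proof -
    have "bnd n (w * adj w)" "bnd n (adj w * w)" unfolding w by (simp_all add: b bnd_diff bnd_mult)
    moreover have "w = (w * adj w) * w" "w = w * (adj w * w)" using pw by (simp_all add: pimD)
    ultimately show ?thesis unfolding bnd_iff by (metis mult.assoc)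
  qed
  have vw: "v * adj w = 0"
  proof -
    have "v * adj w = v * (adj w * w) * adj w" using pw by (simp add: pimD mult.assoc)
    also have "v * (adj w * w) = 0" using assms b unfolding w by (simp add: v_def[symmetric] right_diff_distrib mult_un pimD)
    finally show ?thesis by simp
  qed
  have wv: "w * adj v = 0" using arg_cong[OF vw, of adj] by simp
  have uu: "(v + w) * adj (v + w) = un n" by (simp add: distrib_left distrib_right vw wv w)
  define U where "U = me n (v + w)"
  have eU: "em U = v + w" "U \<in> carrier_mat n n" using b bw by (auto simp: U_def em_me bnd_add)
  have "em (U * mat_adjoint U) = em (1\<^sub>m n)" using eU uu by (subst em_mult[of _ n n _ n]) (auto simp: em_adj un_def[symmetric] simp del: adj_add)
  then have "U * mat_adjoint U = 1\<^sub>m n" using eU by (intro em_inj[of _ n n]) auto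
  then have "det U \<noteq> 0" using det_mult[OF eU(2) mat_adjoint_carrier[OF eU(2)]] by auto
  then have "vec_space.rank n U = n" using vec_space.det_rank_iff[OF eU(2)] by simp
  moreover have "U = M + me n w" using eU bw assms by (intro em_inj[of _ n n]) (auto simp: em_add em_me v_def)
  ultimately have "n \<le> vec_space.rank n M + vec_space.rank n (me n w)"
    using vec_space.rank_subadditive[OF assms(1) me_carrier] by metis
  moreover have "vec_space.rank n (me n w) \<le> s" using bw pw s by (intro rank_pim_le) (auto simp: em_me)
  moreover have "vec_space.rank n M \<le> r" using assms r by (intro rank_pim_le) (auto simp: v_def)
  ultimately have "vec_space.rank n M = r" using ns by linarith
  then show ?thesis using r by (simp add: v_def)
qed

section \<open>Nest algebras inside the ring of finitely supported matrices\<close>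

definition atm :: "nest \<Rightarrow> nat \<Rightarrow> fmat" where "atm A i = em (atoms A ! i)"

abbreviation uno :: "nest \<Rightarrow> fmat" where "uno A \<equiv> un (msize A)"

definition FM :: "nest \<Rightarrow> fmat set" where "FM A = {a. bnd (msize A) a}"

definition NA :: "nest \<Rightarrow> fmat set" where
  "NA A = {a \<in> FM A. \<forall>i<natoms A. \<forall>j<i. atm A i * a * atm A j = 0}"

definition DA :: "nest \<Rightarrow> fmat set" where
  "DA A = {a \<in> FM A. \<forall>i<natoms A. \<forall>j<natoms A. i \<noteq> j \<longrightarrow> atm A i * a * atm A j = 0}"

text \<open>Regularity is separated from membership in the nest algebra because on its own it is
  stable under \<open>adj\<close>, which halves many arguments.\<close>

definition PR :: "nest \<Rightarrow> fmat set" where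
  "PR A = {v \<in> FM A. pim v \<and> (\<forall>i<natoms A. \<forall>j<natoms A. pim (atm A i * v * atm A j))}"

definition RG :: "nest \<Rightarrow> fmat set" where "RG A = NA A \<inter> PR A"

definition OPS :: "nest \<Rightarrow> fmat set" where
  "OPS A = {v \<in> RG A. \<forall>i<natoms A. \<forall>j<natoms A. atm A i * v * atm A j \<noteq> 0 \<longrightarrow>
     (\<forall>s\<le>i. \<forall>t\<in>{j..<natoms A}. (s, t) \<noteq> (i, j) \<longrightarrow> atm A s * v * atm A t = 0)}"

text \<open>The squared Hilbert-Schmidt norm of block \<open>(i, j)\<close>, written as a trace. On
  regular partial isometries it is the rank of the block (\<open>pclass_cl\<close>), so that trace
  identities can replace rank arguments.\<close>

definition cl :: "nest \<Rightarrow> fmat \<Rightarrow> nat \<Rightarrow> nat \<Rightarrow> complex" where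
  "cl A v i j = tr (atm A i * v * atm A j * adj v)"

lemma FM_simps [simp]:
  "0 \<in> FM A" "uno A \<in> FM A" "adj a \<in> FM A \<longleftrightarrow> a \<in> FM A"
  "a \<in> FM A \<Longrightarrow> b \<in> FM A \<Longrightarrow> a + b \<in> FM A"
  "a \<in> FM A \<Longrightarrow> b \<in> FM A \<Longrightarrow> a - b \<in> FM A"
  "a \<in> FM A \<Longrightarrow> b \<in> FM A \<Longrightarrow> a * b \<in> FM A"
  "a \<in> FM A \<Longrightarrow> c \<odot> a \<in> FM A"
  by (auto simp: FM_def bnd_add bnd_diff bnd_mult bnd_scl)

lemma FM_sum [simp]: "(\<And>x. x \<in> S \<Longrightarrow> f x \<in> FM A) \<Longrightarrow> sum f S \<in> FM A"
  by (induction S rule: infinite_finite_induct) auto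

lemma FM_uno [simp]: "a \<in> FM A \<Longrightarrow> uno A * a = a" "a \<in> FM A \<Longrightarrow> a * uno A = a"
  by (auto simp: FM_def un_mult mult_un)

lemma FM_iff: "a \<in> FM A \<longleftrightarrow> uno A * a = a \<and> a * uno A = a"
  unfolding FM_def mem_Collect_eq by (rule bnd_iff)

lemma FM_mid: "a \<in> FM A \<Longrightarrow> b \<in> FM A \<Longrightarrow> a * x * b \<in> FM A"
proof -
  assume *: "a \<in> FM A" "b \<in> FM A"
  have "uno A * (a * x * b) = (uno A * a) * x * b" "a * x * b * uno A = a * x * (b * uno A)" by (simp_all only: mult.assoc)
  then show ?thesis using * unfolding FM_iff by simp
qed

lemma em_mult_full: "a \<in> full A \<Longrightarrow> b \<in> full A \<Longrightarrow> em (a * b) = em a * em b"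
  by (rule em_mult)

lemma pim_0 [simp]: "pim 0" by (simp add: pim_def)

lemma full_em: "a \<in> full A \<Longrightarrow> em a \<in> FM A"
  by (simp add: FM_def em_bnd)

lemma FM_me: "a \<in> FM A \<Longrightarrow> em (me (msize A) a) = a"
  by (simp add: FM_def em_me)

lemma NA_FM: "a \<in> NA A \<Longrightarrow> a \<in> FM A" by (simp add: NA_def)
lemma DA_FM: "a \<in> DA A \<Longrightarrow> a \<in> FM A" by (simp add: DA_def)
lemma PR_FM: "a \<in> PR A \<Longrightarrow> a \<in> FM A" by (simp add: PR_def)
lemma RG_NA: "a \<in> RG A \<Longrightarrow> a \<in> NA A" by (simp add: RG_def)
lemma RG_PR: "a \<in> RG A \<Longrightarrow> a \<in> PR A" by (simp add: RG_def)
lemma OPS_RG: "a \<in> OPS A \<Longrightarrow> a \<in> RG A" by (simp add: OPS_def)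
lemma PR_pim: "a \<in> PR A \<Longrightarrow> pim a" by (simp add: PR_def)
lemma RG_FM: "a \<in> RG A \<Longrightarrow> a \<in> FM A" by (simp add: RG_def PR_def)

lemma NA_closed:
  "a \<in> NA A \<Longrightarrow> b \<in> NA A \<Longrightarrow> a + b \<in> NA A"
  "a \<in> NA A \<Longrightarrow> c \<odot> a \<in> NA A"
  "0 \<in> NA A"
  by (auto simp: NA_def distrib_left distrib_right)

lemma NA_sum: "(\<And>x. x \<in> S \<Longrightarrow> f x \<in> NA A) \<Longrightarrow> sum f S \<in> NA A"
  by (induction S rule: infinite_finite_induct) (auto simp: NA_closed)

lemma DA_closed:
  "a \<in> DA A \<Longrightarrow> b \<in> DA A \<Longrightarrow> a + b \<in> DA A"
  "a \<in> DA A \<Longrightarrow> b \<in> DA A \<Longrightarrow> a - b \<in> DA A"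
  "a \<in> DA A \<Longrightarrow> c \<odot> a \<in> DA A"
  "0 \<in> DA A"
  by (auto simp: DA_def algebra_simps)

lemma DA_sum: "(\<And>x. x \<in> S \<Longrightarrow> f x \<in> DA A) \<Longrightarrow> sum f S \<in> DA A"
  by (induction S rule: infinite_finite_induct) (auto simp: DA_closed)

lemma DA_NA: "a \<in> DA A \<Longrightarrow> a \<in> NA A"
  by (auto simp: DA_def NA_def)

lemma hs_proj_le:
  assumes "pj Q" shows "hs (Q * E) \<le> hs E"
proof -
  have "tr (adj E * E) = tr (adj (Q * E) * (Q * E)) + tr (adj (E - Q * E) * (E - Q * E))"
    using assms by (simp add: pjD algebra_simps)
  then have "hs E = hs (Q * E) + hs (E - Q * E)" by (simp add: hs_def)
  then show ?thesis using hs_ge_0[of "E - Q * E"] by linarith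
qed

lemma pj_tr1_mn:
  assumes "pj p" "tr p = 1" shows "mn p"
proof -
  obtain r f where f: "tr p = of_nat r" "p = (\<Sum>k<r. f k)" "\<And>k. k < r \<Longrightarrow> mn (f k)"
    using pj_decomp[OF assms(1)] by blast
  have "r = 1" using f(1) assms(2) by simp
  then show ?thesis using f by simp
qed

context
  fixes A :: nest
  assumes N: "is_nest A"
begin

lemma msize_pos: "0 < msize A" using N by (simp add: is_nest_def)

lemma atom_carrier: "i < natoms A \<Longrightarrow> atoms A ! i \<in> full A"
  using N by (auto simp: is_nest_def)

lemma at_FM [simp]: "i < natoms A \<Longrightarrow> atm A i \<in> FM A"
  by (simp add: atm_def full_em atom_carrier)

lemma at_adj [simp]: "i < natoms A \<Longrightarrow> adj (atm A i) = atm A i"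
proof -
  assume i: "i < natoms A"
  then have "is_projection (atoms A ! i)" using N by (auto simp: is_nest_def)
  then show ?thesis by (simp add: atm_def is_projection_def flip: em_adj)
qed

lemma at_mult: "i < natoms A \<Longrightarrow> j < natoms A \<Longrightarrow> atm A i * atm A j = (if i = j then atm A i else 0)"
proof -
  assume i: "i < natoms A" and j: "j < natoms A"
  have "is_projection (atoms A ! i)" using N i by (auto simp: is_nest_def)
  moreover have "i \<noteq> j \<longrightarrow> atoms A ! i * atoms A ! j = 0\<^sub>m (msize A) (msize A)" using N i j by (auto simp: is_nest_def)
  moreover have "atm A i * atm A j = em (atoms A ! i * atoms A ! j)"
    unfolding atm_def by (rule em_mult_full[symmetric]) (use i j atom_carrier in auto)
  ultimately show ?thesis by (auto simp: is_projection_def atm_def)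
qed

lemma at_self [simp]: "i < natoms A \<Longrightarrow> atm A i * atm A i = atm A i"
  "i < natoms A \<Longrightarrow> atm A i * (atm A i * x) = atm A i * x"
  by (simp_all add: at_mult flip: mult.assoc)

lemma at_orth: "i < natoms A \<Longrightarrow> j < natoms A \<Longrightarrow> i \<noteq> j \<Longrightarrow> atm A i * atm A j = 0"
  "i < natoms A \<Longrightarrow> j < natoms A \<Longrightarrow> i \<noteq> j \<Longrightarrow> atm A i * (atm A j * x) = 0"
  by (simp_all add: at_mult flip: mult.assoc)

lemma at_pj: "i < natoms A \<Longrightarrow> pj (atm A i)" by (simp add: pj_def)

lemma at_ne_0: "i < natoms A \<Longrightarrow> atm A i \<noteq> 0"
  using N em_0_iff[OF atom_carrier[of i]] by (auto simp: is_nest_def atm_def)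

lemma em_nest_proj:
  assumes "k \<le> natoms A"
  shows "nest_proj A k \<in> full A \<and> em (nest_proj A k) = (\<Sum>i<k. atm A i)"
proof -
  have *: "foldr (+) xs (0\<^sub>m (msize A) (msize A)) \<in> full A \<and>
    em (foldr (+) xs (0\<^sub>m (msize A) (msize A))) = sum_list (map em xs)" if "set xs \<subseteq> full A" for xs
    using that by (induction xs) (auto simp: em_add[of _ "msize A" "msize A"])
  have "set (take k (atoms A)) \<subseteq> full A" using N set_take_subset by (fastforce simp: is_nest_def)
  from *[OF this] have "nest_proj A k \<in> full A" "em (nest_proj A k) = sum_list (map em (take k (atoms A)))"
    by (auto simp: nest_proj_def)
  moreover have "sum_list (map em (take k (atoms A))) = (\<Sum>i<k. atm A i)"
    using assms by (subst sum_list_sum_nth) (auto simp: atm_def lessThan_atLeast0 min_def intro!: sum.cong)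
  ultimately show ?thesis by simp
qed

lemma at_sum: "(\<Sum>i<natoms A. atm A i) = uno A"
  using em_nest_proj[of "natoms A"] N by (simp add: is_nest_def un_def)

lemma natoms_pos: "0 < natoms A"
proof (rule ccontr)
  assume "\<not> 0 < natoms A"
  then have "un (msize A) = 0" using at_sum by simp
  then have "tr (un (msize A)) = 0" by simp
  then show False using msize_pos by (simp add: tr_un)
qed

lemma expand_left: "a \<in> FM A \<Longrightarrow> a = (\<Sum>i<natoms A. atm A i * a)"
  by (metis FM_uno(1) at_sum sum_distrib_right)

lemma expand_right: "a \<in> FM A \<Longrightarrow> a = (\<Sum>i<natoms A. a * atm A i)"
  by (metis FM_uno(2) at_sum sum_distrib_left)

lemma expand_mid: "a \<in> FM A \<Longrightarrow> a * b = (\<Sum>i<natoms A. a * atm A i * b)"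
  by (subst expand_right[of a], assumption) (simp add: sum_distrib_right)

lemma expand_blocks: "a \<in> FM A \<Longrightarrow> a = (\<Sum>i<natoms A. \<Sum>j<natoms A. atm A i * a * atm A j)"
proof -
  assume a: "a \<in> FM A"
  have "a = (\<Sum>i<natoms A. atm A i * a)" by (rule expand_left[OF a])
  also have "\<dots> = (\<Sum>i<natoms A. \<Sum>j<natoms A. atm A i * a * atm A j)" by (intro sum.cong refl expand_right) (simp add: a)
  finally show ?thesis .
qed

lemma block_eqI:
  assumes "a \<in> FM A" "b \<in> FM A" "\<And>i j. i < natoms A \<Longrightarrow> j < natoms A \<Longrightarrow> atm A i * a * atm A j = atm A i * b * atm A j"
  shows "a = b"
  using expand_blocks[OF assms(1)] expand_blocks[OF assms(2)] assms(3) by simp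

text \<open>Together with \<open>comm_DA\<close>: the block diagonal is the relative commutant of
  the atoms.\<close>

lemma DA_comm: "a \<in> DA A \<Longrightarrow> i < natoms A \<Longrightarrow> atm A i * a = a * atm A i"
proof (rule block_eqI)
  fix s t assume *: "a \<in> DA A" "i < natoms A" "s < natoms A" "t < natoms A"
  then show "atm A s * (atm A i * a) * atm A t = atm A s * (a * atm A i) * atm A t"
    by (cases "s = i"; cases "t = i") (auto simp: at_orth DA_def mult.assoc)
qed (auto dest: DA_FM)

lemma comm_DA: "a \<in> FM A \<Longrightarrow> (\<And>i. i < natoms A \<Longrightarrow> atm A i * a = a * atm A i) \<Longrightarrow> a \<in> DA A"
  by (auto simp: DA_def) (simp add: at_orth mult.assoc)

lemma DA_comm2: "a \<in> DA A \<Longrightarrow> i < natoms A \<Longrightarrow> atm A i * (a * x) = a * (atm A i * x)"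
  by (metis DA_comm mult.assoc)

lemma DA_mult: "a \<in> DA A \<Longrightarrow> b \<in> DA A \<Longrightarrow> a * b \<in> DA A"
  by (rule comm_DA) (auto simp: DA_FM DA_comm DA_comm2 mult.assoc)

lemma DA_adj: "adj a \<in> DA A \<longleftrightarrow> a \<in> DA A"
proof -
  have "adj a \<in> DA A" if "a \<in> DA A" for a
  proof (rule comm_DA)
    fix i assume "i < natoms A"
    then have "adj (atm A i * a) = adj (a * atm A i)" using that by (simp add: DA_comm del: adj_mult)
    then show "atm A i * adj a = adj a * atm A i" using \<open>i < natoms A\<close> by simp
  qed (use that in \<open>simp add: DA_FM\<close>)
  from this this[of "adj a"] show ?thesis by auto
qed

lemma at_DA: "i < natoms A \<Longrightarrow> atm A i \<in> DA A"
  by (auto simp: DA_def at_mult)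

lemma uno_DA: "uno A \<in> DA A"
  by (rule comm_DA) auto

lemma NA_mult: "a \<in> NA A \<Longrightarrow> b \<in> NA A \<Longrightarrow> a * b \<in> NA A"
  unfolding NA_def
proof (clarsimp)
  fix i j assume *: "a \<in> FM A" "b \<in> FM A" "\<forall>i<natoms A. \<forall>j<i. atm A i * a * atm A j = 0"
    "\<forall>i<natoms A. \<forall>j<i. atm A i * b * atm A j = 0" "i < natoms A" "j < i"
  have "atm A i * (a * b) * atm A j = atm A i * (\<Sum>k<natoms A. a * atm A k * b) * atm A j"
    using expand_mid[OF *(1)] by metis
  also have "\<dots> = (\<Sum>k<natoms A. (atm A i * a * atm A k) * (atm A k * b * atm A j))"
    by (auto simp: sum_distrib_left sum_distrib_right mult.assoc intro!: sum.cong)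
  also have "\<dots> = 0"
  proof (intro sum.neutral ballI)
    fix k assume "k \<in> {..<natoms A}"
    then show "atm A i * a * atm A k * (atm A k * b * atm A j) = 0" using * by (cases "k < i") auto
  qed
  finally show "atm A i * (a * b) * atm A j = 0" .
qed

lemma NA_adj_DA: "a \<in> NA A \<Longrightarrow> adj a \<in> NA A \<Longrightarrow> a \<in> DA A"
  unfolding DA_def
proof (clarsimp simp: NA_FM)
  fix i j assume *: "a \<in> NA A" "adj a \<in> NA A" "i < natoms A" "j < natoms A" "i \<noteq> j"
  show "atm A i * a * atm A j = 0"
  proof (cases "j < i")
    case False
    then have "atm A j * adj a * atm A i = 0" using * by (simp add: NA_def)
    then have "adj (atm A j * adj a * atm A i) = 0" by simp
    then show ?thesis using * by (simp add: mult.assoc)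
  qed (use * in \<open>simp add: NA_def\<close>)
qed

subsection \<open>Comparison with the given definitions\<close>

lemma nest_alg_iff: "a \<in> full A \<Longrightarrow> a \<in> nest_alg A \<longleftrightarrow> em a \<in> NA A"
proof -
  assume a: "a \<in> full A"
  define x where "x = em a"
  have x: "x \<in> FM A" using a by (simp add: x_def full_em)
  have 1: "em ((1\<^sub>m (msize A) - nest_proj A k) * a * nest_proj A k) = (uno A - (\<Sum>i<k. atm A i)) * x * (\<Sum>i<k. atm A i)"
    if "k \<le> natoms A" for k
    using em_nest_proj[OF that] a
    by (simp add: em_mult_full[of _ A] em_diff[of _ "msize A" "msize A"] un_def x_def
      mult_carrier_mat[of _ "msize A" "msize A"] minus_carrier_mat)
  have 2: "((1\<^sub>m (msize A) - nest_proj A k) * a * nest_proj A k) = 0\<^sub>m (msize A) (msize A) \<longleftrightarrow>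
    (uno A - (\<Sum>i<k. atm A i)) * x * (\<Sum>i<k. atm A i) = 0" if "k \<le> natoms A" for k
    unfolding 1[OF that, symmetric] using em_nest_proj[OF that] a
    by (subst em_0_iff[of _ "msize A" "msize A"]) auto
  have 3: "a \<in> nest_alg A \<longleftrightarrow> (\<forall>k\<in>{1..natoms A}. (uno A - (\<Sum>i<k. atm A i)) * x * (\<Sum>i<k. atm A i) = 0)"
    using 2 a by (auto simp: nest_alg_def)
  show ?thesis unfolding 3 x_def[symmetric]
  proof
    assume *: "\<forall>k\<in>{1..natoms A}. (uno A - (\<Sum>i<k. atm A i)) * x * (\<Sum>i<k. atm A i) = 0"
    have "atm A i * x * atm A j = 0" if ij: "i < natoms A" "j < i" for i j
    proof -
      \<comment> \<open>The cut directly after atom \<open>j\<close> separates it from the later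
        atom \<open>i\<close>, so the condition for \<open>k = Suc j\<close> isolates this
        block.\<close>
      have "atm A i * (\<Sum>s<Suc j. atm A s) = 0" unfolding sum_distrib_left
        by (intro sum.neutral) (use ij in \<open>auto simp: at_orth\<close>)
      then have l: "atm A i * (uno A - (\<Sum>i<Suc j. atm A i)) = atm A i" using ij by (simp add: right_diff_distrib)
      have r: "(\<Sum>s<Suc j. atm A s) * atm A j = atm A j"
        using orth_sum_mult(2)[of "{..<Suc j}" "atm A" "atm A" j] ij by (auto simp: at_orth)
      have "atm A i * x * atm A j = atm A i * ((uno A - (\<Sum>i<Suc j. atm A i)) * x * (\<Sum>i<Suc j. atm A i)) * atm A j"
        using l r by (metis mult.assoc)
      also have "\<dots> = 0" using *[rule_format, of "Suc j"] ij by simp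
      finally show ?thesis .
    qed
    then show "x \<in> NA A" using x by (simp add: NA_def)
  next
    assume *: "x \<in> NA A"
    show "\<forall>k\<in>{1..natoms A}. (uno A - (\<Sum>i<k. atm A i)) * x * (\<Sum>i<k. atm A i) = 0"
    proof
      fix k assume k: "k \<in> {1..natoms A}"
      have "uno A = (\<Sum>i<k. atm A i) + (\<Sum>i=k..<natoms A. atm A i)"
        unfolding at_sum[symmetric] lessThan_atLeast0 using k by (simp add: sum.atLeastLessThan_concat)
      then have u: "uno A - (\<Sum>i<k. atm A i) = (\<Sum>i=k..<natoms A. atm A i)" by simp
      show "(uno A - (\<Sum>i<k. atm A i)) * x * (\<Sum>i<k. atm A i) = 0"
        unfolding u sum_distrib_left sum_distrib_right
        by (intro sum.neutral ballI) (use * in \<open>auto simp: NA_def\<close>)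
    qed
  qed
qed

lemma nest_alg_em: "em ` nest_alg A = NA A"
proof -
  have "nest_alg A \<subseteq> full A" by (auto simp: nest_alg_def)
  then show ?thesis using nest_alg_iff
    by (auto simp: image_iff) (metis FM_me NA_FM me_carrier)
qed

lemma me_nest_alg: "a \<in> NA A \<Longrightarrow> me (msize A) a \<in> nest_alg A"
  using nest_alg_iff[of "me (msize A) a"] by (simp add: FM_me NA_FM)

lemma em_block: "v \<in> full A \<Longrightarrow> i < natoms A \<Longrightarrow> j < natoms A \<Longrightarrow>
    block A i j v \<in> full A \<and> em (block A i j v) = atm A i * em v * atm A j"
  using atom_carrier[of i] atom_carrier[of j]
  by (auto simp: block_def atm_def em_mult_full[of _ A] mult_carrier_mat[of _ "msize A" "msize A"] mult.assoc)

lemma em_pim: "v \<in> full A \<Longrightarrow> partial_isometry v \<longleftrightarrow> pim (em v)"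
proof -
  assume v: "v \<in> full A"
  have "em (v * mat_adjoint v * v) = em v * adj (em v) * em v"
    using v by (simp add: em_mult_full[of _ A] em_adj mult_carrier_mat[of _ "msize A" "msize A"])
  then show ?thesis unfolding partial_isometry_def pim_def
    using em_inj[OF mult_carrier_mat[OF mult_carrier_mat[OF v mat_adjoint_carrier[OF v]] v] v] by auto
qed

lemma Pisom_reg_iff: "v \<in> full A \<Longrightarrow> v \<in> Pisom_reg A \<longleftrightarrow> em v \<in> RG A"
  using em_block em_pim full_em
  by (auto simp: Pisom_reg_def RG_def PR_def nest_alg_iff)

lemma Pisom_reg_full: "v \<in> Pisom_reg A \<Longrightarrow> v \<in> full A"
  by (auto simp: Pisom_reg_def nest_alg_def)

lemma Pisom_op_iff: "v \<in> full A \<Longrightarrow> v \<in> Pisom_op A \<longleftrightarrow> em v \<in> OPS A"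
proof -
  assume v: "v \<in> full A"
  have "block A i j v = 0\<^sub>m (msize A) (msize A) \<longleftrightarrow> atm A i * em v * atm A j = 0" if "i < natoms A" "j < natoms A" for i j
    using em_block[OF v that] em_0_iff by metis
  then show ?thesis using v by (auto simp: Pisom_op_def OPS_def Pisom_reg_iff)
qed

lemma Pisom_op_full: "v \<in> Pisom_op A \<Longrightarrow> v \<in> full A"
  by (auto simp: Pisom_op_def Pisom_reg_full)

lemma projection_iff: "p \<in> full A \<Longrightarrow> is_projection p \<longleftrightarrow> pj (em p)"
proof -
  assume p: "p \<in> full A"
  have "em (p * p) = em p * em p" using p by (simp add: em_mult[of _ "msize A" "msize A"])
  then show ?thesis unfolding is_projection_def pj_def
    using p em_inj[of "p * p" "msize A" "msize A" p] em_inj[of "mat_adjoint p" "msize A" "msize A" p]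
    by (auto simp: em_adj[symmetric])
qed

subsection \<open>Regular partial isometries\<close>

lemma cl_block: "i < natoms A \<Longrightarrow> j < natoms A \<Longrightarrow> cl A v i j = tr ((atm A i * v * atm A j) * adj (atm A i * v * atm A j))"
  unfolding cl_def using tr_comm[of "atm A i" "v * (atm A j * (adj v * atm A i))"]
    tr_comm[of "atm A i" "v * (atm A j * (adj v))"]
  by (simp add: mult.assoc)

lemma cl_hs: "i < natoms A \<Longrightarrow> j < natoms A \<Longrightarrow> cl A v i j = of_real (hs (atm A i * v * atm A j))"
  by (simp only: cl_block tr_comm[of "atm A i * v * atm A j"] tr_hs)

lemma cl_0_iff: "i < natoms A \<Longrightarrow> j < natoms A \<Longrightarrow> cl A v i j = 0 \<longleftrightarrow> atm A i * v * atm A j = 0"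
  by (simp add: cl_hs)

lemma pclass_cl:
  assumes "v \<in> Pisom_reg A" "i < natoms A" "j < natoms A"
  shows "of_int (pclass A v $$ (i, j)) = cl A (em v) i j"
proof -
  have v: "v \<in> full A" using assms Pisom_reg_full by blast
  have "pim (em (block A i j v))" using em_block[OF v assms(2,3)] assms Pisom_reg_iff[OF v] by (simp add: RG_def PR_def)
  from rank_pim[OF _ this] em_block[OF v assms(2,3)] show ?thesis
    using assms by (simp add: pclass_def cl_block)
qed

lemma PR_adj: "v \<in> PR A \<Longrightarrow> adj v \<in> PR A"
proof -
  assume v: "v \<in> PR A"
  have "pim (atm A i * adj v * atm A j)" if "i < natoms A" "j < natoms A" for i j
    using v that pim_adj[of "atm A j * v * atm A i"] by (simp add: PR_def mult.assoc)
  then show ?thesis using v by (auto simp: PR_def pim_adj)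
qed

text \<open>The initial projections \<open>E i\<close> of the blocks in column \<open>j\<close> add
  up to the compression of \<open>Q = adj v * v\<close> to that atom. Hence the squared norms of the
  \<open>E i * E k\<close> add up to that of \<open>Q * E k\<close>, which is at most that of
  \<open>E k\<close>. The term \<open>i = k\<close> already exhausts this bound, so the other ones
  vanish.\<close>

lemma PR_orth:
  assumes v: "v \<in> PR A" and ij: "i < natoms A" "k < natoms A" "i \<noteq> k" "j < natoms A"
  shows "atm A i * v * atm A j * adj v * atm A k = 0"
proof -
  define b where "b i = atm A i * v * atm A j" for i
  define E where "E i = adj (b i) * b i" for i
  have pb: "pim (b i)" if "i < natoms A" for i using v that ij by (simp add: PR_def b_def)
  have pE: "pj (E i)" if "i < natoms A" for i using pb that by (simp add: E_def pim_pj)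
  define Q where "Q = adj v * v"
  have pQ: "pj Q" using v by (simp add: Q_def PR_def pim_pj)
  have Eat: "E i * atm A j = E i" "atm A j * E i = E i" if "i < natoms A" for i using ij that by (simp_all add: E_def b_def mult.assoc)
  have vF: "v \<in> FM A" using v by (simp add: PR_FM)
  have S: "(\<Sum>i<natoms A. E i) = atm A j * Q * atm A j"
  proof -
    have "atm A j * Q * atm A j = atm A j * (adj v * v) * atm A j" by (simp add: Q_def)
    also have "adj v * v = (\<Sum>i<natoms A. adj v * atm A i * v)" by (rule expand_mid) (simp add: vF)
    also have "atm A j * \<dots> * atm A j = (\<Sum>i<natoms A. E i)"
      using ij by (auto simp: sum_distrib_left sum_distrib_right E_def b_def mult.assoc intro!: sum.cong)
    finally show ?thesis by simp
  qed
  have "(\<Sum>i<natoms A. of_real (hs (E i * E k))) = (of_real (hs (Q * E k)) :: complex)"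
  proof -
    have "hs (E i * E k) = Re (tr (E k * E i * E k))" if "i < natoms A" for i
      using that ij pE by (simp add: hs_def pjD mult.assoc)
    then have "(\<Sum>i<natoms A. of_real (hs (E i * E k))) = (\<Sum>i<natoms A. tr (E k * E i * E k))"
    proof (intro sum.cong refl)
      fix i assume i: "i \<in> {..<natoms A}"
      have "tr (E k * E i * E k) = tr (adj (E i * E k) * (E i * E k))" using i ij pE by (simp add: pjD mult.assoc)
      then show "of_real (hs (E i * E k)) = tr (E k * E i * E k)" by (metis tr_hs)
    qed
    also have "\<dots> = tr (E k * (\<Sum>i<natoms A. E i) * E k)" by (simp add: sum_distrib_left sum_distrib_right)
    also have "E k * (\<Sum>i<natoms A. E i) * E k = (E k * atm A j) * Q * (atm A j * E k)" by (simp add: S mult.assoc)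
    also have "\<dots> = adj (Q * E k) * (Q * E k)" using ij pE pQ by (simp add: Eat pjD mult.assoc)
    also have "tr \<dots> = of_real (hs (Q * E k))" by (rule tr_hs)
    finally show ?thesis .
  qed
  then have "(\<Sum>i<natoms A. hs (E i * E k)) = hs (Q * E k)" by (simp only: of_real_sum[symmetric] of_real_eq_iff)
  also have "\<dots> \<le> hs (E k)" by (rule hs_proj_le[OF pQ])
  finally have le: "(\<Sum>i<natoms A. hs (E i * E k)) \<le> hs (E k)" .
  have "(\<Sum>i\<in>{i,k}. hs (E i * E k)) \<le> (\<Sum>i<natoms A. hs (E i * E k))" by (rule sum_mono2) (use ij in auto)
  then have "hs (E i * E k) + hs (E k) \<le> hs (E k)" using le ij pE by (simp add: pjD)
  then have "hs (E i * E k) = 0" using hs_ge_0[of "E i * E k"] by linarith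
  then have EE: "E i * E k = 0" by simp
  have "b i * adj (b k) = b i * (E i * E k) * adj (b k)" using pb ij by (simp add: E_def mult.assoc pimD)
  then have "b i * adj (b k) = 0" using EE by simp
  then show ?thesis using ij by (simp add: b_def mult.assoc)
qed

lemma PR_DA: assumes "v \<in> PR A" shows "v * adj v \<in> DA A" "adj v * v \<in> DA A"
proof -
  have *: "v * adj v \<in> DA A" if v: "v \<in> PR A" for v
    unfolding DA_def
  proof (clarsimp simp: PR_FM[OF that])
    fix i k assume ik: "i < natoms A" "k < natoms A" "i \<noteq> k"
    have "atm A i * (v * adj v) * atm A k = atm A i * (\<Sum>j<natoms A. v * atm A j * adj v) * atm A k"
      using expand_mid[OF PR_FM[OF v]] by metis
    also have "\<dots> = (\<Sum>j<natoms A. atm A i * v * atm A j * adj v * atm A k)"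
      by (simp add: sum_distrib_left sum_distrib_right mult.assoc)
    also have "\<dots> = 0" using PR_orth[OF v] ik by (intro sum.neutral) auto
    finally show "atm A i * (v * adj v) * atm A k = 0" .
  qed
  from *[OF assms] *[OF PR_adj[OF assms]] show "v * adj v \<in> DA A" "adj v * v \<in> DA A" by auto
qed

text \<open>The support projections of \<open>u\<close> are block diagonal, so an atom standing
  between two orthogonal elements can be moved out of the way.\<close>

lemma PR_cross:
  assumes "u \<in> PR A" "w \<in> PR A" "t < natoms A"
  shows "u * adj w = 0 \<Longrightarrow> u * atm A t * adj w = 0" "adj u * w = 0 \<Longrightarrow> adj u * atm A t * w = 0"
proof -
  assume *: "u * adj w = 0"
  have "u * atm A t * adj w = u * (adj u * u * atm A t) * adj w" using assms by (simp add: mult.assoc PR_pim pimD)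
  also have "adj u * u * atm A t = atm A t * (adj u * u)" using PR_DA(2)[OF assms(1)] assms by (simp add: DA_comm)
  finally show "u * atm A t * adj w = 0" using * by (simp add: mult.assoc)
next
  assume *: "adj u * w = 0"
  have "adj u * atm A t * w = adj u * (u * adj u * atm A t) * w" using assms by (simp add: mult.assoc PR_pim pimD)
  also have "u * adj u * atm A t = atm A t * (u * adj u)" using PR_DA(1)[OF assms(1)] assms by (simp add: DA_comm)
  finally show "adj u * atm A t * w = 0" using * by (simp add: mult.assoc)
qed

text \<open>By \<open>PR_cross\<close> the corresponding blocks of orthogonal summands are
  orthogonal too; hence both regularity and the class are additive.\<close>

lemma PR_sum:
  assumes K: "finite K" and u: "\<And>k. k \<in> K \<Longrightarrow> u k \<in> PR A"
    and o1: "\<And>k l. k \<in> K \<Longrightarrow> l \<in> K \<Longrightarrow> k \<noteq> l \<Longrightarrow> u k * adj (u l) = 0"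
    and o2: "\<And>k l. k \<in> K \<Longrightarrow> l \<in> K \<Longrightarrow> k \<noteq> l \<Longrightarrow> adj (u k) * u l = 0"
  shows "sum u K \<in> PR A"
    "i < natoms A \<Longrightarrow> j < natoms A \<Longrightarrow> cl A (sum u K) i j = (\<Sum>k\<in>K. cl A (u k) i j)"
proof -
  have b: "atm A i * sum u K * atm A j = (\<Sum>k\<in>K. atm A i * u k * atm A j)" for i j
    by (simp add: sum_distrib_left sum_distrib_right)
  have o1': "(atm A i * u k * atm A j) * adj (atm A i * u l * atm A j) = 0"
    if "k \<in> K" "l \<in> K" "k \<noteq> l" "i < natoms A" "j < natoms A" for k l i j
    using PR_cross(1)[OF u u _ o1, of k l j] that by (simp add: mult.assoc) (metis mult.assoc mult_zero_left mult_zero_right)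
  have o2': "adj (atm A i * u k * atm A j) * (atm A i * u l * atm A j) = 0"
    if "k \<in> K" "l \<in> K" "k \<noteq> l" "i < natoms A" "j < natoms A" for k l i j
    using PR_cross(2)[OF u u _ o2, of k l i] that by (simp add: mult.assoc) (metis mult.assoc mult_zero_left mult_zero_right)
  have ps: "pim (sum u K)" by (rule pim_sum(1)) (use K PR_pim[OF u] o1 o2 in auto)
  have pb: "pim (atm A i * sum u K * atm A j)" if "i < natoms A" "j < natoms A" for i j
    unfolding b by (rule pim_sum(1)) (use K u o1' o2' that in \<open>auto simp: PR_def simp del: adj_mult\<close>)
  show "sum u K \<in> PR A" using ps pb u by (simp add: PR_def)
  show "cl A (sum u K) i j = (\<Sum>k\<in>K. cl A (u k) i j)" if "i < natoms A" "j < natoms A"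
    unfolding cl_block[OF that] b adj_sum
    by (subst orth_sum_sum) (use K o1' that in \<open>auto simp del: adj_mult\<close>)
qed

lemma RG_sum:
  assumes "finite K" "\<And>k. k \<in> K \<Longrightarrow> u k \<in> RG A"
    "\<And>k l. k \<in> K \<Longrightarrow> l \<in> K \<Longrightarrow> k \<noteq> l \<Longrightarrow> u k * adj (u l) = 0"
    "\<And>k l. k \<in> K \<Longrightarrow> l \<in> K \<Longrightarrow> k \<noteq> l \<Longrightarrow> adj (u k) * u l = 0"
  shows "sum u K \<in> RG A"
  using PR_sum(1)[of K u] NA_sum[of K u A] assms by (auto simp: RG_def)

section \<open>Elements supported in a single block\<close>

definition blk :: "nat \<Rightarrow> nat \<Rightarrow> fmat \<Rightarrow> bool" where
  "blk i j v \<longleftrightarrow> i < natoms A \<and> j < natoms A \<and> atm A i * v * atm A j = v"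

lemma blkD: "blk i j v \<Longrightarrow> i < natoms A" "blk i j v \<Longrightarrow> j < natoms A"
  "blk i j v \<Longrightarrow> atm A i * v = v" "blk i j v \<Longrightarrow> v * atm A j = v" "blk i j v \<Longrightarrow> v \<in> FM A"
proof -
  assume b: "blk i j v"
  show ij: "i < natoms A" "j < natoms A" using b by (auto simp: blk_def)
  have e: "atm A i * v * atm A j = v" using b by (simp add: blk_def)
  have "atm A i * (atm A i * v * atm A j) = atm A i * v * atm A j" using ij by (simp add: mult.assoc)
  then show "atm A i * v = v" unfolding e .
  have "atm A i * v * atm A j * atm A j = atm A i * v * atm A j" using ij by (simp add: mult.assoc)
  then show "v * atm A j = v" unfolding e .
  show "v \<in> FM A" using FM_mid[of "atm A i" A "atm A j" v] e ij by simp
qed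

lemma blkI: "i < natoms A \<Longrightarrow> j < natoms A \<Longrightarrow> atm A i * v = v \<Longrightarrow> v * atm A j = v \<Longrightarrow> blk i j v"
  by (simp add: blk_def)

lemma blk_at: "blk i j v \<Longrightarrow> s < natoms A \<Longrightarrow> t < natoms A \<Longrightarrow>
    atm A s * v = (if s = i then v else 0)" "blk i j v \<Longrightarrow> s < natoms A \<Longrightarrow> t < natoms A \<Longrightarrow>
    v * atm A t = (if t = j then v else 0)"
proof -
  assume b: "blk i j v" and st: "s < natoms A" "t < natoms A"
  note d = blkD[OF b]
  have "atm A s * v = (atm A s * atm A i) * v" using d by (simp add: mult.assoc)
  then show "atm A s * v = (if s = i then v else 0)" using d st by (auto simp: at_mult)
  have "v * atm A t = v * (atm A j * atm A t)" using d by (simp flip: mult.assoc)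
  then show "v * atm A t = (if t = j then v else 0)" using d st by (auto simp: at_mult)
qed

lemma blk_block: "blk i j v \<Longrightarrow> s < natoms A \<Longrightarrow> t < natoms A \<Longrightarrow>
    atm A s * v * atm A t = (if s = i \<and> t = j then v else 0)"
  by (auto simp: blk_at)

lemma blk_adj: "blk i j v \<Longrightarrow> blk j i (adj v)"
proof -
  assume b: "blk i j v"
  note d = blkD[OF b]
  show ?thesis using d(1,2) d(3,4) by (intro blkI) (metis adj_mult at_adj)+
qed

lemma blk_mult: "blk i j v \<Longrightarrow> blk j k w \<Longrightarrow> blk i k (v * w)"
  by (intro blkI) (auto simp: blkD mult.assoc simp flip: mult.assoc[of "atm A i"])

lemma blk_PR: "pim v \<Longrightarrow> blk i j v \<Longrightarrow> v \<in> PR A"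
  by (auto simp: PR_def blkD blk_block)
lemma blk_NA: "blk i j v \<Longrightarrow> i \<le> j \<Longrightarrow> v \<in> NA A"
  by (auto simp: NA_def blkD blk_block)

lemma blk_DA: "blk i i v \<Longrightarrow> v \<in> DA A"
  by (auto simp: DA_def blkD blk_block)

lemma blk_RG: "pim v \<Longrightarrow> blk i j v \<Longrightarrow> i \<le> j \<Longrightarrow> v \<in> RG A"
  by (simp add: RG_def blk_PR blk_NA)

lemma blk_OPS: "pim v \<Longrightarrow> blk i j v \<Longrightarrow> i \<le> j \<Longrightarrow> v \<in> OPS A"
  by (auto simp: OPS_def blk_RG blk_block split: if_splits)

text \<open>The strictly lower blocks become upper ones after taking adjoints. This carries
  information about a nest algebra over to the matrix algebra that it generates.\<close>

lemma FM_split: "a \<in> FM A \<Longrightarrow> \<exists>b\<in>NA A. \<exists>c\<in>NA A. a = b + adj c"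
proof -
  assume a: "a \<in> FM A"
  define f where "f i j = atm A i * a * atm A j" for i j
  have bl: "blk i j (f i j)" if "i < natoms A" "j < natoms A" for i j
    using that at_self(2)[OF that(1)] by (intro blkI) (simp_all add: f_def mult.assoc)
  define b where "b = (\<Sum>i<natoms A. \<Sum>j<natoms A. if i \<le> j then f i j else 0)"
  define c where "c = (\<Sum>i<natoms A. \<Sum>j<natoms A. if i \<le> j then 0 else adj (f i j))"
  have "a = (\<Sum>i<natoms A. \<Sum>j<natoms A. f i j)" unfolding f_def by (rule expand_blocks[OF a])
  also have "\<dots> = b + adj c" unfolding b_def c_def adj_sum sum.distrib[symmetric] by (intro sum.cong refl) simp
  finally have "a = b + adj c" .
  moreover have fN: "f i j \<in> NA A" if "i \<le> j" "j < natoms A" for i j using blk_NA[OF bl] that by simp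
  have "b \<in> NA A" unfolding b_def by (intro NA_sum) (simp add: NA_closed fN)
  moreover have aN: "adj (f i j) \<in> NA A" if "j \<le> i" "i < natoms A" for i j using blk_NA[OF blk_adj[OF bl]] that by simp
  have "c \<in> NA A" unfolding c_def by (intro NA_sum) (simp add: NA_closed aN)
  ultimately show ?thesis by blast
qed

text \<open>By \<open>PR_orth\<close>, applied to \<open>v\<close> and to \<open>adj v\<close>,
  distinct blocks of a regular \<open>v\<close> are orthogonal on both sides, so rank one
  decompositions of the blocks combine to one of \<open>v\<close>. Whatever is additive can then be
  tested on rank one elements in one block. The index triples consist of a block and a position in
  it.\<close>

lemma RG_decomp:
  assumes vR: "v \<in> RG A"
  shows "\<exists>(K :: (nat \<times> nat \<times> nat) set) u I J. finite K \<and> v = sum u K \<and>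
    (\<forall>k\<in>K. mi (u k) \<and> blk (I k) (J k) (u k) \<and> I k \<le> J k \<and> u k * adj (u k) * v = u k) \<and>
    (\<forall>k\<in>K. \<forall>l\<in>K. k \<noteq> l \<longrightarrow> u k * adj (u l) = 0 \<and> adj (u k) * u l = 0)"
proof -
  have v: "v \<in> PR A" by (rule RG_PR[OF vR])
  define b where "b i j = atm A i * v * atm A j" for i j
  define P where "P i j r u \<longleftrightarrow> tr (b i j * adj (b i j)) = of_nat r \<and> b i j = (\<Sum>k<r. u k) \<and>
     (\<forall>k<(r::nat). mi (u k) \<and> (b i j * adj (b i j)) * u k = u k \<and> u k = u k * adj (u k) * b i j)
    \<and> (\<forall>k<r. \<forall>l<r. k \<noteq> l \<longrightarrow> u k * adj (u l) = 0 \<and> adj (u k) * u l = 0)" for i j r u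
  have "\<exists>r u. P i j r u" if "i < natoms A" "j < natoms A" for i j
  proof -
    have "pim (b i j)" using v that by (simp add: PR_def b_def)
    from pim_decomp[OF this] show ?thesis unfolding P_def .
  qed
  then have "\<exists>r u. i < natoms A \<longrightarrow> j < natoms A \<longrightarrow> P i j r u" for i j by blast
  then obtain r u where "\<And>i j. i < natoms A \<Longrightarrow> j < natoms A \<Longrightarrow> P i j (r i j) (u i j)" by metis
  then have ru: "\<And>i j. i < natoms A \<Longrightarrow> j < natoms A \<Longrightarrow> b i j = (\<Sum>k<r i j. u i j k)"
     "\<And>i j k. i < natoms A \<Longrightarrow> j < natoms A \<Longrightarrow> k < r i j \<Longrightarrow>
        mi (u i j k) \<and> (b i j * adj (b i j)) * u i j k = u i j k \<and> u i j k = u i j k * adj (u i j k) * b i j"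
     "\<And>i j k l. i < natoms A \<Longrightarrow> j < natoms A \<Longrightarrow> k < r i j \<Longrightarrow> l < r i j \<Longrightarrow> k \<noteq> l \<Longrightarrow>
        u i j k * adj (u i j l) = 0 \<and> adj (u i j k) * u i j l = 0"
    unfolding P_def by blast+
  define K where "K = (SIGMA i:{..<natoms A}. SIGMA j:{..<natoms A}. {..<r i j})"
  define U where "U = (\<lambda>(i, j, k). u i j k)"
  have KI: "(i, j, k) \<in> K \<longleftrightarrow> i < natoms A \<and> j < natoms A \<and> k < r i j" for i j k by (auto simp: K_def)
  have bat: "atm A i * b i j = b i j" "b i j * atm A j = b i j" if "i < natoms A" "j < natoms A" for i j
    using that by (simp_all add: b_def mult.assoc)
  have bb1: "b i j * adj (b i' j') = 0" if "i < natoms A" "j < natoms A" "i' < natoms A" "j' < natoms A" "(i, j) \<noteq> (i', j')" for i j i' j'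
  proof (cases "j = j'")
    case True
    then show ?thesis using PR_orth[OF v, of i i' j] that by (simp add: b_def mult.assoc)
  next
    case False
    have "b i j * adj (b i' j') = atm A i * v * (atm A j * atm A j') * adj v * atm A i'" using that by (simp add: b_def mult.assoc)
    then show ?thesis using False that by (simp add: at_orth)
  qed
  have bb2: "adj (b i j) * b i' j' = 0" if "i < natoms A" "j < natoms A" "i' < natoms A" "j' < natoms A" "(i, j) \<noteq> (i', j')" for i j i' j'
  proof (cases "i = i'")
    case True
    then show ?thesis using PR_orth[OF PR_adj[OF v], of j j' i] that by (simp add: b_def mult.assoc)
  next
    case False
    have "adj (b i j) * b i' j' = atm A j * adj v * (atm A i * atm A i') * v * atm A j'" using that by (simp add: b_def mult.assoc)
    then show ?thesis using False that by (simp add: at_orth)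
  qed
  have ub: "u i j k = u i j k * adj (u i j k) * b i j" "u i j k = b i j * (adj (b i j) * u i j k)" if "(i, j, k) \<in> K" for i j k
    using ru(2)[of i j k] that by (auto simp: KI mult.assoc)
  have o1: "U k * adj (U l) = 0" and o2: "adj (U k) * U l = 0" if "k \<in> K" "l \<in> K" "k \<noteq> l" for k l
  proof -
    obtain i j k' i' j' l' where e: "k = (i, j, k')" "l = (i', j', l')" using prod_cases3 by metis
    note kl = that[unfolded e KI]
    have "U k * adj (U l) = 0 \<and> adj (U k) * U l = 0"
    proof (cases "(i, j) = (i', j')")
      case True
      then show ?thesis using ru(3)[of i j k' l'] kl that e by (auto simp: U_def)
    next
      case False
      have "u i j k' * adj (u i' j' l') = u i j k' * adj (u i j k') * (b i j * adj (b i' j')) * adj (u i' j' l' * adj (u i' j' l'))"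
        using ub(1)[of i j k'] ub(1)[of i' j' l'] that e by (metis adj_mult mult.assoc)
      then have 1: "u i j k' * adj (u i' j' l') = 0" using bb1 kl False by simp
      have "adj (u i j k') * u i' j' l' = adj (adj (b i j) * u i j k') * (adj (b i j) * b i' j') * (adj (b i' j') * u i' j' l')"
        using ub(2)[of i j k'] ub(2)[of i' j' l'] that e by (metis adj_mult mult.assoc)
      then have 2: "adj (u i j k') * u i' j' l' = 0" using bb2 kl False by simp
      from 1 2 show ?thesis by (simp add: U_def e)
    qed
    then show "U k * adj (U l) = 0" "adj (U k) * U l = 0" by auto
  qed
  have K: "finite K" by (auto simp: K_def)
  have vs: "v = sum U K"
  proof -
    have "v = (\<Sum>i<natoms A. \<Sum>j<natoms A. b i j)" using expand_blocks[OF PR_FM[OF v]] by (simp add: b_def)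
    also have "\<dots> = (\<Sum>i<natoms A. \<Sum>j<natoms A. \<Sum>k<r i j. u i j k)" using ru(1) by simp
    also have "\<dots> = sum U K" unfolding K_def U_def by (simp add: sum.Sigma case_prod_beta)
    finally show ?thesis .
  qed
  have UU: "U k * adj (U k) * v = U k" if "k \<in> K" for k
  proof -
    have "adj (U k) * v = adj (U k) * U k" unfolding vs using orth_sum_mult(1)[of K "\<lambda>k. adj (U k)" U k] K o2 that by blast
    moreover have "mi (U k)" using that ru(2) by (cases k) (auto simp: KI U_def)
    ultimately show ?thesis using that by (simp add: mult.assoc pimD mi_pim)
  qed
  have Ub: "blk i j (u i j k)" "i \<le> j" if "(i, j, k) \<in> K" for i j k
  proof -
    note * = ub[OF that] that[unfolded KI]
    show "blk i j (u i j k)"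
      using * bat[of i j] by (intro blkI) (metis mult.assoc)+
    have "b i j \<noteq> 0" using * ru(2)[of i j k] mi_neq_0 by fastforce
    then show "i \<le> j" using RG_NA[OF vR] * by (auto simp: NA_def b_def not_less[symmetric])
  qed
  have "mi (U k) \<and> blk (fst k) (fst (snd k)) (U k) \<and> fst k \<le> fst (snd k)" if "k \<in> K" for k
    using that Ub[of "fst k" "fst (snd k)" "snd (snd k)"] ru(2)[of "fst k" "fst (snd k)" "snd (snd k)"]
      KI[of "fst k" "fst (snd k)" "snd (snd k)"] by (simp add: U_def b_def case_prod_beta)
  then show ?thesis
    by (rule_tac exI[of _ K], rule_tac exI[of _ U], rule_tac exI[of _ fst], rule_tac exI[of _ "\<lambda>k. fst (snd k)"])
      (use K vs UU o1 o2 in blast)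
qed

lemma mi_blk_ex: assumes "i < natoms A" "j < natoms A" shows "\<exists>g. mi g \<and> blk i j g"
proof -
  obtain e where e: "mn e" "atm A i * e = e" using mn_exists[OF at_pj at_ne_0] assms by blast
  obtain f where f: "mn f" "atm A j * f = f" using mn_exists[OF at_pj at_ne_0] assms by blast
  obtain g where g: "g * adj g = e" "adj g * g = f" using mn_link[OF e(1) f(1)] by blast
  have m: "mi g" using g e by (simp add: mi_def)
  have fa: "f * atm A j = f" using sub_flip[OF at_pj mn_pj, of j f] f assms by simp
  have "atm A i * g = atm A i * (g * adj g) * g" using m by (simp add: mi_pim pimD mult.assoc)
  then have 1: "atm A i * g = g" using e m g by (metis mi_pim pimD(1))
  have "g * atm A j = g * (adj g * g * atm A j)" using m by (simp add: mi_pim pimD mult.assoc)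
  then have "g * atm A j = g" using g fa m by (metis mi_pim pimD(2))
  then show ?thesis using 1 m assms by (auto intro: blkI)
qed

text \<open>Two uses. If both elements lie in the same block, the linking factors are block
  diagonal. If the second block lies weakly above and to the right of the first, the factors lie in
  the nest algebra.\<close>

lemma blk_link:
  assumes "mi u" "blk s t u" "mi u'" "blk s' t' u'"
  shows "\<exists>x y. mi x \<and> mi y \<and> blk s' s x \<and> blk t t' y \<and> u' = x * u * y \<and>
    x * adj x = u' * adj u' \<and> adj x * x = u * adj u \<and> y * adj y = adj u * u \<and> adj y * y = adj u' * u' \<and> y = adj u * adj x * u'"
proof -
  obtain x where x: "x * adj x = u' * adj u'" "adj x * x = u * adj u" using mn_link assms by (meson mi_mn)
  have mx: "mi x" using x assms by (simp add: mi_def)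
  define y where "y = adj u * adj x * u'"
  note pu = pimD[OF mi_pim[OF assms(1)]] pimD[OF mi_pim[OF assms(3)]] pimD[OF mi_pim[OF mx]]
  have "y * adj y = adj u * adj x * (u' * adj u') * x * u" by (simp add: y_def mult.assoc)
  also have "\<dots> = adj u * (adj x * x) * (adj x * x) * u" by (simp add: x(1)[symmetric] mult.assoc)
  also have "\<dots> = adj u * u" by (simp add: x(2) mult.assoc pu)
  finally have y1: "y * adj y = adj u * u" .
  have "adj y * y = adj u' * x * (u * adj u) * adj x * u'" by (simp add: y_def mult.assoc)
  also have "\<dots> = adj u' * (x * adj x) * (x * adj x) * u'" by (simp add: x(2)[symmetric] mult.assoc)
  also have "\<dots> = adj u' * u'" by (simp add: x(1) mult.assoc pu)
  finally have y2: "adj y * y = adj u' * u'" .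
  have my: "mi y" using y1 assms by (simp add: mi_def mi_mn)
  have "x * u * y = x * (u * adj u) * adj x * u'" by (simp add: y_def mult.assoc)
  also have "\<dots> = (x * adj x) * (x * adj x) * u'" by (simp add: x(2)[symmetric] mult.assoc)
  also have "\<dots> = u'" by (simp add: x(1) mult.assoc pu)
  finally have u': "u' = x * u * y" by simp
  have "atm A s' * x = atm A s' * ((x * adj x) * x)" by (simp add: mult.assoc pu)
  also have "\<dots> = (atm A s' * u') * (adj u' * x)" by (simp add: x(1) mult.assoc)
  also have "\<dots> = (u' * adj u') * x" using blkD(3)[OF assms(4)] by (simp add: mult.assoc)
  also have "\<dots> = x" by (simp add: x(1)[symmetric] pu mult.assoc)
  finally have bx1: "atm A s' * x = x" .
  have "x * atm A s = x * ((adj x * x) * atm A s)" by (simp add: mult.assoc pu)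
  also have "\<dots> = x * (u * (adj u * atm A s))" by (simp add: x(2) mult.assoc)
  also have "adj u * atm A s = adj u" using blkD(4)[OF blk_adj[OF assms(2)]] .
  also have "x * (u * adj u) = x" by (simp add: x(2)[symmetric] pu mult.assoc)
  finally have bx2: "x * atm A s = x" .
  have bx: "blk s' s x" using bx1 bx2 assms by (intro blkI) (auto dest: blkD)
  have "blk t t' y" unfolding y_def by (rule blk_mult[OF blk_mult[OF blk_adj[OF assms(2)] blk_adj[OF bx]] assms(4)])
  then show ?thesis using mx my bx u' x y1 y2 y_def by blast
qed

text \<open>The defining condition, applied to either of two nonzero blocks, forbids that one lies
  weakly above and to the right of the other. What remains is strict comparability in both
  coordinates at once.\<close>

lemma OPS_match:
  assumes "v \<in> OPS A" "i < natoms A" "j < natoms A" "s < natoms A" "t < natoms A"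
    "atm A i * v * atm A j \<noteq> 0" "atm A s * v * atm A t \<noteq> 0"
  shows "s < i \<longleftrightarrow> t < j" "s = i \<longleftrightarrow> t = j"
proof -
  have *: "\<forall>s\<le>i. \<forall>t\<in>{j..<natoms A}. (s, t) \<noteq> (i, j) \<longrightarrow> atm A s * v * atm A t = 0"
    if "i < natoms A" "j < natoms A" "atm A i * v * atm A j \<noteq> 0" for i j using assms(1) that unfolding OPS_def by blast
  from *[of i j] *[of s t] assms show "s < i \<longleftrightarrow> t < j" "s = i \<longleftrightarrow> t = j"
    by (smt (verit) atLeastLessThan_iff linorder_not_le nat_less_le prod.inject)+
qed

text \<open>The two-sided normalisation of the block diagonal is what survives of order preservation
  in the limit.\<close>

lemma OPS_normal:
  assumes v: "v \<in> OPS A" and x: "x \<in> DA A"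
  shows "v * x * adj v \<in> DA A" "adj v * x * v \<in> DA A"
proof -
  have F: "v \<in> FM A" "x \<in> FM A" using v x by (auto simp: OPS_def RG_def NA_FM DA_FM)
  show "v * x * adj v \<in> DA A" unfolding DA_def
  proof (clarsimp simp: F)
    fix i k assume ik: "i < natoms A" "k < natoms A" "i \<noteq> k"
    have "atm A i * (v * x * adj v) * atm A k = atm A i * (\<Sum>j<natoms A. v * atm A j * (x * adj v)) * atm A k"
      using expand_mid[OF F(1)] by (metis mult.assoc)
    also have "\<dots> = (\<Sum>j<natoms A. atm A i * v * atm A j * x * adj (atm A k * v * atm A j))"
      using ik by (auto simp: sum_distrib_left sum_distrib_right mult.assoc intro!: sum.cong)
        (metis DA_comm2 at_self(2) x)
    \<comment> \<open>At most one row of \<open>v\<close> meets column \<open>j\<close>, so one of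
      the two outer factors vanishes when \<open>i \<noteq> k\<close>.\<close>
    also have "\<dots> = 0"
    proof (intro sum.neutral ballI)
      fix j assume "j \<in> {..<natoms A}"
      then have "atm A i * v * atm A j = 0 \<or> atm A k * v * atm A j = 0" using OPS_match(2)[OF v, of i j k j] ik by auto
      then show "atm A i * v * atm A j * x * adj (atm A k * v * atm A j) = 0" by (auto simp del: adj_mult)
    qed
    finally show "atm A i * (v * x * adj v) * atm A k = 0" .
  qed
  show "adj v * x * v \<in> DA A" unfolding DA_def
  proof (clarsimp simp: F)
    fix i k assume ik: "i < natoms A" "k < natoms A" "i \<noteq> k"
    have "atm A i * (adj v * x * v) * atm A k = atm A i * (\<Sum>j<natoms A. adj v * atm A j * (x * v)) * atm A k"
      using expand_mid[of "adj v"] F by (metis mult.assoc FM_simps(3))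
    also have "\<dots> = (\<Sum>j<natoms A. adj (atm A j * v * atm A i) * x * (atm A j * v * atm A k))"
      using ik by (auto simp: sum_distrib_left sum_distrib_right mult.assoc intro!: sum.cong)
        (metis DA_comm2 at_self(2) x)
    also have "\<dots> = 0"
    proof (intro sum.neutral ballI)
      fix j assume "j \<in> {..<natoms A}"
      then have "atm A j * v * atm A i = 0 \<or> atm A j * v * atm A k = 0" using OPS_match(2)[OF v, of j i j k] ik by auto
      then show "adj (atm A j * v * atm A i) * x * (atm A j * v * atm A k) = 0" by (auto simp del: adj_mult)
    qed
    finally show "atm A i * (adj v * x * v) * atm A k = 0" .
  qed
qed

text \<open>A block is zero exactly when its entry of \<open>cl\<close> is, so for regular elements
  order preservation can be read off the class.\<close>

lemma OPS_by_class:
  assumes "v \<in> RG A" "w \<in> OPS A" "\<And>i j. i < natoms A \<Longrightarrow> j < natoms A \<Longrightarrow> cl A v i j = cl A w i j"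
  shows "v \<in> OPS A"
proof -
  have *: "atm A i * v * atm A j = 0 \<longleftrightarrow> atm A i * w * atm A j = 0" if "i < natoms A" "j < natoms A" for i j
    using cl_0_iff[OF that, of v] cl_0_iff[OF that, of w] assms(3)[OF that] by simp
  have "atm A s * v * atm A t = 0" if "i < natoms A" "j < natoms A" "atm A i * v * atm A j \<noteq> 0" "s \<le> i"
    "t \<in> {j..<natoms A}" "(s, t) \<noteq> (i, j)" for i j s t
  proof -
    have "atm A i * w * atm A j \<noteq> 0" using *[of i j] that by blast
    then have "atm A s * w * atm A t = 0" using assms(2) that unfolding OPS_def by blast
    then show ?thesis using *[of s t] that by simp
  qed
  then show ?thesis using assms(1) unfolding OPS_def by blast
qed

subsection \<open>Matrix units adapted to the atoms\<close>

text \<open>The first component of an index names the atom, the second distinguishes the units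
  inside it.\<close>

definition unit_sys :: "(nat \<times> nat) set \<Rightarrow> (nat \<times> nat \<Rightarrow> nat \<times> nat \<Rightarrow> fmat) \<Rightarrow> bool" where
  "unit_sys X e \<longleftrightarrow> finite X \<and> (\<forall>i<natoms A. \<exists>x\<in>X. fst x = i)
    \<and> (\<forall>x\<in>X. \<forall>y\<in>X. \<forall>z\<in>X. \<forall>w\<in>X. e x y * e z w = (if y = z then e x w else 0))
    \<and> (\<forall>x\<in>X. \<forall>y\<in>X. adj (e x y) = e y x \<and> mi (e x y) \<and> blk (fst x) (fst y) (e x y))
    \<and> (\<Sum>x\<in>X. e x x) = uno A"

lemma unit_sys_ex: "\<exists>X e. unit_sys X e"
proof -
  have "\<forall>i. \<exists>r f. i < natoms A \<longrightarrow> atm A i = (\<Sum>k<(r::nat). f k) \<and> (\<forall>k<r. mn (f k)) \<and> (\<forall>k<r. \<forall>l<r. k \<noteq> l \<longrightarrow> f k * f l = 0)"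
    using pj_decomp at_pj by metis
  then obtain r f where f: "\<And>i. i < natoms A \<Longrightarrow> atm A i = (\<Sum>k<(r i::nat). f i k)"
    "\<And>i k. i < natoms A \<Longrightarrow> k < r i \<Longrightarrow> mn (f i k)"
    "\<And>i k l. i < natoms A \<Longrightarrow> k < r i \<Longrightarrow> l < r i \<Longrightarrow> k \<noteq> l \<Longrightarrow> f i k * f i l = 0"
    by metis
  define X where "X = (SIGMA i:{..<natoms A}. {..<r i})"
  define F where "F x = f (fst x) (snd x)" for x
  have XI: "x \<in> X \<longleftrightarrow> fst x < natoms A \<and> snd x < r (fst x)" for x by (cases x) (auto simp: X_def)
  have mF: "mn (F x)" if "x \<in> X" for x using f that by (simp add: F_def XI)
  have aF: "atm A (fst x) * F x = F x" "F x * atm A (fst x) = F x" if "x \<in> X" for x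
    unfolding f(1)[OF that[unfolded XI, THEN conjunct1]] F_def
    using orth_sum_mult[of "{..<r (fst x)}" "f (fst x)" "f (fst x)" "snd x"] f(2,3)[of "fst x"] that
    by (simp_all add: XI mn_pj pjD)
  have FF: "F x * F y = 0" if "x \<in> X" "y \<in> X" "x \<noteq> y" for x y
  proof (cases "fst x = fst y")
    case True
    then show ?thesis using f(3)[of "fst x" "snd x" "snd y"] that by (auto simp: F_def XI prod_eq_iff)
  next
    case False
    have "F x * F y = F x * (atm A (fst x) * atm A (fst y)) * F y" using aF that by (metis mult.assoc)
    then show ?thesis using at_orth(1) False that by (simp add: XI)
  qed
  have SF: "(\<Sum>x\<in>X. F x) = uno A"
  proof -
    have "sum F X = (\<Sum>i<natoms A. \<Sum>k<r i. F (i, k))" unfolding X_def by (subst sum.Sigma) auto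
    then show ?thesis unfolding at_sum[symmetric] using f(1) by (simp add: F_def)
  qed
  \<comment> \<open>One minimal projection serves as common range of all links \<open>v x\<close>;
    this is what makes the products \<open>adj (v x) * v y\<close> matrix units.\<close>
  obtain e0 where e0: "mn e0" using mn_exists[OF at_pj at_ne_0] natoms_pos by blast
  have "\<forall>x\<in>X. \<exists>v. v * adj v = e0 \<and> adj v * v = F x" using mn_link e0 mF by blast
  then obtain v where v: "\<And>x. x \<in> X \<Longrightarrow> v x * adj (v x) = e0" "\<And>x. x \<in> X \<Longrightarrow> adj (v x) * v x = F x" by metis
  have mv: "mi (v x)" if "x \<in> X" for x using v(1)[OF that] e0 by (simp add: mi_def)
  note pv = pimD[OF mi_pim[OF mv]]
  have vv: "v x * adj (v y) = (if x = y then e0 else 0)" if "x \<in> X" "y \<in> X" for x y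
  proof -
    have "v x * adj (v y) = v x * (F x * F y) * adj (v y)"
      unfolding v(2)[OF that(1), symmetric] v(2)[OF that(2), symmetric] using pv that by (simp add: mult.assoc)
    then show ?thesis using FF[OF that] v(1)[OF that(1)] by auto
  qed
  have e0v: "e0 * v x = v x" "adj (v x) * e0 = adj (v x)" if "x \<in> X" for x
    unfolding v(1)[OF that, symmetric] using pv that by (simp_all add: mult.assoc)
  define e where "e x y = adj (v x) * v y" for x y
  have vat: "v x * atm A (fst x) = v x" if "x \<in> X" for x
  proof -
    have "v x * atm A (fst x) = v x * (adj (v x) * v x * atm A (fst x))" using pv that by (simp add: mult.assoc)
    also have "\<dots> = v x" using aF(2)[OF that] pv that by (simp add: v(2))
    finally show ?thesis .
  qed
  have "mi (e x y)" if "x \<in> X" "y \<in> X" for x y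
  proof -
    have "e x y * adj (e x y) = adj (v x) * (v y * adj (v y)) * v x" by (simp add: e_def mult.assoc)
    then have "e x y * adj (e x y) = F x" using that by (simp add: v e0v)
    then show ?thesis using mF that by (simp add: mi_def)
  qed
  moreover have "blk (fst x) (fst y) (e x y)" if "x \<in> X" "y \<in> X" for x y
  proof (rule blkI)
    show "e x y * atm A (fst y) = e x y" using vat that by (simp add: e_def mult.assoc)
    have "atm A (fst x) * adj (v x) = adj (v x)" using arg_cong[OF vat[OF that(1)], of adj] that by (simp add: XI)
    then show "atm A (fst x) * e x y = e x y" by (simp add: e_def flip: mult.assoc)
  qed (use that in \<open>auto simp: XI\<close>)
  moreover have "e x y * e z w = (if y = z then e x w else 0)" if "x \<in> X" "y \<in> X" "z \<in> X" "w \<in> X" for x y z w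
  proof -
    have "e x y * e z w = adj (v x) * (v y * adj (v z)) * v w" by (simp add: e_def mult.assoc)
    then show ?thesis using vv[OF that(2,3)] e0v that by (simp add: e_def)
  qed
  moreover have "\<exists>x\<in>X. fst x = i" if "i < natoms A" for i
  proof -
    have "r i \<noteq> 0" using f(1)[OF that] at_ne_0[OF that] by (metis lessThan_0 sum.empty)
    then show ?thesis using that by (intro bexI[of _ "(i, 0)"]) (auto simp: XI)
  qed
  moreover have "finite X" by (simp add: X_def)
  moreover have "(\<Sum>x\<in>X. e x x) = uno A" unfolding SF[symmetric] by (intro sum.cong) (auto simp: e_def v)
  ultimately have "unit_sys X e" unfolding unit_sys_def by (auto simp: e_def)
  then show ?thesis by blast
qed

lemma unit_sysD:
  assumes "unit_sys X e"
  shows "finite X" "i < natoms A \<Longrightarrow> \<exists>x\<in>X. fst x = i"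
    "x \<in> X \<Longrightarrow> y \<in> X \<Longrightarrow> z \<in> X \<Longrightarrow> w \<in> X \<Longrightarrow> e x y * e z w = (if y = z then e x w else 0)"
    "x \<in> X \<Longrightarrow> y \<in> X \<Longrightarrow> adj (e x y) = e y x" "x \<in> X \<Longrightarrow> y \<in> X \<Longrightarrow> mi (e x y)"
    "x \<in> X \<Longrightarrow> y \<in> X \<Longrightarrow> blk (fst x) (fst y) (e x y)" "(\<Sum>x\<in>X. e x x) = uno A"
    "x \<in> X \<Longrightarrow> fst x < natoms A" "x \<in> X \<Longrightarrow> y \<in> X \<Longrightarrow> e x y \<in> FM A"
    "x \<in> X \<Longrightarrow> y \<in> X \<Longrightarrow> tr (e x y) = (if x = y then 1 else 0)" "x \<in> X \<Longrightarrow> pj (e x x)"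
proof -
  show 1: "finite X" "i < natoms A \<Longrightarrow> \<exists>x\<in>X. fst x = i"
    "\<And>x y z w. x \<in> X \<Longrightarrow> y \<in> X \<Longrightarrow> z \<in> X \<Longrightarrow> w \<in> X \<Longrightarrow> e x y * e z w = (if y = z then e x w else 0)"
    "\<And>x y. x \<in> X \<Longrightarrow> y \<in> X \<Longrightarrow> adj (e x y) = e y x" "\<And>x y. x \<in> X \<Longrightarrow> y \<in> X \<Longrightarrow> mi (e x y)"
    "\<And>x y. x \<in> X \<Longrightarrow> y \<in> X \<Longrightarrow> blk (fst x) (fst y) (e x y)" "(\<Sum>x\<in>X. e x x) = uno A"
    using assms unfolding unit_sys_def by blast+
  show "x \<in> X \<Longrightarrow> fst x < natoms A" "x \<in> X \<Longrightarrow> y \<in> X \<Longrightarrow> e x y \<in> FM A" using 1(6) blkD by blast+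
  show "tr (e x y) = (if x = y then 1 else 0)" if "x \<in> X" "y \<in> X"
  proof (cases "x = y")
    case True
    have "e x x = e x x * adj (e x x)" using 1 that by simp
    then show ?thesis using 1(5)[of x x] that True by (metis mi_def mn_tr)
  next
    case False
    have "e x y = e x x * e x y" using 1 that by simp
    then have "tr (e x y) = tr (e x y * e x x)" using tr_comm by metis
    also have "e x y * e x x = 0" using 1(3)[of x y x x] that False by simp
    finally show ?thesis using False by simp
  qed
  show "pj (e x x)" if "x \<in> X" using 1(3)[of x x x x] 1(4)[of x x] that by (simp add: pj_def)
qed

lemma unit_sys_cut: "unit_sys X e \<Longrightarrow> x \<in> X \<Longrightarrow> y \<in> X \<Longrightarrow> e x x * a * e y y = tr (a * e y x) \<odot> e x y"
  using mi_span[OF unit_sysD(5), of X e x y a] unit_sysD(3,4) by simp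

lemma unit_sys_expand:
  assumes "unit_sys X e" "a \<in> FM A"
  shows "a = (\<Sum>x\<in>X. \<Sum>y\<in>X. tr (a * e y x) \<odot> e x y)"
proof -
  note u = unit_sysD[OF assms(1)]
  have "a = (\<Sum>x\<in>X. e x x) * a * (\<Sum>y\<in>X. e y y)" using assms u by simp
  also have "\<dots> = (\<Sum>x\<in>X. \<Sum>y\<in>X. e x x * a * e y y)" by (simp only: sum_distrib_right[of _ _ a] sum_product)
  also have "\<dots> = (\<Sum>x\<in>X. \<Sum>y\<in>X. tr (a * e y x) \<odot> e x y)"
    by (intro sum.cong refl unit_sys_cut[OF assms(1)])
  finally show ?thesis .
qed

end

section \<open>Star homomorphisms respecting the triangular structure\<close>

text \<open>A morphism of pairs: a star homomorphism of the full matrix algebras that respects the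
  nest algebras inside. Nothing is said outside \<open>FM A\<close>, so maps are only ever compared
  there.\<close>

definition SH :: "nest \<Rightarrow> nest \<Rightarrow> (fmat \<Rightarrow> fmat) \<Rightarrow> bool" where
  "SH A B \<psi> \<longleftrightarrow> (\<forall>a\<in>FM A. \<psi> a \<in> FM B) \<and> (\<forall>a\<in>FM A. \<forall>b\<in>FM A. \<psi> (a + b) = \<psi> a + \<psi> b \<and> \<psi> (a * b) = \<psi> a * \<psi> b)
    \<and> (\<forall>c. \<forall>a\<in>FM A. \<psi> (c \<odot> a) = c \<odot> \<psi> a) \<and> (\<forall>a\<in>FM A. \<psi> (adj a) = adj (\<psi> a)) \<and> (\<forall>a\<in>NA A. \<psi> a \<in> NA B)"

text \<open>In \<open>RM\<close> and \<open>OM\<close> only rank one elements of a single block are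
  tested. For regularity this reaches all regular elements (\<open>RM_RG\<close>); \<open>OM\<close>
  does not assert that all of \<open>OPS A\<close> is sent to \<open>OPS B\<close>.\<close>

definition RM :: "nest \<Rightarrow> nest \<Rightarrow> (fmat \<Rightarrow> fmat) \<Rightarrow> bool" where
  "RM A B \<psi> \<longleftrightarrow> SH A B \<psi> \<and> (\<forall>v i j. mi v \<longrightarrow> blk A i j v \<longrightarrow> i \<le> j \<longrightarrow> \<psi> v \<in> RG B)"

definition OM :: "nest \<Rightarrow> nest \<Rightarrow> (fmat \<Rightarrow> fmat) \<Rightarrow> bool" where
  "OM A B \<psi> \<longleftrightarrow> SH A B \<psi> \<and> (\<forall>v i j. mi v \<longrightarrow> blk A i j v \<longrightarrow> i \<le> j \<longrightarrow> \<psi> v \<in> OPS B)"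

lemma OM_RM: "OM A B \<psi> \<Longrightarrow> RM A B \<psi>" by (auto simp: OM_def RM_def OPS_RG)
lemma RM_SH: "RM A B \<psi> \<Longrightarrow> SH A B \<psi>" by (simp add: RM_def)
lemma OM_SH: "OM A B \<psi> \<Longrightarrow> SH A B \<psi>" by (simp add: OM_def)

lemma SHD:
  assumes "SH A B \<psi>"
  shows "a \<in> FM A \<Longrightarrow> \<psi> a \<in> FM B" "a \<in> FM A \<Longrightarrow> b \<in> FM A \<Longrightarrow> \<psi> (a + b) = \<psi> a + \<psi> b"
    "a \<in> FM A \<Longrightarrow> b \<in> FM A \<Longrightarrow> \<psi> (a * b) = \<psi> a * \<psi> b" "a \<in> FM A \<Longrightarrow> \<psi> (c \<odot> a) = c \<odot> \<psi> a"
    "a \<in> FM A \<Longrightarrow> \<psi> (adj a) = adj (\<psi> a)" "a \<in> NA A \<Longrightarrow> \<psi> a \<in> NA B" "\<psi> 0 = 0"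
    "a \<in> FM A \<Longrightarrow> b \<in> FM A \<Longrightarrow> \<psi> (a - b) = \<psi> a - \<psi> b"
proof -
  show 1: "\<And>a. a \<in> FM A \<Longrightarrow> \<psi> a \<in> FM B" "\<And>a b. a \<in> FM A \<Longrightarrow> b \<in> FM A \<Longrightarrow> \<psi> (a + b) = \<psi> a + \<psi> b"
    "\<And>a b. a \<in> FM A \<Longrightarrow> b \<in> FM A \<Longrightarrow> \<psi> (a * b) = \<psi> a * \<psi> b" "\<And>a c. a \<in> FM A \<Longrightarrow> \<psi> (c \<odot> a) = c \<odot> \<psi> a"
    "\<And>a. a \<in> FM A \<Longrightarrow> \<psi> (adj a) = adj (\<psi> a)" "\<And>a. a \<in> NA A \<Longrightarrow> \<psi> a \<in> NA B"
    using assms unfolding SH_def by blast+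
  show "\<psi> 0 = 0" using 1(4)[of 0 0] by simp
  show "\<psi> (a - b) = \<psi> a - \<psi> b" if "a \<in> FM A" "b \<in> FM A"
    using 1(2)[of "a - b" b] that by (simp add: algebra_simps)
qed

lemma SH_sum: "SH A B \<psi> \<Longrightarrow> (\<And>x. x \<in> S \<Longrightarrow> f x \<in> FM A) \<Longrightarrow> \<psi> (sum f S) = (\<Sum>x\<in>S. \<psi> (f x))"
  by (induction S rule: infinite_finite_induct) (auto simp: SHD)

lemma SH_comp: "SH A B \<psi> \<Longrightarrow> SH B C \<chi> \<Longrightarrow> SH A C (\<chi> \<circ> \<psi>)"
  unfolding SH_def by auto

lemma SH_id: "SH A A id"
  by (simp add: SH_def)

lemma SH_cong: "SH A B \<psi> \<Longrightarrow> (\<And>a. a \<in> FM A \<Longrightarrow> \<chi> a = \<psi> a) \<Longrightarrow> SH A B \<chi>"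
  unfolding SH_def by (auto simp: NA_FM)

lemma SH_pj: "SH A B \<psi> \<Longrightarrow> p \<in> FM A \<Longrightarrow> pj p \<Longrightarrow> pj (\<psi> p)"
  unfolding pj_def using SHD(3)[of A B \<psi> p p] SHD(5)[of A B \<psi> p] by simp

lemma SH_pim: "SH A B \<psi> \<Longrightarrow> v \<in> FM A \<Longrightarrow> pim v \<Longrightarrow> pim (\<psi> v)"
  unfolding pim_def using SHD(3)[of A B \<psi> "v * adj v" v] by (simp add: SHD)

lemma RM_id: "is_nest A \<Longrightarrow> RM A A id"
  by (auto simp: RM_def SH_id intro: blk_RG mi_pim)

lemma RM_cong: "is_nest A \<Longrightarrow> RM A B \<psi> \<Longrightarrow> (\<And>a. a \<in> FM A \<Longrightarrow> \<chi> a = \<psi> a) \<Longrightarrow> RM A B \<chi>"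
  unfolding RM_def using SH_cong[of A B \<psi> \<chi>] blkD(5) by metis

lemma cl_sum_row:
  assumes "is_nest B" "v \<in> FM B" "s < natoms B"
  shows "(\<Sum>t<natoms B. cl B v s t) = tr (atm B s * (v * adj v))"
proof -
  have "v * adj v = (\<Sum>t<natoms B. v * atm B t * adj v)" by (rule expand_mid) (use assms in auto)
  then show ?thesis by (simp add: cl_def sum_distrib_left mult.assoc)
qed

lemma cl_sum_col:
  assumes "is_nest B" "v \<in> FM B" "t < natoms B"
  shows "(\<Sum>s<natoms B. cl B v s t) = tr (atm B t * (adj v * v))"
proof -
  have 1: "cl B v s t = tr (atm B t * (adj v * atm B s * v))" for s
    unfolding cl_def using tr_comm[of "atm B s * v" "atm B t * adj v"] by (simp add: mult.assoc)
  have "adj v * v = (\<Sum>s<natoms B. adj v * atm B s * v)" by (rule expand_mid) (use assms in auto)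
  then show ?thesis by (simp add: 1 sum_distrib_left mult.assoc)
qed

section \<open>Classes and the induced maps of dimension distribution groups\<close>

definition gm :: "nest \<Rightarrow> nat \<Rightarrow> nat \<Rightarrow> fmat" where
  "gm A i j = em (generator A i j)"

definition pcl :: "nest \<Rightarrow> fmat \<Rightarrow> int mat" where
  "pcl A v = pclass A (me (msize A) v)"

definition pH :: "nest \<Rightarrow> nest \<Rightarrow> (fmat \<Rightarrow> fmat) \<Rightarrow> int mat \<Rightarrow> int mat" where
  "pH A B \<psi> = induced_hom A B (\<lambda>a. me (msize B) (\<psi> (em a)))"

text \<open>The counterpart of \<open>pH\<close> with complex coefficients, on which traces can be
  used directly; \<open>pH_cH\<close> links the two.\<close>

definition cH :: "nest \<Rightarrow> nest \<Rightarrow> (fmat \<Rightarrow> fmat) \<Rightarrow> (nat \<Rightarrow> nat \<Rightarrow> complex) \<Rightarrow> nat \<Rightarrow> nat \<Rightarrow> complex" where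
  "cH A B \<psi> X s t = (\<Sum>j<natoms A. \<Sum>i\<le>j. X i j * cl B (\<psi> (gm A i j)) s t)"

definition upm :: "nest \<Rightarrow> int mat set" where
  "upm A = {X \<in> carrier_mat (natoms A) (natoms A). upper_triangular X}"

text \<open>Entries are compared as complex numbers since they are computed as traces.\<close>

lemma upm_eqI:
  assumes "X \<in> upm A" "Y \<in> upm A"
    "\<And>i j. i \<le> j \<Longrightarrow> j < natoms A \<Longrightarrow> (of_int (X $$ (i, j)) :: complex) = of_int (Y $$ (i, j))"
  shows "X = Y"
proof (rule eq_matI)
  fix i j assume *: "i < dim_row Y" "j < dim_col Y"
  then show "X $$ (i, j) = Y $$ (i, j)"
    using assms by (cases "i \<le> j") (auto simp: upm_def upper_triangular_def)
qed (use assms in \<open>auto simp: upm_def\<close>)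

text \<open>Every upper block contains a rank one partial isometry, so the choice in
  \<open>generator\<close> has something to choose from.\<close>

lemma generator_props:
  assumes N: "is_nest A" and ij: "i \<le> j" "j < natoms A"
  shows "mi (gm A i j)" "blk A i j (gm A i j)" "generator A i j \<in> full A" "generator A i j \<in> Pisom_reg A"
proof -
  obtain g where g: "mi g" "blk A i j g" using mi_blk_ex[OF N, of i j] ij by auto
  have gF: "g \<in> FM A" using blkD[OF N g(2)] by simp
  define v where "v = me (msize A) g"
  have ev: "em v = g" "v \<in> full A" using gF by (auto simp: v_def FM_me)
  have "v \<in> Pisom_reg A" using Pisom_reg_iff[OF N ev(2)] ev g ij blk_RG[OF N] mi_pim by auto
  moreover have "vec_space.rank (msize A) v = 1"
    using rank_pim[OF ev(2)] g by (simp add: ev mi_pim mi_def mn_tr)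
  moreover have "block A i j v = v"
    using em_block[OF N ev(2), of i j] g ij ev by (intro em_inj[of _ "msize A" "msize A"]) (auto simp: blk_def[OF N])
  ultimately have "\<exists>v. v \<in> Pisom_reg A \<and> vec_space.rank (msize A) v = 1 \<and> block A i j v = v" by blast
  from someI_ex[OF this] have G: "generator A i j \<in> Pisom_reg A" "vec_space.rank (msize A) (generator A i j) = 1"
    "block A i j (generator A i j) = generator A i j" unfolding generator_def by auto
  show "generator A i j \<in> Pisom_reg A" by fact
  show f: "generator A i j \<in> full A" using G Pisom_reg_full[OF N] by blast
  have pg: "pim (gm A i j)" using Pisom_reg_iff[OF N f] G by (simp add: gm_def RG_def PR_def)
  have "tr (gm A i j * adj (gm A i j)) = 1" using rank_pim[OF f] pg G by (simp add: gm_def)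
  then show "mi (gm A i j)" using pj_tr1_mn pim_pj[OF pg] by (simp add: mi_def)
  show "blk A i j (gm A i j)" using em_block[OF N f, of i j] G ij by (auto simp: blk_def[OF N] gm_def)
qed

lemma gm_FM: "is_nest A \<Longrightarrow> i \<le> j \<Longrightarrow> j < natoms A \<Longrightarrow> gm A i j \<in> FM A"
  by (rule blkD(5)[OF _ generator_props(2)])

lemma gm_RG: "is_nest A \<Longrightarrow> i \<le> j \<Longrightarrow> j < natoms A \<Longrightarrow> gm A i j \<in> RG A"
  by (rule blk_RG[OF _ mi_pim[OF generator_props(1)] generator_props(2)])

lemma cl_mi:
  assumes "is_nest A" "mi u" "blk A i j u" "s < natoms A" "t < natoms A"
  shows "cl A u s t = (if s = i \<and> t = j then 1 else 0)"
  using assms mn_tr[of "u * adj u"] by (auto simp: cl_block blk_block mi_def)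

lemma orth_image:
  assumes "SH A B \<psi>" "u \<in> FM A" "w \<in> FM A"
  shows "u * adj w = 0 \<Longrightarrow> \<psi> u * adj (\<psi> w) = 0" "adj u * w = 0 \<Longrightarrow> adj (\<psi> u) * \<psi> w = 0"
  using SHD(3)[OF assms(1), of u "adj w"] SHD(3)[OF assms(1), of "adj u" w] assms by (simp_all add: SHD)

lemma RM_sum:
  assumes N: "is_nest A" "is_nest B" and R: "RM A B \<psi>" and K: "finite K" "\<And>k. k \<in> K \<Longrightarrow> mi (u k) \<and> blk A (I k) (J k) (u k) \<and> I k \<le> J k"
    "\<And>k l. k \<in> K \<Longrightarrow> l \<in> K \<Longrightarrow> k \<noteq> l \<Longrightarrow> u k * adj (u l) = 0 \<and> adj (u k) * u l = 0"
  shows "\<psi> (sum u K) \<in> RG B" "s < natoms B \<Longrightarrow> t < natoms B \<Longrightarrow> cl B (\<psi> (sum u K)) s t = (\<Sum>k\<in>K. cl B (\<psi> (u k)) s t)"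
proof -
  have uF: "u k \<in> FM A" if "k \<in> K" for k using K(2)[OF that] blkD[OF N(1)] by blast
  have e: "\<psi> (sum u K) = (\<Sum>k\<in>K. \<psi> (u k))" by (rule SH_sum[OF RM_SH[OF R]]) (rule uF)
  have r: "\<psi> (u k) \<in> RG B" if "k \<in> K" for k using R K(2)[OF that] by (auto simp: RM_def)
  note o = orth_image[OF RM_SH[OF R] uF uF]
  show "\<psi> (sum u K) \<in> RG B" unfolding e using K r o by (intro RG_sum[OF N(2)]) auto
  show "cl B (\<psi> (sum u K)) s t = (\<Sum>k\<in>K. cl B (\<psi> (u k)) s t)" if "s < natoms B" "t < natoms B"
    unfolding e using K r o that by (intro PR_sum(2)[OF N(2)]) (auto simp: RG_PR)
qed

lemma RM_RG: "is_nest A \<Longrightarrow> is_nest B \<Longrightarrow> RM A B \<psi> \<Longrightarrow> v \<in> RG A \<Longrightarrow> \<psi> v \<in> RG B"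
  using RG_decomp[of A v] RM_sum(1)[of A B \<psi>] by metis

lemma RM_comp: "is_nest A \<Longrightarrow> is_nest B \<Longrightarrow> is_nest C \<Longrightarrow> RM A B \<psi> \<Longrightarrow> RM B C \<chi> \<Longrightarrow> RM A C (\<chi> \<circ> \<psi>)"
  unfolding RM_def[of A C] RM_def[of A B] using RM_RG SH_comp[of A B \<psi> C \<chi>] RM_SH by auto

text \<open>The block diagonal is the intersection of the nest algebra with its adjoints, a
  description that every \<open>SH\<close> respects.\<close>

lemma SH_DA: "is_nest A \<Longrightarrow> is_nest B \<Longrightarrow> SH A B \<psi> \<Longrightarrow> a \<in> DA A \<Longrightarrow> \<psi> a \<in> DA B"
proof -
  assume *: "is_nest A" "is_nest B" "SH A B \<psi>" "a \<in> DA A"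
  have "\<psi> a \<in> NA B" "\<psi> (adj a) \<in> NA B" using SHD(6)[OF *(3) DA_NA] DA_adj[OF *(1), of a] *(4) by blast+
  then show ?thesis using NA_adj_DA[OF *(2)] SHD(5)[OF *(3) DA_FM[OF *(4)]] by simp
qed

text \<open>Block diagonal \<open>x\<close> and \<open>y\<close> commute with the atoms, so under
  the trace they can be brought together with their adjoints and absorbed by
  \<open>w\<close>.\<close>

lemma DA_sandwich_cl:
  assumes N: "is_nest B" and x: "x \<in> DA B" and y: "y \<in> DA B" and w: "w \<in> FM B"
    and xw: "adj x * x * w = w" and yw: "w * (y * adj y) = w" and st: "s < natoms B" "t < natoms B"
  shows "cl B (x * w * y) s t = cl B w s t"
proof -
  have "cl B (x * w * y) s t = tr (atm B s * x * w * y * atm B t * adj y * adj w * adj x)"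
    by (simp add: cl_def mult.assoc)
  also have "atm B s * x = x * atm B s" using x st by (simp add: DA_comm[OF N])
  also have "x * atm B s * w * y * atm B t * adj y * adj w * adj x = x * (atm B s * w * (y * atm B t) * adj y * adj w * adj x)"
    by (simp add: mult.assoc)
  also have "y * atm B t = atm B t * y" using y st by (simp add: DA_comm[OF N])
  also have "tr (x * (atm B s * w * (atm B t * y) * adj y * adj w * adj x)) =
    tr (atm B s * w * atm B t * (y * adj y * adj w) * (adj x * x))"
    by (subst tr_comm) (simp add: mult.assoc)
  also have "y * adj y * adj w = adj w" using arg_cong[OF yw, of adj] by (simp add: mult.assoc)
  also have "atm B s * w * atm B t * adj w * (adj x * x) = atm B s * w * atm B t * (adj w * (adj x * x))" by (simp add: mult.assoc)
  also have "adj w * (adj x * x) = adj w" using arg_cong[OF xw, of adj] by (simp add: mult.assoc)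
  finally show ?thesis by (simp add: cl_def)
qed

text \<open>\<open>blk_link\<close> inside one block, pushed forward: the linking factors remain
  block diagonal by \<open>SH_DA\<close>. Hence the class of an image depends only on the
  block.\<close>

lemma mi_image:
  assumes N: "is_nest A" "is_nest B" and S: "SH A B \<psi>" and u: "mi u" "blk A i j u" "mi u'" "blk A i j u'"
  shows "\<exists>x\<in>DA B. \<exists>y\<in>DA B. \<psi> u' = x * \<psi> u * y \<and> adj x * x * \<psi> u = \<psi> u \<and> \<psi> u * (y * adj y) = \<psi> u"
proof -
  obtain x y where *: "mi x" "mi y" "blk A i i x" "blk A j j y" "u' = x * u * y"
    "adj x * x = u * adj u" "y * adj y = adj u * u" using blk_link[OF N(1) u] by blast
  have F: "x \<in> FM A" "y \<in> FM A" "u \<in> FM A" using * u blkD[OF N(1)] by blast+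
  have D: "\<psi> x \<in> DA B" "\<psi> y \<in> DA B" using * blk_DA[OF N(1)] SH_DA[OF N S] by blast+
  have "adj x * x * u = u" "u * (y * adj y) = u" using * u by (simp_all add: mi_pim pimD)
  then have "\<psi> (adj x * x * u) = \<psi> u" "\<psi> (u * (y * adj y)) = \<psi> u" by simp_all
  then have "adj (\<psi> x) * \<psi> x * \<psi> u = \<psi> u" "\<psi> u * (\<psi> y * adj (\<psi> y)) = \<psi> u" "\<psi> u' = \<psi> x * \<psi> u * \<psi> y"
    using F by (simp_all add: SHD[OF S] *(5))
  then show ?thesis using D by blast
qed

lemma cl_mi_image:
  assumes N: "is_nest A" "is_nest B" and S: "SH A B \<psi>" and u: "mi u" "blk A i j u" "mi u'" "blk A i j u'"
    and st: "s < natoms B" "t < natoms B"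
  shows "cl B (\<psi> u) s t = cl B (\<psi> u') s t"
  using mi_image[OF N S u] DA_sandwich_cl[OF N(2) _ _ SHD(1)[OF S blkD(5)[OF N(1) u(2)]] _ _ st] by metis

lemma sum_upper_delta:
  fixes c :: "nat \<Rightarrow> nat \<Rightarrow> complex"
  assumes "i \<le> j" "j < n"
  shows "(\<Sum>b<n. \<Sum>a\<le>b. (if a = i \<and> b = j then 1 else 0) * c a b) = c i j"
proof -
  have "(\<Sum>a\<le>b. (if a = i \<and> b = j then 1 else 0) * c a b) = (if b = j then c i j else 0)" for b
  proof -
    have "(\<Sum>a\<le>b. (if a = i \<and> b = j then 1 else 0) * c a b) = (\<Sum>a\<le>b. if a = i then (if b = j then c i j else 0) else 0)"
      by (intro sum.cong) auto
    then show ?thesis using assms(1) by (auto simp: sum.delta)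
  qed
  then show ?thesis using assms(2) by (simp add: sum.delta)
qed

text \<open>This is the well-definedness of the induced homomorphism. A rank one decomposition of
  \<open>v\<close> reduces it to one block, where the generator may be substituted by
  \<open>cl_mi_image\<close>.\<close>

lemma cl_cH:
  assumes N: "is_nest A" "is_nest B" and R: "RM A B \<psi>" and v: "v \<in> RG A" and st: "s < natoms B" "t < natoms B"
  shows "cl B (\<psi> v) s t = cH A B \<psi> (cl A v) s t"
proof -
  obtain K :: "(nat \<times> nat \<times> nat) set" and u I J where *: "finite K" "v = sum u K"
    "\<And>k. k \<in> K \<Longrightarrow> mi (u k) \<and> blk A (I k) (J k) (u k) \<and> I k \<le> J k"
    "\<And>k l. k \<in> K \<Longrightarrow> l \<in> K \<Longrightarrow> k \<noteq> l \<Longrightarrow> u k * adj (u l) = 0 \<and> adj (u k) * u l = 0"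
    using RG_decomp[OF N(1) v] by metis
  have u: "cl B (\<psi> (u k)) s t = cH A B \<psi> (cl A (u k)) s t" if k: "k \<in> K" for k
  proof -
    have ij: "I k \<le> J k" "J k < natoms A" using *(3)[OF k] blkD[OF N(1)] by blast+
    have "cH A B \<psi> (cl A (u k)) s t = (\<Sum>j<natoms A. \<Sum>i\<le>j. (if i = I k \<and> j = J k then 1 else 0) * cl B (\<psi> (gm A i j)) s t)"
      unfolding cH_def using *(3)[OF k] by (intro sum.cong refl) (simp add: cl_mi[OF N(1), of "u k" "I k" "J k"])
    also have "\<dots> = cl B (\<psi> (gm A (I k) (J k))) s t" by (rule sum_upper_delta[OF ij])
    finally show ?thesis using cl_mi_image[OF N RM_SH[OF R] _ _ _ _ st] *(3)[OF k] generator_props[OF N(1) ij] by metis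
  qed
  have "cl B (\<psi> v) s t = (\<Sum>k\<in>K. cH A B \<psi> (cl A (u k)) s t)"
    using RM_sum(2)[OF N R *(1,3,4) st] u *(2) by simp
  also have "\<dots> = cH A B \<psi> (\<lambda>i j. \<Sum>k\<in>K. cl A (u k) i j) s t"
    using *(1) by (induction K rule: finite_induct) (simp_all add: cH_def distrib_right sum.distrib)
  also have "\<dots> = cH A B \<psi> (cl A v) s t"
    unfolding cH_def *(2) using RM_sum(2)[OF N(1) N(1) RM_id[OF N(1)] *(1,3,4)] by (intro sum.cong refl) simp
  finally show ?thesis .
qed

lemma sum_swap_upper:
  fixes f :: "nat \<Rightarrow> nat \<Rightarrow> nat \<Rightarrow> nat \<Rightarrow> complex"
  shows "(\<Sum>j'<m. \<Sum>i'\<le>j'. \<Sum>j<n. \<Sum>i\<le>j. f j i j' i') = (\<Sum>j<n. \<Sum>i\<le>j. \<Sum>j'<m. \<Sum>i'\<le>j'. f j i j' i')"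
proof -
  have L: "(\<Sum>j<n. \<Sum>i\<le>j. g j i) = (\<Sum>p\<in>(SIGMA j:{..<n}. {..j}). g (fst p) (snd p))" for n and g :: "nat \<Rightarrow> nat \<Rightarrow> complex"
    by (simp add: sum.Sigma case_prod_beta)
  show ?thesis unfolding L by (rule sum.swap)
qed

lemma cH_comp:
  assumes N: "is_nest A" "is_nest B" "is_nest C" and R: "RM A B \<psi>" "RM B C \<chi>" and st: "s < natoms C" "t < natoms C"
  shows "cH B C \<chi> (cH A B \<psi> X) s t = cH A C (\<chi> \<circ> \<psi>) X s t"
proof -
  have "cH B C \<chi> (cH A B \<psi> X) s t = (\<Sum>j<natoms A. \<Sum>i\<le>j. X i j * cH B C \<chi> (cl B (\<psi> (gm A i j))) s t)"
  proof -
    have "cH B C \<chi> (cH A B \<psi> X) s t = (\<Sum>j'<natoms B. \<Sum>i'\<le>j'. \<Sum>j<natoms A. \<Sum>i\<le>j. X i j * (cl B (\<psi> (gm A i j)) i' j' * cl C (\<chi> (gm B i' j')) s t))"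
      by (simp add: cH_def sum_distrib_right mult.assoc)
    also have "\<dots> = (\<Sum>j<natoms A. \<Sum>i\<le>j. \<Sum>j'<natoms B. \<Sum>i'\<le>j'. X i j * (cl B (\<psi> (gm A i j)) i' j' * cl C (\<chi> (gm B i' j')) s t))"
      by (rule sum_swap_upper)
    finally show ?thesis by (simp add: cH_def sum_distrib_left)
  qed
  also have "\<dots> = cH A C (\<chi> \<circ> \<psi>) X s t" unfolding cH_def[of A C]
  proof (intro sum.cong refl)
    fix j i assume "j \<in> {..<natoms A}" "i \<in> {..j}"
    then have "\<psi> (gm A i j) \<in> RG B" using RM_RG[OF N(1,2) R(1) gm_RG[OF N(1)]] by auto
    from cl_cH[OF N(2,3) R(2) this st] show "X i j * cH B C \<chi> (cl B (\<psi> (gm A i j))) s t = X i j * cl C ((\<chi> \<circ> \<psi>) (gm A i j)) s t"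
      by simp
  qed
  finally show ?thesis .
qed

lemma cH_cong:
  assumes "\<And>i j. i \<le> j \<Longrightarrow> j < natoms A \<Longrightarrow> X i j = Y i j"
  shows "cH A B \<psi> X s t = cH A B \<psi> Y s t"
  unfolding cH_def using assms by (intro sum.cong refl) auto

lemma pcl_cl: "is_nest A \<Longrightarrow> v \<in> RG A \<Longrightarrow> i < natoms A \<Longrightarrow> j < natoms A \<Longrightarrow> of_int (pcl A v $$ (i, j)) = cl A v i j"
  using pclass_cl[of A "me (msize A) v" i j] Pisom_reg_iff[of A "me (msize A) v"]
  by (simp add: pcl_def FM_me RG_FM)

lemma pcl_upm: "is_nest A \<Longrightarrow> v \<in> RG A \<Longrightarrow> pcl A v \<in> upm A"
proof -
  assume N: "is_nest A" and v: "v \<in> RG A"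
  have d: "pcl A v \<in> carrier_mat (natoms A) (natoms A)" by (simp add: pcl_def pclass_def)
  have "pcl A v $$ (i, j) = 0" if "i < natoms A" "j < i" for i j
  proof -
    have "atm A i * v * atm A j = 0" using RG_NA[OF v] that by (simp add: NA_def)
    then have "of_int (pcl A v $$ (i, j)) = (0 :: complex)" using pcl_cl[OF N v] that by (simp add: cl_def)
    then show ?thesis by simp
  qed
  then show ?thesis using d by (auto simp: upm_def)
qed

lemma pH_carrier: "pH A B \<psi> X \<in> carrier_mat (natoms B) (natoms B)"
  by (simp add: pH_def induced_hom_def)

lemma pH_cH:
  assumes N: "is_nest A" "is_nest B" and R: "RM A B \<psi>" and st: "s < natoms B" "t < natoms B"
  shows "of_int (pH A B \<psi> X $$ (s, t)) = cH A B \<psi> (\<lambda>i j. of_int (X $$ (i, j))) s t"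
proof -
  have "of_int (pclass B (me (msize B) (\<psi> (gm A i j))) $$ (s, t)) = cl B (\<psi> (gm A i j)) s t" if "i \<le> j" "j < natoms A" for i j
    using pcl_cl[OF N(2) RM_RG[OF N R gm_RG[OF N(1) that]] st] by (simp add: pcl_def)
  then show ?thesis using st
    by (simp add: pH_def induced_hom_def cH_def gm_def)
qed

lemma pH_upm:
  assumes N: "is_nest A" "is_nest B" and R: "RM A B \<psi>"
  shows "pH A B \<psi> X \<in> upm B"
proof -
  have "pH A B \<psi> X $$ (s, t) = 0" if st: "s < natoms B" "t < s" for s t
  proof -
    have "of_int (pH A B \<psi> X $$ (s, t)) = (0 :: complex)"
    proof -
      have "cl B (\<psi> (gm A i j)) s t = 0" if "i \<le> j" "j < natoms A" for i j
        using RG_NA[OF RM_RG[OF N R gm_RG[OF N(1) that]]] st by (simp add: NA_def cl_def)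
      then show ?thesis using st by (simp add: pH_cH[OF N R] cH_def)
    qed
    then show ?thesis by simp
  qed
  then show ?thesis using pH_carrier by (auto simp: upm_def carrier_matD[OF pH_carrier])
qed

lemma pH_comp:
  assumes N: "is_nest A" "is_nest B" "is_nest C" and R: "RM A B \<psi>" "RM B C \<chi>"
  shows "pH B C \<chi> (pH A B \<psi> X) = pH A C (\<chi> \<circ> \<psi>) X"
proof (rule upm_eqI)
  note RC = RM_comp[OF N R]
  show "pH B C \<chi> (pH A B \<psi> X) \<in> upm C" "pH A C (\<chi> \<circ> \<psi>) X \<in> upm C" using pH_upm N R RC by blast+
  fix s t assume st: "s \<le> t" "t < natoms C"
  have "of_int (pH B C \<chi> (pH A B \<psi> X) $$ (s, t)) = cH B C \<chi> (cH A B \<psi> (\<lambda>i j. of_int (X $$ (i, j)))) s t"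
    using st by (subst pH_cH[OF N(2,3) R(2)]) (auto intro!: cH_cong pH_cH[OF N(1,2) R(1)])
  also have "\<dots> = of_int (pH A C (\<chi> \<circ> \<psi>) X $$ (s, t))"
    using st by (simp add: cH_comp[OF N R] pH_cH[OF N(1,3) RC])
  finally show "(of_int (pH B C \<chi> (pH A B \<psi> X) $$ (s, t)) :: complex) = of_int (pH A C (\<chi> \<circ> \<psi>) X $$ (s, t))" .
qed

lemma pH_pcl:
  assumes N: "is_nest A" "is_nest B" and R: "RM A B \<psi>" and v: "v \<in> RG A"
  shows "pH A B \<psi> (pcl A v) = pcl B (\<psi> v)"
proof (rule upm_eqI)
  show "pH A B \<psi> (pcl A v) \<in> upm B" "pcl B (\<psi> v) \<in> upm B" using pH_upm[OF N R] pcl_upm[OF N(2) RM_RG[OF N R v]] by blast+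
  fix s t assume st: "s \<le> t" "t < natoms B"
  have "(of_int (pH A B \<psi> (pcl A v) $$ (s, t)) :: complex) = cH A B \<psi> (cl A v) s t"
    using st by (subst pH_cH[OF N R]) (auto intro!: cH_cong pcl_cl[OF N(1) v])
  also have "\<dots> = cl B (\<psi> v) s t" using st by (simp add: cl_cH[OF N R v])
  also have "\<dots> = of_int (pcl B (\<psi> v) $$ (s, t))" using st by (simp add: pcl_cl[OF N(2) RM_RG[OF N R v]])
  finally show "(of_int (pH A B \<psi> (pcl A v) $$ (s, t)) :: complex) = of_int (pcl B (\<psi> v) $$ (s, t))" .
qed

lemma cH_id:
  assumes N: "is_nest A" and ij: "s \<le> t" "t < natoms A"
  shows "cH A A id X s t = X s t"
proof -
  have "cH A A id X s t = (\<Sum>j<natoms A. \<Sum>i\<le>j. (if i = s \<and> j = t then 1 else 0) * X i j)"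
    unfolding cH_def using ij by (intro sum.cong refl) (auto simp: cl_mi[OF N generator_props(1,2)[OF N]])
  also have "\<dots> = X s t" by (rule sum_upper_delta[OF ij])
  finally show ?thesis .
qed

lemma pH_id:
  assumes N: "is_nest A" and X: "X \<in> upm A" shows "pH A A id X = X"
  by (rule upm_eqI[OF pH_upm[OF N N RM_id[OF N]] X])
    (simp add: pH_cH[OF N N RM_id[OF N]] cH_id[OF N])

lemma pH_cong:
  assumes "\<And>i j. i \<le> j \<Longrightarrow> j < natoms A \<Longrightarrow> \<psi> (gm A i j) = \<chi> (gm A i j)"
  shows "pH A B \<psi> X = pH A B \<chi> X"
proof -
  have "(\<Sum>j<natoms A. \<Sum>i\<le>j. X $$ (i, j) * pclass B (me (msize B) (\<psi> (em (generator A i j)))) $$ (s, t)) =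
    (\<Sum>j<natoms A. \<Sum>i\<le>j. X $$ (i, j) * pclass B (me (msize B) (\<chi> (em (generator A i j)))) $$ (s, t))" for s t
    using assms by (intro sum.cong refl) (simp add: gm_def)
  then show ?thesis by (simp add: pH_def induced_hom_def)
qed

lemma induced_hom_pH:
  assumes N: "is_nest A" and "\<And>a. a \<in> nest_alg A \<Longrightarrow> \<phi> a \<in> full B \<and> em (\<phi> a) = \<psi> (em a)"
  shows "induced_hom A B \<phi> X = pH A B \<psi> X"
proof -
  have "\<phi> (generator A i j) = me (msize B) (\<psi> (em (generator A i j)))" if "i \<le> j" "j < natoms A" for i j
  proof -
    have "generator A i j \<in> nest_alg A" using generator_props(4)[OF N that] by (simp add: Pisom_reg_def)
    with assms(2)[OF this] show ?thesis by (metis me_em)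
  qed
  then have "(\<Sum>j<natoms A. \<Sum>i\<le>j. X $$ (i, j) * pclass B (\<phi> (generator A i j)) $$ (s, t)) =
    (\<Sum>j<natoms A. \<Sum>i\<le>j. X $$ (i, j) * pclass B (me (msize B) (\<psi> (em (generator A i j)))) $$ (s, t))" for s t
    by (intro sum.cong refl) simp
  then show ?thesis by (simp add: pH_def induced_hom_def)
qed

lemma upm_closed: "X \<in> upm A \<Longrightarrow> Y \<in> upm A \<Longrightarrow> X + Y \<in> upm A" "X \<in> upm A \<Longrightarrow> - X \<in> upm A"
  "0\<^sub>m (natoms A) (natoms A) \<in> upm A"
  by (auto simp: upm_def upper_triangular_def)

lemma pH_add:
  assumes N: "is_nest A" "is_nest B" and R: "RM A B \<psi>" and X: "X \<in> upm A" and Y: "Y \<in> upm A"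
  shows "pH A B \<psi> (X + Y) = pH A B \<psi> X + pH A B \<psi> Y"
proof (rule upm_eqI)
  show "pH A B \<psi> (X + Y) \<in> upm B" "pH A B \<psi> X + pH A B \<psi> Y \<in> upm B" using pH_upm[OF N R] upm_closed by blast+
  fix s t assume st: "s \<le> t" "t < natoms B"
  have "cH A B \<psi> (\<lambda>i j. of_int ((X + Y) $$ (i, j))) s t = cH A B \<psi> (\<lambda>i j. of_int (X $$ (i, j)) + of_int (Y $$ (i, j))) s t"
    using X Y by (intro cH_cong) (auto simp: upm_def)
  also have "\<dots> = cH A B \<psi> (\<lambda>i j. of_int (X $$ (i, j))) s t + cH A B \<psi> (\<lambda>i j. of_int (Y $$ (i, j))) s t"
    by (simp add: cH_def distrib_right sum.distrib)
  finally show "(of_int (pH A B \<psi> (X + Y) $$ (s, t)) :: complex) = of_int ((pH A B \<psi> X + pH A B \<psi> Y) $$ (s, t))"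
    using st by (simp add: pH_cH[OF N R] carrier_matD[OF pH_carrier])
qed

section \<open>Naturality of the range and domain maps\<close>

lemma pi_f_entry:
  assumes N: "is_nest A" and X: "X \<in> upm A" and st: "s < natoms A" "t < natoms A"
  shows "pi_f A X \<in> carrier_mat (natoms A) (natoms A)"
    "pi_f A X $$ (s, t) = (if s = t then \<Sum>j<natoms A. X $$ (s, j) else 0)"
proof -
  show "pi_f A X \<in> carrier_mat (natoms A) (natoms A)" by (simp add: pi_f_def induced_hom_def)
  have g: "pclass A (generator A i j * mat_adjoint (generator A i j)) $$ (s, t) = (if s = i \<and> t = i then 1 else 0)"
    if ij: "i \<le> j" "j < natoms A" for i j
  proof -
    note gp = generator_props[OF N ij]
    define p where "p = gm A i j * adj (gm A i j)"
    have bp: "blk A i i p" unfolding p_def using gp blk_mult[OF N] blk_adj[OF N] by blast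
    have mp: "mi p" using gp by (simp add: p_def mi_mn mn_mi)
    have e: "em (generator A i j * mat_adjoint (generator A i j)) = p"
      using gp by (simp add: em_mult_full[of _ A] em_adj p_def gm_def)
    have f: "generator A i j * mat_adjoint (generator A i j) \<in> full A" using gp(3) by auto
    have "generator A i j * mat_adjoint (generator A i j) \<in> Pisom_reg A"
      using Pisom_reg_iff[OF N f] e blk_RG[OF N mi_pim[OF mp] bp] by simp
    from pclass_cl[OF N this st] have "of_int (pclass A (generator A i j * mat_adjoint (generator A i j)) $$ (s, t)) = (if s = i \<and> t = i then 1 else 0 :: complex)"
      using cl_mi[OF N mp bp st] e by simp
    then show ?thesis by (cases "s = i \<and> t = i") auto
  qed
  have "pi_f A X $$ (s, t) = (\<Sum>j<natoms A. \<Sum>i\<le>j. X $$ (i, j) * (if s = i \<and> t = i then 1 else 0))"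
    unfolding pi_f_def induced_hom_def using st by (auto simp: g intro!: sum.cong)
  also have "\<dots> = (\<Sum>j<natoms A. \<Sum>i\<le>j. if i = s then (if s = t then X $$ (s, j) else 0) else 0)"
    by (intro sum.cong refl) auto
  also have "\<dots> = (\<Sum>j<natoms A. if s = t then X $$ (s, j) else 0)"
    using X st by (intro sum.cong refl) (auto simp: sum.delta upm_def upper_triangular_def)
  finally show "pi_f A X $$ (s, t) = (if s = t then \<Sum>j<natoms A. X $$ (s, j) else 0)" by simp
qed

lemma pi_i_entry:
  assumes N: "is_nest A" and X: "X \<in> upm A" and st: "s < natoms A" "t < natoms A"
  shows "pi_i A X \<in> carrier_mat (natoms A) (natoms A)"
    "pi_i A X $$ (s, t) = (if s = t then \<Sum>i<natoms A. X $$ (i, s) else 0)"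
proof -
  show "pi_i A X \<in> carrier_mat (natoms A) (natoms A)" by (simp add: pi_i_def induced_hom_def)
  have g: "pclass A (mat_adjoint (generator A i j) * generator A i j) $$ (s, t) = (if s = j \<and> t = j then 1 else 0)"
    if ij: "i \<le> j" "j < natoms A" for i j
  proof -
    note gp = generator_props[OF N ij]
    define p where "p = adj (gm A i j) * gm A i j"
    have bp: "blk A j j p" unfolding p_def using gp blk_mult[OF N] blk_adj[OF N] by blast
    have mp: "mi p" using gp by (simp add: p_def mi_mn mn_mi)
    have e: "em (mat_adjoint (generator A i j) * generator A i j) = p"
      using gp by (simp add: em_mult_full[of _ A] em_adj p_def gm_def)
    have f: "mat_adjoint (generator A i j) * generator A i j \<in> full A" using gp(3) by auto
    have "mat_adjoint (generator A i j) * generator A i j \<in> Pisom_reg A"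
      using Pisom_reg_iff[OF N f] e blk_RG[OF N mi_pim[OF mp] bp] by simp
    from pclass_cl[OF N this st] have "of_int (pclass A (mat_adjoint (generator A i j) * generator A i j) $$ (s, t)) = (if s = j \<and> t = j then 1 else 0 :: complex)"
      using cl_mi[OF N mp bp st] e by simp
    then show ?thesis by (cases "s = j \<and> t = j") auto
  qed
  have "pi_i A X $$ (s, t) = (\<Sum>j<natoms A. \<Sum>i\<le>j. X $$ (i, j) * (if s = j \<and> t = j then 1 else 0))"
    unfolding pi_i_def induced_hom_def using st by (auto simp: g intro!: sum.cong)
  also have "\<dots> = (\<Sum>j<natoms A. if j = s then (if s = t then (\<Sum>i\<le>s. X $$ (i, s)) else 0) else 0)"
    by (intro sum.cong refl) auto
  also have "\<dots> = (if s = t then (\<Sum>i\<le>s. X $$ (i, s)) else 0)" using st by (simp add: sum.delta)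
  also have "(\<Sum>i\<le>s. X $$ (i, s)) = (\<Sum>i<natoms A. X $$ (i, s))"
  proof (rule sum.mono_neutral_left)
    show "\<forall>i\<in>{..<natoms A} - {..s}. X $$ (i, s) = 0"
    proof
      fix i assume "i \<in> {..<natoms A} - {..s}"
      then have "i < natoms A" "s < i" by auto
      then show "X $$ (i, s) = 0" using X by (auto simp: upm_def upper_triangular_def)
    qed
  qed (use st in auto)
  finally show "pi_i A X $$ (s, t) = (if s = t then \<Sum>i<natoms A. X $$ (i, s) else 0)" .
qed

lemma pi_upm: "is_nest A \<Longrightarrow> X \<in> upm A \<Longrightarrow> pi_f A X \<in> upm A" "is_nest A \<Longrightarrow> X \<in> upm A \<Longrightarrow> pi_i A X \<in> upm A"
  using pi_f_entry[of A X] pi_i_entry[of A X] by (auto simp: upm_def pi_f_def pi_i_def induced_hom_def upper_triangular_def)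

lemma sum_diag_upper:
  fixes F :: "nat \<Rightarrow> complex"
  shows "(\<Sum>j<n. \<Sum>i\<le>j. (if i = j then F i else 0) * c i j) = (\<Sum>i<n. F i * c i i)"
proof (rule sum.cong)
  fix j
  have "(\<Sum>i\<le>j. (if i = j then F i else 0) * c i j) = (\<Sum>i\<le>j. if i = j then F j * c j j else 0)" by (intro sum.cong) auto
  then show "(\<Sum>i\<le>j. (if i = j then F i else 0) * c i j) = F j * (c j j :: complex)" by (simp add: sum.delta)
qed simp

lemma cl_diag:
  assumes N: "is_nest B" and d: "d \<in> DA B" and st: "s < natoms B" "t < natoms B"
  shows "cl B d s t = (if s = t then tr (atm B s * (d * adj d)) else 0)"
proof (cases "s = t")
  case True
  have "atm B s * d * atm B s * adj d = atm B s * (d * adj d)"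
    using DA_comm[OF N d st(1)] st by (metis N at_self(1) mult.assoc)
  then show ?thesis using True by (simp add: cl_def)
qed (use d st in \<open>simp add: cl_def DA_def\<close>)

lemma sum_upper_rows:
  fixes x :: "nat \<Rightarrow> nat \<Rightarrow> complex"
  assumes "\<And>i j. j < i \<Longrightarrow> i < n \<Longrightarrow> x i j = 0"
  shows "(\<Sum>j<n. \<Sum>i\<le>j. x i j) = (\<Sum>i<n. \<Sum>j<n. x i j)"
proof -
  have "(\<Sum>j<n. \<Sum>i\<le>j. x i j) = (\<Sum>j<n. \<Sum>i<n. x i j)"
    by (intro sum.cong refl sum.mono_neutral_left) (use assms in auto)
  then show ?thesis using sum.swap by metis
qed

lemma mi_rows:
  assumes N: "is_nest A" "is_nest B" and S: "SH A B \<psi>" and e: "mn e" "blk A i i e" "mn f" "blk A i i f" and s: "s < natoms B"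
  shows "tr (atm B s * \<psi> e) = tr (atm B s * \<psi> f)"
proof -
  have *: "tr (atm B s * \<psi> e) = cl B (\<psi> e) s s" if "mn e" "blk A i i e" for e
  proof -
    have F: "e \<in> FM A" using blkD[OF N(1)] that by blast
    have "\<psi> e * adj (\<psi> e) = \<psi> e" using SH_pj[OF S F mn_pj] that by (simp add: pj_def)
    then show ?thesis using cl_diag[OF N(2) SH_DA[OF N S blk_DA[OF N(1)]], of i e s s] that s by simp
  qed
  show ?thesis unfolding *[OF e(1,2)] *[OF e(3,4)]
    using cl_mi_image[OF N S _ _ _ _ s s] e mn_mi by blast
qed

lemma gm_rows:
  assumes N: "is_nest A" "is_nest B" and S: "SH A B \<psi>" and e: "mn e" "blk A i i e" and s: "s < natoms B"
  shows "tr (atm B s * \<psi> e) = tr (atm B s * \<psi> (gm A i i * adj (gm A i i)))"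
proof -
  have "i < natoms A" using blkD(1)[OF N(1) e(2)] .
  note g = generator_props[OF N(1) order_refl this]
  show ?thesis
    by (rule mi_rows[OF N S e mi_mn(2)[OF g(1)] blk_mult[OF N(1) g(2) blk_adj[OF N(1) g(2)]] s])
qed

lemma pH_diag:
  assumes N: "is_nest A" "is_nest B" and R: "RM A B \<psi>" and st: "s < natoms B" "t < natoms B"
    and Y: "\<And>i j. i < natoms A \<Longrightarrow> j < natoms A \<Longrightarrow> of_int (Y $$ (i, j)) = (if i = j then y i else 0)"
  shows "of_int (pH A B \<psi> Y $$ (s, t)) = (if s = t then \<Sum>i<natoms A. y i * tr (atm B s * \<psi> (gm A i i * adj (gm A i i))) else 0)"
proof -
  note S = RM_SH[OF R]
  have gd: "cl B (\<psi> (gm A i i)) s t = (if s = t then tr (atm B s * \<psi> (gm A i i * adj (gm A i i))) else 0)" if "i < natoms A" for i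
  proof -
    have "\<psi> (gm A i i) \<in> DA B" using that generator_props(2)[OF N(1)] blk_DA[OF N(1)] SH_DA[OF N S] by blast
    then show ?thesis using st gm_FM[OF N(1), of i i] that by (simp add: cl_diag[OF N(2)] SHD[OF S])
  qed
  have "of_int (pH A B \<psi> Y $$ (s, t)) = cH A B \<psi> (\<lambda>i j. if i = j then y i else 0) s t"
    using st by (subst pH_cH[OF N R]) (auto intro!: cH_cong simp: Y)
  also have "\<dots> = (\<Sum>i<natoms A. y i * cl B (\<psi> (gm A i i)) s t)" unfolding cH_def by (rule sum_diag_upper)
  finally show ?thesis by (simp add: gd)
qed

text \<open>Row sums of the class of an image are traces of its range projection, and for the
  generator of block \<open>(i, j)\<close> these depend on \<open>i\<close> alone
  (\<open>gm_rows\<close>). Taking row sums therefore commutes with the induced map.\<close>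

lemma pH_pi_f:
  assumes N: "is_nest A" "is_nest B" and R: "RM A B \<psi>" and X: "X \<in> upm A"
  shows "pH A B \<psi> (pi_f A X) = pi_f B (pH A B \<psi> X)"
proof (rule upm_eqI)
  show "pH A B \<psi> (pi_f A X) \<in> upm B" "pi_f B (pH A B \<psi> X) \<in> upm B" using pH_upm[OF N R] pi_upm[OF N(2)] by blast+
  fix s t assume st: "s \<le> t" "t < natoms B"
  define x :: "nat \<Rightarrow> nat \<Rightarrow> complex" where "x i j = of_int (X $$ (i, j))" for i j
  have x0: "x i j = 0" if "j < i" "i < natoms A" for i j using X that by (auto simp: x_def upm_def upper_triangular_def)
  define c where "c i = tr (atm B s * \<psi> (gm A i i * adj (gm A i i)))" for i
  note S = RM_SH[OF R]
  have "(of_int (pH A B \<psi> (pi_f A X) $$ (s, t)) :: complex) = (if s = t then \<Sum>i<natoms A. (\<Sum>k<natoms A. x i k) * c i else 0)"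
    unfolding c_def using st by (intro pH_diag[OF N R]) (auto simp: pi_f_entry[OF N(1) X] x_def)
  also have "(\<Sum>i<natoms A. (\<Sum>k<natoms A. x i k) * c i) = (\<Sum>j<natoms A. \<Sum>i\<le>j. x i j * c i)"
    unfolding sum_distrib_right by (rule sum_upper_rows[symmetric]) (simp add: x0)
  also have "\<dots> = (\<Sum>j<natoms A. \<Sum>i\<le>j. \<Sum>u<natoms B. x i j * cl B (\<psi> (gm A i j)) s u)"
  proof (intro sum.cong refl)
    fix j i assume "j \<in> {..<natoms A}" "i \<in> {..j}"
    then have ij: "i \<le> j" "j < natoms A" by auto
    note F = gm_FM[OF N(1) ij] and gp = generator_props[OF N(1) ij]
    have "tr (atm B s * (\<psi> (gm A i j) * adj (\<psi> (gm A i j)))) = c i"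
      using gm_rows[OF N S mi_mn(2)[OF gp(1)] blk_mult[OF N(1) gp(2) blk_adj[OF N(1) gp(2)]], of s] st F by (simp add: c_def SHD[OF S])
    then show "x i j * c i = (\<Sum>u<natoms B. x i j * cl B (\<psi> (gm A i j)) s u)"
      using cl_sum_row[OF N(2) SHD(1)[OF S F], of s] st by (simp add: sum_distrib_left[symmetric])
  qed
  also have "\<dots> = (\<Sum>u<natoms B. cH A B \<psi> x s u)"
    unfolding cH_def by (subst sum.swap[of _ "{..<natoms B}"]) (auto intro!: sum.cong sum.swap)
  also have "(if s = t then \<dots> else 0) = of_int (pi_f B (pH A B \<psi> X) $$ (s, t))"
    using st by (simp add: pi_f_entry[OF N(2) pH_upm[OF N R]] pH_cH[OF N R] x_def[abs_def])
  finally show "(of_int (pH A B \<psi> (pi_f A X) $$ (s, t)) :: complex) = of_int (pi_f B (pH A B \<psi> X) $$ (s, t))" .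
qed

lemma pH_pi_i:
  assumes N: "is_nest A" "is_nest B" and R: "RM A B \<psi>" and X: "X \<in> upm A"
  shows "pH A B \<psi> (pi_i A X) = pi_i B (pH A B \<psi> X)"
proof (rule upm_eqI)
  show "pH A B \<psi> (pi_i A X) \<in> upm B" "pi_i B (pH A B \<psi> X) \<in> upm B" using pH_upm[OF N R] pi_upm[OF N(2)] by blast+
  fix s t assume st: "s \<le> t" "t < natoms B"
  define x :: "nat \<Rightarrow> nat \<Rightarrow> complex" where "x i j = of_int (X $$ (i, j))" for i j
  have x0: "x i j = 0" if "j < i" "i < natoms A" for i j using X that by (auto simp: x_def upm_def upper_triangular_def)
  define c where "c i = tr (atm B s * \<psi> (gm A i i * adj (gm A i i)))" for i
  note S = RM_SH[OF R]
  have "(of_int (pH A B \<psi> (pi_i A X) $$ (s, t)) :: complex) = (if s = t then \<Sum>i<natoms A. (\<Sum>k<natoms A. x k i) * c i else 0)"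
    unfolding c_def using st by (intro pH_diag[OF N R]) (auto simp: pi_i_entry[OF N(1) X] x_def)
  also have "(\<Sum>i<natoms A. (\<Sum>k<natoms A. x k i) * c i) = (\<Sum>j<natoms A. \<Sum>i\<le>j. x i j * c j)"
    unfolding sum_distrib_right by (subst sum_upper_rows) (auto simp: x0 intro: sum.swap)
  also have "\<dots> = (\<Sum>j<natoms A. \<Sum>i\<le>j. \<Sum>u<natoms B. x i j * cl B (\<psi> (gm A i j)) u s)"
  proof (intro sum.cong refl)
    fix j i assume "j \<in> {..<natoms A}" "i \<in> {..j}"
    then have ij: "i \<le> j" "j < natoms A" by auto
    note F = gm_FM[OF N(1) ij] and gp = generator_props[OF N(1) ij]
    have "tr (atm B s * (adj (\<psi> (gm A i j)) * \<psi> (gm A i j))) = c j"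
      using gm_rows[OF N S mi_mn(1)[OF gp(1)] blk_mult[OF N(1) blk_adj[OF N(1) gp(2)] gp(2)], of s] st F by (simp add: c_def SHD[OF S])
    then show "x i j * c j = (\<Sum>u<natoms B. x i j * cl B (\<psi> (gm A i j)) u s)"
      using cl_sum_col[OF N(2) SHD(1)[OF S F], of s] st by (simp add: sum_distrib_left[symmetric])
  qed
  also have "\<dots> = (\<Sum>u<natoms B. cH A B \<psi> x u s)"
    unfolding cH_def by (subst sum.swap[of _ "{..<natoms B}"]) (auto intro!: sum.cong sum.swap)
  also have "(if s = t then \<dots> else 0) = of_int (pi_i B (pH A B \<psi> X) $$ (s, t))"
    using st by (simp add: pi_i_entry[OF N(2) pH_upm[OF N R]] pH_cH[OF N R] x_def[abs_def])
  finally show "(of_int (pH A B \<psi> (pi_i A X) $$ (s, t)) :: complex) = of_int (pi_i B (pH A B \<psi> X) $$ (s, t))" .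
qed

section \<open>The scales of a nest algebra\<close>

lemma Sigma_reg_pcl: "is_nest A \<Longrightarrow> Sigma_reg A = pcl A ` RG A"
proof -
  assume N: "is_nest A"
  have "Pisom_reg A = me (msize A) ` RG A"
  proof (rule equalityI; rule subsetI)
    fix p assume p: "p \<in> Pisom_reg A"
    then have f: "p \<in> full A" by (rule Pisom_reg_full[OF N])
    then have "em p \<in> RG A" using p Pisom_reg_iff[OF N f] by simp
    then have "me (msize A) (em p) \<in> me (msize A) ` RG A" by (rule imageI)
    then show "p \<in> me (msize A) ` RG A" using f by simp
  next
    fix p assume "p \<in> me (msize A) ` RG A"
    then obtain q where q: "q \<in> RG A" "p = me (msize A) q" by auto
    have "em p = q" "p \<in> full A" using q RG_FM by (simp_all add: FM_me)
    then show "p \<in> Pisom_reg A" using q Pisom_reg_iff[OF N, of p] by simp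
  qed
  then show ?thesis by (auto simp: Sigma_reg_def pcl_def image_iff)
qed

lemma Sigma_op_pcl: "is_nest A \<Longrightarrow> Sigma_op A = pcl A ` OPS A"
proof -
  assume N: "is_nest A"
  have "Pisom_op A = me (msize A) ` OPS A"
  proof (rule equalityI; rule subsetI)
    fix p assume p: "p \<in> Pisom_op A"
    then have f: "p \<in> full A" by (rule Pisom_op_full[OF N])
    then have "em p \<in> OPS A" using p Pisom_op_iff[OF N f] by simp
    then have "me (msize A) (em p) \<in> me (msize A) ` OPS A" by (rule imageI)
    then show "p \<in> me (msize A) ` OPS A" using f by simp
  next
    fix p assume "p \<in> me (msize A) ` OPS A"
    then obtain q where q: "q \<in> OPS A" "p = me (msize A) q" by auto
    have "em p = q" "p \<in> full A" using q RG_FM[OF OPS_RG] by (simp_all add: FM_me)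
    then show "p \<in> Pisom_op A" using q Pisom_op_iff[OF N, of p] by simp
  qed
  then show ?thesis by (auto simp: Sigma_op_def pcl_def image_iff)
qed

lemma Sigma_0_pcl: "is_nest A \<Longrightarrow> Sigma_0 A = pcl A ` {p \<in> NA A. pj p}"
proof -
  assume N: "is_nest A"
  have "{p \<in> nest_alg A. is_projection p} = me (msize A) ` {p \<in> NA A. pj p}"
  proof (rule equalityI; rule subsetI)
    fix p assume p: "p \<in> {p \<in> nest_alg A. is_projection p}"
    then have f: "p \<in> full A" by (auto simp: nest_alg_def)
    then have "em p \<in> NA A" "pj (em p)" using p nest_alg_iff[OF N f] projection_iff[OF N f] by auto
    then show "p \<in> me (msize A) ` {p \<in> NA A. pj p}" using f by (auto simp: image_iff intro!: exI[of _ "em p"])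
  next
    fix p assume "p \<in> me (msize A) ` {p \<in> NA A. pj p}"
    then obtain q where q: "q \<in> NA A" "pj q" "p = me (msize A) q" by auto
    then show "p \<in> {p \<in> nest_alg A. is_projection p}"
      using me_nest_alg[OF N q(1)] projection_iff[OF N, of p] by (simp add: FM_me NA_FM)
  qed
  then show ?thesis by (auto simp: Sigma_0_def pcl_def image_iff)
qed

lemma pj_NA_RG: assumes N: "is_nest A" and p: "p \<in> NA A" "pj p" shows "p \<in> DA A" "p \<in> RG A"
proof -
  show d: "p \<in> DA A" using NA_adj_DA[OF N p(1)] p by (simp add: pjD)
  have "pim (atm A i * p * atm A j)" if "i < natoms A" "j < natoms A" for i j
  proof (cases "i = j")
    case True
    have "atm A i * p * atm A i = atm A i * p" using DA_comm[OF N d that(1)] that by (metis N at_self(1) mult.assoc)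
    moreover have "pj (atm A i * p)" using pj_comm_mult[OF at_pj[OF N that(1)] p(2) DA_comm[OF N d that(1)]] .
    ultimately show ?thesis using True pj_pim by simp
  qed (use d that in \<open>simp add: DA_def\<close>)
  then show "p \<in> RG A" using p by (simp add: RG_def PR_def NA_FM pj_pim)
qed

text \<open>Turns the condition on classes in \<open>lim_Sigma_op\<close> into a condition on the
  partial isometries themselves.\<close>

lemma pcl_op_imp: "is_nest A \<Longrightarrow> v \<in> RG A \<Longrightarrow> pcl A v \<in> Sigma_op A \<Longrightarrow> v \<in> OPS A"
  unfolding Sigma_op_pcl
proof -
  assume N: "is_nest A" and v: "v \<in> RG A" and "pcl A v \<in> pcl A ` OPS A"
  then obtain w where w: "w \<in> OPS A" "pcl A v = pcl A w" by auto
  show "v \<in> OPS A"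
    by (rule OPS_by_class[OF N v w(1)]) (metis N OPS_RG pcl_cl v w)
qed

lemma dist_group_simps: "carrier (dist_group A) = upm A" "X \<otimes>\<^bsub>dist_group A\<^esub> Y = X + Y"
  "\<one>\<^bsub>dist_group A\<^esub> = 0\<^sub>m (natoms A) (natoms A)"
  by (auto simp: dist_group_def upm_def)

lemma dist_group: "comm_group (dist_group A)"
proof (rule comm_groupI)
  fix X assume X: "X \<in> carrier (dist_group A)"
  then have "X \<in> carrier_mat (natoms A) (natoms A)" by (simp add: dist_group_simps upm_def)
  then have "- X + X = 0\<^sub>m (natoms A) (natoms A)" by (intro eq_matI) auto
  then show "\<exists>Y\<in>carrier (dist_group A). Y \<otimes>\<^bsub>dist_group A\<^esub> X = \<one>\<^bsub>dist_group A\<^esub>"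
    using X by (intro bexI[of _ "- X"]) (auto simp: dist_group_simps upm_closed)
qed (auto simp: dist_group_simps upm_closed, auto simp: upm_def intro: comm_add_mat assoc_add_mat)

section \<open>Direct limits of sequences\<close>

lemma sys_map_self [simp]: "sys_map f k k x = x"
  by (simp add: sys_map_def)

lemma sys_map_Suc: "k \<le> n \<Longrightarrow> sys_map f k (Suc n) x = f n (sys_map f k n x)"
  by (simp add: sys_map_def)

lemma sys_map_comp: "k \<le> m \<Longrightarrow> m \<le> n \<Longrightarrow> sys_map f m n (sys_map f k m x) = sys_map f k n x"
proof (induction n)
  case (Suc n)
  then show ?case by (cases "m \<le> n") (auto simp: sys_map_Suc le_Suc_eq)
qed auto

locale dsys =
  fixes D :: "nat \<Rightarrow> 'a set" and f :: "nat \<Rightarrow> 'a \<Rightarrow> 'a"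
  assumes f_in: "x \<in> D k \<Longrightarrow> f k x \<in> D (Suc k)"
begin

abbreviation "cls \<equiv> dlim_in D f"

lemma sys_in: "k \<le> n \<Longrightarrow> x \<in> D k \<Longrightarrow> sys_map f k n x \<in> D n"
proof (induction n)
  case (Suc n)
  then show ?case by (cases "k \<le> n") (auto simp: sys_map_Suc f_in le_Suc_eq)
qed auto

lemma rel_equiv: "equiv (SIGMA k:UNIV. D k) (dlim_rel D f)"
proof (rule equivI)
  show "refl_on (SIGMA k:UNIV. D k) (dlim_rel D f)"
    by (auto simp: refl_on_def dlim_rel_def)
  show "sym (dlim_rel D f)"
    unfolding sym_def dlim_rel_def by (auto; metis max.bounded_iff)
  show "trans (dlim_rel D f)"
  proof (rule transI)
    fix x y z assume "(x, y) \<in> dlim_rel D f" "(y, z) \<in> dlim_rel D f"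
    then obtain k a m b l c n n' where *: "x = (k, a)" "y = (m, b)" "z = (l, c)" "a \<in> D k" "b \<in> D m" "c \<in> D l"
      "n \<ge> max k m" "sys_map f k n a = sys_map f m n b" "n' \<ge> max m l" "sys_map f m n' b = sys_map f l n' c"
      unfolding dlim_rel_def by auto
    define N where "N = max n n'"
    have "sys_map f k N a = sys_map f n N (sys_map f k n a)" using *(7) by (simp add: sys_map_comp N_def)
    also have "\<dots> = sys_map f m N b" unfolding *(8) using *(7) by (simp add: sys_map_comp N_def)
    also have "\<dots> = sys_map f n' N (sys_map f m n' b)" using *(9) by (simp add: sys_map_comp N_def)
    also have "\<dots> = sys_map f l N c" unfolding *(10) using *(9) by (simp add: sys_map_comp N_def)
    finally show "(x, z) \<in> dlim_rel D f"
      using * by (auto simp: dlim_rel_def N_def intro!: exI[of _ "max n n'"])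
  qed
qed (auto simp: dlim_rel_def)

lemma cls_in: "a \<in> D k \<Longrightarrow> cls k a \<in> dlim D f"
  unfolding dlim_def dlim_in_def by (intro quotientI) auto

lemma dlim_cases: "X \<in> dlim D f \<Longrightarrow> (\<And>k a. a \<in> D k \<Longrightarrow> X = cls k a \<Longrightarrow> P) \<Longrightarrow> P"
  unfolding dlim_def dlim_in_def by (auto elim!: quotientE)

lemma cls_eq_iff: "a \<in> D k \<Longrightarrow> b \<in> D m \<Longrightarrow> cls k a = cls m b \<longleftrightarrow> (\<exists>n\<ge>max k m. sys_map f k n a = sys_map f m n b)"
  unfolding dlim_in_def using eq_equiv_class_iff[OF rel_equiv, of "(k, a)" "(m, b)"]
  by (auto simp: dlim_rel_def)

lemma cls_shift: "a \<in> D k \<Longrightarrow> k \<le> n \<Longrightarrow> cls n (sys_map f k n a) = cls k a"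
  by (subst cls_eq_iff) (auto intro: sys_in intro!: exI[of _ n])

lemma cls_step: "a \<in> D k \<Longrightarrow> cls (Suc k) (f k a) = cls k a"
  using cls_shift[of a k "Suc k"] by (simp add: sys_map_Suc)

lemma cls_mem: "(m, b) \<in> cls k a \<Longrightarrow> b \<in> D m \<and> cls m b = cls k a"
proof -
  assume "(m, b) \<in> cls k a"
  then have r: "((k, a), (m, b)) \<in> dlim_rel D f" by (simp add: dlim_in_def)
  show ?thesis using equiv_class_eq[OF rel_equiv r] r by (auto simp: dlim_in_def dlim_rel_def)
qed

lemma cls_self: "a \<in> D k \<Longrightarrow> (k, a) \<in> cls k a"
  by (auto simp: dlim_in_def dlim_rel_def)

lemma cls_same_eventually:
  assumes "a \<in> D k" "b \<in> D k" "cls k a = cls k b"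
  shows "\<exists>n0\<ge>k. \<forall>n\<ge>n0. sys_map f k n a = sys_map f k n b"
proof -
  obtain n0 where n0: "n0 \<ge> k" "sys_map f k n0 a = sys_map f k n0 b" using assms cls_eq_iff by auto
  then have "sys_map f k n a = sys_map f k n b" if "n \<ge> n0" for n
    using sys_map_comp[of k n0 n f] that by metis
  then show ?thesis using n0 by blast
qed

lemma common2:
  assumes "X \<in> dlim D f" "Y \<in> dlim D f"
  shows "\<exists>k a b. a \<in> D k \<and> b \<in> D k \<and> X = cls k a \<and> Y = cls k b"
proof -
  obtain k a m b where "a \<in> D k" "X = cls k a" "b \<in> D m" "Y = cls m b" using assms by (metis dlim_cases)
  then show ?thesis
    by (intro exI[of _ "max k m"] exI[of _ "sys_map f k (max k m) a"] exI[of _ "sys_map f m (max k m) b"])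
      (auto simp: sys_in cls_shift)
qed

lemma common3:
  assumes "X \<in> dlim D f" "Y \<in> dlim D f" "Z \<in> dlim D f"
  shows "\<exists>k a b c. a \<in> D k \<and> b \<in> D k \<and> c \<in> D k \<and> X = cls k a \<and> Y = cls k b \<and> Z = cls k c"
proof -
  obtain k a b where 1: "a \<in> D k" "b \<in> D k" "X = cls k a" "Y = cls k b" using common2 assms by metis
  obtain m c where 2: "c \<in> D m" "Z = cls m c" using assms by (metis dlim_cases)
  show ?thesis
    by (intro exI[of _ "max k m"] exI[of _ "sys_map f k (max k m) a"] exI[of _ "sys_map f k (max k m) b"] exI[of _ "sys_map f m (max k m) c"])
      (use 1 2 in \<open>auto simp: sys_in cls_shift\<close>)
qed

lemma compat_sys:
  assumes "\<And>k a. a \<in> D k \<Longrightarrow> T (Suc k) (f k a) = T k a" "a \<in> D k" "k \<le> n"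
  shows "T n (sys_map f k n a) = T k a"
  using assms(3)
proof (induction n rule: dec_induct)
  case (step n)
  then show ?case using assms(1)[OF sys_in[OF _ assms(2), of n]] by (simp add: sys_map_Suc)
qed simp

text \<open>The universal property of the limit, for arbitrary compatible functions on the levels;
  the value is picked by choice and compatibility makes it independent of the
  representative.\<close>

lemma dlim_desc:
  assumes "\<And>k a. a \<in> D k \<Longrightarrow> T (Suc k) (f k a) = T k a"
  shows "\<exists>h. \<forall>k. \<forall>a\<in>D k. h (cls k a) = T k a"
proof -
  have wd: "T k a = T m b" if ab: "a \<in> D k" "b \<in> D m" "cls k a = cls m b" for k a m b
  proof -
    obtain n where "n \<ge> max k m" "sys_map f k n a = sys_map f m n b" using cls_eq_iff[OF ab(1,2)] ab(3) by blast
    then show ?thesis using compat_sys[of T, OF assms ab(1), of n] compat_sys[of T, OF assms ab(2), of n] by simp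
  qed
  define h where "h X = (SOME y. \<exists>k a. a \<in> D k \<and> X = cls k a \<and> y = T k a)" for X
  have "h (cls k a) = T k a" if "a \<in> D k" for k a
    unfolding h_def by (rule some_equality) (use that wd in blast)+
  then show ?thesis by blast
qed

lemma dlim_map_cls:
  assumes "\<And>k a. a \<in> D k \<Longrightarrow> g k a \<in> D k" "\<And>k a. a \<in> D k \<Longrightarrow> f k (g k a) = g (Suc k) (f k a)" "a \<in> D k"
  shows "dlim_map D f g (cls k a) = cls k (g k a)"
proof -
  have c: "cls (Suc k) (g (Suc k) (f k a)) = cls k (g k a)" if "a \<in> D k" for k a
    using cls_step[OF assms(1)[OF that]] assms(2)[OF that] by simp
  obtain h where h: "\<And>k a. a \<in> D k \<Longrightarrow> h (cls k a) = cls k (g k a)"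
    using dlim_desc[of "\<lambda>k a. cls k (g k a)", OF c] by blast
  have "cls m (g m b) = cls k (g k a)" if "(m, b) \<in> cls k a" for m b
    using cls_mem[OF that] h assms(3) by metis
  then have "(\<lambda>(m, b). cls m (g m b)) p = cls k (g k a)" if "p \<in> cls k a" for p using that by (cases p) simp
  moreover have "cls k a \<noteq> {}" using cls_self[OF assms(3)] by blast
  ultimately show ?thesis unfolding dlim_map_def by simp
qed

lemma dlim_map2_cls:
  assumes g: "\<And>k a b. a \<in> D k \<Longrightarrow> b \<in> D k \<Longrightarrow> g k a b \<in> D k"
    "\<And>k a b. a \<in> D k \<Longrightarrow> b \<in> D k \<Longrightarrow> f k (g k a b) = g (Suc k) (f k a) (f k b)" and ab: "a \<in> D k" "b \<in> D k"
  shows "dlim_map2 D f g (cls k a) (cls k b) = cls k (g k a b)"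
proof -
  have sg: "sys_map f k n (g k a b) = g n (sys_map f k n a) (sys_map f k n b)" if "k \<le> n" "a \<in> D k" "b \<in> D k" for k n a b
    using that(1)
  proof (induction n rule: dec_induct)
    case (step n)
    then show ?case using g(2) sys_in that by (simp add: sys_map_Suc)
  qed simp
  have *: "cls (max m m') (g (max m m') (sys_map f m (max m m') c) (sys_map f m' (max m m') d)) = cls k (g k a b)"
    if md: "(m, c) \<in> cls k a" "(m', d) \<in> cls k b" for m c m' d
  proof -
    define M where "M = max m m'"
    have c: "c \<in> D m" "cls m c = cls k a" "d \<in> D m'" "cls m' d = cls k b" using cls_mem md by blast+
    obtain n where n: "n \<ge> max m k" "sys_map f m n c = sys_map f k n a" using cls_eq_iff c ab by metis
    obtain n' where n': "n' \<ge> max m' k" "sys_map f m' n' d = sys_map f k n' b" using cls_eq_iff c ab by metis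
    \<comment> \<open>A level at which both representatives have met \<open>a\<close> and
      \<open>b\<close> and which lies beyond the level \<open>M\<close> prescribed by
      \<open>dlim_map2\<close>.\<close>
    define L where "L = max (max n n') M"
    have L: "sys_map f m L c = sys_map f k L a" "sys_map f m' L d = sys_map f k L b"
      using n n' sys_map_comp[of m n L f c] sys_map_comp[of k n L f a] sys_map_comp[of m' n' L f d] sys_map_comp[of k n' L f b]
      by (auto simp: L_def)
    have mM: "m \<le> M" "m' \<le> M" "M \<le> L" "k \<le> L" using n by (auto simp: M_def L_def)
    have i: "sys_map f m M c \<in> D M" "sys_map f m' M d \<in> D M" using sys_in c mM by blast+
    have "cls M (g M (sys_map f m M c) (sys_map f m' M d)) = cls L (sys_map f M L (g M (sys_map f m M c) (sys_map f m' M d)))"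
      using cls_shift[OF g(1)[OF i] mM(3)] by simp
    also have "\<dots> = cls L (g L (sys_map f m L c) (sys_map f m' L d))"
      using mM by (simp add: sg[OF mM(3) i] sys_map_comp)
    also have "\<dots> = cls L (sys_map f k L (g k a b))" unfolding L using sg[OF mM(4) ab] by simp
    also have "\<dots> = cls k (g k a b)" using cls_shift[OF g(1)[OF ab] mM(4)] .
    finally show ?thesis unfolding M_def .
  qed
  then have "(case p of (k, a) \<Rightarrow> \<Union>(m, b)\<in>cls k' b'. cls (max k m) (g (max k m) (sys_map f k (max k m) a) (sys_map f m (max k m) b))) = cls k (g k a b)"
    if "p \<in> cls k a" "k' = k" "b' = b" for p k' b'
  proof -
    obtain m c where p: "p = (m, c)" by fastforce
    have "(case q of (m', d) \<Rightarrow> cls (max m m') (g (max m m') (sys_map f m (max m m') c) (sys_map f m' (max m m') d))) = cls k (g k a b)"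
      if "q \<in> cls k b" for q
      using * that \<open>p \<in> cls k a\<close> p by (cases q) simp
    moreover have "cls k b \<noteq> {}" using cls_self[OF ab(2)] by blast
    ultimately show ?thesis using that p by simp
  qed
  moreover have "cls k a \<noteq> {}" using cls_self[OF ab(1)] by blast
  ultimately show ?thesis unfolding dlim_map2_def by simp
qed

end

section \<open>Order preserving systems\<close>

locale osys =
  fixes A :: "nat \<Rightarrow> nest" and \<alpha> :: "nat \<Rightarrow> complex mat \<Rightarrow> complex mat"
  assumes sys: "order_preserving_system A \<alpha>"
begin

text \<open>The star extension of \<open>\<alpha> k\<close> chosen by \<open>star_maps\<close>,
  transported to \<open>fmat\<close>.\<close>

definition S :: "nat \<Rightarrow> fmat \<Rightarrow> fmat" where
  "S k a = em (star_maps A \<alpha> k (me (msize (A k)) a))"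

definition SS :: "nat \<Rightarrow> nat \<Rightarrow> fmat \<Rightarrow> fmat" where
  "SS k n = sys_map S k n"

lemma N [simp]: "is_nest (A k)"
  using sys by (simp add: order_preserving_system_def)

lemma ext: "matrix_star_hom (msize (A k)) (msize (A (Suc k))) (star_maps A \<alpha> k)"
  "a \<in> nest_alg (A k) \<Longrightarrow> star_maps A \<alpha> k a = \<alpha> k a"
proof -
  have "\<exists>\<psi>. extends_to (A k) (A (Suc k)) (\<alpha> k) \<psi>"
    using sys by (simp add: order_preserving_system_def star_extendible_embedding_def)
  then have "extends_to (A k) (A (Suc k)) (\<alpha> k) (star_maps A \<alpha> k)"
    unfolding star_maps_def star_extension_def by (rule someI_ex)
  then show "matrix_star_hom (msize (A k)) (msize (A (Suc k))) (star_maps A \<alpha> k)"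
    "a \<in> nest_alg (A k) \<Longrightarrow> star_maps A \<alpha> k a = \<alpha> k a" by (auto simp: extends_to_def)
qed

lemma alpha_in: "a \<in> nest_alg (A k) \<Longrightarrow> \<alpha> k a \<in> nest_alg (A (Suc k))"
  using sys by (auto simp: order_preserving_system_def star_extendible_embedding_def)

lemma nest_alg_full: "a \<in> nest_alg (A k) \<Longrightarrow> a \<in> full (A k)"
  by (simp add: nest_alg_def)

lemma em_star: "a \<in> full (A k) \<Longrightarrow> em (star_maps A \<alpha> k a) = S k (em a)"
  by (simp add: S_def)

lemma star_full: "a \<in> full (A k) \<Longrightarrow> star_maps A \<alpha> k a \<in> full (A (Suc k))"
  using ext(1)[of k] by (simp add: matrix_star_hom_def)

lemma em_alpha: "a \<in> nest_alg (A k) \<Longrightarrow> em (\<alpha> k a) = S k (em a)"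
  using em_star nest_alg_full ext(2) by metis

lemma S_SH: "SH (A k) (A (Suc k)) (S k)"
proof -
  define n where "n = msize (A k)"
  define m where "m = msize (A (Suc k))"
  define p where "p = star_maps A \<alpha> k"
  have h: "\<And>a. a \<in> carrier_mat n n \<Longrightarrow> p a \<in> carrier_mat m m"
    "\<And>a b. a \<in> carrier_mat n n \<Longrightarrow> b \<in> carrier_mat n n \<Longrightarrow> p (a + b) = p a + p b"
    "\<And>a b. a \<in> carrier_mat n n \<Longrightarrow> b \<in> carrier_mat n n \<Longrightarrow> p (a * b) = p a * p b"
    "\<And>a c. a \<in> carrier_mat n n \<Longrightarrow> p (c \<cdot>\<^sub>m a) = c \<cdot>\<^sub>m p a"
    "\<And>a. a \<in> carrier_mat n n \<Longrightarrow> p (mat_adjoint a) = mat_adjoint (p a)"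
    using ext(1)[of k] unfolding matrix_star_hom_def n_def m_def p_def by blast+
  have ema: "em (me n a) = a" if "a \<in> FM (A k)" for a using FM_me[OF that] by (simp add: n_def)
  have me: "me n (a + b) = me n a + me n b" "me n (a * b) = me n a * me n b"
    "me n (adj a) = mat_adjoint (me n a)" "me n (c \<odot> a) = c \<cdot>\<^sub>m me n a" if "a \<in> FM (A k)" "b \<in> FM (A k)" for a b c
  proof -
    show "me n (a + b) = me n a + me n b"
      by (rule em_inj[of _ n n]) (use that in \<open>auto simp: ema em_add[of _ n n]\<close>)
    show "me n (a * b) = me n a * me n b"
      by (rule em_inj[of _ n n, OF me_carrier mult_carrier_mat[OF me_carrier me_carrier]])
        (use that in \<open>simp add: ema em_mult[OF me_carrier me_carrier]\<close>)
    show "me n (adj a) = mat_adjoint (me n a)"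
      by (rule em_inj[of _ n n]) (use that in \<open>auto simp: ema em_adj\<close>)
    show "me n (c \<odot> a) = c \<cdot>\<^sub>m me n a"
      by (rule em_inj[of _ n n]) (use that in \<open>auto simp: ema em_smult\<close>)
  qed
  have FMp: "S k a \<in> FM (A (Suc k))" for a using h(1) by (simp add: S_def FM_def em_bnd n_def m_def p_def)
  have Sd: "S k a = em (p (me n a))" for a by (simp add: S_def p_def n_def)
  have "S k a \<in> NA (A (Suc k))" if "a \<in> NA (A k)" for a
  proof -
    have "me n a \<in> nest_alg (A k)" using me_nest_alg[OF N that] by (simp add: n_def)
    then have "p (me n a) \<in> nest_alg (A (Suc k))" using ext(2) alpha_in by (simp add: p_def)
    then show ?thesis using nest_alg_em[OF N] Sd by blast
  qed
  then show ?thesis unfolding SH_def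
    using h me FMp by (auto simp: Sd em_add[of _ m m] em_mult[of _ m m _ m] em_smult em_adj)
qed

lemma S_OPS: "v \<in> OPS (A k) \<Longrightarrow> S k v \<in> OPS (A (Suc k))"
proof -
  assume v: "v \<in> OPS (A k)"
  have F: "v \<in> FM (A k)" using v OPS_RG RG_FM by blast
  define w where "w = me (msize (A k)) v"
  have w: "w \<in> full (A k)" "em w = v" using F by (auto simp: w_def FM_me)
  then have "w \<in> Pisom_op (A k)" using Pisom_op_iff[OF N w(1)] v by simp
  moreover have "\<alpha> k ` Pisom_op (A k) \<subseteq> Pisom_op (A (Suc k))"
    using sys by (simp add: order_preserving_system_def order_preserving_def)
  ultimately have aw: "\<alpha> k w \<in> Pisom_op (A (Suc k))" by blast
  moreover have "w \<in> nest_alg (A k)" using \<open>w \<in> Pisom_op (A k)\<close> by (simp add: Pisom_op_def Pisom_reg_def)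
  ultimately show ?thesis using Pisom_op_iff[OF N Pisom_op_full[OF N aw]] em_alpha w by simp
qed

text \<open>Injectivity of the embedding, evaluated at the unit. Since full matrix algebras are
  simple, this yields injectivity on the whole algebra and even a lower bound for norms
  (\<open>SH_ent_le\<close>).\<close>

lemma S_inj: "S k (uno (A k)) \<noteq> 0"
proof
  assume *: "S k (uno (A k)) = 0"
  have inj: "inj_on (\<alpha> k) (nest_alg (A k))"
    using sys by (simp add: order_preserving_system_def star_extendible_embedding_def)
  define u where "u = me (msize (A k)) (uno (A k))"
  define z where "z = me (msize (A k)) 0"
  have uz: "u \<in> nest_alg (A k)" "z \<in> nest_alg (A k)"
    unfolding u_def z_def by (intro me_nest_alg[OF N] NA_closed(3) DA_NA uno_DA[OF N])+
  have e: "em u = uno (A k)" "em z = 0" by (simp_all add: u_def z_def FM_me)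
  have "em (\<alpha> k u) = em (\<alpha> k z)" using em_alpha uz e * SHD(7)[OF S_SH] by simp
  then have "\<alpha> k u = \<alpha> k z" using em_inj nest_alg_full alpha_in uz by metis
  then have "u = z" using inj uz by (simp add: inj_on_eq_iff)
  then have "uno (A k) = 0" using e by metis
  then show False using tr_un[of "msize (A k)"] msize_pos[OF N, of k] by simp
qed

lemma SS_self [simp]: "SS k k a = a" by (simp add: SS_def)
lemma SS_Suc: "k \<le> n \<Longrightarrow> SS k (Suc n) a = S n (SS k n a)" by (simp add: SS_def sys_map_Suc)
lemma SS_comp: "k \<le> m \<Longrightarrow> m \<le> n \<Longrightarrow> SS m n (SS k m a) = SS k n a" by (simp add: SS_def sys_map_comp)
lemma SS_one: "SS k (Suc k) a = S k a" by (simp add: SS_Suc)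

lemma SS_SH: "k \<le> n \<Longrightarrow> SH (A k) (A n) (SS k n)"
proof (induction n rule: dec_induct)
  case base
  then show ?case using SH_cong[OF SH_id] by (simp add: SH_cong[OF SH_id])
next
  case (step n)
  have "SS k (Suc n) = S n \<circ> SS k n" using step by (auto simp: SS_Suc)
  then show ?case using SH_comp[OF step.IH S_SH] by (simp only:)
qed

lemma SS_FM: "k \<le> n \<Longrightarrow> a \<in> FM (A k) \<Longrightarrow> SS k n a \<in> FM (A n)"
  by (rule SHD(1)[OF SS_SH])

lemma SS_OPS: "k \<le> n \<Longrightarrow> v \<in> OPS (A k) \<Longrightarrow> SS k n v \<in> OPS (A n)"
  by (induction n rule: dec_induct) (auto simp: SS_Suc S_OPS)

lemma SS_OM: "k \<le> n \<Longrightarrow> OM (A k) (A n) (SS k n)"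
  unfolding OM_def using SS_SH SS_OPS blk_OPS[OF N] mi_pim by blast

lemmas SS_RM = OM_RM[OF SS_OM]

lemma em_sys_alpha: "k \<le> n \<Longrightarrow> a \<in> nest_alg (A k) \<Longrightarrow> sys_map \<alpha> k n a \<in> nest_alg (A n) \<and> em (sys_map \<alpha> k n a) = SS k n (em a)"
  by (induction n rule: dec_induct) (auto simp: SS_Suc sys_map_Suc alpha_in em_alpha)

lemma em_sys_star: "k \<le> n \<Longrightarrow> a \<in> full (A k) \<Longrightarrow> sys_map (star_maps A \<alpha>) k n a \<in> full (A n) \<and> em (sys_map (star_maps A \<alpha>) k n a) = SS k n (em a)"
  by (induction n rule: dec_induct) (auto simp: SS_Suc sys_map_Suc star_full em_star)

lemma Gsets_upm: "Gsets A k = upm (A k)"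
  by (simp add: Gsets_def dist_group_simps)

lemma Gmaps_pH: "Gmaps A \<alpha> k X = pH (A k) (A (Suc k)) (S k) X"
  unfolding Gmaps_def by (rule induced_hom_pH[OF N]) (auto simp: em_alpha alpha_in nest_alg_full)

lemma S_RM: "RM (A k) (A (Suc k)) (S k)"
  using RM_cong[OF N SS_RM[of k "Suc k"], of "S k"] by (simp add: SS_one)

lemma sys_Gmaps: "k \<le> n \<Longrightarrow> X \<in> upm (A k) \<Longrightarrow> sys_map (Gmaps A \<alpha>) k n X = pH (A k) (A n) (SS k n) X"
proof (induction n rule: dec_induct)
  case base
  have "pH (A k) (A k) (SS k k) X = pH (A k) (A k) id X" by (rule pH_cong) simp
  then show ?case unfolding sys_map_self using pH_id[OF N base] by (simp only:)
next
  case (step n)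
  have e: "SS k (Suc n) = S n \<circ> SS k n" using step by (auto simp: SS_Suc)
  show ?case
    unfolding sys_map_Suc[OF step.hyps(1)] step.IH[OF step.prems]
    unfolding e Gmaps_pH by (rule pH_comp[OF N N N SS_RM[OF step.hyps(1)] S_RM])
qed

sublocale G: dsys "Gsets A" "Gmaps A \<alpha>"
  by unfold_locales (simp add: Gsets_upm Gmaps_pH pH_upm[OF N N S_RM])

sublocale L: dsys "\<lambda>k. nest_alg (A k)" \<alpha>
  by unfold_locales (rule alpha_in)

abbreviation gc :: "nat \<Rightarrow> int mat \<Rightarrow> (nat \<times> int mat) set" where
  "gc \<equiv> dlim_in (Gsets A) (Gmaps A \<alpha>)"

abbreviation "Grp \<equiv> lim_group A \<alpha>"
abbreviation "Alg \<equiv> lim_alg A \<alpha>"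
abbreviation "Cst \<equiv> lim_cstar A \<alpha>"

abbreviation lc :: "nat \<Rightarrow> complex mat \<Rightarrow> (nat \<times> complex mat) set" where
  "lc \<equiv> dlim_in (\<lambda>k. nest_alg (A k)) \<alpha>"

lemma gc_shift: "X \<in> upm (A k) \<Longrightarrow> k \<le> n \<Longrightarrow> gc n (pH (A k) (A n) (SS k n) X) = gc k X"
  using G.cls_shift[of X k n] by (simp add: Gsets_upm sys_Gmaps)

lemma gc_in: "X \<in> upm (A k) \<Longrightarrow> gc k X \<in> carrier Grp"
  using G.cls_in[of X k] by (simp add: Gsets_upm lim_group_def)

lemma gc_cases:
  assumes "x \<in> carrier Grp" obtains k X where "X \<in> upm (A k)" "x = gc k X"
  using assms that G.dlim_cases[of x thesis] by (auto simp: Gsets_upm lim_group_def)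

lemma gc_eq_eventually:
  assumes "X \<in> upm (A k)" "Y \<in> upm (A k)" "gc k X = gc k Y"
  shows "\<exists>n0\<ge>k. \<forall>n\<ge>n0. pH (A k) (A n) (SS k n) X = pH (A k) (A n) (SS k n) Y"
  using G.cls_same_eventually[of X k Y] assms sys_Gmaps by (auto simp: Gsets_upm)

lemma gc_add: "X \<in> upm (A k) \<Longrightarrow> Y \<in> upm (A k) \<Longrightarrow> gc k X \<otimes>\<^bsub>Grp\<^esub> gc k Y = gc k (X + Y)"
  unfolding lim_group_def monoid.simps
  by (rule G.dlim_map2_cls) (auto simp: Gsets_upm upm_closed Gmaps_pH pH_add[OF N N S_RM])

lemma gc_pi_f: "X \<in> upm (A k) \<Longrightarrow> lim_pi_f A \<alpha> (gc k X) = gc k (pi_f (A k) X)"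
  unfolding lim_pi_f_def
  by (rule G.dlim_map_cls) (auto simp: Gsets_upm pi_upm[OF N] Gmaps_pH pH_pi_f[OF N N S_RM])

lemma gc_pi_i: "X \<in> upm (A k) \<Longrightarrow> lim_pi_i A \<alpha> (gc k X) = gc k (pi_i (A k) X)"
  unfolding lim_pi_i_def
  by (rule G.dlim_map_cls) (auto simp: Gsets_upm pi_upm[OF N] Gmaps_pH pH_pi_i[OF N N S_RM])

lemma pH_zero: "is_nest B \<Longrightarrow> is_nest C \<Longrightarrow> RM B C \<psi> \<Longrightarrow> pH B C \<psi> (0\<^sub>m (natoms B) (natoms B)) = 0\<^sub>m (natoms C) (natoms C)"
  by (rule upm_eqI[OF pH_upm upm_closed(3)]) (auto simp: pH_cH cH_def)

lemma gc_zero: "gc k (0\<^sub>m (natoms (A k)) (natoms (A k))) = \<one>\<^bsub>Grp\<^esub>"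
  using gc_shift[of "0\<^sub>m (natoms (A 0)) (natoms (A 0))" 0 k] pH_zero[OF N N SS_RM[of 0 k]]
  by (simp add: upm_closed lim_group_def)

lemma upm_minus: "X \<in> upm B \<Longrightarrow> - X + X = 0\<^sub>m (natoms B) (natoms B)"
proof -
  assume "X \<in> upm B"
  then have "X \<in> carrier_mat (natoms B) (natoms B)" by (simp add: upm_def)
  then show ?thesis by (intro eq_matI) auto
qed

lemma carrier_lim: "carrier Grp = dlim (Gsets A) (Gmaps A \<alpha>)" by (simp add: lim_group_def)

lemma lim_comm_group: "comm_group Grp"
proof (rule comm_groupI)
  fix x y assume xy: "x \<in> carrier Grp" "y \<in> carrier Grp"
  obtain k a b where k: "a \<in> upm (A k)" "b \<in> upm (A k)" "x = gc k a" "y = gc k b"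
    using G.common2[of x y] xy by (auto simp: Gsets_upm carrier_lim)
  show "x \<otimes>\<^bsub>Grp\<^esub> y \<in> carrier Grp" using k by (simp add: gc_add gc_in upm_closed)
  have "a + b = b + a" using k by (auto simp: upm_def intro: comm_add_mat)
  then show "x \<otimes>\<^bsub>Grp\<^esub> y = y \<otimes>\<^bsub>Grp\<^esub> x" using k by (simp add: gc_add)
  show "\<one>\<^bsub>Grp\<^esub> \<otimes>\<^bsub>Grp\<^esub> x = x"
    unfolding gc_zero[of k, symmetric] using k by (simp add: gc_add upm_closed) (simp add: upm_def)
  show "\<exists>z\<in>carrier Grp. z \<otimes>\<^bsub>Grp\<^esub> x = \<one>\<^bsub>Grp\<^esub>"
    unfolding gc_zero[of k, symmetric] using k
    by (intro bexI[of _ "gc k (- a)"]) (auto simp: gc_add gc_in upm_closed upm_minus)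
next
  fix x y z assume xy: "x \<in> carrier Grp" "y \<in> carrier Grp" "z \<in> carrier Grp"
  obtain k a b c where k: "a \<in> upm (A k)" "b \<in> upm (A k)" "c \<in> upm (A k)" "x = gc k a" "y = gc k b" "z = gc k c"
    using G.common3[of x y z] xy by (auto simp: Gsets_upm carrier_lim)
  have "a + b + c = a + (b + c)" using k by (auto simp: upm_def intro: assoc_add_mat)
  then show "x \<otimes>\<^bsub>Grp\<^esub> y \<otimes>\<^bsub>Grp\<^esub> z = x \<otimes>\<^bsub>Grp\<^esub> (y \<otimes>\<^bsub>Grp\<^esub> z)"
    using k by (simp add: gc_add upm_closed)
next
  show "\<one>\<^bsub>Grp\<^esub> \<in> carrier Grp"
    unfolding gc_zero[of 0, symmetric] by (rule gc_in) (rule upm_closed)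
qed

lemma lim_Sigma_eq: "lim_Sigma A \<alpha> = {gc k (pcl (A k) v) |k v. v \<in> RG (A k)}"
  by (auto simp: lim_Sigma_def lim_union_def Sigma_reg_pcl)

lemma lim_Sigma_0_eq: "lim_Sigma_0 A \<alpha> = {gc k (pcl (A k) p) |k p. p \<in> NA (A k) \<and> pj p}"
  by (auto simp: lim_Sigma_0_def lim_union_def Sigma_0_pcl)

lemma lim_Sigma_op_eq: "lim_Sigma_op A \<alpha> = {gc k (pcl (A k) v) |k v. v \<in> RG (A k) \<and> (\<forall>n>k. SS k n v \<in> OPS (A n))}"
proof -
  have *: "{v \<in> Pisom_reg (A k). \<forall>n>k. pclass (A n) (sys_map \<alpha> k n v) \<in> Sigma_op (A n)} =
     me (msize (A k)) ` {v \<in> RG (A k). \<forall>n>k. SS k n v \<in> OPS (A n)}" for k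
  proof -
    have i: "pclass (A n) (sys_map \<alpha> k n v) \<in> Sigma_op (A n) \<longleftrightarrow> SS k n (em v) \<in> OPS (A n)"
      if v: "v \<in> Pisom_reg (A k)" and n: "k < n" for v n
    proof -
      have vn: "v \<in> nest_alg (A k)" using v by (simp add: Pisom_reg_def)
      have vR: "em v \<in> RG (A k)" using Pisom_reg_iff[OF N nest_alg_full[OF vn]] v by simp
      have "sys_map \<alpha> k n v = me (msize (A n)) (SS k n (em v))"
        using em_sys_alpha[OF _ vn, of n] n nest_alg_full by (metis less_imp_le me_em)
      then have e: "pclass (A n) (sys_map \<alpha> k n v) = pcl (A n) (SS k n (em v))" by (simp add: pcl_def)
      show ?thesis unfolding e
        using pcl_op_imp[OF N RM_RG[OF N N SS_RM vR]] n by (auto simp: Sigma_op_pcl)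
    qed
    show ?thesis
    proof (rule equalityI; rule subsetI)
      fix v assume v: "v \<in> {v \<in> Pisom_reg (A k). \<forall>n>k. pclass (A n) (sys_map \<alpha> k n v) \<in> Sigma_op (A n)}"
      then have f: "v \<in> full (A k)" using Pisom_reg_full[OF N] by blast
      have "em v \<in> {v \<in> RG (A k). \<forall>n>k. SS k n v \<in> OPS (A n)}" using v i Pisom_reg_iff[OF N f] by auto
      then have "me (msize (A k)) (em v) \<in> me (msize (A k)) ` {v \<in> RG (A k). \<forall>n>k. SS k n v \<in> OPS (A n)}" by (rule imageI)
      then show "v \<in> me (msize (A k)) ` {v \<in> RG (A k). \<forall>n>k. SS k n v \<in> OPS (A n)}" using f by simp
    next
      fix v assume "v \<in> me (msize (A k)) ` {v \<in> RG (A k). \<forall>n>k. SS k n v \<in> OPS (A n)}"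
      then obtain w where w: "w \<in> RG (A k)" "\<forall>n>k. SS k n w \<in> OPS (A n)" "v = me (msize (A k)) w" by auto
      have f: "em v = w" "v \<in> full (A k)" using w RG_FM by (simp_all add: FM_me)
      then have "v \<in> Pisom_reg (A k)" using Pisom_reg_iff[OF N f(2)] w by simp
      then show "v \<in> {v \<in> Pisom_reg (A k). \<forall>n>k. pclass (A n) (sys_map \<alpha> k n v) \<in> Sigma_op (A n)}"
        using i w f by simp
    qed
  qed
  show ?thesis unfolding lim_Sigma_op_def lim_union_def * by (auto simp: pcl_def)
qed

end

section \<open>Intertwined systems\<close>

text \<open>The maps are indexed by all levels instead of a subsequence, with level functions
  \<open>\<mu>\<close> and \<open>\<nu>\<close>. Strict growth of the round trips matters since
  \<open>lim_Sigma_op\<close> only speaks about levels strictly above the given one.\<close>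

definition twine :: "(nat \<Rightarrow> nest) \<Rightarrow> (nat \<Rightarrow> complex mat \<Rightarrow> complex mat) \<Rightarrow> (nat \<Rightarrow> nest) \<Rightarrow> (nat \<Rightarrow> complex mat \<Rightarrow> complex mat)
    \<Rightarrow> (nat \<Rightarrow> nat) \<Rightarrow> (nat \<Rightarrow> nat) \<Rightarrow> (nat \<Rightarrow> fmat \<Rightarrow> fmat) \<Rightarrow> (nat \<Rightarrow> fmat \<Rightarrow> fmat) \<Rightarrow> bool" where
  "twine A \<alpha> A' \<alpha>' \<mu> \<nu> \<theta> \<eta> \<longleftrightarrow> mono \<mu> \<and> mono \<nu> \<and> (\<forall>k. k < \<nu> (\<mu> k)) \<and> (\<forall>m. m < \<mu> (\<nu> m))
    \<and> (\<forall>k. SH (A k) (A' (\<mu> k)) (\<theta> k)) \<and> (\<forall>m. SH (A' m) (A (\<nu> m)) (\<eta> m))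
    \<and> (\<forall>k. \<forall>a\<in>FM (A k). osys.SS A' \<alpha>' (\<mu> k) (\<mu> (Suc k)) (\<theta> k a) = \<theta> (Suc k) (osys.S A \<alpha> k a))
    \<and> (\<forall>m. \<forall>b\<in>FM (A' m). osys.SS A \<alpha> (\<nu> m) (\<nu> (Suc m)) (\<eta> m b) = \<eta> (Suc m) (osys.S A' \<alpha>' m b))
    \<and> (\<forall>k. \<forall>a\<in>FM (A k). \<eta> (\<mu> k) (\<theta> k a) = osys.SS A \<alpha> k (\<nu> (\<mu> k)) a)
    \<and> (\<forall>m. \<forall>b\<in>FM (A' m). \<theta> (\<nu> m) (\<eta> m b) = osys.SS A' \<alpha>' m (\<mu> (\<nu> m)) b)"

lemma twine_sym: "twine A \<alpha> A' \<alpha>' \<mu> \<nu> \<theta> \<eta> \<Longrightarrow> twine A' \<alpha>' A \<alpha> \<nu> \<mu> \<eta> \<theta>"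
  unfolding twine_def by blast

text \<open>For atoms \<open>p\<close> and \<open>q\<close> the block \<open>p * W * q\<close> is a
  partial isometry as soon as \<open>p\<close> commutes with \<open>W * adj W\<close> and
  \<open>q\<close> with \<open>adj W * p * W\<close>. Thus regularity becomes a statement about
  normalising the diagonal, which can be moved between the systems.\<close>

lemma normal_PR:
  assumes N: "is_nest B" and W: "W \<in> FM B" "pim W" "W * adj W \<in> DA B" "\<And>s. s < natoms B \<Longrightarrow> adj W * atm B s * W \<in> DA B"
  shows "W \<in> PR B"
proof -
  have "pim (atm B s * W * atm B t)" if st: "s < natoms B" "t < natoms B" for s t
  proof -
    define p where "p = atm B s"
    define q where "q = atm B t"
    have pq: "adj p = p" "adj q = q" "p * p = p" "q * q = q" using st by (simp_all add: p_def q_def at_adj[OF N] at_self[OF N])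
    have c1: "q * (adj W * p * W) = adj W * p * W * q" using DA_comm[OF N W(4)[OF st(1)] st(2)] by (simp add: p_def q_def)
    have c2: "p * (W * adj W) = W * adj W * p" using DA_comm[OF N W(3) st(1)] by (simp add: p_def)
    have "p * W * q * adj (p * W * q) * (p * W * q) = p * W * ((q * q) * (adj W * (p * p) * W)) * q" by (simp add: mult.assoc pq(1,2))
    also have "\<dots> = p * W * (adj W * p * W * q) * q" by (simp only: pq c1)
    also have "\<dots> = p * (W * adj W * p) * W * (q * q)" by (simp add: mult.assoc)
    also have "\<dots> = (p * p) * (W * adj W * W) * (q * q)" unfolding c2[symmetric] by (simp only: mult.assoc)
    also have "\<dots> = p * W * q" using W(2) by (simp add: pq pim_def)
    finally show ?thesis by (simp add: pim_def p_def q_def)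
  qed
  then show ?thesis using W by (simp add: PR_def)
qed

lemma le_sum2:
  fixes f :: "'a \<Rightarrow> 'b \<Rightarrow> nat"
  shows "finite X \<Longrightarrow> finite Y \<Longrightarrow> x \<in> X \<Longrightarrow> y \<in> Y \<Longrightarrow> f x y \<le> (\<Sum>x\<in>X. \<Sum>y\<in>Y. f x y)"
  by (rule order_trans[OF member_le_sum[of y Y "f x"] member_le_sum[of x X "\<lambda>x. \<Sum>y\<in>Y. f x y"]]) auto

context osys
begin

lemma SS_DA: "k \<le> n \<Longrightarrow> x \<in> DA (A k) \<Longrightarrow> SS k n x \<in> DA (A n)"
  by (rule SH_DA[OF N N SS_SH])

text \<open>Cutting by diagonal matrix units, which stay block diagonal, shows that an element can
  become block diagonal only if every matrix unit in its expansion does. So there are only finitely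
  many events to wait for.\<close>

lemma DA_stabilises:
  "\<exists>n0\<ge>m. \<forall>n\<ge>n0. \<forall>x\<in>FM (A m). (\<exists>n'\<ge>m. SS m n' x \<in> DA (A n')) \<longrightarrow> SS m n x \<in> DA (A n)"
proof -
  obtain X e where X: "unit_sys (A m) X e" using unit_sys_ex[OF N] by blast
  note u = unit_sysD[OF N X]
  \<comment> \<open>One level per matrix unit; if the unit never becomes block diagonal, any level
    from \<open>m\<close> on will do.\<close>
  have "\<exists>n0\<ge>m. (\<exists>n'\<ge>m. SS m n' (e x y) \<in> DA (A n')) \<longrightarrow> SS m n0 (e x y) \<in> DA (A n0)" for x y by blast
  then obtain n1 where n1: "\<And>x y. n1 x y \<ge> m"
    "\<And>x y. (\<exists>n'\<ge>m. SS m n' (e x y) \<in> DA (A n')) \<Longrightarrow> SS m (n1 x y) (e x y) \<in> DA (A (n1 x y))" by metis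
  define n0 where "n0 = m + (\<Sum>x\<in>X. \<Sum>y\<in>X. n1 x y)"
  have le: "n1 x y \<le> n0" if "x \<in> X" "y \<in> X" for x y
    using le_sum2[OF u(1,1) that, of n1] by (simp add: n0_def)
  have "SS m n x \<in> DA (A n)" if n: "n \<ge> n0" and x: "x \<in> FM (A m)" and n': "n' \<ge> m" "SS m n' x \<in> DA (A n')" for n x n'
  proof -
    have mn: "m \<le> n" using n by (simp add: n0_def)
    note S = SHD[OF SS_SH[OF mn]] SHD[OF SS_SH[OF n'(1)]]
    have ed: "e y y \<in> DA (A m)" if "y \<in> X" for y using blk_DA[OF N u(6)[OF that that]] .
    note c = unit_sys_cut[OF N X, symmetric]
    have "tr (x * e w v) \<odot> SS m n (e v w) \<in> DA (A n)" if vw: "v \<in> X" "w \<in> X" for v w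
    proof (cases "tr (x * e w v) = 0")
      case False
      have "SS m n' (tr (x * e w v) \<odot> e v w) \<in> DA (A n')" unfolding c[OF vw]
        using S(11) u(9) x n'(2) vw by (simp add: DA_mult[OF N] SS_DA[OF n'(1) ed])
      then have "(1 / tr (x * e w v)) \<odot> SS m n' (tr (x * e w v) \<odot> e v w) \<in> DA (A n')" by (rule DA_closed)
      then have "SS m n' (e v w) \<in> DA (A n')" using False S(12) u(9) vw by simp
      then have "SS m (n1 v w) (e v w) \<in> DA (A (n1 v w))" using n1(2) n'(1) by blast
      then have "SS (n1 v w) n (SS m (n1 v w) (e v w)) \<in> DA (A n)" using le[OF vw] n by (rule_tac SS_DA) auto
      then have "SS m n (e v w) \<in> DA (A n)" using le[OF vw] n n1(1)[of v w] by (simp add: SS_comp)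
      then show ?thesis by (rule DA_closed)
    qed (simp add: DA_closed)
    moreover have "SS m n x = (\<Sum>v\<in>X. \<Sum>w\<in>X. tr (x * e w v) \<odot> SS m n (e v w))"
      by (subst unit_sys_expand[OF N X x]) (simp add: SH_sum[OF SS_SH[OF mn]] S u)
    ultimately show ?thesis by (simp add: DA_sum)
  qed
  then show ?thesis by (intro exI[of _ n0]) (auto simp: n0_def)
qed

text \<open>The atoms of a later level act on the image of an earlier one through block diagonal
  elements of its commutant; this uses only that matrix units go to order preserving elements.\<close>

lemma atom_splits:
  assumes mn: "m \<le> n" and s: "s < natoms (A n)" and i: "i < natoms (A m)"
  shows "\<exists>z\<in>DA (A n). atm (A n) s * SS m n (atm (A m) i) = z * SS m n (atm (A m) i) \<and> (\<forall>a\<in>FM (A m). z * SS m n a = SS m n a * z)"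
proof -
  obtain X e where X: "unit_sys (A m) X e" using unit_sys_ex[OF N] by blast
  note u = unit_sysD[OF N X]
  note S = SHD[OF SS_SH[OF mn]]
  define g where "g x y = SS m n (e x y)" for x y
  have gg: "g x y * g z w = (if y = z then g x w else 0)" if "x \<in> X" "y \<in> X" "z \<in> X" "w \<in> X" for x y z w
    using S(3)[of "e x y" "e z w"] u(3)[OF that] u(9) S(7) that by (auto simp: g_def)
  have gg': "g x y * (g z w * b) = (if y = z then g x w * b else 0)" if "x \<in> X" "y \<in> X" "z \<in> X" "w \<in> X" for x y z w b
    using gg[OF that] by (metis mult.assoc mult_zero_left)
  have ga: "adj (g x y) = g y x" if "x \<in> X" "y \<in> X" for x y
    using S(5)[of "e x y"] u(4,9) that by (simp add: g_def)
  \<comment> \<open>Of a matrix unit and its adjoint at least one is upper triangular and has an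
    order preserving image; \<open>OPS_normal\<close> covers both positions.\<close>
  have nrm: "g x y * d * g y x \<in> DA (A n)" if xy: "x \<in> X" "y \<in> X" and d: "d \<in> DA (A n)" for x y d
  proof (cases "fst x \<le> fst y")
    case True
    have "g x y \<in> OPS (A n)" unfolding g_def
      by (rule SS_OPS[OF mn blk_OPS[OF N mi_pim[OF u(5)[OF xy]] u(6)[OF xy] True]])
    from OPS_normal(1)[OF N this d] show ?thesis using ga xy by simp
  next
    case False
    have "g y x \<in> OPS (A n)" unfolding g_def using False
      by (intro SS_OPS[OF mn blk_OPS[OF N mi_pim[OF u(5)[OF xy(2,1)]] u(6)[OF xy(2,1)]]]) auto
    from OPS_normal(2)[OF N this d] show ?thesis using ga xy by simp
  qed
  obtain x0 where x0: "x0 \<in> X" "fst x0 = i" using u(2)[OF i] by blast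
  define p where "p = atm (A n) s"
  \<comment> \<open>The corner of \<open>p\<close> at \<open>x0\<close> is copied to every diagonal
    position, so that \<open>z\<close> commutes with all the \<open>g a b\<close>.\<close>
  define z where "z = (\<Sum>x\<in>X. g x x0 * p * g x0 x)"
  have zD: "z \<in> DA (A n)" unfolding z_def p_def by (intro DA_sum nrm x0 at_DA[OF N s])
  have zl: "z * g a b = g a x0 * p * g x0 b" if "a \<in> X" "b \<in> X" for a b
  proof -
    have "z * g a b = (\<Sum>x\<in>X. if x = a then g a x0 * p * g x0 b else 0)"
      unfolding z_def sum_distrib_right using that x0 by (intro sum.cong refl) (auto simp: mult.assoc gg)
    then show ?thesis using u(1) that by (simp add: sum.delta)
  qed
  have zr: "g a b * z = g a x0 * p * g x0 b" if "a \<in> X" "b \<in> X" for a b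
  proof -
    have "g a b * z = (\<Sum>x\<in>X. if x = b then g a x0 * p * g x0 b else 0)"
      unfolding z_def sum_distrib_left using that x0 by (intro sum.cong refl) (auto simp: mult.assoc gg')
    then show ?thesis using u(1) that by (simp add: sum.delta)
  qed
  have zc: "z * SS m n a = SS m n a * z" if a: "a \<in> FM (A m)" for a
  proof -
    have e: "SS m n a = (\<Sum>x\<in>X. \<Sum>y\<in>X. tr (a * e y x) \<odot> g x y)"
      by (subst unit_sys_expand[OF N X a]) (simp add: SH_sum[OF SS_SH[OF mn]] S u g_def)
    show ?thesis unfolding e sum_distrib_left sum_distrib_right
      by (intro sum.cong refl) (simp add: zl zr)
  qed
  \<comment> \<open>Over atom \<open>i\<close> the units \<open>g y x0\<close> are block diagonal
    and commute with \<open>p\<close>; there the copies agree with \<open>p\<close> itself.\<close>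
  have zp: "z * g y y = p * g y y" if y: "y \<in> X" "fst y = i" for y
  proof -
    have "e y x0 \<in> DA (A m)" using u(6)[OF y(1) x0(1)] x0 y blk_DA[OF N] by simp
    then have "g y x0 \<in> DA (A n)" unfolding g_def by (rule SS_DA[OF mn])
    then have "p * g y x0 = g y x0 * p" using DA_comm[OF N _ s] by (simp add: p_def)
    then have "z * g y y = p * (g y x0 * g x0 y)" using zl[OF y(1) y(1)] by (simp flip: mult.assoc)
    then show ?thesis using gg x0 y by simp
  qed
  have "atm (A m) i = (\<Sum>x\<in>X. atm (A m) i * e x x)"
    using u(7) i by (metis FM_uno(2) N at_FM sum_distrib_left)
  also have "\<dots> = (\<Sum>x\<in>X. if fst x = i then e x x else 0)"
  proof (intro sum.cong refl)
    fix x assume x: "x \<in> X"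
    show "atm (A m) i * e x x = (if fst x = i then e x x else 0)"
      using blk_at(1)[OF N u(6)[OF x x] i i] by auto
  qed
  finally have "SS m n (atm (A m) i) = SS m n (\<Sum>x\<in>X. if fst x = i then e x x else 0)" by simp
  also have "\<dots> = (\<Sum>x\<in>X. SS m n (if fst x = i then e x x else 0))"
    by (rule SH_sum[OF SS_SH[OF mn]]) (simp add: u)
  also have "\<dots> = (\<Sum>x\<in>X. if fst x = i then g x x else 0)"
    by (intro sum.cong refl) (simp add: g_def S)
  finally have q: "SS m n (atm (A m) i) = (\<Sum>x\<in>X. if fst x = i then g x x else 0)" .
  have "p * SS m n (atm (A m) i) = z * SS m n (atm (A m) i)"
    unfolding q sum_distrib_left by (intro sum.cong refl) (simp add: zp)
  then show ?thesis using zD zc unfolding p_def by blast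
qed

end

locale twin = X: osys A \<alpha> + Y: osys A' \<alpha>'
  for A \<alpha> A' \<alpha>' +
  fixes \<mu> \<nu> :: "nat \<Rightarrow> nat" and \<theta> \<eta> :: "nat \<Rightarrow> fmat \<Rightarrow> fmat"
  assumes tw: "twine A \<alpha> A' \<alpha>' \<mu> \<nu> \<theta> \<eta>"
begin

lemma mono_mu: "k \<le> n \<Longrightarrow> \<mu> k \<le> \<mu> n" and mono_nu: "k \<le> n \<Longrightarrow> \<nu> k \<le> \<nu> n"
  using tw by (auto simp: twine_def mono_def)

lemma grow: "k < \<nu> (\<mu> k)" "m < \<mu> (\<nu> m)"
  using tw by (auto simp: twine_def)

lemma theta_SH: "SH (A k) (A' (\<mu> k)) (\<theta> k)" and eta_SH: "SH (A' m) (A (\<nu> m)) (\<eta> m)"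
  using tw by (auto simp: twine_def)

lemma eta_theta: "a \<in> FM (A k) \<Longrightarrow> \<eta> (\<mu> k) (\<theta> k a) = X.SS k (\<nu> (\<mu> k)) a"
  and theta_eta: "b \<in> FM (A' m) \<Longrightarrow> \<theta> (\<nu> m) (\<eta> m b) = Y.SS m (\<mu> (\<nu> m)) b"
  using tw by (auto simp: twine_def)

lemma theta_nat: "k \<le> n \<Longrightarrow> a \<in> FM (A k) \<Longrightarrow> Y.SS (\<mu> k) (\<mu> n) (\<theta> k a) = \<theta> n (X.SS k n a)"
proof (induction n rule: dec_induct)
  case (step n)
  have "Y.SS (\<mu> k) (\<mu> (Suc n)) (\<theta> k a) = Y.SS (\<mu> n) (\<mu> (Suc n)) (Y.SS (\<mu> k) (\<mu> n) (\<theta> k a))"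
    using step.hyps by (simp add: Y.SS_comp mono_mu)
  then show ?case using step tw SHD(1)[OF X.SS_SH] by (simp add: twine_def X.SS_Suc)
qed simp

lemma swap: "twin A' \<alpha>' A \<alpha> \<nu> \<mu> \<eta> \<theta>"
  by (rule twin.intro[OF Y.osys_axioms X.osys_axioms twin_axioms.intro[OF twine_sym[OF tw]]])

lemmas eta_nat = twin.theta_nat[OF swap]

text \<open>With \<open>DA_stabilises\<close> this makes the diagonal of the limit accessible:
  whatever is block diagonal on the other side becomes block diagonal here, at a level chosen in
  advance.\<close>

lemma DA_back:
  assumes "x \<in> FM (A' m)" "\<eta> m x \<in> DA (A (\<nu> m))"
  shows "Y.SS m (\<mu> (\<nu> m)) x \<in> DA (A' (\<mu> (\<nu> m)))"
  using SH_DA[OF X.N Y.N theta_SH assms(2)] theta_eta[OF assms(1)] by simp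

definition psi :: "nat \<Rightarrow> nat \<Rightarrow> fmat \<Rightarrow> fmat" where
  "psi k n a = Y.SS (\<mu> k) n (\<theta> k a)"

lemma psi_SH: "\<mu> k \<le> n \<Longrightarrow> SH (A k) (A' n) (psi k n)"
  using SH_comp[OF theta_SH Y.SS_SH] by (simp add: psi_def[abs_def] comp_def)

text \<open>The image of a matrix unit need not be regular at level \<open>\<mu> k\<close>; it becomes regular
  once the part of that level lying in the diagonal of the limit algebra has become block diagonal.\<close>

lemma eventually_regular: "\<exists>n0\<ge>\<mu> k. \<forall>n\<ge>n0. RM (A k) (A' n) (psi k n)"
proof -
  define m where "m = \<mu> k"
  obtain n0 where n0: "n0 \<ge> m"
    "\<And>n x n'. n \<ge> n0 \<Longrightarrow> x \<in> FM (A' m) \<Longrightarrow> n' \<ge> m \<Longrightarrow> Y.SS m n' x \<in> DA (A' n') \<Longrightarrow> Y.SS m n x \<in> DA (A' n)"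
    using Y.DA_stabilises[of m] by blast
  have "psi k n v \<in> RG (A' n)" if n: "n \<ge> n0" and v: "mi v" "blk (A k) i j v" "i \<le> j" for n v i j
  proof -
    have mn: "m \<le> n" using n n0 by simp
    note S = SHD[OF Y.SS_SH[OF mn]]
    have vF: "v \<in> FM (A k)" using blkD(5)[OF X.N v(2)] .
    have vO: "v \<in> OPS (A k)" by (rule blk_OPS[OF X.N mi_pim[OF v(1)] v(2,3)])
    define w where "w = \<theta> k v"
    have wN: "w \<in> NA (A' m)" unfolding w_def m_def by (rule SHD(6)[OF theta_SH RG_NA[OF OPS_RG[OF vO]]])
    have wF: "w \<in> FM (A' m)" using NA_FM[OF wN] .
    define W where "W = Y.SS m n w"
    have We: "psi k n v = W" by (simp add: psi_def W_def w_def m_def)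
    \<comment> \<open>Seen from the other system \<open>w\<close> is the image of an order
      preserving element, which normalises the diagonal. \<open>DA_back\<close> and the choice of
      \<open>n0\<close> bring this back to level \<open>n\<close>.\<close>
    have norm: "Y.SS m n (adj w * x * w) \<in> DA (A' n)" if x: "x \<in> DA (A' m)" for x
    proof -
      note E = SHD[OF eta_SH[of m]]
      have xF: "x \<in> FM (A' m)" using DA_FM[OF x] .
      have ew: "\<eta> m w = X.SS k (\<nu> m) v" unfolding w_def m_def by (rule eta_theta[OF vF])
      have "X.SS k (\<nu> m) v \<in> OPS (A (\<nu> m))" using X.SS_OPS[OF _ vO] grow(1)[of k] by (simp add: m_def)
      then have "adj (\<eta> m w) * \<eta> m x * \<eta> m w \<in> DA (A (\<nu> m))" unfolding ew
        by (rule OPS_normal(2)[OF X.N _ SH_DA[OF Y.N X.N eta_SH x]])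
      then have "\<eta> m (adj w * x * w) \<in> DA (A (\<nu> m))" using wF xF by (simp add: E)
      from DA_back[OF _ this] show ?thesis using n0(2)[OF n, of _ "\<mu> (\<nu> m)"] wF xF grow(2)[of m] by simp
    qed
    \<comment> \<open>On the image of atom \<open>i\<close> of level \<open>m\<close>, an atom of
      level \<open>n\<close> acts as a factor \<open>z i\<close> that commutes with everything
      coming from level \<open>m\<close>. This reduces the claim to \<open>norm\<close> for the
      atoms of level \<open>m\<close>.\<close>
    have fin: "adj W * atm (A' n) s * W \<in> DA (A' n)" if s: "s < natoms (A' n)" for s
    proof -
      obtain z where z: "\<And>i. i < natoms (A' m) \<Longrightarrow> z i \<in> DA (A' n)"
        "\<And>i. i < natoms (A' m) \<Longrightarrow> atm (A' n) s * Y.SS m n (atm (A' m) i) = z i * Y.SS m n (atm (A' m) i)"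
        "\<And>i a. i < natoms (A' m) \<Longrightarrow> a \<in> FM (A' m) \<Longrightarrow> z i * Y.SS m n a = Y.SS m n a * z i"
        using Y.atom_splits[OF mn s] by metis
      have "w = (\<Sum>i<natoms (A' m). atm (A' m) i * w)" by (rule expand_left[OF Y.N wF])
      then have "W = Y.SS m n (\<Sum>i<natoms (A' m). atm (A' m) i * w)" by (simp add: W_def)
      also have "\<dots> = (\<Sum>i<natoms (A' m). Y.SS m n (atm (A' m) i * w))" by (rule SH_sum[OF Y.SS_SH[OF mn]]) (simp add: wF)
      also have "\<dots> = (\<Sum>i<natoms (A' m). Y.SS m n (atm (A' m) i) * W)" by (simp add: S wF W_def)
      finally have Wi: "W = (\<Sum>i<natoms (A' m). Y.SS m n (atm (A' m) i) * W)" .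
      have aW: "adj W = Y.SS m n (adj w)" by (simp add: W_def S wF)
      have "adj W * atm (A' n) s * W = adj W * atm (A' n) s * (\<Sum>i<natoms (A' m). Y.SS m n (atm (A' m) i) * W)" using Wi by simp
      also have "\<dots> = (\<Sum>i<natoms (A' m). adj W * (atm (A' n) s * Y.SS m n (atm (A' m) i)) * W)" by (simp add: sum_distrib_left mult.assoc)
      also have "\<dots> = (\<Sum>i<natoms (A' m). (adj W * z i) * Y.SS m n (atm (A' m) i) * W)" by (simp add: z(2) mult.assoc)
      also have "\<dots> = (\<Sum>i<natoms (A' m). z i * Y.SS m n (adj w * atm (A' m) i * w))"
      proof (intro sum.cong refl)
        fix i assume "i \<in> {..<natoms (A' m)}"
        then have i: "i < natoms (A' m)" by simp
        have "adj W * z i = z i * adj W" using z(3)[OF i, of "adj w"] wF by (simp add: aW)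
        then show "(adj W * z i) * Y.SS m n (atm (A' m) i) * W = z i * Y.SS m n (adj w * atm (A' m) i * w)"
          using i wF by (simp add: S mult.assoc W_def)
      qed
      also have "\<dots> \<in> DA (A' n)" by (intro DA_sum DA_mult[OF Y.N] z norm at_DA[OF Y.N]) auto
      finally show ?thesis .
    qed
    have pW: "pim W" unfolding W_def w_def
      by (rule SH_pim[OF Y.SS_SH[OF mn] _ SH_pim[OF theta_SH vF mi_pim[OF v(1)]]]) (use wF in \<open>simp add: w_def\<close>)
    have "W * adj W = Y.SS m n (w * adj w)" using wF by (simp add: W_def S)
    moreover have "w * adj w = \<theta> k (v * adj v)" using vF by (simp add: w_def SHD[OF theta_SH])
    moreover have "v * adj v \<in> DA (A k)" by (rule PR_DA(1)[OF X.N RG_PR[OF OPS_RG[OF vO]]])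
    ultimately have WD: "W * adj W \<in> DA (A' n)" using Y.SS_DA[OF mn] SH_DA[OF X.N Y.N theta_SH] by (simp add: m_def)
    have "W \<in> PR (A' n)" by (rule normal_PR[OF Y.N S(1)[OF wF, folded W_def] pW WD fin])
    moreover have "W \<in> NA (A' n)" unfolding W_def by (rule S(6)[OF wN])
    ultimately show ?thesis by (simp add: We RG_def)
  qed
  then show ?thesis using n0(1) psi_SH by (intro exI[of _ n0]) (auto simp: RM_def m_def)
qed

lemma psi_step: "\<mu> k \<le> n \<Longrightarrow> n \<le> n' \<Longrightarrow> Y.SS n n' (psi k n a) = psi k n' a"
  by (simp add: psi_def Y.SS_comp)

lemma eta_psi: "\<mu> k \<le> n \<Longrightarrow> a \<in> FM (A k) \<Longrightarrow> \<eta> n (psi k n a) = X.SS k (\<nu> n) a"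
  unfolding psi_def using eta_nat[of "\<mu> k" n "\<theta> k a"] SHD(1)[OF theta_SH] eta_theta[of a k] grow(1)[of k] mono_nu[of "\<mu> k" n]
  by (simp add: X.SS_comp)

text \<open>A conflict between two blocks of an element that is order preserving throughout the other
  system forces the connecting matrix units into the diagonal of the limit algebra.\<close>

lemma conflict_collapses:
  assumes O: "\<eta> m w \<in> OPS (A (\<nu> m))" and wF: "w \<in> FM (A' m)"
    and u: "mi u" "blk (A' m) s t u" "u * adj u * w = u" "u * adj w = u * adj u"
    and u': "mi u'" "blk (A' m) s' t' u'" "u' * adj u' * w = u'"
    and st: "s' \<le> s" "t \<le> t'"
  shows "\<exists>x y. x \<in> FM (A' m) \<and> y \<in> FM (A' m) \<and> u' = x * u * y \<and> \<eta> m x \<in> DA (A (\<nu> m)) \<and> \<eta> m y \<in> DA (A (\<nu> m))"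
proof -
  obtain x y where xy: "mi x" "mi y" "blk (A' m) s' s x" "blk (A' m) t t' y" "u' = x * u * y"
    "x * adj x = u' * adj u'" "adj x * x = u * adj u" "y * adj y = adj u * u" "adj y * y = adj u' * u'" "y = adj u * adj x * u'"
    using blk_link[OF Y.N u(1,2) u'(1,2)] by blast
  have F: "x \<in> FM (A' m)" "y \<in> FM (A' m)" "u \<in> FM (A' m)" "u' \<in> FM (A' m)"
    using blkD(5)[OF Y.N] xy(3,4) u(2) u'(2) by blast+
  define h where "h = \<nu> m"
  note E = SHD[OF eta_SH[of m], folded h_def]
  define B where "B = \<eta> m x"
  define D where "D = \<eta> m y"
  define U where "U = \<eta> m u"
  define U' where "U' = \<eta> m u'"
  define W where "W = \<eta> m w"
  have FF: "B \<in> FM (A h)" "D \<in> FM (A h)" "U \<in> FM (A h)" "U' \<in> FM (A h)" "W \<in> FM (A h)"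
    using F wF E by (simp_all add: B_def D_def U_def U'_def W_def)
  have WO: "W \<in> OPS (A h)" using O by (simp add: W_def h_def)
  have BN: "B \<in> NA (A h)" "D \<in> NA (A h)" unfolding B_def D_def
    using E(6) blk_NA[OF Y.N xy(3) st(1)] blk_NA[OF Y.N xy(4) st(2)] by blast+
  have r: "U * adj U * W = U" "U * adj W = U * adj U" "U' * adj U' * W = U'"
    "B * adj B = U' * adj U'" "adj B * B = U * adj U" "D = adj U * adj B * U'"
    using arg_cong[OF u(3), of "\<eta> m"] arg_cong[OF u(4), of "\<eta> m"] arg_cong[OF u'(3), of "\<eta> m"]
      arg_cong[OF xy(6), of "\<eta> m"] arg_cong[OF xy(7), of "\<eta> m"] arg_cong[OF xy(10), of "\<eta> m"] F wF
    by (simp_all add: E B_def D_def U_def U'_def W_def)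
  have pB: "pim B" unfolding B_def by (rule SH_pim[OF eta_SH F(1) mi_pim[OF xy(1)]])
  have BU: "B = B * (U * adj U)" using pimD(2)[OF pB] r(5) by simp
  have UB: "B = U' * adj U' * B" using pimD(1)[OF pB] r(4) by simp
  have UD: "U' * adj U' \<in> DA (A h)" "U * adj U \<in> DA (A h)"
  proof -
    have "u' * adj u' \<in> DA (A' m)" "u * adj u \<in> DA (A' m)"
      using PR_DA(1)[OF Y.N blk_PR[OF Y.N mi_pim]] u u' by blast+
    from this[THEN SH_DA[OF Y.N X.N eta_SH]] show "U' * adj U' \<in> DA (A h)" "U * adj U \<in> DA (A h)"
      using F by (simp_all add: E U_def U'_def h_def)
  qed
  \<comment> \<open>\<open>W\<close> cut by the range projection of \<open>U\<close> is
    \<open>U\<close>, and \<open>B\<close> lives on that range.\<close>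
  have BW: "B * W = B * U"
  proof -
    have "B * W = B * (U * adj U * W)" using BU by (metis mult.assoc)
    then show ?thesis using r(1) by simp
  qed
  have BUD: "B * U = U' * adj D"
  proof -
    have "U' * adj D = U' * adj U' * B * U" by (simp add: r(6) mult.assoc)
    then show ?thesis using UB by simp
  qed
  \<comment> \<open>Suppose \<open>B\<close> has a nonzero block \<open>(a, b)\<close> with
    \<open>a < b\<close>, and let \<open>W\<close> match \<open>b\<close> with \<open>c\<close>.
    Then block \<open>(a, c)\<close> of \<open>B * W = U' * adj D\<close> is nonzero, which gives
    some \<open>d\<close> such that \<open>W\<close> matches \<open>a\<close> with \<open>d\<close>
    and \<open>D\<close> has a nonzero block \<open>(c, d)\<close>. Triangularity of
    \<open>D\<close> yields \<open>c \<le> d\<close>, but monotonicity of \<open>W\<close> yields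
    \<open>d < c\<close>.\<close>
  have "atm (A h) a * B * atm (A h) b = 0" if ab: "a < natoms (A h)" "b < natoms (A h)" "a < b" for a b
  proof (rule ccontr)
    define p where "p = atm (A h)"
    assume "atm (A h) a * B * atm (A h) b \<noteq> 0"
    then have ne: "p a * B * p b \<noteq> 0" by (simp add: p_def)
    have "p a * B * p b = p a * B * (U * adj U * p b)" using BU by (metis mult.assoc)
    also have "U * adj U * p b = p b * (U * adj U)" using DA_comm[OF X.N UD(2) ab(2)] by (simp add: p_def)
    also have "U * adj U = U * adj U * W * adj W" using r(1,2) by simp
    also have "p a * B * (p b * (U * adj U * W * adj W)) = p a * B * (p b * (U * adj U)) * W * adj W" by (simp only: mult.assoc)
    also have "p b * (U * adj U) = U * adj U * p b" using DA_comm[OF X.N UD(2) ab(2)] by (simp add: p_def)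
    also have "p a * B * (U * adj U * p b) = p a * B * p b" using BU by (metis mult.assoc)
    finally have "p a * B * p b = p a * B * p b * W * adj W" .
    then have "p a * B * p b * W \<noteq> 0" using ne by (metis mult_zero_left)
    moreover have "p a * B * p b * W = (\<Sum>c<natoms (A h). p a * B * p b * W * p c)"
      unfolding p_def by (rule expand_right[OF X.N]) (use FF ab in simp)
    ultimately obtain c where c: "c < natoms (A h)" "p a * B * p b * W * p c \<noteq> 0" by (metis (no_types, lifting) lessThan_iff sum.neutral)
    have bc: "p b * W * p c \<noteq> 0"
    proof
      assume "p b * W * p c = 0"
      then have "p a * B * (p b * W * p c) = 0" by simp
      then show False using c(2) by (simp add: mult.assoc)
    qed
    have "W * p c = (\<Sum>b'<natoms (A h). p b' * (W * p c))" unfolding p_def by (rule expand_left[OF X.N]) (use FF c in simp)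
    also have "\<dots> = (\<Sum>b'<natoms (A h). if b' = b then p b * W * p c else 0)"
    proof (intro sum.cong refl)
      fix b' assume b': "b' \<in> {..<natoms (A h)}"
      have "p b' * W * p c = 0" if "b' \<noteq> b"
        using OPS_match(2)[OF X.N WO, of b' c b c] bc b' c ab that by (auto simp: p_def)
      then show "p b' * (W * p c) = (if b' = b then p b * W * p c else 0)" by (auto simp: mult.assoc)
    qed
    also have "\<dots> = p b * W * p c" using ab by (simp add: sum.delta)
    finally have Wc: "W * p c = p b * W * p c" .
    have "p a * B * p b * W * p c = p a * B * (p b * W * p c)" by (simp add: mult.assoc)
    also have "\<dots> = p a * (B * W) * p c" unfolding Wc[symmetric] by (simp only: mult.assoc)
    also have "\<dots> = p a * (U' * adj U' * W) * adj D * p c" using BW BUD r(3) by (simp add: mult.assoc)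
    also have "\<dots> = (p a * (U' * adj U')) * W * adj D * p c" by (simp add: mult.assoc)
    also have "p a * (U' * adj U') = U' * adj U' * p a" using DA_comm[OF X.N UD(1) ab(1)] by (simp add: p_def)
    finally have "U' * adj U' * (p a * W * adj D * p c) \<noteq> 0" using c(2) by (simp add: mult.assoc)
    then have "p a * W * adj D * p c \<noteq> 0" by (metis mult_zero_right)
    moreover have "p a * W * adj D * p c = (\<Sum>d<natoms (A h). (p a * W) * p d * (adj D * p c))"
      unfolding p_def mult.assoc[of "atm (A h) a * W" "adj D"] by (rule expand_mid[OF X.N]) (use FF ab in simp)
    ultimately obtain d where d: "d < natoms (A h)" "p a * W * p d * (adj D * p c) \<noteq> 0" by (metis (no_types, lifting) lessThan_iff sum.neutral)
    have ad: "p a * W * p d \<noteq> 0" using d(2) by (metis mult_zero_left)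
    have "p c * D * p d \<noteq> 0"
    proof
      assume "p c * D * p d = 0"
      then have "adj (p c * D * p d) = 0" by simp
      then have "p d * adj D * p c = 0" using c d by (simp add: p_def at_adj[OF X.N] mult.assoc)
      then have "p a * W * p d * (p d * adj D * p c) = 0" by simp
      moreover have "p a * W * p d * (p d * adj D * p c) = p a * W * (p d * p d) * (adj D * p c)" by (simp add: mult.assoc)
      ultimately show False using d by (simp add: p_def at_self[OF X.N])
    qed
    then have "c \<le> d" using BN(2) c d by (metis (mono_tags, lifting) NA_def mem_Collect_eq not_le p_def)
    moreover have "a < b \<longleftrightarrow> d < c" using OPS_match(1)[OF X.N WO, of b c a d] ab c d ad bc by (simp add: p_def)
    ultimately show False using ab by simp
  qed
  then have BD: "B \<in> DA (A h)" using BN(1) FF unfolding DA_def NA_def by (auto simp: nat_neq_iff)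
  \<comment> \<open>\<open>D\<close> turns out to be the conjugate \<open>adj W * adj B * W\<close>
    of a block diagonal element, and \<open>W\<close> normalises the diagonal.\<close>
  have "D = adj (U * adj U * W) * adj B * (U' * adj U' * W)" unfolding r(1,3) by (rule r(6))
  also have "\<dots> = adj W * (adj (U' * adj U' * (B * (U * adj U)))) * W" by (simp add: mult.assoc)
  also have "U' * adj U' * (B * (U * adj U)) = B" using BU UB by simp
  also have "adj W * adj B * W \<in> DA (A h)" using OPS_normal(2)[OF X.N WO] BD DA_adj[OF X.N] by blast
  finally have "D \<in> DA (A h)" .
  then show ?thesis using BD F xy(5) by (auto simp: B_def D_def h_def)
qed

text \<open>Two nonzero blocks of the image come from rank one pieces \<open>u k\<close> and
  \<open>u l\<close> at a level where the image is regular. If the blocks of these pieces are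
  strictly comparable in both coordinates, then \<open>u k + u l\<close> is order preserving there
  and remains so. Otherwise \<open>conflict_collapses\<close> applies, and later on every block of
  one piece is also a block of the other. In all cases both given blocks occur in a single order
  preserving element.\<close>

lemma eventually_op:
  assumes v: "v \<in> RG (A k)" "\<forall>n>k. X.SS k n v \<in> OPS (A n)"
  shows "\<exists>n0\<ge>\<mu> k. \<forall>n\<ge>n0. psi k n v \<in> OPS (A' n)"
proof -
  obtain m where m: "m \<ge> \<mu> k" "RM (A k) (A' m) (psi k m)" using eventually_regular by blast
  define w where "w = psi k m v"
  have wR: "w \<in> RG (A' m)" unfolding w_def by (rule RM_RG[OF X.N Y.N m(2) v(1)])
  have "\<nu> m > k" using grow(1)[of k] mono_nu[OF m(1)] by simp
  then have O: "\<eta> m w \<in> OPS (A (\<nu> m))" using v RG_FM by (simp add: w_def eta_psi[OF m(1)])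
  obtain n0 where n0: "n0 \<ge> m"
    "\<And>n x n'. n \<ge> n0 \<Longrightarrow> x \<in> FM (A' m) \<Longrightarrow> n' \<ge> m \<Longrightarrow> Y.SS m n' x \<in> DA (A' n') \<Longrightarrow> Y.SS m n x \<in> DA (A' n)"
    using Y.DA_stabilises[of m] by blast
  obtain K :: "(nat \<times> nat \<times> nat) set" and u I J where K: "finite K" "w = sum u K"
    "\<And>k. k \<in> K \<Longrightarrow> mi (u k) \<and> blk (A' m) (I k) (J k) (u k) \<and> I k \<le> J k \<and> u k * adj (u k) * w = u k"
    "\<And>k l. k \<in> K \<Longrightarrow> l \<in> K \<Longrightarrow> k \<noteq> l \<Longrightarrow> u k * adj (u l) = 0 \<and> adj (u k) * u l = 0"
    using RG_decomp[OF Y.N wR] by metis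
  have uw: "u k * adj w = u k * adj (u k)" if "k \<in> K" for k
    unfolding K(2) adj_sum by (rule orth_sum_mult(1)[OF K(1)]) (use K(4) that in auto)
  have "Y.SS m n w \<in> OPS (A' n)" if n: "n \<ge> n0" for n
  proof -
    have mn: "m \<le> n" using n0 n by simp
    let ?p = "atm (A' n)"
    define f where "f = Y.SS m n"
    note S = SHD[OF Y.SS_SH[OF mn], folded f_def]
    have RMf: "RM (A' m) (A' n) f" unfolding f_def by (rule Y.SS_RM[OF mn])
    have uF: "u k \<in> FM (A' m)" if "k \<in> K" for k using blkD(5)[OF Y.N] K(3) that by blast
    have fO: "f (u k) \<in> OPS (A' n)" if "k \<in> K" for k unfolding f_def
      by (rule Y.SS_OPS[OF mn]) (use K(3)[OF that] blk_OPS[OF Y.N mi_pim] in blast)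
    have tra: "?p a * f (u k) * ?p b \<noteq> 0"
      if kl: "k \<in> K" "l \<in> K" "I l \<le> I k" "J k \<le> J l" and ab: "a < natoms (A' n)" "b < natoms (A' n)" "?p a * f (u l) * ?p b \<noteq> 0" for k l a b
    proof
      assume z: "?p a * f (u k) * ?p b = 0"
      obtain x y where xy: "x \<in> FM (A' m)" "y \<in> FM (A' m)" "u l = x * u k * y" "\<eta> m x \<in> DA (A (\<nu> m))" "\<eta> m y \<in> DA (A (\<nu> m))"
        using conflict_collapses[OF O RG_FM[OF wR], of "u k" "I k" "J k" "u l" "I l" "J l"] K(3) uw kl by blast
      have D: "f x \<in> DA (A' n)" "f y \<in> DA (A' n)" unfolding f_def
        using n0(2)[OF n _ _ DA_back] xy grow(2)[of m] by auto
      have "?p a * f (u l) * ?p b = (?p a * f x) * f (u k) * (f y * ?p b)"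
        using xy uF[OF kl(1)] by (simp add: S mult.assoc)
      also have "\<dots> = f x * (?p a * f (u k) * ?p b) * f y"
        using DA_comm[OF Y.N D(1) ab(1)] DA_comm[OF Y.N D(2) ab(2)] by (simp add: mult.assoc)
      finally show False using z ab(3) by simp
    qed
    have fw: "f w = (\<Sum>k\<in>K. f (u k))" unfolding K(2) f_def by (rule SH_sum[OF Y.SS_SH[OF mn]]) (rule uF)
    have ex: "\<exists>k\<in>K. ?p a * f (u k) * ?p b \<noteq> 0" if "?p a * f w * ?p b \<noteq> 0" for a b
    proof (rule ccontr)
      assume "\<not> ?thesis"
      then have "(\<Sum>k\<in>K. ?p a * f (u k) * ?p b) = 0" by (intro sum.neutral) auto
      then show False using that by (simp add: fw sum_distrib_left sum_distrib_right)
    qed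
    have "?p a' * f w * ?p b' = 0"
      if ab: "a < natoms (A' n)" "b < natoms (A' n)" "?p a * f w * ?p b \<noteq> 0" "a' \<le> a" "b' \<in> {b..<natoms (A' n)}" "(a', b') \<noteq> (a, b)" for a b a' b'
    proof (rule ccontr)
      assume ne: "?p a' * f w * ?p b' \<noteq> 0"
      have ab': "a' < natoms (A' n)" "b' < natoms (A' n)" using ab by auto
      have contr: False if g: "g \<in> OPS (A' n)" "?p a * g * ?p b \<noteq> 0" "?p a' * g * ?p b' \<noteq> 0" for g
        using OPS_match[OF Y.N g(1) ab(1,2) ab' g(2,3)] ab by auto
      obtain k where k: "k \<in> K" "?p a * f (u k) * ?p b \<noteq> 0" using ex ab by blast
      obtain l where l: "l \<in> K" "?p a' * f (u l) * ?p b' \<noteq> 0" using ex ne by blast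
      have both: False if c: "I k < I l \<and> J k < J l \<or> I l < I k \<and> J l < J k"
      proof -
        have kl: "k \<noteq> l" using c by auto
        define g where "g = sum u {k, l}"
        have sub: "finite {k, l}" "\<And>j. j \<in> {k, l} \<Longrightarrow> mi (u j) \<and> blk (A' m) (I j) (J j) (u j) \<and> I j \<le> J j"
          "\<And>i j. i \<in> {k, l} \<Longrightarrow> j \<in> {k, l} \<Longrightarrow> i \<noteq> j \<Longrightarrow> u i * adj (u j) = 0 \<and> adj (u i) * u j = 0"
          using K(3) K(4) k(1) l(1) by (simp, blast, blast)
        have gR: "g \<in> RG (A' m)" unfolding g_def using RM_sum(1)[OF Y.N Y.N RM_id[OF Y.N] sub] by simp
        have bg: "atm (A' m) s * g * atm (A' m) t = (if s = I k \<and> t = J k then u k else if s = I l \<and> t = J l then u l else 0)"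
          if "s < natoms (A' m)" "t < natoms (A' m)" for s t
          using kl c that sub(2)[of k] sub(2)[of l] by (auto simp: g_def distrib_left distrib_right blk_block[OF Y.N])
        have "g \<in> OPS (A' m)" unfolding OPS_def using gR c bg by (auto split: if_splits)
        then have fgO: "f g \<in> OPS (A' n)" unfolding f_def by (rule Y.SS_OPS[OF mn])
        \<comment> \<open>The entries of \<open>cl\<close> are nonnegative, so the contributions of
          the two summands cannot cancel.\<close>
        have nz: "?p s * f g * ?p t \<noteq> 0" if st: "s < natoms (A' n)" "t < natoms (A' n)"
          and "?p s * f (u k) * ?p t \<noteq> 0 \<or> ?p s * f (u l) * ?p t \<noteq> 0" for s t
        proof
          assume "?p s * f g * ?p t = 0"
          then have "cl (A' n) (f g) s t = 0" using cl_0_iff[OF Y.N st] by blast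
          then have "cl (A' n) (f (u k)) s t + cl (A' n) (f (u l)) s t = 0"
            using RM_sum(2)[OF Y.N Y.N RMf sub(1), of u I J s t] sub(2,3) st kl by (simp add: g_def)
          then have "hs (?p s * f (u k) * ?p t) + hs (?p s * f (u l) * ?p t) = 0"
            unfolding cl_hs[OF Y.N st] by (metis of_real_add of_real_eq_0_iff)
          then have "hs (?p s * f (u k) * ?p t) = 0 \<and> hs (?p s * f (u l) * ?p t) = 0"
            using hs_ge_0 by (metis add_nonneg_eq_0_iff)
          then show False using that(3) by simp
        qed
        show False using contr[OF fgO nz nz] ab(1,2) ab' k(2) l(2) by blast
      qed
      consider "I l \<le> I k" "J k \<le> J l" | "I k \<le> I l" "J l \<le> J k" | "I k < I l" "J k < J l" | "I l < I k" "J l < J k" by linarith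
      then show False
      proof cases
        case 1
        then show False using contr[OF fO[OF k(1)] k(2) tra[OF k(1) l(1) 1 ab' l(2)]] by simp
      next
        case 2
        then show False using contr[OF fO[OF l(1)] tra[OF l(1) k(1) 2 ab(1,2) k(2)] l(2)] by simp
      next
        case 3 then show False using both by blast
      next
        case 4 then show False using both by blast
      qed
    qed
    moreover have "f w \<in> RG (A' n)" by (rule RM_RG[OF Y.N Y.N RMf wR])
    ultimately show ?thesis unfolding OPS_def f_def[symmetric] by blast
  qed
  then show ?thesis using n0(1) m(1) psi_step[OF m(1)] by (intro exI[of _ n0]) (auto simp: w_def)
qed

end

section \<open>Intertwined systems have isomorphic invariants\<close>

context twin
begin

text \<open>\<open>gmap k X\<close> is computed at any level at which \<open>psi k n\<close> has become regular.\<close>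

definition lev :: "nat \<Rightarrow> nat" where
  "lev k = (SOME n0. n0 \<ge> \<mu> k \<and> (\<forall>n\<ge>n0. RM (A k) (A' n) (psi k n)))"

definition gmap :: "nat \<Rightarrow> int mat \<Rightarrow> (nat \<times> int mat) set" where
  "gmap k X = Y.gc (lev k) (pH (A k) (A' (lev k)) (psi k (lev k)) X)"

lemma lev: "\<mu> k \<le> lev k" "lev k \<le> n \<Longrightarrow> RM (A k) (A' n) (psi k n)"
proof -
  have "\<exists>n0. n0 \<ge> \<mu> k \<and> (\<forall>n\<ge>n0. RM (A k) (A' n) (psi k n))" using eventually_regular[of k] by blast
  from someI_ex[OF this] show "\<mu> k \<le> lev k" "lev k \<le> n \<Longrightarrow> RM (A k) (A' n) (psi k n)" unfolding lev_def by blast+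
qed

lemma gmap_at: "lev k \<le> n \<Longrightarrow> gmap k X = Y.gc n (pH (A k) (A' n) (psi k n) X)"
proof -
  assume n: "lev k \<le> n"
  have "Y.gc n (pH (A k) (A' n) (psi k n) X) = Y.gc n (pH (A' (lev k)) (A' n) (Y.SS (lev k) n) (pH (A k) (A' (lev k)) (psi k (lev k)) X))"
    unfolding pH_comp[OF X.N Y.N Y.N lev(2)[OF order_refl] Y.SS_RM[OF n]]
    using n lev(1)[of k] by (intro arg_cong[of _ _ "Y.gc n"] pH_cong) (simp add: psi_step)
  also have "\<dots> = gmap k X" unfolding gmap_def
    by (rule Y.gc_shift[OF pH_upm[OF X.N Y.N lev(2)[OF order_refl]] n])
  finally show ?thesis by simp
qed

lemma gmap_compat: "X \<in> upm (A k) \<Longrightarrow> gmap (Suc k) (Gmaps A \<alpha> k X) = gmap k X"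
proof -
  define n where "n = max (lev k) (lev (Suc k))"
  have n: "lev k \<le> n" "lev (Suc k) \<le> n" "\<mu> k \<le> n" "\<mu> (Suc k) \<le> n" using lev(1)[of k] lev(1)[of "Suc k"] by (auto simp: n_def)
  have "pH (A (Suc k)) (A' n) (psi (Suc k) n) (Gmaps A \<alpha> k X) = pH (A k) (A' n) (psi (Suc k) n \<circ> X.S k) X"
    unfolding X.Gmaps_pH by (rule pH_comp[OF X.N X.N Y.N X.S_RM lev(2)[OF n(2)]])
  also have "\<dots> = pH (A k) (A' n) (psi k n) X"
  proof (rule pH_cong)
    fix i j assume "i \<le> j" "j < natoms (A k)"
    then have F: "gm (A k) i j \<in> FM (A k)" by (rule gm_FM[OF X.N])
    have "psi (Suc k) n (X.S k (gm (A k) i j)) = Y.SS (\<mu> (Suc k)) n (Y.SS (\<mu> k) (\<mu> (Suc k)) (\<theta> k (gm (A k) i j)))"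
      using theta_nat[of k "Suc k", OF _ F] by (simp add: psi_def X.SS_one)
    then show "(psi (Suc k) n \<circ> X.S k) (gm (A k) i j) = psi k n (gm (A k) i j)"
      using n by (simp add: psi_def Y.SS_comp mono_mu)
  qed
  finally show ?thesis using gmap_at[OF n(1)] gmap_at[OF n(2)] by simp
qed

lemma gamma_ex: "\<exists>\<gamma>. \<forall>k. \<forall>X\<in>upm (A k). \<gamma> (X.gc k X) = gmap k X"
  using X.G.dlim_desc[of gmap] gmap_compat by (auto simp: X.Gsets_upm)

end

text \<open>By the intertwining relations the round trip of levelwise maps is a system map, which is
  trivial in the limit. It is stated outside the locale so that both orders of the two systems are
  available.\<close>

lemma gamma_inverse:
  assumes t: "twin A \<alpha> A' \<alpha>' \<mu> \<nu> \<theta> \<eta>"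
    and g: "\<And>k X. X \<in> upm (A k) \<Longrightarrow> \<gamma> (dlim_in (Gsets A) (Gmaps A \<alpha>) k X) = twin.gmap A A' \<alpha>' \<mu> \<theta> k X"
    and g': "\<And>k X. X \<in> upm (A' k) \<Longrightarrow> \<gamma>' (dlim_in (Gsets A') (Gmaps A' \<alpha>') k X) = twin.gmap A' A \<alpha> \<nu> \<eta> k X"
    and x: "x \<in> carrier (lim_group A \<alpha>)"
  shows "\<gamma>' (\<gamma> x) = x"
proof -
  interpret T: twin A \<alpha> A' \<alpha>' \<mu> \<nu> \<theta> \<eta> by (rule t)
  interpret T': twin A' \<alpha>' A \<alpha> \<nu> \<mu> \<eta> \<theta>
    by (rule twin.intro[OF T.Y.osys_axioms T.X.osys_axioms twin_axioms.intro[OF twine_sym[OF T.tw]]])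
  obtain k X where X: "X \<in> upm (A k)" "x = T.X.gc k X" using T.X.gc_cases[OF x] .
  define n where "n = T.lev k"
  \<comment> \<open>Far enough for the way back to be regular and for the round trip to be compared
    with the system map from level \<open>k\<close>.\<close>
  define p where "p = max k (T'.lev n)"
  have np: "T'.lev n \<le> p" "\<nu> n \<le> p" "k \<le> p" "\<mu> k \<le> n" using T'.lev(1)[of n] T.lev(1)[of k] by (auto simp: p_def n_def)
  have R: "RM (A k) (A' n) (T.psi k n)" unfolding n_def by (rule T.lev(2)[OF order_refl])
  have R': "RM (A' n) (A p) (T'.psi n p)" by (rule T'.lev(2)[OF np(1)])
  have "\<gamma>' (\<gamma> x) = \<gamma>' (T.Y.gc n (pH (A k) (A' n) (T.psi k n) X))" using X g T.gmap_def by (simp add: n_def)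
  also have "\<dots> = T'.gmap n (pH (A k) (A' n) (T.psi k n) X)" by (rule g'[OF pH_upm[OF T.X.N T.Y.N R]])
  also have "\<dots> = T.X.gc p (pH (A' n) (A p) (T'.psi n p) (pH (A k) (A' n) (T.psi k n) X))" by (rule T'.gmap_at[OF np(1)])
  also have "pH (A' n) (A p) (T'.psi n p) (pH (A k) (A' n) (T.psi k n) X) = pH (A k) (A p) (T'.psi n p \<circ> T.psi k n) X"
    by (rule pH_comp[OF T.X.N T.Y.N T.X.N R R'])
  also have "\<dots> = pH (A k) (A p) (T.X.SS k p) X"
  proof (rule pH_cong)
    fix i j assume "i \<le> j" "j < natoms (A k)"
    then have F: "gm (A k) i j \<in> FM (A k)" by (rule gm_FM[OF T.X.N])
    have "k \<le> \<nu> n" using T.grow(1)[of k] T.mono_nu[OF np(4)] by simp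
    then show "(T'.psi n p \<circ> T.psi k n) (gm (A k) i j) = T.X.SS k p (gm (A k) i j)"
      using T.eta_psi[OF np(4) F] np by (simp add: T'.psi_def T.X.SS_comp)
  qed
  also have "T.X.gc p \<dots> = x" using T.X.gc_shift[OF X(1) np(3)] X(2) by simp
  finally show ?thesis .
qed

context twin
begin

lemma gamma_props:
  assumes g: "\<And>k X. X \<in> upm (A k) \<Longrightarrow> \<gamma> (X.gc k X) = gmap k X"
  shows "x \<in> carrier X.Grp \<Longrightarrow> \<gamma> x \<in> carrier Y.Grp"
    "\<gamma> \<in> hom X.Grp Y.Grp"
    "\<gamma> ` lim_Sigma A \<alpha> \<subseteq> lim_Sigma A' \<alpha>'" "\<gamma> ` lim_Sigma_0 A \<alpha> \<subseteq> lim_Sigma_0 A' \<alpha>'"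
    "\<gamma> ` lim_K0 A \<alpha> \<subseteq> lim_K0 A' \<alpha>'" "\<gamma> ` lim_Sigma_op A \<alpha> \<subseteq> lim_Sigma_op A' \<alpha>'"
    "x \<in> carrier X.Grp \<Longrightarrow> \<gamma> (lim_pi_f A \<alpha> x) = lim_pi_f A' \<alpha>' (\<gamma> x)"
    "x \<in> carrier X.Grp \<Longrightarrow> \<gamma> (lim_pi_i A \<alpha> x) = lim_pi_i A' \<alpha>' (\<gamma> x)"
proof -
  have R: "RM (A k) (A' (lev k)) (psi k (lev k))" for k by (rule lev(2)[OF order_refl])
  note U = pH_upm[OF X.N Y.N R]
  show 1: "\<gamma> x \<in> carrier Y.Grp" if "x \<in> carrier X.Grp" for x
    using X.gc_cases[OF that] g Y.gc_in[OF U] by (metis gmap_def)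
  have "\<gamma> (x \<otimes>\<^bsub>X.Grp\<^esub> y) = \<gamma> x \<otimes>\<^bsub>Y.Grp\<^esub> \<gamma> y"
    if xy: "x \<in> carrier X.Grp" "y \<in> carrier X.Grp" for x y
  proof -
    obtain k a b where k: "a \<in> upm (A k)" "b \<in> upm (A k)" "x = X.gc k a" "y = X.gc k b"
      using X.G.common2[of x y] xy by (auto simp: X.Gsets_upm X.carrier_lim)
    then show ?thesis by (simp add: X.gc_add g upm_closed gmap_def Y.gc_add U pH_add[OF X.N Y.N R])
  qed
  with 1 show "\<gamma> \<in> hom X.Grp Y.Grp" by (auto simp: hom_def)
  have gv: "\<gamma> (X.gc k (pcl (A k) v)) = Y.gc n (pcl (A' n) (psi k n v))" if "v \<in> RG (A k)" "lev k \<le> n" for k v n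
    using that gmap_at[OF that(2)] pH_pcl[OF X.N Y.N lev(2)[OF that(2)] that(1)] g[OF pcl_upm[OF X.N that(1)]] by simp
  have rv: "psi k n v \<in> RG (A' n)" if "v \<in> RG (A k)" "lev k \<le> n" for k v n
    by (rule RM_RG[OF X.N Y.N lev(2)[OF that(2)] that(1)])
  show "\<gamma> ` lim_Sigma A \<alpha> \<subseteq> lim_Sigma A' \<alpha>'"
    unfolding X.lim_Sigma_eq Y.lim_Sigma_eq using gv[OF _ order_refl] rv[OF _ order_refl] by fastforce
  show "\<gamma> ` lim_Sigma_0 A \<alpha> \<subseteq> lim_Sigma_0 A' \<alpha>'"
  proof
    fix y assume "y \<in> \<gamma> ` lim_Sigma_0 A \<alpha>"
    then obtain k p where p: "p \<in> NA (A k)" "pj p" "y = \<gamma> (X.gc k (pcl (A k) p))" unfolding X.lim_Sigma_0_eq by blast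
    have S: "SH (A k) (A' (lev k)) (psi k (lev k))" by (rule RM_SH[OF R])
    show "y \<in> lim_Sigma_0 A' \<alpha>'" unfolding Y.lim_Sigma_0_eq
      using gv[OF pj_NA_RG(2)[OF X.N p(1,2)] order_refl] p(3) SHD(6)[OF S p(1)] SH_pj[OF S NA_FM[OF p(1)] p(2)] by blast
  qed
  show "\<gamma> ` lim_Sigma_op A \<alpha> \<subseteq> lim_Sigma_op A' \<alpha>'"
  proof
    fix y assume "y \<in> \<gamma> ` lim_Sigma_op A \<alpha>"
    then obtain k v where v: "v \<in> RG (A k)" "\<forall>n>k. X.SS k n v \<in> OPS (A n)" "y = \<gamma> (X.gc k (pcl (A k) v))"
      unfolding X.lim_Sigma_op_eq by blast
    obtain n0 where n0: "n0 \<ge> \<mu> k" "\<And>n. n \<ge> n0 \<Longrightarrow> psi k n v \<in> OPS (A' n)" using eventually_op[OF v(1,2)] by blast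
    define n where "n = max n0 (lev k)"
    have n: "lev k \<le> n" "n0 \<le> n" "\<mu> k \<le> n" using n0 by (auto simp: n_def)
    have "\<forall>n'>n. Y.SS n n' (psi k n v) \<in> OPS (A' n')" using n n0(2) psi_step[OF n(3)] by simp
    then show "y \<in> lim_Sigma_op A' \<alpha>'" unfolding Y.lim_Sigma_op_eq
      using gv[OF v(1) n(1)] v(3) rv[OF v(1) n(1)] by blast
  qed
  have gh: "group_hom (dist_group (A k)) (dist_group (A' (lev k))) (pH (A k) (A' (lev k)) (psi k (lev k)))" for k
    using dist_group U pH_add[OF X.N Y.N R] by (intro group_hom.intro group_hom_axioms.intro)
      (auto simp: comm_group_def hom_def dist_group_simps)
  show "\<gamma> ` lim_K0 A \<alpha> \<subseteq> lim_K0 A' \<alpha>'"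
  proof
    fix y assume "y \<in> \<gamma> ` lim_K0 A \<alpha>"
    then obtain k X where X: "X \<in> K0 (A k)" "y = \<gamma> (X.gc k X)" unfolding lim_K0_def lim_union_def by blast
    define H where "H = pH (A k) (A' (lev k)) (psi k (lev k))"
    have sub: "Sigma_0 (A k) \<subseteq> carrier (dist_group (A k))"
      unfolding Sigma_0_pcl[OF X.N] dist_group_simps using pcl_upm[OF X.N pj_NA_RG(2)[OF X.N]] by blast
    have "X \<in> carrier (dist_group (A k))"
      using X(1) group.generate_in_carrier[OF comm_group.axioms(2)[OF dist_group] sub] by (simp add: K0_def)
    then have Xu: "X \<in> upm (A k)" by (simp add: dist_group_simps)
    have S: "SH (A k) (A' (lev k)) (psi k (lev k))" by (rule RM_SH[OF R])
    have "H ` Sigma_0 (A k) \<subseteq> Sigma_0 (A' (lev k))"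
    proof
      fix Z assume "Z \<in> H ` Sigma_0 (A k)"
      then obtain p where p: "p \<in> NA (A k)" "pj p" "Z = H (pcl (A k) p)" unfolding Sigma_0_pcl[OF X.N] by blast
      have "Z = pcl (A' (lev k)) (psi k (lev k) p)" unfolding p(3) H_def
        by (rule pH_pcl[OF X.N Y.N R pj_NA_RG(2)[OF X.N p(1,2)]])
      then show "Z \<in> Sigma_0 (A' (lev k))" unfolding Sigma_0_pcl[OF Y.N]
        using SHD(6)[OF S p(1)] SH_pj[OF S NA_FM[OF p(1)] p(2)] by blast
    qed
    then have "generate (dist_group (A' (lev k))) (H ` Sigma_0 (A k)) \<subseteq> K0 (A' (lev k))"
      unfolding K0_def by (rule group.mono_generate[OF comm_group.axioms(2)[OF dist_group]])
    then have "H X \<in> K0 (A' (lev k))"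
      using group_hom.generate_img[OF gh sub] X(1) by (auto simp: K0_def H_def)
    moreover have "y = Y.gc (lev k) (H X)" using X(2) g[OF Xu] by (simp add: gmap_def H_def)
    ultimately show "y \<in> lim_K0 A' \<alpha>'" unfolding lim_K0_def lim_union_def by blast
  qed
  show "\<gamma> (lim_pi_f A \<alpha> x) = lim_pi_f A' \<alpha>' (\<gamma> x)" "\<gamma> (lim_pi_i A \<alpha> x) = lim_pi_i A' \<alpha>' (\<gamma> x)"
    if x: "x \<in> carrier X.Grp"
  proof -
    obtain k X where X: "X \<in> upm (A k)" "x = X.gc k X" using X.gc_cases[OF x] .
    then show "\<gamma> (lim_pi_f A \<alpha> x) = lim_pi_f A' \<alpha>' (\<gamma> x)" "\<gamma> (lim_pi_i A \<alpha> x) = lim_pi_i A' \<alpha>' (\<gamma> x)"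
      by (simp_all add: X.gc_pi_f X.gc_pi_i g pi_upm gmap_def Y.gc_pi_f Y.gc_pi_i U pH_pi_f[OF X.N Y.N R] pH_pi_i[OF X.N Y.N R])
  qed
qed

lemma twin_Inv_iso: "\<exists>\<gamma>. Inv_iso A \<alpha> A' \<alpha>' \<gamma> \<and> \<gamma> ` lim_Sigma_op A \<alpha> = lim_Sigma_op A' \<alpha>'"
proof -
  interpret T': twin A' \<alpha>' A \<alpha> \<nu> \<mu> \<eta> \<theta> by (rule swap)
  have t: "twin A \<alpha> A' \<alpha>' \<mu> \<nu> \<theta> \<eta>" by (rule twin_axioms)
  have t': "twin A' \<alpha>' A \<alpha> \<nu> \<mu> \<eta> \<theta>" by (rule T'.twin_axioms)
  obtain \<gamma> where g: "\<And>k X. X \<in> upm (A k) \<Longrightarrow> \<gamma> (X.gc k X) = gmap k X" using gamma_ex by blast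
  obtain \<gamma>' where g': "\<And>k X. X \<in> upm (A' k) \<Longrightarrow> \<gamma>' (Y.gc k X) = T'.gmap k X" using T'.gamma_ex by blast
  note i = gamma_inverse[OF t g g'] and i' = gamma_inverse[OF t' g' g]
  note P = gamma_props[OF g] and P' = T'.gamma_props[OF g']
  have bij: "bij_betw \<gamma> (carrier X.Grp) (carrier Y.Grp)"
    by (rule bij_betw_byWitness[where f' = \<gamma>']) (use i i' P(1) P'(1) in auto)
  \<comment> \<open>Only inclusions are available in either direction; the one for the inverse turns
    that for \<open>\<gamma>\<close> into an equality.\<close>
  have eq: "\<gamma> ` M = M'" if "\<gamma> ` M \<subseteq> M'" "\<gamma>' ` M' \<subseteq> M" "M' \<subseteq> carrier Y.Grp" for M M'
  proof (rule equalityI[OF that(1)], rule subsetI)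
    fix y assume y: "y \<in> M'"
    then have "\<gamma> (\<gamma>' y) = y" using i'[of y] that(3) by blast
    moreover have "\<gamma>' y \<in> M" using y that(2) by blast
    ultimately show "y \<in> \<gamma> ` M" by (metis imageI)
  qed
  have c: "lim_Sigma A' \<alpha>' \<subseteq> carrier Y.Grp"
    unfolding Y.lim_Sigma_eq using Y.gc_in pcl_upm[OF Y.N] by blast
  have c0: "lim_Sigma_0 A' \<alpha>' \<subseteq> lim_Sigma A' \<alpha>'" and cop: "lim_Sigma_op A' \<alpha>' \<subseteq> lim_Sigma A' \<alpha>'"
    unfolding Y.lim_Sigma_eq Y.lim_Sigma_0_eq Y.lim_Sigma_op_eq using pj_NA_RG(2)[OF Y.N] by blast+
  have cK: "lim_K0 A' \<alpha>' \<subseteq> carrier Y.Grp"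
  proof
    fix y assume "y \<in> lim_K0 A' \<alpha>'"
    then obtain k X where X: "X \<in> K0 (A' k)" "y = Y.gc k X" unfolding lim_K0_def lim_union_def by blast
    have sub: "Sigma_0 (A' k) \<subseteq> carrier (dist_group (A' k))"
      unfolding Sigma_0_pcl[OF Y.N] dist_group_simps using pcl_upm[OF Y.N pj_NA_RG(2)[OF Y.N]] by blast
    have "X \<in> upm (A' k)"
      using X(1) group.generate_in_carrier[OF comm_group.axioms(2)[OF dist_group] sub] by (simp add: K0_def dist_group_simps)
    then show "y \<in> carrier Y.Grp" using X Y.gc_in by simp
  qed
  show ?thesis
    by (rule exI[of _ \<gamma>]) (use P P' bij eq c c0 cop cK in \<open>auto simp: Inv_iso_def iso_def simp del: image_subset_iff\<close>)
qed

end

section \<open>Existence and uniqueness of embeddings with prescribed classes\<close>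

text \<open>Induction on the rows. Suppose row \<open>i\<close> of \<open>x\<close> uses column
  \<open>j\<close> and that of \<open>y\<close> a later column \<open>j'\<close>. The column sum
  forces \<open>y\<close> to fill column \<open>j\<close> from an earlier row; there
  \<open>x\<close> uses the same column by induction, so \<open>x\<close> meets column
  \<open>j\<close> twice. The other case is symmetric.\<close>

lemma coupling_unique:
  fixes x y :: "nat \<Rightarrow> nat \<Rightarrow> complex"
  assumes mx: "\<And>i j s t. i < n \<Longrightarrow> j < n \<Longrightarrow> s < n \<Longrightarrow> t < n \<Longrightarrow> x i j \<noteq> 0 \<Longrightarrow> x s t \<noteq> 0 \<Longrightarrow> (s < i \<longleftrightarrow> t < j) \<and> (s = i \<longleftrightarrow> t = j)"
    and my: "\<And>i j s t. i < n \<Longrightarrow> j < n \<Longrightarrow> s < n \<Longrightarrow> t < n \<Longrightarrow> y i j \<noteq> 0 \<Longrightarrow> y s t \<noteq> 0 \<Longrightarrow> (s < i \<longleftrightarrow> t < j) \<and> (s = i \<longleftrightarrow> t = j)"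
    and r: "\<And>i. i < n \<Longrightarrow> (\<Sum>j<n. x i j) = (\<Sum>j<n. y i j)"
    and c: "\<And>j. j < n \<Longrightarrow> (\<Sum>i<n. x i j) = (\<Sum>i<n. y i j)"
    and ij: "i < n" "j < n"
  shows "x i j = y i j"
proof -
  define M where "M z \<longleftrightarrow> (\<forall>i<n. \<forall>j<n. \<forall>s<n. \<forall>t<n. z i j \<noteq> 0 \<longrightarrow> z s t \<noteq> 0 \<longrightarrow> (s < i \<longleftrightarrow> t < j) \<and> (s = i \<longleftrightarrow> t = j))"
    for z :: "nat \<Rightarrow> nat \<Rightarrow> complex"
  have Mx: "M x" unfolding M_def using mx by blast
  have My: "M y" unfolding M_def using my by blast
  have row: "(\<Sum>j<n. z i j) = z i j" if "M z"
    "i < n" "j < n" "z i j \<noteq> 0" for z :: "nat \<Rightarrow> nat \<Rightarrow> complex" and i j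
  proof -
    have "(\<Sum>t<n. z i t) = (\<Sum>t\<in>{j}. z i t)"
    proof (rule sum.mono_neutral_right)
      show "\<forall>t\<in>{..<n} - {j}. z i t = 0" using that unfolding M_def by blast
    qed (use that in auto)
    then show ?thesis by simp
  qed
  have col: "(\<Sum>i<n. z i j) = z i j" if "M z"
    "i < n" "j < n" "z i j \<noteq> 0" for z :: "nat \<Rightarrow> nat \<Rightarrow> complex" and i j
  proof -
    have "(\<Sum>t<n. z t j) = (\<Sum>t\<in>{i}. z t j)"
    proof (rule sum.mono_neutral_right)
      show "\<forall>t\<in>{..<n} - {i}. z t j = 0" using that unfolding M_def by blast
    qed (use that in auto)
    then show ?thesis by simp
  qed
  note rx = row[OF Mx] and ry = row[OF My] and cx = col[OF Mx] and cy = col[OF My]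
  have exr: "\<exists>j<n. z i j \<noteq> 0" if "(\<Sum>j<n. z i j) \<noteq> 0" for z :: "nat \<Rightarrow> nat \<Rightarrow> complex" and i
    using that by (meson lessThan_iff sum.neutral)
  have exc: "\<exists>i<n. z i j \<noteq> 0" if "(\<Sum>i<n. z i j) \<noteq> 0" for z :: "nat \<Rightarrow> nat \<Rightarrow> complex" and j
    using that by (meson lessThan_iff sum.neutral)
  have same: "j = j'" if "i < n" "j < n" "j' < n" "x i j \<noteq> 0" "y i j' \<noteq> 0" for i j j'
    using that
  proof (induction i arbitrary: j j' rule: less_induct)
    case (less i)
    show ?case
    proof (rule ccontr)
      assume "j \<noteq> j'"
      then consider "j < j'" | "j' < j" by linarith
      then show False
      proof cases
        case 1
        have "(\<Sum>i<n. y i j) \<noteq> 0" using c[of j] cx[of i j] less.prems by simp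
        then obtain i' where i': "i' < n" "y i' j \<noteq> 0" using exc by blast
        have lt: "i' < i" using my[of i j' i' j] i' less.prems 1 by blast
        have "(\<Sum>j<n. x i' j) \<noteq> 0" using r[of i'] ry[of i' j] i' less.prems by simp
        then obtain j'' where j'': "j'' < n" "x i' j'' \<noteq> 0" using exr by blast
        have "j'' = j" using less.IH[OF lt] i' j'' less.prems by blast
        then have "x i' j \<noteq> 0" using j'' by simp
        then show False using mx[of i j i' j] i' less.prems lt by blast
      next
        case 2
        have "(\<Sum>i<n. x i j') \<noteq> 0" using c[of j'] cy[of i j'] less.prems by simp
        then obtain i' where i': "i' < n" "x i' j' \<noteq> 0" using exc by blast
        have lt: "i' < i" using mx[of i j i' j'] i' less.prems 2 by blast
        have "(\<Sum>j<n. y i' j) \<noteq> 0" using r[of i'] rx[of i' j'] i' less.prems by simp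
        then obtain j'' where j'': "j'' < n" "y i' j'' \<noteq> 0" using exr by blast
        have "j' = j''" using less.IH[OF lt] i' j'' less.prems by blast
        then have "y i' j' \<noteq> 0" using j'' by simp
        then show False using my[of i j' i' j'] i' less.prems lt by blast
      qed
    qed
  qed
  show ?thesis
  proof (cases "x i j = 0")
    case False
    have "(\<Sum>j<n. y i j) \<noteq> 0" using r[of i] rx[of i j] ij False by simp
    then obtain j' where "j' < n" "y i j' \<noteq> 0" using exr by blast
    then have "y i j \<noteq> 0" using same[of i j j'] ij False by simp
    then show ?thesis using rx[OF ij False] ry[of i j] r[of i] ij by simp
  next
    case True
    show ?thesis
    proof (rule ccontr)
      assume "x i j \<noteq> y i j"
      then have y: "y i j \<noteq> 0" using True by simp
      have "(\<Sum>j<n. x i j) \<noteq> 0" using r[of i] ry[of i j] ij y by simp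
      then obtain j' where "j' < n" "x i j' \<noteq> 0" using exr by blast
      then show False using same[of i j' j] ij y True by simp
    qed
  qed
qed

text \<open>Block diagonal factors preserve the normalisation property, so regularity follows from
  \<open>normal_PR\<close>; the order is then read off the class, which is that of
  \<open>w\<close>.\<close>

lemma DA_sandwich_OPS:
  assumes N: "is_nest B" and w: "w \<in> OPS B" and x: "x \<in> DA B" and y: "y \<in> DA B"
    and xw: "adj x * x * w = w" and yw: "w * (y * adj y) = w"
  shows "x * w * y \<in> OPS B"
proof -
  have wR: "w \<in> RG B" "w \<in> FM B" "pim w" using w OPS_RG RG_FM RG_PR PR_pim by blast+
  have aw: "y * adj y * adj w = adj w" using arg_cong[OF yw, of adj] by (simp add: mult.assoc)
  have wa: "adj w * (adj x * x) = adj w" using arg_cong[OF xw, of adj] by (simp add: mult.assoc)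
  have e: "(x * w * y) * adj (x * w * y) = x * (w * adj w) * adj x"
  proof -
    have "(x * w * y) * adj (x * w * y) = x * w * (y * adj y * adj w) * adj x" by (simp add: mult.assoc)
    also have "\<dots> = x * (w * adj w) * adj x" unfolding aw by (simp only: mult.assoc)
    finally show ?thesis .
  qed
  have "x * w * y * adj (x * w * y) * (x * w * y) = x * w * ((adj w * (adj x * x)) * w) * y" unfolding e by (simp add: mult.assoc)
  also have "\<dots> = x * w * y" using wR(3) by (simp add: wa pimD mult.assoc)
  finally have pim: "pim (x * w * y)" by (simp add: pim_def)
  have F: "x * w * y \<in> FM B" using wR x y by (simp add: DA_FM)
  have D1: "x * w * y * adj (x * w * y) \<in> DA B" unfolding e
    using PR_DA(1)[OF N RG_PR[OF wR(1)]] x by (simp add: DA_mult[OF N] DA_adj[OF N])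
  have D2: "adj (x * w * y) * atm B s * (x * w * y) \<in> DA B" if "s < natoms B" for s
  proof -
    have "adj x * atm B s * x \<in> DA B" using x at_DA[OF N that] by (simp add: DA_mult[OF N] DA_adj[OF N])
    then have "adj y * (adj w * (adj x * atm B s * x) * w) * y \<in> DA B"
      using OPS_normal(2)[OF N w] y by (simp add: DA_mult[OF N] DA_adj[OF N])
    then show ?thesis by (simp add: mult.assoc)
  qed
  have "x * w * y \<in> NA B" using x y wR RG_NA by (simp add: NA_mult[OF N] DA_NA)
  then have "x * w * y \<in> RG B" using normal_PR[OF N F pim D1 D2] by (simp add: RG_def)
  then show ?thesis
    by (rule OPS_by_class[OF N _ w]) (rule DA_sandwich_cl[OF N x y wR(2) xw yw])
qed

lemma mi_OPS_transfer:
  assumes N: "is_nest A" "is_nest B" and S: "SH A B \<psi>" and u: "mi u" "blk A i j u" "mi u'" "blk A i j u'" and O: "\<psi> u \<in> OPS B"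
  shows "\<psi> u' \<in> OPS B"
  using mi_image[OF N S u] DA_sandwich_OPS[OF N(2) O] by metis

text \<open>One order preserving image per block suffices, since the other rank one elements of the
  block differ by block diagonal factors.\<close>

lemma OM_I:
  assumes N: "is_nest A" "is_nest B" and S: "SH A B \<psi>"
    and g: "\<And>i j. i \<le> j \<Longrightarrow> j < natoms A \<Longrightarrow> \<exists>u. mi u \<and> blk A i j u \<and> \<psi> u \<in> OPS B"
  shows "OM A B \<psi>"
  unfolding OM_def
proof (intro conjI allI impI S)
  fix v i j assume v: "mi v" "blk A i j v" "i \<le> j"
  obtain u where "mi u" "blk A i j u" "\<psi> u \<in> OPS B" using g[OF v(3)] blkD(2)[OF N(1) v(2)] by blast
  then show "\<psi> v \<in> OPS B" using mi_OPS_transfer[OF N S _ _ v(1,2)] by blast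
qed

text \<open>The second map has to preserve all of \<open>OPS B\<close>, because the first one does
  not send rank one elements to rank one elements in general.\<close>

lemma OM_comp_OPS:
  assumes N: "is_nest A" "is_nest B" "is_nest C" and "OM A B \<psi>" "SH B C \<chi>" "\<And>v. v \<in> OPS B \<Longrightarrow> \<chi> v \<in> OPS C"
  shows "OM A C (\<chi> \<circ> \<psi>)"
  using assms SH_comp[OF OM_SH] unfolding OM_def by auto

section \<open>Projections and unitaries of the block diagonal\<close>

lemma atm_tr_pj:
  assumes N: "is_nest B" and P: "P \<in> DA B" "pj P" and s: "s < natoms B"
  shows "pj (atm B s * P)" "P * (atm B s * P) = atm B s * P" "blk B s s (atm B s * P)"
proof -
  have c: "atm B s * P = P * atm B s" by (rule DA_comm[OF N P(1) s])
  show "pj (atm B s * P)" by (rule pj_comm_mult[OF at_pj[OF N s] P(2) c])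
  have "P * (atm B s * P) = (P * atm B s) * P" by (simp add: mult.assoc)
  then show "P * (atm B s * P) = atm B s * P" using P by (simp add: c[symmetric] mult.assoc pjD)
  show "blk B s s (atm B s * P)"
  proof (rule blkI[OF N s s])
    show "atm B s * (atm B s * P) = atm B s * P" using at_self[OF N s] by simp
    show "atm B s * P * atm B s = atm B s * P" unfolding c using at_self[OF N s] by (simp add: mult.assoc)
  qed
qed

lemma DA_equiv:
  assumes N: "is_nest B" and P: "P \<in> DA B" "pj P" and Q: "Q \<in> DA B" "pj Q"
    and eq: "\<And>s. s < natoms B \<Longrightarrow> tr (atm B s * P) = tr (atm B s * Q)"
  shows "\<exists>u\<in>DA B. u * adj u = P \<and> adj u * u = Q"
proof -
  have "\<forall>s<natoms B. \<exists>u. u * adj u = atm B s * P \<and> adj u * u = atm B s * Q"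
    using pj_equiv[OF atm_tr_pj(1)[OF N P] atm_tr_pj(1)[OF N Q] eq] by blast
  then obtain u where u: "\<And>s. s < natoms B \<Longrightarrow> u s * adj (u s) = atm B s * P" "\<And>s. s < natoms B \<Longrightarrow> adj (u s) * u s = atm B s * Q"
    by metis
  have pu: "pim (u s)" if "s < natoms B" for s using u(1)[OF that] atm_tr_pj(1)[OF N P that] pj_imp_pim by metis
  have bu: "blk B s s (u s)" if s: "s < natoms B" for s
  proof (rule blkI[OF N s s])
    have "u s = atm B s * P * u s" using u(1)[OF s] pimD(1)[OF pu[OF s]] by simp
    then show "atm B s * u s = u s" using at_self(2)[OF N s] by (metis mult.assoc)
    have "u s = u s * (atm B s * Q)" using u(2)[OF s] pimD(2)[OF pu[OF s]] by simp
    then have "u s * atm B s = u s * (atm B s * Q * atm B s)" by (metis mult.assoc)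
    also have "atm B s * Q * atm B s = atm B s * Q" by (rule blkD(4)[OF N atm_tr_pj(3)[OF N Q s]])
    also have "u s * (atm B s * Q) = u s" using u(2)[OF s] pimD(2)[OF pu[OF s]] by simp
    finally show "u s * atm B s = u s" .
  qed
  have o: "u s * adj (u t) = 0" "adj (u s) * u t = 0" if "s < natoms B" "t < natoms B" "s \<noteq> t" for s t
  proof -
    have "u s * adj (u t) = u s * (atm B s * atm B t) * adj (u t)"
      using blkD(4)[OF N bu[OF that(1)]] blkD(3)[OF N blk_adj[OF N bu[OF that(2)]]] by (metis mult.assoc)
    then show "u s * adj (u t) = 0" using at_orth(1)[OF N that] by simp
    have "adj (u s) * u t = adj (u s) * (atm B s * atm B t) * u t"
      using blkD(4)[OF N blk_adj[OF N bu[OF that(1)]]] blkD(3)[OF N bu[OF that(2)]] by (metis mult.assoc)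
    then show "adj (u s) * u t = 0" using at_orth(1)[OF N that] by simp
  qed
  have "(\<Sum>s<natoms B. u s) * adj (\<Sum>s<natoms B. u s) = (\<Sum>s<natoms B. u s * adj (u s))"
    by (rule pim_sum(2)) (use pu o in auto)
  moreover have "adj (\<Sum>s<natoms B. u s) * (\<Sum>s<natoms B. u s) = (\<Sum>s<natoms B. adj (u s) * u s)"
    by (rule pim_sum(3)) (use pu o in auto)
  moreover have "(\<Sum>s<natoms B. u s) \<in> DA B" using bu blk_DA[OF N] by (intro DA_sum) auto
  moreover have "(\<Sum>s<natoms B. atm B s * P) = P" "(\<Sum>s<natoms B. atm B s * Q) = Q"
    using expand_left[OF N] P Q DA_FM by metis+
  ultimately show ?thesis using u by (intro bexI[of _ "\<Sum>s<natoms B. u s"]) auto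
qed

lemma DA_sub:
  assumes N: "is_nest B" and R: "R \<in> DA B" "pj R"
    and r: "\<And>s. s < natoms B \<Longrightarrow> tr (atm B s * R) = of_nat (r s) \<and> d s \<le> r s"
  shows "\<exists>Q\<in>DA B. pj Q \<and> R * Q = Q \<and> (\<forall>s<natoms B. tr (atm B s * Q) = of_nat (d s))"
proof -
  have "\<forall>s<natoms B. \<exists>Q. pj Q \<and> (atm B s * R) * Q = Q \<and> tr Q = of_nat (d s)"
    using pj_sub_exists[OF atm_tr_pj(1)[OF N R]] r by blast
  then obtain Q where Q: "\<And>s. s < natoms B \<Longrightarrow> pj (Q s)" "\<And>s. s < natoms B \<Longrightarrow> (atm B s * R) * Q s = Q s"
    "\<And>s. s < natoms B \<Longrightarrow> tr (Q s) = of_nat (d s)" by metis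
  have aQ: "atm B s * Q s = Q s" if "s < natoms B" for s using Q(2)[OF that] at_self(2)[OF N that] by (metis mult.assoc)
  have Qa: "Q s * atm B s = Q s" if "s < natoms B" for s using sub_flip[OF at_pj[OF N that] Q(1)[OF that]] aQ[OF that] by simp
  have bQ: "blk B s s (Q s)" if "s < natoms B" for s using blkI[OF N that that aQ Qa] that by simp
  have RQ: "R * Q s = Q s" if "s < natoms B" for s
  proof -
    have "R * Q s = (R * (atm B s * R)) * Q s" using Q(2)[OF that] by (metis mult.assoc)
    then show ?thesis using atm_tr_pj(2)[OF N R that] Q(2)[OF that] by simp
  qed
  have o: "Q s * Q t = 0" if "s < natoms B" "t < natoms B" "s \<noteq> t" for s t
  proof -
    have "Q s * Q t = Q s * (atm B s * atm B t) * Q t" using aQ Qa that by (metis mult.assoc)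
    then show ?thesis using at_orth(1)[OF N that] by simp
  qed
  have "tr (atm B s * (\<Sum>t<natoms B. Q t)) = of_nat (d s)" if s: "s < natoms B" for s
  proof -
    have "atm B s * (\<Sum>t<natoms B. Q t) = (\<Sum>t<natoms B. if t = s then Q s else 0)"
      unfolding sum_distrib_left using s by (intro sum.cong refl) (auto simp: blk_at[OF N bQ])
    then show ?thesis using Q(3) s by (simp add: sum.delta)
  qed
  moreover have "R * (\<Sum>t<natoms B. Q t) = (\<Sum>t<natoms B. Q t)" using RQ by (simp add: sum_distrib_left)
  moreover have "pj (\<Sum>t<natoms B. Q t)" by (rule pj_sum) (use Q o in auto)
  moreover have "(\<Sum>t<natoms B. Q t) \<in> DA B" using bQ blk_DA[OF N] by (intro DA_sum) auto
  ultimately show ?thesis by blast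
qed

text \<open>Makes room for the images of the diagonal matrix units, with prescribed rank in each
  atom.\<close>

lemma DA_partition:
  assumes N: "is_nest B" and "finite X" and "R \<in> DA B" "pj R"
    and "\<And>s. s < natoms B \<Longrightarrow> tr (atm B s * R) = of_nat (r s) \<and> (\<Sum>x\<in>X. d x s) \<le> r s"
  shows "\<exists>P. (\<forall>x\<in>X. P x \<in> DA B \<and> pj (P x) \<and> R * P x = P x \<and> (\<forall>s<natoms B. tr (atm B s * P x) = of_nat (d x s)))
    \<and> (\<forall>x\<in>X. \<forall>y\<in>X. x \<noteq> y \<longrightarrow> P x * P y = 0)"
  using assms(2-)
proof (induction X arbitrary: R r rule: finite_induct)
  case (insert x F)
  have "\<exists>Q\<in>DA B. pj Q \<and> R * Q = Q \<and> (\<forall>s<natoms B. tr (atm B s * Q) = of_nat (d x s))"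
    by (rule DA_sub[OF N insert.prems(1,2), where r = r]) (use insert.prems(3) insert.hyps in fastforce)
  then obtain Q where Q: "Q \<in> DA B" "pj Q" "R * Q = Q" "\<And>s. s < natoms B \<Longrightarrow> tr (atm B s * Q) = of_nat (d x s)" by blast
  have R': "R - Q \<in> DA B" "pj (R - Q)" using insert.prems Q by (simp_all add: DA_closed pj_diff)
  have "tr (atm B s * (R - Q)) = of_nat (r s - d x s) \<and> (\<Sum>x\<in>F. d x s) \<le> r s - d x s" if "s < natoms B" for s
  proof -
    have "d x s + (\<Sum>x\<in>F. d x s) \<le> r s" using insert.prems(3)[OF that] insert.hyps by simp
    then show ?thesis using insert.prems(3)[OF that] Q(4)[OF that] by (simp add: right_diff_distrib of_nat_diff)
  qed
  from insert.IH[OF R' this] obtain P where P: "\<And>y. y \<in> F \<Longrightarrow> P y \<in> DA B \<and> pj (P y) \<and> (R - Q) * P y = P y \<and> (\<forall>s<natoms B. tr (atm B s * P y) = of_nat (d y s))"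
    "\<And>y z. y \<in> F \<Longrightarrow> z \<in> F \<Longrightarrow> y \<noteq> z \<Longrightarrow> P y * P z = 0" by blast
  have RR: "R * R = R" "Q * Q = Q" "Q * R = Q" using insert.prems(2) Q sub_flip[of R Q] by (simp_all add: pjD)
  have PQ: "R * P y = P y" "Q * P y = 0" "P y * Q = 0" if "y \<in> F" for y
  proof -
    have e: "(R - Q) * P y = P y" using P(1)[OF that] by simp
    have "R * (R - Q) = R - Q" using RR Q by (simp add: algebra_simps)
    then show "R * P y = P y" using e by (metis mult.assoc)
    have "Q * (R - Q) = 0" using RR by (simp add: algebra_simps)
    then show q: "Q * P y = 0" using e by (metis mult.assoc mult_zero_left)
    have "adj (Q * P y) = 0" using q by simp
    then show "P y * Q = 0" using P(1)[OF that] Q(2) by (simp add: pjD)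
  qed
  define P' where "P' y = (if y = x then Q else P y)" for y
  show ?case
    by (rule exI[of _ P']) (use P Q PQ insert.hyps in \<open>auto simp: P'_def\<close>)
qed auto

text \<open>In each atom the complements of the two support projections have equal trace, so they
  are linked by a block diagonal partial isometry \<open>v\<close>, and \<open>U + v\<close> is
  unitary.\<close>

lemma DA_unitary:
  assumes N: "is_nest B" and U: "U \<in> DA B" "pim U"
  shows "\<exists>W\<in>DA B. W * adj W = uno B \<and> adj W * W = uno B \<and> W * (adj U * U) = U \<and> (U * adj U) * W = U"
proof -
  define P where "P = U * adj U"
  define Q where "Q = adj U * U"
  have PQ: "P \<in> DA B" "Q \<in> DA B" "pj P" "pj Q" using U by (simp_all add: P_def Q_def DA_mult[OF N] DA_adj[OF N] pim_pj)
  have pu: "pj (uno B)" by (simp add: pj_def)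
  have q: "uno B - P \<in> DA B" "pj (uno B - P)" "uno B - Q \<in> DA B" "pj (uno B - Q)"
    using PQ uno_DA[OF N] PQ(1,2)[THEN DA_FM] by (simp_all add: DA_closed pj_diff[OF pu])
  have "tr (atm B s * P) = tr (atm B s * Q)" if "s < natoms B" for s
    using tr_comm[of "atm B s * U" "adj U"] DA_comm[OF N _ that, of "adj U"] U(1) by (simp add: P_def Q_def DA_adj[OF N] flip: mult.assoc)
  then have "tr (atm B s * (uno B - P)) = tr (atm B s * (uno B - Q))" if "s < natoms B" for s using that by (simp add: right_diff_distrib)
  from DA_equiv[OF N q this] obtain v where v: "v \<in> DA B" "v * adj v = uno B - P" "adj v * v = uno B - Q" by blast
  have pv: "pim v" using v(2) q(2) pj_imp_pim by metis
  have "P * v = P * (v * adj v) * v" "v * Q = v * ((adj v * v) * Q)" using pv by (simp_all add: pimD mult.assoc)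
  then have vP: "P * v = 0" "v * Q = 0" unfolding v(2,3) using PQ PQ(1,2)[THEN DA_FM] by (simp_all add: right_diff_distrib left_diff_distrib pjD)
  have UP: "P * U = U" "U * Q = U" "adj U * P = adj U" "Q * adj U = adj U" using U(2) by (simp_all add: P_def Q_def pimD mult.assoc)
  have vU: "adj U * v = 0" "v * adj U = 0" using vP UP(3,4) by (metis mult.assoc mult_zero_right, metis mult.assoc mult_zero_left)
  then have "adj v * U = 0" "U * adj v = 0" by (metis adj_0 adj_adj adj_mult)+
  then show ?thesis using U v vU vP UP
    by (intro bexI[of _ "U + v"]) (simp_all add: P_def[symmetric] Q_def[symmetric] distrib_left distrib_right DA_closed)
qed

text \<open>The corner at \<open>x0\<close> is carried along both systems of matrix units. The point
  is that the resulting intertwiner is block diagonal: equal classes mean that \<open>f x0 x\<close>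
  and \<open>p x0 x\<close> match the same atoms, so going back along one and forth along the other
  returns to the atom of departure.\<close>

lemma OM_unitary_equiv:
  assumes N: "is_nest A" "is_nest B" and O: "OM A B \<phi>" "OM A B \<psi>"
    and eq: "\<And>i j s t. i \<le> j \<Longrightarrow> j < natoms A \<Longrightarrow> s < natoms B \<Longrightarrow> t < natoms B \<Longrightarrow> cl B (\<phi> (gm A i j)) s t = cl B (\<psi> (gm A i j)) s t"
  shows "\<exists>u\<in>DA B. u * adj u = uno B \<and> adj u * u = uno B \<and> (\<forall>a\<in>FM A. u * \<psi> a = \<phi> a * u)"
proof -
  obtain X e where X: "unit_sys A X e" using unit_sys_ex[OF N(1)] by blast
  note u = unit_sysD[OF N(1) X]
  note F = SHD[OF OM_SH[OF O(1)]] and P = SHD[OF OM_SH[OF O(2)]]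
  \<comment> \<open>\<open>x0\<close> lies over the first atom, so that every \<open>e x0 x\<close>
    is upper triangular and has order preserving images.\<close>
  obtain x0 where x0: "x0 \<in> X" "fst x0 = 0" using u(2)[OF natoms_pos[OF N(1)]] by blast
  define f where "f x y = \<phi> (e x y)" for x y
  define p where "p x y = \<psi> (e x y)" for x y
  have fm: "f x y * f z w = (if y = z then f x w else 0)" "p x y * p z w = (if y = z then p x w else 0)"
    "adj (f x y) = f y x" "adj (p x y) = p y x" "f x y \<in> FM B" "p x y \<in> FM B"
    if "x \<in> X" "y \<in> X" "z \<in> X" "w \<in> X" for x y z w
  proof -
    have eF: "e x y \<in> FM A" "e z w \<in> FM A" using u(9) that by blast+
    show "f x y * f z w = (if y = z then f x w else 0)" "p x y * p z w = (if y = z then p x w else 0)"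
      using F(3)[OF eF] P(3)[OF eF] u(3)[OF that] F(7) P(7) by (cases "y = z"; simp add: f_def p_def)+
    show "adj (f x y) = f y x" "adj (p x y) = p y x" "f x y \<in> FM B" "p x y \<in> FM B"
      using F(1,5)[OF eF(1)] P(1,5)[OF eF(1)] u(4)[OF that(1,2)] by (simp_all add: f_def p_def)
  qed
  have OPS: "f x y \<in> OPS B" "p x y \<in> OPS B" if "x \<in> X" "y \<in> X" "fst x \<le> fst y" for x y
    using O u(5)[OF that(1,2)] u(6)[OF that(1,2)] that(3) unfolding OM_def f_def p_def by blast+
  have cle: "cl B (f x y) s t = cl B (p x y) s t" if xy: "x \<in> X" "y \<in> X" "fst x \<le> fst y" and st: "s < natoms B" "t < natoms B" for x y s t
  proof -
    have l: "fst y < natoms A" using u(8) xy by blast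
    have "cl B (f x y) s t = cl B (\<phi> (gm A (fst x) (fst y))) s t" unfolding f_def
      by (rule cl_mi_image[OF N OM_SH[OF O(1)] u(5)[OF xy(1,2)] u(6)[OF xy(1,2)] generator_props(1,2)[OF N(1) xy(3) l] st])
    also have "\<dots> = cl B (\<psi> (gm A (fst x) (fst y))) s t" by (rule eq[OF xy(3) l st])
    also have "\<dots> = cl B (p x y) s t" unfolding p_def
      by (rule cl_mi_image[OF N OM_SH[OF O(2)] generator_props(1,2)[OF N(1) xy(3) l] u(5)[OF xy(1,2)] u(6)[OF xy(1,2)] st])
    finally show ?thesis .
  qed
  have diagD: "f x x \<in> DA B" "p x x \<in> DA B" "pj (f x x)" "pj (p x x)" if "x \<in> X" for x
    using SH_DA[OF N OM_SH[OF O(1)] blk_DA[OF N(1) u(6)[OF that that]]] SH_DA[OF N OM_SH[OF O(2)] blk_DA[OF N(1) u(6)[OF that that]]]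
      SH_pj[OF OM_SH[OF O(1)] u(9)[OF that that] u(11)[OF that]] SH_pj[OF OM_SH[OF O(2)] u(9)[OF that that] u(11)[OF that]]
    by (simp_all add: f_def p_def)
  have trd: "tr (atm B s * f x x) = tr (atm B s * p x x)" if "x \<in> X" "s < natoms B" for x s
    using cle[OF that(1,1) order_refl that(2,2)] cl_diag[OF N(2) diagD(1) that(2,2)] cl_diag[OF N(2) diagD(2) that(2,2)] that diagD
    by (simp add: pjD)
  obtain u1 where u1: "u1 \<in> DA B" "u1 * adj u1 = f x0 x0" "adj u1 * u1 = p x0 x0"
    using DA_equiv[OF N(2) diagD(1)[OF x0(1)] diagD(3)[OF x0(1)] diagD(2)[OF x0(1)] diagD(4)[OF x0(1)] trd[OF x0(1)]] by blast
  have pu1: "pim u1" using u1(2) diagD(3)[OF x0(1)] pj_imp_pim by metis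
  have fu1: "f x0 x0 * u1 = u1" "u1 * p x0 x0 = u1" using pimD(1,2)[OF pu1] u1 by simp_all
  define c where "c x = f x x0 * u1 * p x0 x" for x
  have cD: "c x \<in> DA B" if x: "x \<in> X" for x
    unfolding DA_def
  proof (clarsimp, intro conjI allI impI)
    show "c x \<in> FM B" using fm(5,6) x x0 DA_FM[OF u1(1)] by (simp add: c_def)
    fix s t assume st: "s < natoms B" "t < natoms B" "s \<noteq> t"
    have x0x: "fst x0 \<le> fst x" using x0 by simp
    note po = OPS(2)[OF x0(1) x x0x]
    have fF: "f x x0 \<in> FM B" "f x0 x \<in> FM B" "p x0 x \<in> FM B" using fm(5,6) x x0 by blast+
    have "atm B s * c x * atm B t = (\<Sum>r<natoms B. (atm B s * f x x0) * atm B r * (u1 * p x0 x * atm B t))"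
      unfolding c_def using expand_mid[OF N(2), of "atm B s * f x x0" "u1 * p x0 x * atm B t"] fF st by (simp add: mult.assoc at_FM[OF N(2)])
    also have "\<dots> = 0"
    proof (intro sum.neutral ballI)
      fix r assume "r \<in> {..<natoms B}"
      then have r: "r < natoms B" by simp
      have "atm B r * (u1 * p x0 x * atm B t) = u1 * (atm B r * p x0 x * atm B t)"
        using DA_comm2[OF N(2) u1(1) r] by (simp add: mult.assoc)
      \<comment> \<open>Otherwise \<open>p x0 x\<close> would match atom \<open>r\<close> with both
        \<open>s\<close> and \<open>t\<close>.\<close>
      moreover have "atm B s * f x x0 * atm B r = 0 \<or> atm B r * p x0 x * atm B t = 0"
      proof (rule ccontr)
        assume "\<not> ?thesis"
        then have ne: "atm B s * f x x0 * atm B r \<noteq> 0" "atm B r * p x0 x * atm B t \<noteq> 0" by auto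
        have "adj (atm B s * f x x0 * atm B r) = atm B r * f x0 x * atm B s"
          using st r fm(3)[OF x x0(1) x x] by (simp add: at_adj[OF N(2)] mult.assoc)
        then have "atm B r * f x0 x * atm B s \<noteq> 0" using ne(1) by (metis adj_eq_0)
        then have "cl B (f x0 x) r s \<noteq> 0" using cl_0_iff[OF N(2) r st(1)] by blast
        then have "atm B r * p x0 x * atm B s \<noteq> 0" using cl_0_iff[OF N(2) r st(1)] cle[OF x0(1) x x0x r st(1)] by simp
        then show False using OPS_match(2)[OF N(2) po r st(2) r st(1) ne(2)] st(3) by simp
      qed
      ultimately show "(atm B s * f x x0) * atm B r * (u1 * p x0 x * atm B t) = 0"
      proof (elim disjE)
        assume "atm B s * f x x0 * atm B r = 0" then show ?thesis by simp
      next
        assume a: "atm B r * p x0 x * atm B t = 0" and b: "atm B r * (u1 * p x0 x * atm B t) = u1 * (atm B r * p x0 x * atm B t)"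
        have "(atm B s * f x x0) * atm B r * (u1 * p x0 x * atm B t) = (atm B s * f x x0) * (atm B r * (u1 * p x0 x * atm B t))" by (simp add: mult.assoc)
        then show ?thesis using a b by simp
      qed
    qed
    finally show "atm B s * c x * atm B t = 0" .
  qed
  have cc: "c x * adj (c y) = (if x = y then f x x else 0)" "adj (c x) * c y = (if x = y then p x x else 0)" if xy: "x \<in> X" "y \<in> X" for x y
  proof -
    have "c x * adj (c y) = f x x0 * u1 * (p x0 x * p y x0) * adj u1 * f x0 y"
      using fm(3,4) xy x0 by (simp add: c_def mult.assoc)
    also have "\<dots> = (if x = y then f x x0 * (u1 * p x0 x0 * adj u1) * f x0 x else 0)"
      using fm(2)[of x0 x y x0] xy x0 by (auto simp: mult.assoc)
    finally show "c x * adj (c y) = (if x = y then f x x else 0)"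
      using fm(1)[of x x0 x0 x0] fm(1)[of x x0 x0 x] xy x0 by (cases "x = y") (simp_all add: fu1 u1)
    have "adj (c x) * c y = p x x0 * adj u1 * (f x0 x * f y x0) * u1 * p x0 y"
      using fm(3,4) xy x0 by (simp add: c_def mult.assoc)
    also have "\<dots> = (if x = y then p x x0 * (adj u1 * (f x0 x0 * u1)) * p x0 x else 0)"
      using fm(1)[of x0 x y x0] xy x0 by (auto simp: mult.assoc)
    finally show "adj (c x) * c y = (if x = y then p x x else 0)"
      using fm(2)[of x x0 x0 x0] fm(2)[of x x0 x0 x] xy x0 by (cases "x = y") (simp_all add: fu1 u1)
  qed
  define U where "U = (\<Sum>x\<in>X. c x)"
  have UD: "U \<in> DA B" unfolding U_def by (rule DA_sum[OF cD])
  have UU: "U * adj U = \<phi> (uno A)" "adj U * U = \<psi> (uno A)"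
  proof -
    have "U * adj U = (\<Sum>x\<in>X. c x * adj (c x))" unfolding U_def adj_sum by (rule orth_sum_sum[OF u(1)]) (simp add: cc)
    also have "\<dots> = (\<Sum>x\<in>X. \<phi> (e x x))" by (intro sum.cong refl) (simp add: cc f_def)
    also have "\<dots> = \<phi> (\<Sum>x\<in>X. e x x)" by (rule SH_sum[OF OM_SH[OF O(1)], symmetric]) (simp add: u)
    finally show "U * adj U = \<phi> (uno A)" by (simp add: u)
    have "adj U * U = (\<Sum>x\<in>X. adj (c x) * c x)" unfolding U_def adj_sum by (rule orth_sum_sum[OF u(1)]) (simp add: cc)
    also have "\<dots> = (\<Sum>x\<in>X. \<psi> (e x x))" by (intro sum.cong refl) (simp add: cc p_def)
    also have "\<dots> = \<psi> (\<Sum>x\<in>X. e x x)" by (rule SH_sum[OF OM_SH[OF O(2)], symmetric]) (simp add: u)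
    finally show "adj U * U = \<psi> (uno A)" by (simp add: u)
  qed
  have pmU: "pim U" using SH_pj[OF OM_SH[OF O(1)] FM_simps(2)] UU(1) pj_imp_pim by (simp add: pj_def)
  \<comment> \<open>The embeddings may fail to be unital, so \<open>U\<close> only links their
    supports; it is completed to a unitary.\<close>
  obtain W where W: "W \<in> DA B" "W * adj W = uno B" "adj W * W = uno B" "W * \<psi> (uno A) = U" "\<phi> (uno A) * W = U"
    using DA_unitary[OF N(2) UD pmU] UU by auto
  have "W * \<psi> a = \<phi> a * W" if a: "a \<in> FM A" for a
  proof -
    have cxy: "U * p x y = f x y * U" if "x \<in> X" "y \<in> X" for x y
    proof -
      have "U * p x y = (\<Sum>z\<in>X. if z = x then f x x0 * u1 * p x0 y else 0)"
        unfolding U_def sum_distrib_right c_def using fm(2)[of x0 _ x y] that x0 by (intro sum.cong refl) (auto simp: mult.assoc)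
      moreover have "f x y * U = (\<Sum>z\<in>X. if z = y then f x x0 * u1 * p x0 y else 0)"
        unfolding U_def sum_distrib_left c_def
      proof (intro sum.cong refl)
        fix z assume z: "z \<in> X"
        have "f x y * (f z x0 * u1 * p x0 z) = (f x y * f z x0) * u1 * p x0 z" by (simp add: mult.assoc)
        then show "f x y * (f z x0 * u1 * p x0 z) = (if z = y then f x x0 * u1 * p x0 y else 0)"
          using fm(1)[of x y z x0] that z x0 by auto
      qed
      ultimately show ?thesis using that u(1) by (simp add: sum.delta)
    qed
    have e: "\<psi> a = (\<Sum>x\<in>X. \<Sum>y\<in>X. tr (a * e y x) \<odot> p x y)" "\<phi> a = (\<Sum>x\<in>X. \<Sum>y\<in>X. tr (a * e y x) \<odot> f x y)"
      by (subst unit_sys_expand[OF N(1) X a], simp add: SH_sum[OF OM_SH[OF O(2)]] SH_sum[OF OM_SH[OF O(1)]] F P u f_def p_def)+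
    have 1: "U * \<psi> a = \<phi> a * U" unfolding e sum_distrib_left sum_distrib_right
      by (intro sum.cong refl) (simp add: cxy)
    have "\<psi> (uno A) * \<psi> a = \<psi> a" "\<phi> a * \<phi> (uno A) = \<phi> a" using F(3)[OF a, of "uno A"] P(3)[of "uno A" a] a by simp_all
    then show ?thesis using 1 W(4,5) by (metis mult.assoc)
  qed
  then show ?thesis using W by blast
qed

text \<open>The given \<open>w i j\<close> need not multiply like matrix units. The construction
  uses those of the first row, moved by block diagonal equivalences to a common range
  \<open>Fp\<close> and to disjoint initial projections \<open>P x\<close>. The products
  \<open>adj (V x) * V y\<close> are matrix units, and their classes are the prescribed ones by
  \<open>coupling_unique\<close>, since both sides are increasing matchings with the same
  marginals.\<close>

lemma OM_exists:
  assumes N: "is_nest A" "is_nest B"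
    and w: "\<And>i j. i \<le> j \<Longrightarrow> j < natoms A \<Longrightarrow> w i j \<in> OPS B"
    and wd: "\<And>i. i < natoms A \<Longrightarrow> w i i \<in> DA B"
    and wf: "\<And>i j s. i \<le> j \<Longrightarrow> j < natoms A \<Longrightarrow> s < natoms B \<Longrightarrow> tr (atm B s * (w i j * adj (w i j))) = tr (atm B s * (w i i * adj (w i i)))"
    and wi: "\<And>i j s. i \<le> j \<Longrightarrow> j < natoms A \<Longrightarrow> s < natoms B \<Longrightarrow> tr (atm B s * (adj (w i j) * w i j)) = tr (atm B s * (w j j * adj (w j j)))"
    and R: "R \<in> DA B" "pj R"
    and dim: "\<And>s. s < natoms B \<Longrightarrow> (\<Sum>i<natoms A. tr (atm A i) * tr (atm B s * (w i i * adj (w i i)))) = tr (atm B s * R)"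
  shows "\<exists>\<phi>. OM A B \<phi> \<and> (\<forall>i j s t. i \<le> j \<longrightarrow> j < natoms A \<longrightarrow> s < natoms B \<longrightarrow> t < natoms B \<longrightarrow> cl B (\<phi> (gm A i j)) s t = cl B (w i j) s t)"
proof -
  obtain X e where X: "unit_sys A X e" using unit_sys_ex[OF N(1)] by blast
  note u = unit_sysD[OF N(1) X]
  have wR: "w i j \<in> RG B" "w i j \<in> PR B" "w i j \<in> FM B" "pim (w i j)" if "i \<le> j" "j < natoms A" for i j
    using w[OF that] OPS_RG RG_PR RG_FM PR_pim by blast+
  have "\<exists>n. tr (atm B s * (w i i * adj (w i i))) = of_nat n" if "i < natoms A" "s < natoms B" for i s
    using pj_tr_nat[OF atm_tr_pj(1)[OF N(2) PR_DA(1)[OF N(2) wR(2)] pim_pj(1)[OF wR(4)] that(2)]] that by blast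
  then obtain D where D: "\<And>i s. i < natoms A \<Longrightarrow> s < natoms B \<Longrightarrow> tr (atm B s * (w i i * adj (w i i))) = of_nat (D i s)" by metis
  have "\<exists>n. tr (atm B s * R) = of_nat n" if "s < natoms B" for s
    using pj_tr_nat[OF atm_tr_pj(1)[OF N(2) R that]] .
  then obtain r where r: "\<And>s. s < natoms B \<Longrightarrow> tr (atm B s * R) = of_nat (r s)" by metis
  \<comment> \<open>Each atom contributes as many diagonal units as its dimension, so
    \<open>dim\<close> says that the required ranks fill \<open>R\<close> exactly.\<close>
  have sumD: "(\<Sum>x\<in>X. D (fst x) s) = r s" if s: "s < natoms B" for s
  proof -
    have tri: "tr (atm A i) = (\<Sum>x\<in>X. if fst x = i then 1 else 0)" if i: "i < natoms A" for i
    proof -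
      have "atm A i = atm A i * (\<Sum>x\<in>X. e x x)" unfolding u(7) using i by (simp add: at_FM[OF N(1)])
      also have "\<dots> = (\<Sum>x\<in>X. if fst x = i then e x x else 0)"
        unfolding sum_distrib_left
      proof (intro sum.cong refl)
        fix x assume x: "x \<in> X"
        show "atm A i * e x x = (if fst x = i then e x x else 0)"
          using blk_at(1)[OF N(1) u(6)[OF x x] i i] by auto
      qed
      finally have "tr (atm A i) = (\<Sum>x\<in>X. tr (if fst x = i then e x x else 0))" by (metis tr_sum)
      also have "\<dots> = (\<Sum>x\<in>X. if fst x = i then 1 else 0)" using u(10) by (intro sum.cong refl) auto
      finally show ?thesis .
    qed
    have "(of_nat (\<Sum>x\<in>X. D (fst x) s) :: complex) = (\<Sum>x\<in>X. \<Sum>i<natoms A. if i = fst x then of_nat (D i s) else 0)"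
      using u(8) by (simp add: sum.delta)
    also have "\<dots> = (\<Sum>i<natoms A. \<Sum>x\<in>X. if i = fst x then of_nat (D i s) else 0)" by (rule sum.swap)
    also have "\<dots> = (\<Sum>i<natoms A. tr (atm A i) * tr (atm B s * (w i i * adj (w i i))))"
      using D s by (intro sum.cong refl) (auto simp: tri sum_distrib_right intro!: sum.cong)
    also have "\<dots> = of_nat (r s)" using dim[OF s] r[OF s] by simp
    finally show ?thesis by (simp only: of_nat_eq_iff)
  qed
  have "\<exists>P. (\<forall>x\<in>X. P x \<in> DA B \<and> pj (P x) \<and> R * P x = P x \<and> (\<forall>s<natoms B. tr (atm B s * P x) = of_nat (D (fst x) s)))
    \<and> (\<forall>x\<in>X. \<forall>y\<in>X. x \<noteq> y \<longrightarrow> P x * P y = 0)"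
    by (rule DA_partition[OF N(2) u(1) R, of r]) (simp add: r sumD)
  then obtain P where P: "\<And>x. x \<in> X \<Longrightarrow> P x \<in> DA B \<and> pj (P x) \<and> (\<forall>s<natoms B. tr (atm B s * P x) = of_nat (D (fst x) s))"
    "\<And>x y. x \<in> X \<Longrightarrow> y \<in> X \<Longrightarrow> x \<noteq> y \<Longrightarrow> P x * P y = 0"
    by blast
  define Fp where "Fp = w 0 0 * adj (w 0 0)"
  have n0: "0 < natoms A" by (rule natoms_pos[OF N(1)])
  have FpD: "Fp \<in> DA B" "pj Fp" unfolding Fp_def using PR_DA(1)[OF N(2) wR(2)[OF le0 n0]] pim_pj(1)[OF wR(4)[OF le0 n0]] by blast+
  have "\<exists>V. V \<in> OPS B \<and> V * adj V = Fp \<and> adj V * V = P x \<and> (\<forall>s<natoms B. \<forall>t<natoms B. cl B V s t = cl B (w 0 (fst x)) s t)"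
    if x: "x \<in> X" for x
  proof -
    define v where "v = w 0 (fst x)"
    have l: "fst x < natoms A" using u(8)[OF x] .
    have v: "v \<in> OPS B" "v \<in> FM B" "pim v" "v \<in> PR B" unfolding v_def using w[OF le0 l] wR[OF le0 l] by blast+
    have "\<exists>a\<in>DA B. a * adj a = Fp \<and> adj a * a = v * adj v"
      by (rule DA_equiv[OF N(2) FpD PR_DA(1)[OF N(2) v(4)] pim_pj(1)[OF v(3)]]) (use wf[of 0 "fst x"] l in \<open>simp add: v_def Fp_def\<close>)
    then obtain a where a: "a \<in> DA B" "a * adj a = Fp" "adj a * a = v * adj v" by blast
    have "\<exists>b\<in>DA B. b * adj b = adj v * v \<and> adj b * b = P x"
      by (rule DA_equiv[OF N(2) PR_DA(2)[OF N(2) v(4)] pim_pj(2)[OF v(3)]]) (use P(1)[OF x] wi[of 0 "fst x"] l D in \<open>auto simp: v_def\<close>)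
    then obtain b where b: "b \<in> DA B" "b * adj b = adj v * v" "adj b * b = P x" by blast
    note pv = pimD[OF v(3)]
    have pab: "pim a" "pim b" using a(2) b(3) FpD P(1)[OF x] pj_mult_adj_iff by metis+
    have aw: "adj a * a * v = v" "v * (b * adj b) = v" using a b pv by simp_all
    have "(a * v * b) * adj (a * v * b) = a * (v * (b * adj b) * adj v) * adj a" by (simp add: mult.assoc)
    also have "\<dots> = a * (adj a * a) * adj a" by (simp add: aw a(3))
    also have "\<dots> = Fp" using pimD[OF pab(1)] a(2) by (simp add: mult.assoc)
    finally have 1: "(a * v * b) * adj (a * v * b) = Fp" .
    have "adj (a * v * b) * (a * v * b) = adj b * (adj v * (adj a * a * v)) * b" by (simp add: mult.assoc)
    also have "\<dots> = adj b * (b * adj b) * b" by (simp add: aw b(2))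
    also have "\<dots> = P x" using pimD[OF pab(2)] b(3) by (simp add: mult.assoc)
    finally have 2: "adj (a * v * b) * (a * v * b) = P x" .
    show ?thesis
      by (rule exI[of _ "a * v * b"])
        (use DA_sandwich_OPS[OF N(2) v(1) a(1) b(1) aw] DA_sandwich_cl[OF N(2) a(1) b(1) v(2) aw] 1 2 in \<open>simp add: v_def\<close>)
  qed
  then obtain V where V: "\<And>x. x \<in> X \<Longrightarrow> V x \<in> OPS B" "\<And>x. x \<in> X \<Longrightarrow> V x * adj (V x) = Fp" "\<And>x. x \<in> X \<Longrightarrow> adj (V x) * V x = P x"
    "\<And>x s t. x \<in> X \<Longrightarrow> s < natoms B \<Longrightarrow> t < natoms B \<Longrightarrow> cl B (V x) s t = cl B (w 0 (fst x)) s t" by metis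
  have VF: "V x \<in> FM B" "pim (V x)" if "x \<in> X" for x using V(1)[OF that] OPS_RG RG_PR RG_FM PR_pim by blast+
  have VV: "V x * adj (V y) = (if x = y then Fp else 0)" if "x \<in> X" "y \<in> X" for x y
  proof -
    have "V x * adj (V y) = V x * (adj (V x) * V x) * ((adj (V y) * V y) * adj (V y))" using pimD[OF VF(2)] that by (simp add: mult.assoc)
    also have "\<dots> = V x * (P x * P y) * adj (V y)" using V(3) that by (simp add: mult.assoc)
    finally show ?thesis using P(2)[OF that] V(2)[OF that(1)] by auto
  qed
  have FpV: "Fp * V x = V x" if "x \<in> X" for x using pimD(1)[OF VF(2)[OF that]] V(2)[OF that] by simp
  define E where "E x y = adj (V x) * V y" for x y
  have EE: "E x y * E z v = (if y = z then E x v else 0)" if "x \<in> X" "y \<in> X" "z \<in> X" "v \<in> X" for x y z v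
  proof -
    have "E x y * E z v = adj (V x) * (V y * adj (V z)) * V v" by (simp add: E_def mult.assoc)
    then show ?thesis using VV[OF that(2,3)] FpV[OF that(4)] by (simp add: E_def mult.assoc)
  qed
  have Ea: "adj (E x y) = E y x" for x y by (simp add: E_def)
  have EF: "E x y \<in> FM B" if "x \<in> X" "y \<in> X" for x y using VF that by (simp add: E_def)
  have Ecl: "E x y \<in> OPS B \<and> (\<forall>s<natoms B. \<forall>t<natoms B. cl B (E x y) s t = cl B (w (fst x) (fst y)) s t)"
    if xy: "x \<in> X" "y \<in> X" "fst x \<le> fst y" for x y
  proof -
    have l: "fst y < natoms A" using u(8) xy by blast
    define v where "v = w (fst x) (fst y)"
    have v: "v \<in> OPS B" "v \<in> RG B" "v \<in> FM B" using w wR xy l by (auto simp: v_def)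
    have EEs: "E x y * adj (E x y) = P x" "adj (E x y) * E x y = P y" using EE Ea xy V(3) by (simp_all add: E_def[of x x] E_def[of y y])
    have pE: "pim (E x y)" using EEs(1) P(1)[OF xy(1)] pj_imp_pim by metis
    have "E x y \<in> PR B"
    proof (rule normal_PR[OF N(2) EF[OF xy(1,2)] pE])
      show "E x y * adj (E x y) \<in> DA B" using EEs P xy by simp
      fix s assume s: "s < natoms B"
      have "adj (E x y) * atm B s * E x y = adj (V y) * (V x * atm B s * adj (V x)) * V y" by (simp add: E_def mult.assoc)
      then show "adj (E x y) * atm B s * E x y \<in> DA B"
        using OPS_normal(2)[OF N(2) V(1)[OF xy(2)] OPS_normal(1)[OF N(2) V(1)[OF xy(1)] at_DA[OF N(2) s]]] by simp
    qed
    \<comment> \<open>A nonzero block of the product passes through an atom matched by both factors.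
      Composites of increasing matchings are increasing, which is the hypothesis of
      \<open>coupling_unique\<close>.\<close>
    have mid: "\<exists>q<natoms B. atm B q * V x * atm B s \<noteq> 0 \<and> atm B q * V y * atm B t \<noteq> 0"
      if st: "s < natoms B" "t < natoms B" "atm B s * E x y * atm B t \<noteq> 0" for s t
    proof (rule ccontr)
      assume no: "\<not> ?thesis"
      have "atm B s * E x y * atm B t = (\<Sum>q<natoms B. (atm B s * adj (V x)) * atm B q * (V y * atm B t))"
        unfolding E_def using expand_mid[OF N(2), of "atm B s * adj (V x)" "V y * atm B t"] VF xy st by (simp add: mult.assoc at_FM[OF N(2)])
      also have "\<dots> = (\<Sum>q<natoms B. adj (atm B q * V x * atm B s) * (atm B q * V y * atm B t))"
        using st by (intro sum.cong refl) (simp add: at_adj[OF N(2)] mult.assoc at_self[OF N(2)])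
      also have "\<dots> = 0" by (intro sum.neutral) (use no in \<open>auto simp del: adj_mult\<close>)
      finally show False using st by simp
    qed
    have clE: "cl B (E x y) s t = cl B v s t" if "s < natoms B" "t < natoms B" for s t
    proof (rule coupling_unique[where n = "natoms B", OF _ _ _ _ that])
      fix i j s t assume st: "i < natoms B" "j < natoms B" "s < natoms B" "t < natoms B"
      { assume ne: "cl B (E x y) i j \<noteq> 0" "cl B (E x y) s t \<noteq> 0"
        have "atm B i * E x y * atm B j \<noteq> 0" "atm B s * E x y * atm B t \<noteq> 0"
          using ne cl_0_iff[OF N(2) st(1,2)] cl_0_iff[OF N(2) st(3,4)] by blast+
        then obtain q q' where q: "q < natoms B" "q' < natoms B" "atm B q * V x * atm B i \<noteq> 0" "atm B q * V y * atm B j \<noteq> 0"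
          "atm B q' * V x * atm B s \<noteq> 0" "atm B q' * V y * atm B t \<noteq> 0" using mid st by meson
        show "(s < i \<longleftrightarrow> t < j) \<and> (s = i \<longleftrightarrow> t = j)"
          using OPS_match[OF N(2) V(1)[OF xy(1)] q(1) st(1) q(2) st(3) q(3,5)] OPS_match[OF N(2) V(1)[OF xy(2)] q(1) st(2) q(2) st(4) q(4,6)]
          by blast }
      { assume ne: "cl B v i j \<noteq> 0" "cl B v s t \<noteq> 0"
        then have ne': "atm B i * v * atm B j \<noteq> 0" "atm B s * v * atm B t \<noteq> 0"
          using cl_0_iff[OF N(2) st(1,2)] cl_0_iff[OF N(2) st(3,4)] by blast+
        show "(s < i \<longleftrightarrow> t < j) \<and> (s = i \<longleftrightarrow> t = j)"
          using OPS_match[OF N(2) v(1) st ne'] by blast }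
    next
      fix i assume i: "i < natoms B"
      show "(\<Sum>j<natoms B. cl B (E x y) i j) = (\<Sum>j<natoms B. cl B v i j)"
        using cl_sum_row[OF N(2) EF[OF xy(1,2)] i] cl_sum_row[OF N(2) v(3) i] EEs P(1)[OF xy(1)] i wf[OF xy(3) l i] D[of "fst x" i] u(8)[OF xy(1)]
        by (simp add: v_def)
      show "(\<Sum>j<natoms B. cl B (E x y) j i) = (\<Sum>j<natoms B. cl B v j i)"
        using cl_sum_col[OF N(2) EF[OF xy(1,2)] i] cl_sum_col[OF N(2) v(3) i] EEs P(1)[OF xy(2)] i wi[OF xy(3) l i] D[of "fst y" i] l
        by (simp add: v_def)
    qed
    have "E x y \<in> NA B" unfolding NA_def
    proof (clarsimp simp: EF[OF xy(1,2)])
      fix s t assume st: "s < natoms B" "t < s"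
      then have "cl B v s t = 0" using RG_NA[OF v(2)] by (simp add: NA_def cl_def)
      then show "atm B s * E x y * atm B t = 0" using clE[of s t] cl_0_iff[OF N(2), of s t "E x y"] st by simp
    qed
    then have "E x y \<in> RG B" using \<open>E x y \<in> PR B\<close> by (simp add: RG_def)
    then show ?thesis using OPS_by_class[OF N(2) _ v(1)] clE by (simp add: v_def)
  qed
  \<comment> \<open>The linear extension of \<open>e x y \<mapsto> E x y\<close>; the coefficient of
    \<open>e x y\<close> in \<open>a\<close> is \<open>tr (a * e y x)\<close>.\<close>
  define \<phi> where "\<phi> a = (\<Sum>x\<in>X. \<Sum>y\<in>X. tr (a * e y x) \<odot> E x y)" for a
  have fe: "\<phi> (e x y) = E x y" if xy: "x \<in> X" "y \<in> X" for x y
  proof -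
    have "\<phi> (e x y) = (\<Sum>z\<in>X. \<Sum>v\<in>X. if v = y then (if z = x then E z v else 0) else 0)"
      unfolding \<phi>_def using xy u(3,10) by (intro sum.cong refl) auto
    also have "\<dots> = E x y" using xy u(1) by (simp add: sum.delta)
    finally show ?thesis .
  qed
  have add: "\<phi> (a + b) = \<phi> a + \<phi> b" for a b by (simp add: \<phi>_def distrib_right scl_add_left sum.distrib)
  have scl: "\<phi> (c \<odot> a) = c \<odot> \<phi> a" for c a by (simp add: \<phi>_def scl_sum)
  have sum: "\<phi> (sum g S) = (\<Sum>x\<in>S. \<phi> (g x))" for g :: "nat \<times> nat \<Rightarrow> fmat" and S
    by (induction S rule: infinite_finite_induct) (simp_all add: add scl[of 0, simplified])
  have mul1: "\<phi> (e x y * b) = E x y * \<phi> b" if "x \<in> X" "y \<in> X" "b \<in> FM A" for x y b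
  proof -
    have m: "\<phi> (e x y * e z v) = E x y * E z v" if "z \<in> X" "v \<in> X" for z v
      using u(3) EE fe scl[of 0 0] \<open>x \<in> X\<close> \<open>y \<in> X\<close> that by auto
    have "\<phi> (e x y * b) = \<phi> (\<Sum>z\<in>X. \<Sum>v\<in>X. tr (b * e v z) \<odot> (e x y * e z v))"
      by (subst unit_sys_expand[OF N(1) X that(3)]) (simp add: sum_distrib_left)
    also have "\<dots> = E x y * \<phi> b" by (simp add: sum scl m \<phi>_def[of b] sum_distrib_left cong: sum.cong)
    finally show ?thesis .
  qed
  have mul: "\<phi> (a * b) = \<phi> a * \<phi> b" if ab: "a \<in> FM A" "b \<in> FM A" for a b
  proof -
    have "\<phi> (a * b) = \<phi> (\<Sum>x\<in>X. \<Sum>y\<in>X. tr (a * e y x) \<odot> (e x y * b))"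
      by (subst unit_sys_expand[OF N(1) X ab(1)]) (simp add: sum_distrib_right)
    also have "\<dots> = \<phi> a * \<phi> b" by (simp add: sum scl mul1 ab \<phi>_def[of a] sum_distrib_right cong: sum.cong)
    finally show ?thesis .
  qed
  have "\<phi> a \<in> NA B" if a: "a \<in> NA A" for a
    unfolding \<phi>_def
  proof (intro NA_sum)
    fix x y assume xy: "x \<in> X" "y \<in> X"
    show "tr (a * e y x) \<odot> E x y \<in> NA B"
    proof (cases "fst x \<le> fst y")
      case True
      then show ?thesis using Ecl[OF xy] OPS_RG RG_NA NA_closed by blast
    next
      case False
      have e1: "a * e y x * e x x = a * e y x" using u(3)[of y x x x] xy by (simp add: mult.assoc)
      have "tr (a * e y x) = tr (e x x * (a * e y x))" using tr_comm[of "a * e y x" "e x x"] unfolding e1 .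
      also have "e x x * (a * e y x) = e x x * (atm A (fst x) * a * atm A (fst y)) * e y x"
        using blkD(4)[OF N(1) u(6)[OF xy(1,1)]] blkD(3)[OF N(1) u(6)[OF xy(2,1)]] by (metis mult.assoc)
      also have "atm A (fst x) * a * atm A (fst y) = 0" using a False u(8)[OF xy(1)] by (simp add: NA_def)
      finally show ?thesis by (simp add: NA_closed)
    qed
  qed
  moreover have "\<phi> a \<in> FM B" for a unfolding \<phi>_def using EF by simp
  moreover have "\<phi> (adj a) = adj (\<phi> a)" for a
  proof -
    have "tr (adj a * e y x) = cnj (tr (a * e x y))" if "x \<in> X" "y \<in> X" for x y
      using tr_adj[of "a * e x y"] u(4)[OF that] tr_comm[of "e y x" "adj a"] by simp
    then have "\<phi> (adj a) = (\<Sum>x\<in>X. \<Sum>y\<in>X. cnj (tr (a * e x y)) \<odot> E x y)" by (simp add: \<phi>_def)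
    also have "\<dots> = (\<Sum>y\<in>X. \<Sum>x\<in>X. cnj (tr (a * e x y)) \<odot> E x y)" by (rule sum.swap)
    also have "\<dots> = adj (\<phi> a)" by (simp add: \<phi>_def Ea)
    finally show ?thesis .
  qed
  ultimately have S: "SH A B \<phi>" unfolding SH_def using mul add scl by blast
  have OM: "OM A B \<phi>"
  proof (rule OM_I[OF N S])
    fix i j assume ij: "i \<le> j" "j < natoms A"
    obtain x y where xy: "x \<in> X" "fst x = i" "y \<in> X" "fst y = j" using u(2)[of i] u(2)[of j] ij by auto
    show "\<exists>u. mi u \<and> blk A i j u \<and> \<phi> u \<in> OPS B"
      using u(5,6)[OF xy(1,3)] fe[OF xy(1,3)] Ecl[OF xy(1,3)] xy ij by (intro exI[of _ "e x y"]) simp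
  qed
  have "cl B (\<phi> (gm A i j)) s t = cl B (w i j) s t" if ij: "i \<le> j" "j < natoms A" and st: "s < natoms B" "t < natoms B" for i j s t
  proof -
    obtain x y where xy: "x \<in> X" "fst x = i" "y \<in> X" "fst y = j" using u(2)[of i] u(2)[of j] ij by auto
    have "cl B (\<phi> (gm A i j)) s t = cl B (\<phi> (e x y)) s t"
      using cl_mi_image[OF N S generator_props(1,2)[OF N(1) ij] u(5)[OF xy(1,3)] _ st] u(6)[OF xy(1,3)] xy by simp
    then show ?thesis using fe[OF xy(1,3)] Ecl[OF xy(1,3)] xy ij st by simp
  qed
  then show ?thesis using OM by blast
qed

section \<open>Isomorphic invariants come from intertwined systems\<close>

text \<open>Agreement with \<open>\<gamma>\<close> is demanded in the limit group only; agreement at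
  a level costs a further system map.\<close>

definition lifts :: "(nat \<Rightarrow> nest) \<Rightarrow> (nat \<Rightarrow> complex mat \<Rightarrow> complex mat) \<Rightarrow> (nat \<Rightarrow> nest) \<Rightarrow> (nat \<Rightarrow> complex mat \<Rightarrow> complex mat)
    \<Rightarrow> ((nat \<times> int mat) set \<Rightarrow> (nat \<times> int mat) set) \<Rightarrow> nat \<Rightarrow> nat \<Rightarrow> (fmat \<Rightarrow> fmat) \<Rightarrow> bool" where
  "lifts A \<alpha> A' \<alpha>' \<gamma> k m \<phi> \<longleftrightarrow> (\<forall>v\<in>RG (A k). \<gamma> (dlim_in (Gsets A) (Gmaps A \<alpha>) k (pcl (A k) v)) =
     dlim_in (Gsets A') (Gmaps A' \<alpha>') m (pcl (A' m) (\<phi> v)))"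

lemma pcl_eqI:
  assumes "is_nest A" "v \<in> RG A" "w \<in> RG A" "\<And>i j. i \<le> j \<Longrightarrow> j < natoms A \<Longrightarrow> cl A v i j = cl A w i j"
  shows "pcl A v = pcl A w"
  by (rule upm_eqI[OF pcl_upm pcl_upm]) (use assms in \<open>auto simp: pcl_cl\<close>)

lemma zero_RG: "is_nest A \<Longrightarrow> 0 \<in> RG A"
  by (simp add: RG_def PR_def NA_closed)

lemma pcl_0: "is_nest A \<Longrightarrow> pcl A 0 = 0\<^sub>m (natoms A) (natoms A)"
  by (rule upm_eqI[OF pcl_upm upm_closed(3)]) (auto simp: zero_RG pcl_cl cl_def)

text \<open>Induction on the rank: the class of a generator is added in each step.\<close>

lemma RG_induct:
  assumes N: "is_nest A" and v: "v \<in> RG A" and P0: "P (0\<^sub>m (natoms A) (natoms A))"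
    and PS: "\<And>X i j. i \<le> j \<Longrightarrow> j < natoms A \<Longrightarrow> X \<in> upm A \<Longrightarrow> P X \<Longrightarrow> P (pcl A (gm A i j) + X)"
  shows "P (pcl A v)"
proof -
  obtain K :: "(nat \<times> nat \<times> nat) set" and u I J where K: "finite K" "v = sum u K"
    "\<And>k. k \<in> K \<Longrightarrow> mi (u k) \<and> blk A (I k) (J k) (u k) \<and> I k \<le> J k"
    "\<And>k l. k \<in> K \<Longrightarrow> l \<in> K \<Longrightarrow> k \<noteq> l \<Longrightarrow> u k * adj (u l) = 0 \<and> adj (u k) * u l = 0"
    using RG_decomp[OF N v] by metis
  have "P (pcl A (sum u K))" using K(1,3,4)
  proof (induction K rule: finite_induct)
    case empty
    then show ?case using P0 by (simp add: pcl_0[OF N])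
  next
    case (insert x F)
    have f: "finite (insert x F)" using insert.hyps by simp
    have F: "\<And>k. k \<in> F \<Longrightarrow> mi (u k) \<and> blk A (I k) (J k) (u k) \<and> I k \<le> J k"
      "\<And>k l. k \<in> F \<Longrightarrow> l \<in> F \<Longrightarrow> k \<noteq> l \<Longrightarrow> u k * adj (u l) = 0 \<and> adj (u k) * u l = 0"
      using insert.prems by blast+
    note R = RM_sum[OF N N RM_id[OF N] f, of u I J, unfolded id_apply, OF insert.prems]
      RM_sum[OF N N RM_id[OF N] insert.hyps(1), of u I J, unfolded id_apply, OF F]
    have x: "mi (u x)" "blk A (I x) (J x) (u x)" "I x \<le> J x" "J x < natoms A"
      using insert.prems(1)[of x] blkD(2)[OF N, of "I x" "J x" "u x"] by auto
    note g = generator_props[OF N x(3,4)]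
    note d = pcl_upm[OF N gm_RG[OF N x(3,4)]] pcl_upm[OF N R(3)]
    have "pcl A (sum u (insert x F)) = pcl A (gm A (I x) (J x)) + pcl A (sum u F)"
    proof (rule upm_eqI[OF pcl_upm[OF N R(1)] upm_closed(1)[OF d]])
      fix s t assume st: "s \<le> t" "t < natoms A"
      have "(of_int (pcl A (sum u (insert x F)) $$ (s, t)) :: complex) = cl A (u x) s t + cl A (sum u F) s t"
        using st pcl_cl[OF N R(1)] R(2,4) insert.hyps by simp
      also have "\<dots> = cl A (gm A (I x) (J x)) s t + cl A (sum u F) s t"
        using cl_mi[OF N x(1,2), of s t] cl_mi[OF N g(1,2), of s t] st by simp
      also have "\<dots> = of_int ((pcl A (gm A (I x) (J x)) + pcl A (sum u F)) $$ (s, t))"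
        using st d pcl_cl[OF N R(3)] pcl_cl[OF N gm_RG[OF N x(3,4)], of s t] by (auto simp: upm_def)
      finally show "(of_int (pcl A (sum u (insert x F)) $$ (s, t)) :: complex) = of_int ((pcl A (gm A (I x) (J x)) + pcl A (sum u F)) $$ (s, t))" .
    qed
    then show ?case using PS[OF x(3,4) d(2) insert.IH[OF F]] by simp
  qed
  then show ?thesis using K(2) by simp
qed

lemma pi_gm:
  assumes N: "is_nest A" and ij: "i \<le> j" "j < natoms A"
  shows "pi_f A (pcl A (gm A i j)) = pcl A (gm A i i)" "pi_i A (pcl A (gm A i j)) = pcl A (gm A j j)"
proof -
  have ii: "i \<le> i" "i < natoms A" "j \<le> j" using ij by auto
  note u = pcl_upm[OF N gm_RG[OF N ij]]
  have c: "of_int (pcl A (gm A i j) $$ (s, t)) = (if s = i \<and> t = j then 1 else 0 :: complex)" if "i \<le> j" "j < natoms A" "s < natoms A" "t < natoms A" for i j s t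
    using pcl_cl[OF N gm_RG[OF N that(1,2)] that(3,4)] cl_mi[OF N generator_props(1,2)[OF N that(1,2)] that(3,4)] by simp
  show "pi_f A (pcl A (gm A i j)) = pcl A (gm A i i)"
    by (rule upm_eqI[OF pi_upm(1)[OF N u] pcl_upm[OF N gm_RG[OF N ii(1,2)]]])
      (use ij ii in \<open>auto simp: pi_f_entry[OF N u] c sum.delta if_distrib cong: if_cong\<close>)
  show "pi_i A (pcl A (gm A i j)) = pcl A (gm A j j)"
    by (rule upm_eqI[OF pi_upm(2)[OF N u] pcl_upm[OF N gm_RG[OF N ii(3) ij(2)]]])
      (use ij ii in \<open>auto simp: pi_i_entry[OF N u] c sum.delta if_distrib cong: if_cong\<close>)
qed

text \<open>Translates relations between \<open>pi_f\<close>, \<open>pi_i\<close> and classes into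
  the marginal conditions of \<open>OM_exists\<close>.\<close>

lemma pi_tr:
  assumes N: "is_nest B" and w: "w \<in> RG B" and s: "s < natoms B"
  shows "tr (atm B s * (w * adj w)) = of_int (pi_f B (pcl B w) $$ (s, s))"
    "tr (atm B s * (adj w * w)) = of_int (pi_i B (pcl B w) $$ (s, s))"
  using cl_sum_row[OF N RG_FM[OF w] s] cl_sum_col[OF N RG_FM[OF w] s] pcl_cl[OF N w] s
    pi_f_entry(2)[OF N pcl_upm[OF N w] s s] pi_i_entry(2)[OF N pcl_upm[OF N w] s s] by simp_all

locale gam = X: osys A \<alpha> + Y: osys A' \<alpha>' for A \<alpha> A' \<alpha>' +
  fixes \<gamma> :: "(nat \<times> int mat) set \<Rightarrow> (nat \<times> int mat) set"
  assumes g: "Inv_iso A \<alpha> A' \<alpha>' \<gamma>" and gop: "\<gamma> ` lim_Sigma_op A \<alpha> = lim_Sigma_op A' \<alpha>'"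
begin

lemma ghom: "group_hom X.Grp Y.Grp \<gamma>"
  using g X.lim_comm_group Y.lim_comm_group
  by (auto simp: Inv_iso_def iso_def group_hom_def group_hom_axioms_def comm_group_def)

lemma g_add: "U \<in> upm (A k) \<Longrightarrow> V \<in> upm (A k) \<Longrightarrow> \<gamma> (X.gc k (U + V)) = \<gamma> (X.gc k U) \<otimes>\<^bsub>Y.Grp\<^esub> \<gamma> (X.gc k V)"
  using group_hom.hom_mult[OF ghom X.gc_in X.gc_in] X.gc_add by metis

lemma g_zero: "\<gamma> (X.gc k (0\<^sub>m (natoms (A k)) (natoms (A k)))) = Y.gc m (0\<^sub>m (natoms (A' m)) (natoms (A' m)))"
  unfolding X.gc_zero Y.gc_zero by (rule group_hom.hom_one[OF ghom])

lemma lifts_gen: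
  assumes R: "RM (A k) (A' m) \<phi>"
    and e: "\<And>i j. i \<le> j \<Longrightarrow> j < natoms (A k) \<Longrightarrow> \<gamma> (X.gc k (pcl (A k) (gm (A k) i j))) = Y.gc m (pcl (A' m) (\<phi> (gm (A k) i j)))"
  shows "lifts A \<alpha> A' \<alpha>' \<gamma> k m \<phi>"
  unfolding lifts_def
proof
  fix v assume v: "v \<in> RG (A k)"
  have "\<gamma> (X.gc k (pcl (A k) v)) = Y.gc m (pH (A k) (A' m) \<phi> (pcl (A k) v))"
  proof (rule RG_induct[OF X.N v, where P = "\<lambda>X. \<gamma> (dlim_in (Gsets A) (Gmaps A \<alpha>) k X) = Y.gc m (pH (A k) (A' m) \<phi> X)"])
    show "\<gamma> (X.gc k (0\<^sub>m (natoms (A k)) (natoms (A k)))) = Y.gc m (pH (A k) (A' m) \<phi> (0\<^sub>m (natoms (A k)) (natoms (A k))))"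
      using g_zero[of k m] X.pH_zero[OF X.N Y.N R] by simp
    fix Z i j assume *: "i \<le> j" "j < natoms (A k)" "Z \<in> upm (A k)" "\<gamma> (X.gc k Z) = Y.gc m (pH (A k) (A' m) \<phi> Z)"
    note u = pcl_upm[OF X.N gm_RG[OF X.N *(1,2)]]
    have "\<gamma> (X.gc k (pcl (A k) (gm (A k) i j) + Z)) = Y.gc m (pH (A k) (A' m) \<phi> (pcl (A k) (gm (A k) i j)) + pH (A k) (A' m) \<phi> Z)"
      unfolding g_add[OF u *(3)] *(4) e[OF *(1,2)] pH_pcl[OF X.N Y.N R gm_RG[OF X.N *(1,2)]]
      by (rule Y.gc_add[OF pcl_upm[OF Y.N RM_RG[OF X.N Y.N R gm_RG[OF X.N *(1,2)]]] pH_upm[OF X.N Y.N R]])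
    also have "\<dots> = Y.gc m (pH (A k) (A' m) \<phi> (pcl (A k) (gm (A k) i j) + Z))" using pH_add[OF X.N Y.N R u *(3)] by simp
    finally show "\<gamma> (X.gc k (pcl (A k) (gm (A k) i j) + Z)) = Y.gc m (pH (A k) (A' m) \<phi> (pcl (A k) (gm (A k) i j) + Z))" .
  qed
  then show "\<gamma> (X.gc k (pcl (A k) v)) = Y.gc m (pcl (A' m) (\<phi> v))" using pH_pcl[OF X.N Y.N R v] by simp
qed

lemma gc_pcl_shift: "v \<in> RG (A' m) \<Longrightarrow> m \<le> n \<Longrightarrow> Y.gc n (pcl (A' n) (Y.SS m n v)) = Y.gc m (pcl (A' m) v)"
  using Y.gc_shift[OF pcl_upm[OF Y.N], of v m n] pH_pcl[OF Y.N Y.N Y.SS_RM] by simp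

lemma gm_op: "i \<le> j \<Longrightarrow> j < natoms (A k) \<Longrightarrow> \<exists>m v. v \<in> RG (A' m) \<and> (\<forall>n>m. Y.SS m n v \<in> OPS (A' n)) \<and> \<gamma> (X.gc k (pcl (A k) (gm (A k) i j))) = Y.gc m (pcl (A' m) v)"
proof -
  assume ij: "i \<le> j" "j < natoms (A k)"
  have "X.gc k (pcl (A k) (gm (A k) i j)) \<in> lim_Sigma_op A \<alpha>"
    unfolding X.lim_Sigma_op_eq using gm_RG[OF X.N ij] X.SS_OM[of k] generator_props(1,2)[OF X.N ij] ij
    unfolding OM_def by (auto intro!: exI[of _ k])
  then have "\<gamma> (X.gc k (pcl (A k) (gm (A k) i j))) \<in> lim_Sigma_op A' \<alpha>'" using gop by blast
  then show ?thesis unfolding Y.lim_Sigma_op_eq by blast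
qed

text \<open>\<open>\<gamma>\<close> sends the classes of generators to classes of elements
  \<open>w0 i j\<close> that stay order preserving. The relations that \<open>OM_exists\<close> asks
  for, namely the marginals and the total dimension, hold in the limit group because
  \<open>\<gamma>\<close> respects \<open>pi_f\<close>, \<open>pi_i\<close> and
  \<open>Sigma_0\<close>. They are finitely many and so hold together at some level
  \<open>n\<close>.\<close>

lemma lift_ex: "\<exists>m \<phi>. OM (A k) (A' m) \<phi> \<and> lifts A \<alpha> A' \<alpha>' \<gamma> k m \<phi>"
proof -
  define l where "l = natoms (A k)"
  have "\<forall>i j. \<exists>m v. i \<le> j \<longrightarrow> j < l \<longrightarrow> v \<in> RG (A' m) \<and> (\<forall>n>m. Y.SS m n v \<in> OPS (A' n)) \<and> \<gamma> (X.gc k (pcl (A k) (gm (A k) i j))) = Y.gc m (pcl (A' m) v)"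
    using gm_op unfolding l_def by blast
  then obtain mm vv where mv: "\<And>i j. i \<le> j \<Longrightarrow> j < l \<Longrightarrow> vv i j \<in> RG (A' (mm i j))"
    "\<And>i j n. i \<le> j \<Longrightarrow> j < l \<Longrightarrow> n > mm i j \<Longrightarrow> Y.SS (mm i j) n (vv i j) \<in> OPS (A' n)"
    "\<And>i j. i \<le> j \<Longrightarrow> j < l \<Longrightarrow> \<gamma> (X.gc k (pcl (A k) (gm (A k) i j))) = Y.gc (mm i j) (pcl (A' (mm i j)) (vv i j))" by metis
  have uN: "uno (A k) \<in> NA (A k)" "pj (uno (A k))" using DA_NA[OF uno_DA[OF X.N]] by (auto simp: pj_def)
  have uR: "uno (A k) \<in> RG (A k)" by (rule pj_NA_RG(2)[OF X.N uN])
  have "X.gc k (pcl (A k) (uno (A k))) \<in> lim_Sigma_0 A \<alpha>" unfolding X.lim_Sigma_0_eq using uN by blast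
  then have "\<gamma> (X.gc k (pcl (A k) (uno (A k)))) \<in> lim_Sigma_0 A' \<alpha>'" using g by (auto simp: Inv_iso_def)
  then obtain m2 p where p: "p \<in> NA (A' m2)" "pj p" "\<gamma> (X.gc k (pcl (A k) (uno (A k)))) = Y.gc m2 (pcl (A' m2) p)"
    unfolding Y.lim_Sigma_0_eq by blast
  have pR: "p \<in> RG (A' m2)" by (rule pj_NA_RG(2)[OF Y.N p(1,2)])
  \<comment> \<open>\<open>Suc\<close> because elements behind \<open>lim_Sigma_op\<close> are order
    preserving only at levels strictly above their own.\<close>
  define M where "M = Suc (m2 + (\<Sum>i<l. \<Sum>j<l. mm i j))"
  have M: "mm i j < M" if "i < l" "j < l" for i j
    using le_sum2[of "{..<l}" "{..<l}" i j mm] that by (simp add: M_def)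
  have M2: "m2 \<le> M" by (simp add: M_def)
  define w0 where "w0 i j = Y.SS (mm i j) M (vv i j)" for i j
  let ?H = "\<lambda>n. pH (A' M) (A' n) (Y.SS M n)" and ?W = "\<lambda>i j. pcl (A' M) (w0 i j)" and ?g = "\<lambda>i j. pcl (A k) (gm (A k) i j)"
  have w0: "w0 i j \<in> OPS (A' M)" "\<gamma> (X.gc k (?g i j)) = Y.gc M (?W i j)"
    if "i \<le> j" "j < l" for i j
    using mv(2)[OF that, of M] mv(3)[OF that] gc_pcl_shift[OF mv(1)[OF that], of M] M[of i j] that by (auto simp: w0_def)
  have w0R: "w0 i j \<in> RG (A' M)" if "i \<le> j" "j < l" for i j using w0(1)[OF that] OPS_RG by blast
  note w0u = pcl_upm[OF Y.N w0R]
  define r0 where "r0 = Y.SS m2 M p"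
  have r0: "r0 \<in> RG (A' M)" "\<gamma> (X.gc k (pcl (A k) (uno (A k)))) = Y.gc M (pcl (A' M) r0)" "r0 \<in> NA (A' M)" "pj r0"
    using gc_pcl_shift[OF pR M2] p RM_RG[OF Y.N Y.N Y.SS_RM[OF M2] pR] SHD(6)[OF Y.SS_SH[OF M2] p(1)] SH_pj[OF Y.SS_SH[OF M2] NA_FM[OF p(1)] p(2)]
    by (auto simp: r0_def)
  have rel: "Y.gc M (pi_f (A' M) (?W i j)) = Y.gc M (?W i i)"
    "Y.gc M (pi_i (A' M) (?W i j)) = Y.gc M (?W j j)" if ij: "i \<le> j" "j < l" for i j
  proof -
    have d: "i \<le> i" "i < l" "j \<le> j" using ij by auto
    note u = pcl_upm[OF X.N gm_RG[OF X.N ij[unfolded l_def]]]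
    have 1: "lim_pi_f A' \<alpha>' (\<gamma> (X.gc k (?g i j))) = \<gamma> (lim_pi_f A \<alpha> (X.gc k (?g i j)))"
      "lim_pi_i A' \<alpha>' (\<gamma> (X.gc k (?g i j))) = \<gamma> (lim_pi_i A \<alpha> (X.gc k (?g i j)))"
      using g X.gc_in[OF u] by (simp_all add: Inv_iso_def)
    show "Y.gc M (pi_f (A' M) (?W i j)) = Y.gc M (?W i i)"
      using 1(1) Y.gc_pi_f[OF w0u[OF ij]] w0(2)[OF ij] w0(2)[OF d(1,2)] X.gc_pi_f[OF u] pi_gm(1)[OF X.N ij[unfolded l_def]] by simp
    show "Y.gc M (pi_i (A' M) (?W i j)) = Y.gc M (?W j j)"
      using 1(2) Y.gc_pi_i[OF w0u[OF ij]] w0(2)[OF ij] w0(2)[OF d(3) ij(2)] X.gc_pi_i[OF u] pi_gm(2)[OF X.N ij[unfolded l_def]] by simp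
  qed
  define c where "c n x s t = (\<Sum>j<l. \<Sum>i\<le>j. x i j * cl (A' n) (Y.SS M n (w0 i j)) s t)" for n s t and x :: "nat \<Rightarrow> nat \<Rightarrow> complex"
  \<comment> \<open>\<open>Z'\<close> is the combination of the classes \<open>?W i j\<close> with
    the coefficients of \<open>Z\<close>, recorded through its images at later levels. For the class
    of the unit this expresses its image under \<open>\<gamma>\<close> by the
    \<open>w0 i j\<close>.\<close>
  define Q where "Q Z Z' \<longleftrightarrow> Z' \<in> upm (A' M) \<and> \<gamma> (X.gc k Z) = Y.gc M Z' \<and>
    (\<forall>n\<ge>M. \<forall>s t. s \<le> t \<longrightarrow> t < natoms (A' n) \<longrightarrow> of_int (?H n Z' $$ (s, t)) = c n (\<lambda>i j. of_int (Z $$ (i, j))) s t)" for Z Z'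
  have "\<exists>Z'. Q (pcl (A k) (uno (A k))) Z'"
  proof (rule RG_induct[OF X.N uR, where P = "\<lambda>Z. \<exists>Z'. Q Z Z'"])
    have "Q (0\<^sub>m (natoms (A k)) (natoms (A k))) (0\<^sub>m (natoms (A' M)) (natoms (A' M)))"
      unfolding Q_def c_def using g_zero[of k M] X.pH_zero[OF Y.N Y.N Y.SS_RM] by (auto simp: upm_closed l_def intro!: sum.neutral[symmetric])
    then show "\<exists>Z'. Q (0\<^sub>m (natoms (A k)) (natoms (A k))) Z'" by blast
    fix Z i j assume ij: "i \<le> j" "j < natoms (A k)" and Z: "Z \<in> upm (A k)" and "\<exists>Z'. Q Z Z'"
    then obtain Z' where Z': "Q Z Z'" by blast
    have ij': "i \<le> j" "j < l" using ij by (auto simp: l_def)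
    note u = pcl_upm[OF X.N gm_RG[OF X.N ij]]
    have "Q (?g i j + Z) (?W i j + Z')"
      unfolding Q_def
    proof (intro conjI allI impI)
      show "?W i j + Z' \<in> upm (A' M)" using Z' w0u[OF ij'] by (simp add: Q_def upm_closed)
      show "\<gamma> (X.gc k (?g i j + Z)) = Y.gc M (?W i j + Z')"
        using Z' w0u[OF ij'] by (simp add: g_add[OF u Z] Q_def w0(2)[OF ij'] Y.gc_add)
      fix n s t assume n: "M \<le> n" and st: "s \<le> t" "t < natoms (A' n)"
      have st': "s < natoms (A' n)" using st by simp
      have Zu: "Z' \<in> upm (A' M)" using Z' by (simp add: Q_def)
      note R = Y.SS_RM[OF n]
      have "of_int (?H n (?W i j + Z') $$ (s, t)) =
        of_int (?H n (?W i j) $$ (s, t)) + (of_int (?H n Z' $$ (s, t)) :: complex)"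
        using st st' by (simp add: pH_add[OF Y.N Y.N R w0u[OF ij'] Zu] carrier_matD[OF pH_carrier])
      also have "of_int (?H n (?W i j) $$ (s, t)) = cl (A' n) (Y.SS M n (w0 i j)) s t"
        using pH_pcl[OF Y.N Y.N R w0R[OF ij']] pcl_cl[OF Y.N RM_RG[OF Y.N Y.N R w0R[OF ij']] st' st(2)] by simp
      also have "\<dots> = c n (\<lambda>a b. if a = i \<and> b = j then 1 else 0) s t"
        unfolding c_def by (rule sum_upper_delta[OF ij', symmetric])
      also have "of_int (?H n Z' $$ (s, t)) = c n (\<lambda>i j. of_int (Z $$ (i, j))) s t"
        using Z' n st by (simp add: Q_def)
      also have "c n (\<lambda>a b. if a = i \<and> b = j then 1 else 0) s t + \<dots> = c n (\<lambda>a b. (if a = i \<and> b = j then 1 else 0) + of_int (Z $$ (a, b))) s t"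
        by (simp add: c_def distrib_right sum.distrib)
      also have "\<dots> = c n (\<lambda>a b. of_int ((?g i j + Z) $$ (a, b))) s t"
        unfolding c_def
      proof (intro sum.cong refl)
        fix b a assume "b \<in> {..<l}" "a \<in> {..b}"
        then have ab: "a < natoms (A k)" "b < natoms (A k)" by (auto simp: l_def)
        have "of_int (?g i j $$ (a, b)) = (if a = i \<and> b = j then 1 else 0 :: complex)"
          using pcl_cl[OF X.N gm_RG[OF X.N ij] ab] cl_mi[OF X.N generator_props(1,2)[OF X.N ij] ab] by simp
        moreover have "(?g i j + Z) $$ (a, b) = ?g i j $$ (a, b) + Z $$ (a, b)"
          using Z u ab by (auto simp: upm_def)
        ultimately show "((if a = i \<and> b = j then 1 else 0) + of_int (Z $$ (a, b))) * cl (A' n) (Y.SS M n (w0 a b)) s t =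
          of_int ((?g i j + Z) $$ (a, b)) * cl (A' n) (Y.SS M n (w0 a b)) s t"
          by simp
      qed
      finally show "of_int (?H n (?W i j + Z') $$ (s, t)) =
        c n (\<lambda>a b. of_int ((?g i j + Z) $$ (a, b))) s t" .
    qed
    then show "\<exists>Z'. Q (?g i j + Z) Z'" by blast
  qed
  then obtain Z where Z: "Q (pcl (A k) (uno (A k))) Z" by blast
  have Zu: "Z \<in> upm (A' M)" and Zr: "Y.gc M Z = Y.gc M (pcl (A' M) r0)" using Z r0(2) by (auto simp: Q_def)
  have ev: "\<forall>\<^sub>F n in sequentially. ?H n U = ?H n V"
    if "U \<in> upm (A' M)" "V \<in> upm (A' M)" "Y.gc M U = Y.gc M V" for U V
    using Y.gc_eq_eventually[OF that] by (auto simp: eventually_sequentially)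
  have "\<forall>\<^sub>F n in sequentially. n \<ge> M \<and> ?H n Z = ?H n (pcl (A' M) r0)
     \<and> (\<forall>j\<in>{..<l}. \<forall>i\<in>{..j}. ?H n (pi_f (A' M) (?W i j)) = ?H n (?W i i))
     \<and> (\<forall>j\<in>{..<l}. \<forall>i\<in>{..j}. ?H n (pi_i (A' M) (?W i j)) = ?H n (?W j j))"
  proof (intro eventually_conj eventually_ball_finite ballI finite_lessThan finite_atMost eventually_ge_at_top)
    show "\<forall>\<^sub>F n in sequentially. ?H n Z = ?H n (pcl (A' M) r0)"
      by (rule ev[OF Zu pcl_upm[OF Y.N r0(1)] Zr])
    fix j i assume "j \<in> {..<l}" "i \<in> {..j}"
    then have ij: "i \<le> j" "j < l" "i \<le> i" "i < l" "j \<le> j" by auto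
    show "\<forall>\<^sub>F n in sequentially. ?H n (pi_f (A' M) (?W i j)) = ?H n (?W i i)"
      by (rule ev[OF pi_upm(1)[OF Y.N w0u[OF ij(1,2)]] w0u[OF ij(3,4)] rel(1)[OF ij(1,2)]])
    show "\<forall>\<^sub>F n in sequentially. ?H n (pi_i (A' M) (?W i j)) = ?H n (?W j j)"
      by (rule ev[OF pi_upm(2)[OF Y.N w0u[OF ij(1,2)]] w0u[OF ij(5,2)] rel(2)[OF ij(1,2)]])
  qed
  then obtain n where n: "M \<le> n" "?H n Z = ?H n (pcl (A' M) r0)"
    "\<And>i j. i \<le> j \<Longrightarrow> j < l \<Longrightarrow> ?H n (pi_f (A' M) (?W i j)) = ?H n (?W i i)"
    "\<And>i j. i \<le> j \<Longrightarrow> j < l \<Longrightarrow> ?H n (pi_i (A' M) (?W i j)) = ?H n (?W j j)"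
    unfolding eventually_sequentially by (metis atMost_iff lessThan_iff order_refl)
  define B where "B = A' n"
  define w where "w i j = Y.SS M n (w0 i j)" for i j
  have NB: "is_nest B" by (simp add: B_def)
  note Rn = Y.SS_RM[OF n(1), folded B_def]
  have wO: "w i j \<in> OPS B" if "i \<le> j" "j < l" for i j unfolding w_def B_def by (rule Y.SS_OPS[OF n(1) w0(1)[OF that]])
  have wR: "w i j \<in> RG B" if "i \<le> j" "j < l" for i j using wO[OF that] OPS_RG by blast
  have pf: "pi_f B (pcl B (w i j)) = pcl B (w i i)" "pi_i B (pcl B (w i j)) = pcl B (w j j)" if ij: "i \<le> j" "j < l" for i j
  proof -
    have ii: "i \<le> i" "i < l" "j \<le> j" using ij by auto
    show "pi_f B (pcl B (w i j)) = pcl B (w i i)"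
      using n(3)[OF ij] pH_pi_f[OF Y.N Y.N Rn[unfolded B_def] w0u[OF ij]] pH_pcl[OF Y.N Y.N Rn[unfolded B_def] w0R[OF ij]]
        pH_pcl[OF Y.N Y.N Rn[unfolded B_def] w0R[OF ii(1,2)]] by (simp add: B_def w_def)
    show "pi_i B (pcl B (w i j)) = pcl B (w j j)"
      using n(4)[OF ij] pH_pi_i[OF Y.N Y.N Rn[unfolded B_def] w0u[OF ij]] pH_pcl[OF Y.N Y.N Rn[unfolded B_def] w0R[OF ij]]
        pH_pcl[OF Y.N Y.N Rn[unfolded B_def] w0R[OF ii(3) ij(2)]] by (simp add: B_def w_def)
  qed
  have trf: "tr (atm B s * (w i j * adj (w i j))) = cl B (w i i) s s" "tr (atm B s * (adj (w i j) * w i j)) = cl B (w j j) s s"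
    if ij: "i \<le> j" "j < l" and s: "s < natoms B" for i j s
  proof -
    have ii: "i \<le> i" "i < l" "j \<le> j" using ij by auto
    show "tr (atm B s * (w i j * adj (w i j))) = cl B (w i i) s s" "tr (atm B s * (adj (w i j) * w i j)) = cl B (w j j) s s"
      using pi_tr[OF NB wR[OF ij] s] pf[OF ij] pcl_cl[OF NB wR[OF ii(1,2)] s s] pcl_cl[OF NB wR[OF ii(3) ij(2)] s s] by simp_all
  qed
  \<comment> \<open>\<open>pi_f\<close> has diagonal values, and by \<open>pf\<close> it fixes the
    class of \<open>w i i\<close>.\<close>
  have wD: "w i i \<in> DA B" if i: "i < l" for i
    unfolding DA_def
  proof (clarsimp simp: RG_FM[OF wR[OF order_refl i]])
    fix s t assume st: "s < natoms B" "t < natoms B" "s \<noteq> t"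
    have "pcl B (w i i) $$ (s, t) = 0"
      using pi_f_entry(2)[OF NB pcl_upm[OF NB wR[OF order_refl i]] st(1,2)] pf(1)[OF order_refl i] st by simp
    then have "cl B (w i i) s t = 0" using pcl_cl[OF NB wR[OF order_refl i] st(1,2)] by simp
    then show "atm B s * w i i * atm B t = 0" using cl_0_iff[OF NB st(1,2)] by blast
  qed
  define R where "R = Y.SS M n r0"
  have R: "R \<in> NA B" "pj R" "R \<in> RG B" "R \<in> DA B"
    using SHD(6)[OF Y.SS_SH[OF n(1)] r0(3)] SH_pj[OF Y.SS_SH[OF n(1)] NA_FM[OF r0(3)] r0(4)] pj_NA_RG[OF NB] by (auto simp: R_def B_def)
  have dim: "(\<Sum>i<natoms (A k). tr (atm (A k) i) * tr (atm B s * (w i i * adj (w i i)))) = tr (atm B s * R)" if s: "s < natoms B" for s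
  proof -
    have uc: "of_int (pcl (A k) (uno (A k)) $$ (i, j)) = (if i = j then tr (atm (A k) i) else 0)" if "i < l" "j < l" for i j
      using pcl_cl[OF X.N uR] cl_diag[OF X.N uno_DA[OF X.N]] that by (simp add: l_def at_FM[OF X.N])
    have "tr (atm B s * R) = cl B R s s" using cl_diag[OF NB R(4) s s] R(2) by (simp add: pjD)
    also have "\<dots> = of_int (pcl B R $$ (s, s))" using pcl_cl[OF NB R(3) s s] by simp
    also have "pcl B R = ?H n Z"
      using n(2) pH_pcl[OF Y.N Y.N Rn[unfolded B_def] r0(1)] by (simp add: R_def B_def)
    also have "of_int (\<dots> $$ (s, s)) = c n (\<lambda>i j. of_int (pcl (A k) (uno (A k)) $$ (i, j))) s s"
      using Z n(1) s by (simp add: Q_def B_def)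
    also have "\<dots> = (\<Sum>j<l. \<Sum>i\<le>j. (if i = j then tr (atm (A k) i) else 0) * cl B (w i j) s s)"
      unfolding c_def using uc by (intro sum.cong refl) (auto simp: w_def B_def)
    also have "\<dots> = (\<Sum>i<l. tr (atm (A k) i) * cl B (w i i) s s)" by (rule sum_diag_upper)
    also have "\<dots> = (\<Sum>i<natoms (A k). tr (atm (A k) i) * tr (atm B s * (w i i * adj (w i i))))"
      using trf(1)[OF order_refl _ s] by (intro sum.cong) (auto simp: l_def)
    finally show ?thesis by simp
  qed
  have "\<exists>\<phi>. OM (A k) B \<phi> \<and> (\<forall>i j s t. i \<le> j \<longrightarrow> j < natoms (A k) \<longrightarrow> s < natoms B \<longrightarrow> t < natoms B \<longrightarrow> cl B (\<phi> (gm (A k) i j)) s t = cl B (w i j) s t)"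
  proof (rule OM_exists[OF X.N NB])
    fix i j s assume ij: "i \<le> j" "j < natoms (A k)" and s: "s < natoms B"
    then have ij': "i \<le> j" "j < l" "i \<le> i" "i < l" "j \<le> j" by (auto simp: l_def)
    show "tr (atm B s * (w i j * adj (w i j))) = tr (atm B s * (w i i * adj (w i i)))" using trf(1)[OF ij'(1,2) s] trf(1)[OF ij'(3,4) s] by simp
    show "tr (atm B s * (adj (w i j) * w i j)) = tr (atm B s * (w j j * adj (w j j)))" using trf(2)[OF ij'(1,2) s] trf(1)[OF ij'(5,2) s] by simp
  qed (use wO wD R dim in \<open>auto simp: l_def\<close>)
  then obtain \<phi> where \<phi>: "OM (A k) B \<phi>" "\<And>i j s t. i \<le> j \<Longrightarrow> j < natoms (A k) \<Longrightarrow> s < natoms B \<Longrightarrow> t < natoms B \<Longrightarrow> cl B (\<phi> (gm (A k) i j)) s t = cl B (w i j) s t"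
    by blast
  have "lifts A \<alpha> A' \<alpha>' \<gamma> k n \<phi>"
  proof (rule lifts_gen)
    show "RM (A k) (A' n) \<phi>" using OM_RM[OF \<phi>(1)] by (simp add: B_def)
    fix i j assume ij: "i \<le> j" "j < natoms (A k)"
    then have ij': "i \<le> j" "j < l" by (auto simp: l_def)
    have "pcl B (\<phi> (gm (A k) i j)) = pcl B (w i j)"
      by (rule pcl_eqI[OF NB RM_RG[OF X.N NB OM_RM[OF \<phi>(1)] gm_RG[OF X.N ij]] wR[OF ij']]) (use \<phi>(2)[OF ij] in auto)
    then show "\<gamma> (X.gc k (?g i j)) = Y.gc n (pcl (A' n) (\<phi> (gm (A k) i j)))"
      using w0(2)[OF ij'] gc_pcl_shift[OF w0R[OF ij'] n(1)] by (simp add: B_def w_def)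
  qed
  then show ?thesis using \<phi>(1) by (auto simp: B_def)
qed

end

text \<open>A lift of \<open>\<gamma>'\<close> composed with \<open>f\<close> has, at a sufficiently
  late level, the same classes as the system map, so the two differ by a block diagonal unitary.
  Conjugation by it makes the triangle commute exactly and changes no class.\<close>

lemma lift_step:
  assumes G: "gam A \<alpha> A' \<alpha>' \<gamma>" and G': "gam A' \<alpha>' A \<alpha> \<gamma>'" and inv: "\<And>x. x \<in> carrier (lim_group A \<alpha>) \<Longrightarrow> \<gamma>' (\<gamma> x) = x"
    and f: "OM (A k) (A' m) f" "lifts A \<alpha> A' \<alpha>' \<gamma> k m f"
  shows "\<exists>n h. k < n \<and> OM (A' m) (A n) h \<and> lifts A' \<alpha>' A \<alpha> \<gamma>' m n h \<and> (\<forall>a\<in>FM (A k). h (f a) = osys.SS A \<alpha> k n a)"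
proof -
  interpret G: gam A \<alpha> A' \<alpha>' \<gamma> by (rule G)
  interpret G': gam A' \<alpha>' A \<alpha> \<gamma>' by (rule G')
  obtain n0 h0 where h0: "OM (A' m) (A n0) h0" "lifts A' \<alpha>' A \<alpha> \<gamma>' m n0 h0" using G'.lift_ex by blast
  \<comment> \<open>\<open>Suc k\<close> makes the levels of the back and forth argument strictly
    increase.\<close>
  define n1 where "n1 = max n0 (Suc k)"
  have n1: "n0 \<le> n1" "k < n1" "k \<le> n1" by (auto simp: n1_def)
  define h1 where "h1 = G.X.SS n0 n1 \<circ> h0"
  have h1: "OM (A' m) (A n1) h1" unfolding h1_def
    by (rule OM_comp_OPS[OF G.Y.N G.X.N G.X.N h0(1) G.X.SS_SH[OF n1(1)] G.X.SS_OPS[OF n1(1)]])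
  have fR: "f v \<in> RG (A' m)" if "v \<in> RG (A k)" for v by (rule RM_RG[OF G.X.N G.Y.N OM_RM[OF f(1)] that])
  have h1l: "\<gamma>' (G.Y.gc m (pcl (A' m) v)) = G.X.gc n1 (pcl (A n1) (h1 v))" if v: "v \<in> RG (A' m)" for v
    using h0(2) v G'.gc_pcl_shift[OF RM_RG[OF G.Y.N G.X.N OM_RM[OF h0(1)] v] n1(1)] by (simp add: lifts_def h1_def)
  have eqc: "G.X.gc n1 (pcl (A n1) (h1 (f v))) = G.X.gc n1 (pcl (A n1) (G.X.SS k n1 v))" if v: "v \<in> RG (A k)" for v
  proof -
    have "G.X.gc n1 (pcl (A n1) (h1 (f v))) = \<gamma>' (\<gamma> (G.X.gc k (pcl (A k) v)))" using h1l[OF fR[OF v]] f(2) v by (simp add: lifts_def)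
    also have "\<dots> = G.X.gc k (pcl (A k) v)" by (rule inv[OF G.X.gc_in[OF pcl_upm[OF G.X.N v]]])
    finally show ?thesis using G'.gc_pcl_shift[OF v n1(3)] by simp
  qed
  define l where "l = natoms (A k)"
  have hfR: "h1 (f v) \<in> RG (A n1)" if "v \<in> RG (A k)" for v by (rule RM_RG[OF G.Y.N G.X.N OM_RM[OF h1] fR[OF that]])
  have sR: "G.X.SS k n1 v \<in> RG (A n1)" if "v \<in> RG (A k)" for v by (rule RM_RG[OF G.X.N G.X.N G.X.SS_RM[OF n1(3)] that])
  have "\<forall>\<^sub>F n in sequentially. n \<ge> n1 \<and> (\<forall>j\<in>{..<l}. \<forall>i\<in>{..j}. pH (A n1) (A n) (G.X.SS n1 n) (pcl (A n1) (h1 (f (gm (A k) i j)))) =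
     pH (A n1) (A n) (G.X.SS n1 n) (pcl (A n1) (G.X.SS k n1 (gm (A k) i j))))"
  proof (intro eventually_conj eventually_ball_finite ballI finite_lessThan finite_atMost eventually_ge_at_top)
    fix j i assume "j \<in> {..<l}" "i \<in> {..j}"
    then have v: "gm (A k) i j \<in> RG (A k)" by (intro gm_RG[OF G.X.N]) (auto simp: l_def)
    show "\<forall>\<^sub>F n in sequentially. pH (A n1) (A n) (G.X.SS n1 n) (pcl (A n1) (h1 (f (gm (A k) i j)))) =
     pH (A n1) (A n) (G.X.SS n1 n) (pcl (A n1) (G.X.SS k n1 (gm (A k) i j)))"
      using G.X.gc_eq_eventually[OF pcl_upm[OF G.X.N hfR[OF v]] pcl_upm[OF G.X.N sR[OF v]] eqc[OF v]] by (auto simp: eventually_sequentially)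
  qed
  then obtain n where n: "n1 \<le> n" "\<And>i j. i \<le> j \<Longrightarrow> j < l \<Longrightarrow> pH (A n1) (A n) (G.X.SS n1 n) (pcl (A n1) (h1 (f (gm (A k) i j)))) =
     pH (A n1) (A n) (G.X.SS n1 n) (pcl (A n1) (G.X.SS k n1 (gm (A k) i j)))"
    unfolding eventually_sequentially by (metis atMost_iff lessThan_iff order_refl)
  have kn: "k \<le> n" "k < n" using n(1) n1 by auto
  define h2 where "h2 = G.X.SS n1 n \<circ> h1"
  have h2: "OM (A' m) (A n) h2" unfolding h2_def
    by (rule OM_comp_OPS[OF G.Y.N G.X.N G.X.N h1 G.X.SS_SH[OF n(1)] G.X.SS_OPS[OF n(1)]])
  note S2 = SHD[OF OM_SH[OF h2]]
  have h2l: "\<gamma>' (G.Y.gc m (pcl (A' m) v)) = G.X.gc n (pcl (A n) (h2 v))" if v: "v \<in> RG (A' m)" for v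
    using h1l[OF v] G'.gc_pcl_shift[OF RM_RG[OF G.Y.N G.X.N OM_RM[OF h1] v] n(1)] by (simp add: h2_def)
  have pe: "pcl (A n) (h2 (f (gm (A k) i j))) = pcl (A n) (G.X.SS k n (gm (A k) i j))" if ij: "i \<le> j" "j < l" for i j
  proof -
    have v: "gm (A k) i j \<in> RG (A k)" using ij by (intro gm_RG[OF G.X.N]) (auto simp: l_def)
    note R = G.X.SS_RM[OF n(1)]
    show ?thesis
      using n(2)[OF ij] pH_pcl[OF G.X.N G.X.N R hfR[OF v]] pH_pcl[OF G.X.N G.X.N R sR[OF v]] n1 n(1) by (simp add: h2_def G.X.SS_comp)
  qed
  have RMc: "RM (A k) (A n) (h2 \<circ> f)" by (rule RM_comp[OF G.X.N G.Y.N G.X.N OM_RM[OF f(1)] OM_RM[OF h2]])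
  have ce: "cl (A n) ((h2 \<circ> f) (gm (A k) i j)) s t = cl (A n) (G.X.SS k n (gm (A k) i j)) s t"
    if ij: "i \<le> j" "j < natoms (A k)" and st: "s < natoms (A n)" "t < natoms (A n)" for i j s t
  proof -
    have v: "gm (A k) i j \<in> RG (A k)" by (rule gm_RG[OF G.X.N ij])
    show ?thesis
      using pe[of i j] ij pcl_cl[OF G.X.N RM_RG[OF G.X.N G.X.N RMc v] st] pcl_cl[OF G.X.N RM_RG[OF G.X.N G.X.N G.X.SS_RM[OF kn(1)] v] st]
      by (simp add: l_def)
  qed
  \<comment> \<open>For a composite this property is not automatic; here it is inherited from the
    system map, which has the same classes on generators.\<close>
  have OMc: "OM (A k) (A n) (h2 \<circ> f)"
  proof (rule OM_I[OF G.X.N G.X.N RM_SH[OF RMc]])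
    fix i j assume ij: "i \<le> j" "j < natoms (A k)"
    note gp = generator_props(1,2)[OF G.X.N ij]
    have "G.X.SS k n (gm (A k) i j) \<in> OPS (A n)" using G.X.SS_OM[OF kn(1)] gp ij by (simp add: OM_def)
    then have "(h2 \<circ> f) (gm (A k) i j) \<in> OPS (A n)"
      by (rule OPS_by_class[OF G.X.N RM_RG[OF G.X.N G.X.N RMc gm_RG[OF G.X.N ij]]]) (rule ce[OF ij])
    then show "\<exists>u. mi u \<and> blk (A k) i j u \<and> (h2 \<circ> f) u \<in> OPS (A n)" using gp by blast
  qed
  obtain u where u: "u \<in> DA (A n)" "u * adj u = uno (A n)" "adj u * u = uno (A n)"
    "\<And>a. a \<in> FM (A k) \<Longrightarrow> u * (h2 \<circ> f) a = G.X.SS k n a * u"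
    using OM_unitary_equiv[OF G.X.N G.X.N G.X.SS_OM[OF kn(1)] OMc] ce by (metis (no_types, lifting))
  define h where "h b = u * h2 b * adj u" for b
  have uF: "u \<in> FM (A n)" "adj u \<in> DA (A n)" using u(1) DA_FM DA_adj[OF G.X.N] by auto
  have SHh: "SH (A' m) (A n) h"
    unfolding SH_def
  proof (intro conjI ballI allI)
    fix a b c assume a: "a \<in> FM (A' m)"
    show "h a \<in> FM (A n)" using a S2 uF by (simp add: h_def)
    show "h (c \<odot> a) = c \<odot> h a" using a S2 by (simp add: h_def)
    show "h (adj a) = adj (h a)" using a S2 by (simp add: h_def mult.assoc)
    assume b: "b \<in> FM (A' m)"
    show "h (a + b) = h a + h b" using a b S2 by (simp add: h_def distrib_left distrib_right)
    have "h a * h b = u * h2 a * (adj u * u) * h2 b * adj u" by (simp add: h_def mult.assoc)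
    then show "h (a * b) = h a * h b" using a b S2 uF by (simp add: h_def u(3) mult.assoc)
  next
    fix a assume "a \<in> NA (A' m)"
    then show "h a \<in> NA (A n)" using S2(6) u(1) uF by (simp add: h_def NA_mult[OF G.X.N] DA_NA)
  qed
  have cut: "adj u * u * b = b" "b * (adj u * adj (adj u)) = b" if "b \<in> FM (A n)" for b using that u by simp_all
  have hO: "h v \<in> OPS (A n)" if "h2 v \<in> OPS (A n)" for v unfolding h_def
    by (rule DA_sandwich_OPS[OF G.X.N that u(1) uF(2) cut[OF RG_FM[OF OPS_RG[OF that]]]])
  have OMh: "OM (A' m) (A n) h" using h2 hO SHh unfolding OM_def by blast
  have "lifts A' \<alpha>' A \<alpha> \<gamma>' m n h" unfolding lifts_def
  proof
    fix v assume v: "v \<in> RG (A' m)"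
    have hv: "h2 v \<in> RG (A n)" "h v \<in> RG (A n)" by (rule RM_RG[OF G.Y.N G.X.N OM_RM[OF h2] v], rule RM_RG[OF G.Y.N G.X.N OM_RM[OF OMh] v])
    have "pcl (A n) (h v) = pcl (A n) (h2 v)"
      by (rule pcl_eqI[OF G.X.N hv(2,1)], unfold h_def, rule DA_sandwich_cl[OF G.X.N u(1) uF(2) RG_FM[OF hv(1)] cut[OF RG_FM[OF hv(1)]]])
        (use RG_FM[OF hv(1)] in auto)
    then show "\<gamma>' (G.Y.gc m (pcl (A' m) v)) = G.X.gc n (pcl (A n) (h v))" using h2l[OF v] by simp
  qed
  moreover have "h (f a) = G.X.SS k n a" if a: "a \<in> FM (A k)" for a
  proof -
    have "h (f a) = (u * (h2 \<circ> f) a) * adj u" by (simp add: h_def)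
    also have "\<dots> = G.X.SS k n a * (u * adj u)" unfolding u(4)[OF a] by (simp add: mult.assoc)
    finally show ?thesis using SHD(1)[OF G.X.SS_SH[OF kn(1)] a] u(2) by simp
  qed
  ultimately show ?thesis using kn(2) OMh by blast
qed

lemma gam_inverse:
  assumes "gam A \<alpha> A' \<alpha>' \<gamma>"
  shows "gam A' \<alpha>' A \<alpha> (inv_into (carrier (lim_group A \<alpha>)) \<gamma>)"
proof -
  interpret G: gam A \<alpha> A' \<alpha>' \<gamma> by (rule assms)
  define C where "C = carrier (lim_group A \<alpha>)"
  define \<delta> where "\<delta> = inv_into C \<gamma>"
  have iso: "\<gamma> \<in> iso (lim_group A \<alpha>) (lim_group A' \<alpha>')" using G.g by (simp add: Inv_iso_def)
  then have bij: "bij_betw \<gamma> C (carrier (lim_group A' \<alpha>'))" by (simp add: iso_def C_def)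
  have l: "\<delta> (\<gamma> x) = x" if "x \<in> C" for x unfolding \<delta>_def using bij that by (simp add: bij_betw_inv_into_left)
  have r: "\<gamma> (\<delta> y) = y" "\<delta> y \<in> C" if "y \<in> carrier (lim_group A' \<alpha>')" for y
    unfolding \<delta>_def using bij that by (auto simp: bij_betw_inv_into_right bij_betw_def inv_into_into)
  have img: "\<delta> ` M' = M" if "\<gamma> ` M = M'" "M \<subseteq> C" for M M'
  proof -
    have "\<delta> ` \<gamma> ` M = M" using l that(2) by (force simp: image_image)
    then show ?thesis using that(1) by simp
  qed
  have K0u: "K0 (A k) \<subseteq> upm (A k)" for k
  proof -
    have sub: "Sigma_0 (A k) \<subseteq> carrier (dist_group (A k))"
      unfolding Sigma_0_pcl[OF G.X.N] dist_group_simps using pcl_upm[OF G.X.N pj_NA_RG(2)[OF G.X.N]] by blast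
    show ?thesis using group.generate_in_carrier[OF comm_group.axioms(2)[OF dist_group] sub] by (auto simp: K0_def dist_group_simps)
  qed
  have c: "lim_Sigma A \<alpha> \<subseteq> C" "lim_Sigma_0 A \<alpha> \<subseteq> C" "lim_Sigma_op A \<alpha> \<subseteq> C" "lim_K0 A \<alpha> \<subseteq> C"
    unfolding G.X.lim_Sigma_eq G.X.lim_Sigma_0_eq G.X.lim_Sigma_op_eq lim_K0_def lim_union_def C_def
    using G.X.gc_in pcl_upm[OF G.X.N] pj_NA_RG(2)[OF G.X.N] K0u by blast+
  have "\<delta> \<in> iso (lim_group A' \<alpha>') (lim_group A \<alpha>)"
    unfolding \<delta>_def C_def by (rule group.iso_set_sym[OF comm_group.axioms(2)[OF G.X.lim_comm_group] iso])
  moreover have "\<delta> (lim_pi_f A' \<alpha>' y) = lim_pi_f A \<alpha> (\<delta> y)" "\<delta> (lim_pi_i A' \<alpha>' y) = lim_pi_i A \<alpha> (\<delta> y)"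
    if y: "y \<in> carrier (lim_group A' \<alpha>')" for y
  proof -
    obtain k X where X: "X \<in> upm (A k)" "\<delta> y = G.X.gc k X" using G.X.gc_cases r(2)[OF y] unfolding C_def by metis
    have "lim_pi_f A \<alpha> (\<delta> y) \<in> C" "lim_pi_i A \<alpha> (\<delta> y) \<in> C"
      using X G.X.gc_pi_f G.X.gc_pi_i G.X.gc_in pi_upm[OF G.X.N] by (simp_all add: C_def)
    moreover have "\<gamma> (lim_pi_f A \<alpha> (\<delta> y)) = lim_pi_f A' \<alpha>' y" "\<gamma> (lim_pi_i A \<alpha> (\<delta> y)) = lim_pi_i A' \<alpha>' y"
      using G.g r[OF y] by (simp_all add: Inv_iso_def C_def)
    ultimately show "\<delta> (lim_pi_f A' \<alpha>' y) = lim_pi_f A \<alpha> (\<delta> y)" "\<delta> (lim_pi_i A' \<alpha>' y) = lim_pi_i A \<alpha> (\<delta> y)" using l by metis+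
  qed
  ultimately have "Inv_iso A' \<alpha>' A \<alpha> \<delta>" using img[OF _ c(1)] img[OF _ c(2)] img[OF _ c(4)] G.g unfolding Inv_iso_def by simp
  moreover have "\<delta> ` lim_Sigma_op A' \<alpha>' = lim_Sigma_op A \<alpha>" by (rule img[OF G.gop c(3)])
  ultimately show ?thesis unfolding \<delta>_def C_def by (intro gam.intro gam_axioms.intro G.X.osys_axioms G.Y.osys_axioms)
qed

lemma gam_twine:
  assumes G: "gam A \<alpha> A' \<alpha>' \<gamma>"
  shows "\<exists>\<mu> \<nu> \<theta> \<eta>. twine A \<alpha> A' \<alpha>' \<mu> \<nu> \<theta> \<eta>"
proof -
  interpret G: gam A \<alpha> A' \<alpha>' \<gamma> by (rule G)
  define \<delta> where "\<delta> = inv_into (carrier (lim_group A \<alpha>)) \<gamma>"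
  have G': "gam A' \<alpha>' A \<alpha> \<delta>" unfolding \<delta>_def by (rule gam_inverse[OF G])
  have bij: "bij_betw \<gamma> (carrier (lim_group A \<alpha>)) (carrier (lim_group A' \<alpha>'))" using G.g by (simp add: Inv_iso_def iso_def)
  have l: "\<delta> (\<gamma> x) = x" if "x \<in> carrier (lim_group A \<alpha>)" for x unfolding \<delta>_def using bij that by (simp add: bij_betw_inv_into_left)
  have r: "\<gamma> (\<delta> y) = y" if "y \<in> carrier (lim_group A' \<alpha>')" for y unfolding \<delta>_def using bij that by (simp add: bij_betw_inv_into_right)
  \<comment> \<open>The bounds by \<open>i\<close> make the chosen levels cofinal and ensure that
    level \<open>i\<close> maps into stage \<open>i\<close>.\<close>
  define P where "P i x \<longleftrightarrow> (case x of (k, m, f) \<Rightarrow> i \<le> k \<and> i \<le> m \<and> OM (A k) (A' m) f \<and> lifts A \<alpha> A' \<alpha>' \<gamma> k m f)" for i :: nat and x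
  define Q where "Q x y \<longleftrightarrow> (case x of (k, m, f) \<Rightarrow> case y of (k', m', f') \<Rightarrow> k < k' \<and> m < m' \<and> (\<exists>h. SH (A' m) (A k') h \<and>
    (\<forall>a\<in>FM (A k). h (f a) = G.X.SS k k' a) \<and> (\<forall>b\<in>FM (A' m). f' (h b) = G.Y.SS m m' b)))" for x y
  have "\<exists>F. \<forall>i. P i (F i) \<and> Q (F i) (F (Suc i))"
  proof (rule dependent_nat_choice)
    obtain m f where "OM (A 0) (A' m) f" "lifts A \<alpha> A' \<alpha>' \<gamma> 0 m f" using G.lift_ex by blast
    then show "\<exists>x. P 0 x" unfolding P_def by (intro exI[of _ "(0, m, f)"]) simp
  next
    fix x i assume "P i x"
    then obtain k m f where x: "x = (k, m, f)" "i \<le> k" "i \<le> m" "OM (A k) (A' m) f" "lifts A \<alpha> A' \<alpha>' \<gamma> k m f"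
      unfolding P_def by (cases x) auto
    obtain n h where h: "k < n" "OM (A' m) (A n) h" "lifts A' \<alpha>' A \<alpha> \<delta> m n h" "\<forall>a\<in>FM (A k). h (f a) = G.X.SS k n a"
      using lift_step[OF G G' l x(4,5)] by blast
    obtain n' f' where f': "m < n'" "OM (A n) (A' n') f'" "lifts A \<alpha> A' \<alpha>' \<gamma> n n' f'" "\<forall>b\<in>FM (A' m). f' (h b) = G.Y.SS m n' b"
      using lift_step[OF G' G r h(2,3)] by blast
    show "\<exists>y. P (Suc i) y \<and> Q x y"
      by (rule exI[of _ "(n, n', f')"]) (use x h f' OM_SH[OF h(2)] in \<open>auto simp: P_def Q_def\<close>)
  qed
  then obtain F where F: "\<And>i. P i (F i)" "\<And>i. Q (F i) (F (Suc i))" by blast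
  define k where "k i = fst (F i)" for i
  define m where "m i = fst (snd (F i))" for i
  define f where "f i = snd (snd (F i))" for i
  have Fe: "F i = (k i, m i, f i)" for i by (simp add: k_def m_def f_def)
  have p: "i \<le> k i" "i \<le> m i" "OM (A (k i)) (A' (m i)) (f i)" for i using F(1)[of i] by (simp_all add: P_def Fe)
  have "\<exists>h. SH (A' (m i)) (A (k (Suc i))) h \<and>
    (\<forall>a\<in>FM (A (k i)). h (f i a) = G.X.SS (k i) (k (Suc i)) a) \<and> (\<forall>b\<in>FM (A' (m i)). f (Suc i) (h b) = G.Y.SS (m i) (m (Suc i)) b)" for i
    using F(2)[of i] by (simp add: Q_def Fe)
  then obtain h where h: "\<And>i. SH (A' (m i)) (A (k (Suc i))) (h i)"
    "\<And>i a. a \<in> FM (A (k i)) \<Longrightarrow> h i (f i a) = G.X.SS (k i) (k (Suc i)) a"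
    "\<And>i b. b \<in> FM (A' (m i)) \<Longrightarrow> f (Suc i) (h i b) = G.Y.SS (m i) (m (Suc i)) b" by metis
  have inc: "k i < k (Suc i)" "m i < m (Suc i)" for i using F(2)[of i] by (simp_all add: Q_def Fe)
  have mon: "i \<le> j \<Longrightarrow> k i \<le> k j" "i \<le> j \<Longrightarrow> m i \<le> m j" for i j
    by (rule lift_Suc_mono_le[of k]; simp add: inc less_imp_le) (rule lift_Suc_mono_le[of m]; simp add: inc less_imp_le)
  have fS: "SH (A (k i)) (A' (m i)) (f i)" for i by (rule OM_SH[OF p(3)])
  have nat1: "f j (G.X.SS (k i) (k j) a) = G.Y.SS (m i) (m j) (f i a)" if "i \<le> j" "a \<in> FM (A (k i))" for i j a
    using that(1)
  proof (induction j rule: dec_induct)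
    case (step j)
    have F1: "G.X.SS (k i) (k j) a \<in> FM (A (k j))" by (rule G.X.SS_FM[OF mon(1)[OF step.hyps(1)] that(2)])
    have F2: "f j (G.X.SS (k i) (k j) a) \<in> FM (A' (m j))" by (rule SHD(1)[OF fS F1])
    have "f (Suc j) (G.X.SS (k i) (k (Suc j)) a) = f (Suc j) (G.X.SS (k j) (k (Suc j)) (G.X.SS (k i) (k j) a))"
      using mon step.hyps by (simp add: G.X.SS_comp)
    also have "\<dots> = f (Suc j) (h j (f j (G.X.SS (k i) (k j) a)))" using h(2)[OF F1] by simp
    also have "\<dots> = G.Y.SS (m j) (m (Suc j)) (f j (G.X.SS (k i) (k j) a))" by (rule h(3)[OF F2])
    also have "\<dots> = G.Y.SS (m i) (m (Suc j)) (f i a)" unfolding step.IH using mon step.hyps by (simp add: G.Y.SS_comp)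
    finally show ?case .
  qed simp
  define \<mu> where "\<mu> = m"
  define \<nu> where "\<nu> i = k (Suc i)" for i
  \<comment> \<open>The stages only provide maps at the levels \<open>k i\<close> and
    \<open>m i\<close>; other levels are first moved up by system maps.\<close>
  define \<theta> where "\<theta> i a = f i (G.X.SS i (k i) a)" for i a
  define \<eta> where "\<eta> i b = h i (G.Y.SS i (m i) b)" for i b
  have "twine A \<alpha> A' \<alpha>' \<mu> \<nu> \<theta> \<eta>"
    unfolding twine_def
  proof (intro conjI allI ballI)
    show "mono \<mu>" "mono \<nu>" using mon by (auto simp: mono_def \<mu>_def \<nu>_def)
    fix i
    show "i < \<nu> (\<mu> i)" using p(2)[of i] p(1)[of "Suc (m i)"] by (simp add: \<mu>_def \<nu>_def)
    show "i < \<mu> (\<nu> i)" using p(1)[of "Suc i"] p(2)[of "k (Suc i)"] by (simp add: \<mu>_def \<nu>_def)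
    show "SH (A i) (A' (\<mu> i)) (\<theta> i)"
      using SH_comp[OF G.X.SS_SH[OF p(1)[of i]] fS] by (simp add: \<theta>_def[abs_def] \<mu>_def comp_def)
    show "SH (A' i) (A (\<nu> i)) (\<eta> i)"
      using SH_comp[OF G.Y.SS_SH[OF p(2)[of i]] h(1)] by (simp add: \<eta>_def[abs_def] \<nu>_def comp_def)
  next
    fix i a assume a: "a \<in> FM (A i)"
    have F1: "G.X.SS i (k i) a \<in> FM (A (k i))" by (rule G.X.SS_FM[OF p(1) a])
    have "G.Y.SS (\<mu> i) (\<mu> (Suc i)) (\<theta> i a) = f (Suc i) (G.X.SS (k i) (k (Suc i)) (G.X.SS i (k i) a))"
      using nat1[of i "Suc i", OF _ F1] by (simp add: \<mu>_def \<theta>_def)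
    also have "\<dots> = f (Suc i) (G.X.SS i (k (Suc i)) a)" using p(1)[of i] inc(1)[of i] by (simp add: G.X.SS_comp)
    also have "G.X.SS i (k (Suc i)) a = G.X.SS (Suc i) (k (Suc i)) (G.X.S i a)"
      using G.X.SS_comp[of i "Suc i" "k (Suc i)" a] p(1)[of "Suc i"] by (simp add: G.X.SS_one)
    finally show "G.Y.SS (\<mu> i) (\<mu> (Suc i)) (\<theta> i a) = \<theta> (Suc i) (G.X.S i a)" by (simp add: \<theta>_def)
    show "\<eta> (\<mu> i) (\<theta> i a) = G.X.SS i (\<nu> (\<mu> i)) a"
    proof -
      define J where "J = m i"
      have iJ: "i \<le> J" using p(2) by (simp add: J_def)
      have F2: "G.X.SS (k i) (k J) (G.X.SS i (k i) a) \<in> FM (A (k J))" by (rule G.X.SS_FM[OF mon(1)[OF iJ] F1])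
      have "\<eta> (\<mu> i) (\<theta> i a) = h J (G.Y.SS (m i) (m J) (f i (G.X.SS i (k i) a)))" by (simp add: \<eta>_def \<theta>_def \<mu>_def J_def)
      also have "\<dots> = h J (f J (G.X.SS (k i) (k J) (G.X.SS i (k i) a)))" unfolding nat1[OF iJ F1] ..
      also have "\<dots> = G.X.SS (k J) (k (Suc J)) (G.X.SS (k i) (k J) (G.X.SS i (k i) a))" by (rule h(2)[OF F2])
      also have "\<dots> = G.X.SS i (k (Suc J)) a"
        using p(1)[of i] mon(1)[OF iJ] inc(1)[of J] by (simp add: G.X.SS_comp)
      finally show ?thesis by (simp add: \<nu>_def \<mu>_def J_def)
    qed
  next
    fix i b assume b: "b \<in> FM (A' i)"
    have F1: "G.Y.SS i (m i) b \<in> FM (A' (m i))" by (rule G.Y.SS_FM[OF p(2) b])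
    have F2: "h i (G.Y.SS i (m i) b) \<in> FM (A (k (Suc i)))" by (rule SHD(1)[OF h(1) F1])
    have "G.X.SS (\<nu> i) (\<nu> (Suc i)) (\<eta> i b) = h (Suc i) (f (Suc i) (h i (G.Y.SS i (m i) b)))"
      using h(2)[OF F2] by (simp add: \<nu>_def \<eta>_def)
    also have "\<dots> = h (Suc i) (G.Y.SS (m i) (m (Suc i)) (G.Y.SS i (m i) b))" using h(3)[OF F1] by simp
    also have "G.Y.SS (m i) (m (Suc i)) (G.Y.SS i (m i) b) = G.Y.SS i (m (Suc i)) b" using p(2)[of i] inc(2)[of i] by (simp add: G.Y.SS_comp)
    also have "\<dots> = G.Y.SS (Suc i) (m (Suc i)) (G.Y.S i b)"
      using G.Y.SS_comp[of i "Suc i" "m (Suc i)" b] p(2)[of "Suc i"] by (simp add: G.Y.SS_one)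
    finally show "G.X.SS (\<nu> i) (\<nu> (Suc i)) (\<eta> i b) = \<eta> (Suc i) (G.Y.S i b)" by (simp add: \<eta>_def)
    show "\<theta> (\<nu> i) (\<eta> i b) = G.Y.SS i (\<mu> (\<nu> i)) b"
    proof -
      define J where "J = k (Suc i)"
      have iJ: "Suc i \<le> J" using p(1) by (simp add: J_def)
      have "\<theta> (\<nu> i) (\<eta> i b) = f J (G.X.SS (k (Suc i)) (k J) (h i (G.Y.SS i (m i) b)))" by (simp add: \<eta>_def \<theta>_def \<nu>_def J_def)
      also have "\<dots> = G.Y.SS (m (Suc i)) (m J) (f (Suc i) (h i (G.Y.SS i (m i) b)))" by (rule nat1[OF iJ F2])
      also have "\<dots> = G.Y.SS (m (Suc i)) (m J) (G.Y.SS (m i) (m (Suc i)) (G.Y.SS i (m i) b))" using h(3)[OF F1] by simp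
      also have "\<dots> = G.Y.SS i (m J) b" using p(2)[of i] mon(2)[OF iJ] inc(2)[of i] by (simp add: G.Y.SS_comp)
      finally show ?thesis by (simp add: \<nu>_def \<mu>_def J_def)
    qed
  qed
  then show ?thesis by blast
qed

section \<open>Operator norm\<close>

definition hn :: "fmat \<Rightarrow> real" where "hn a = sqrt (hs a)"

lemma hn_ge_0 [simp]: "0 \<le> hn a" by (simp add: hn_def)
lemma hn_0 [simp]: "hn 0 = 0" by (simp add: hn_def)
lemma hn_0_iff [simp]: "hn a = 0 \<longleftrightarrow> a = 0" by (simp add: hn_def)

lemma hn_L2: "bnd n a \<Longrightarrow> hn a = L2_set (\<lambda>p. cmod (ent a (snd p) (fst p))) ({..<n} \<times> {..<n})"
  by (simp add: hn_def L2_set_def hs_bnd sum.cartesian_product case_prod_unfold)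

lemma hn_add: "hn (a + b) \<le> hn a + hn b"
proof -
  obtain n where n: "bnd n a" "bnd n b" using bnd_ex2 by blast
  have "hn (a + b) \<le> L2_set (\<lambda>p. cmod (ent a (snd p) (fst p)) + cmod (ent b (snd p) (fst p))) ({..<n} \<times> {..<n})"
    unfolding hn_L2[OF bnd_add[OF n]] by (rule L2_set_mono) (auto simp: ent_simps norm_triangle_ineq)
  also have "\<dots> \<le> hn a + hn b" unfolding hn_L2[OF n(1)] hn_L2[OF n(2)] by (rule L2_set_triangle_ineq)
  finally show ?thesis .
qed

lemma tr_adj_le: "cmod (tr (adj a * b)) \<le> hn a * hn b"
proof -
  obtain n where n: "bnd n a" "bnd n b" using bnd_ex2 by blast
  have "tr (adj a * b) = (\<Sum>p\<in>{..<n} \<times> {..<n}. cnj (ent a (snd p) (fst p)) * ent b (snd p) (fst p))"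
    using n by (simp add: tr_bnd[OF bnd_mult[of n "adj a" b]] ent_mult[of n "adj a"] ent_simps
      sum.cartesian_product case_prod_unfold)
  also have "cmod \<dots> \<le> (\<Sum>p\<in>{..<n} \<times> {..<n}. cmod (cnj (ent a (snd p) (fst p)) * ent b (snd p) (fst p)))"
    by (rule norm_sum)
  also have "\<dots> = (\<Sum>p\<in>{..<n} \<times> {..<n}. \<bar>cmod (ent a (snd p) (fst p))\<bar> * \<bar>cmod (ent b (snd p) (fst p))\<bar>)"
    by (simp add: norm_mult)
  also have "\<dots> \<le> hn a * hn b" unfolding hn_L2[OF n(1)] hn_L2[OF n(2)] by (rule L2_set_mult_ineq)
  finally show ?thesis .
qed

lemma hs_mult: "hs (a * b) \<le> hs a * hs b"
proof -
  obtain n where n: "bnd n a" "bnd n b" using bnd_ex2 by blast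
  have e: "(cmod (ent (a * b) i j))\<^sup>2 \<le> (\<Sum>k<n. (cmod (ent a i k))\<^sup>2) * (\<Sum>k<n. (cmod (ent b k j))\<^sup>2)" for i j
  proof -
    have "cmod (ent (a * b) i j) \<le> (\<Sum>k<n. \<bar>cmod (ent a i k)\<bar> * \<bar>cmod (ent b k j)\<bar>)"
      unfolding ent_mult[OF n(1)] by (rule order_trans[OF norm_sum]) (simp add: norm_mult)
    also have "\<dots> \<le> L2_set (\<lambda>k. cmod (ent a i k)) {..<n} * L2_set (\<lambda>k. cmod (ent b k j)) {..<n}"
      by (rule L2_set_mult_ineq)
    finally have "(cmod (ent (a * b) i j))\<^sup>2 \<le> (L2_set (\<lambda>k. cmod (ent a i k)) {..<n} * L2_set (\<lambda>k. cmod (ent b k j)) {..<n})\<^sup>2"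
      by (rule power_mono) simp
    then show ?thesis by (simp add: power_mult_distrib L2_set_def sum_nonneg)
  qed
  have "hs (a * b) \<le> (\<Sum>j<n. \<Sum>i<n. (\<Sum>k<n. (cmod (ent a i k))\<^sup>2) * (\<Sum>k<n. (cmod (ent b k j))\<^sup>2))"
    unfolding hs_bnd[OF bnd_mult[OF n]] by (intro sum_mono e)
  also have "\<dots> = (\<Sum>i<n. \<Sum>k<n. (cmod (ent a i k))\<^sup>2) * hs b"
    unfolding hs_bnd[OF n(2)] sum_product[of "\<lambda>i. \<Sum>k<n. (cmod (ent a i k))\<^sup>2"] by (rule sum.swap)
  also have "(\<Sum>i<n. \<Sum>k<n. (cmod (ent a i k))\<^sup>2) = hs a"
    unfolding hs_bnd[OF n(1)] by (rule sum.swap)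
  finally show ?thesis .
qed

lemma hs_scl: "hs (c \<odot> a) = (cmod c)\<^sup>2 * hs a"
proof -
  obtain n where "bnd n a" using bnd_ex by blast
  then show ?thesis using bnd_scl[of n a c] by (simp add: hs_bnd ent_simps norm_mult power_mult_distrib sum_distrib_left)
qed

lemma hn_scl: "hn (c \<odot> a) = cmod c * hn a"
  by (simp add: hn_def hs_scl real_sqrt_mult)

lemma hn_sq: "hn a * hn a = hs a" by (simp add: hn_def)

text \<open>The norm of left multiplication on the Hilbert-Schmidt space. That space consists of
  copies of the column space, so this is the operator norm (\<open>opnorm_nm\<close>), but without
  reference to vectors or sizes.\<close>

definition nm :: "fmat \<Rightarrow> real" where
  "nm a = Sup {hn (a * X) | X. hn X \<le> 1}"

lemma nm_bdd: "bdd_above {hn (a * X) | X. hn X \<le> 1}"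
proof (rule bdd_aboveI[of _ "hn a"])
  fix r assume "r \<in> {hn (a * X) | X. hn X \<le> 1}"
  then obtain X where X: "r = hn (a * X)" "hn X \<le> 1" by blast
  have "hn (a * X) \<le> hn a * hn X" using hs_mult[of a X] by (simp add: hn_def real_sqrt_mult[symmetric])
  also have "\<dots> \<le> hn a * 1" using X by (intro mult_left_mono) auto
  finally show "r \<le> hn a" using X by simp
qed

lemma nm_ge_0 [simp]: "0 \<le> nm a"
  unfolding nm_def by (rule cSup_upper[OF _ nm_bdd]) (auto intro!: exI[of _ 0])

lemma nm_bd: "hn (a * X) \<le> nm a * hn X"
proof (cases "X = 0")
  case False
  then have p: "hn X > 0" by (simp add: less_le)
  define Y where "Y = of_real (1 / hn X) \<odot> X"
  have "hn Y \<le> 1" using p by (simp add: Y_def hn_scl norm_divide)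
  then have "hn (a * Y) \<le> nm a" unfolding nm_def by (intro cSup_upper nm_bdd) auto
  then show ?thesis using p by (simp add: Y_def hn_scl norm_divide field_simps)
qed simp

lemma nm_le: "0 \<le> C \<Longrightarrow> (\<And>X. hn (a * X) \<le> C * hn X) \<Longrightarrow> nm a \<le> C"
proof -
  assume C: "0 \<le> C" "\<And>X. hn (a * X) \<le> C * hn X"
  show ?thesis unfolding nm_def
  proof (rule cSup_least)
    show "{hn (a * X) | X. hn X \<le> 1} \<noteq> {}" by (auto intro!: exI[of _ 0])
    fix r assume "r \<in> {hn (a * X) | X. hn X \<le> 1}"
    then obtain X where X: "r = hn (a * X)" "hn X \<le> 1" by blast
    have "r \<le> C * hn X" using X C by simp
    also have "\<dots> \<le> C * 1" using X C by (intro mult_left_mono)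
    finally show "r \<le> C" by simp
  qed
qed

lemma nm_0 [simp]: "nm 0 = 0" using nm_le[of 0 0] nm_ge_0[of 0] by simp

lemma nm_add: "nm (a + b) \<le> nm a + nm b"
proof (rule nm_le)
  fix X
  have "hn ((a + b) * X) \<le> hn (a * X) + hn (b * X)" unfolding distrib_right by (rule hn_add)
  also have "\<dots> \<le> nm a * hn X + nm b * hn X" by (intro add_mono nm_bd)
  finally show "hn ((a + b) * X) \<le> (nm a + nm b) * hn X" by (simp add: distrib_right)
qed simp

lemma nm_mult: "nm (a * b) \<le> nm a * nm b"
proof (rule nm_le)
  fix X
  have "hn (a * b * X) \<le> nm a * hn (b * X)" unfolding mult.assoc by (rule nm_bd)
  also have "\<dots> \<le> nm a * (nm b * hn X)" by (intro mult_left_mono nm_bd) simp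
  finally show "hn (a * b * X) \<le> nm a * nm b * hn X" by (simp add: mult.assoc)
qed simp

lemma nm_scl: "nm (c \<odot> a) \<le> cmod c * nm a"
proof (rule nm_le)
  fix X show "hn (c \<odot> a * X) \<le> cmod c * nm a * hn X"
    using mult_left_mono[OF nm_bd[of a X], of "cmod c"] by (simp add: hn_scl mult.assoc)
qed simp

lemma nm_minus [simp]: "nm (- a) = nm a"
  using nm_scl[of "-1" a] nm_scl[of "-1" "-a"] by (simp add: scl_m1)

lemma nm_diff: "nm (a - b) \<le> nm a + nm b" using nm_add[of a "-b"] by simp

lemma nm_diff_comm: "nm (a - b) = nm (b - a)" using nm_minus[of "a - b"] by simp

lemma nm_triangle: "nm (a - c) \<le> nm (a - b) + nm (b - c)"
  using nm_add[of "a - b" "b - c"] by simp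

lemma nm_sum: "nm (sum f S) \<le> (\<Sum>x\<in>S. nm (f x))"
  by (induction S rule: infinite_finite_induct) (auto intro: order_trans[OF nm_add])

lemma nm_adj [simp]: "nm (adj a) = nm a"
proof -
  have "nm (adj a) \<le> nm a" for a
  proof (rule nm_le)
    fix X
    have "hn (adj a * X) * hn (adj a * X) = cmod (tr (adj X * (a * (adj a * X))))"
      using tr_hs[of "adj a * X"] by (simp add: hn_sq mult.assoc)
    also have "\<dots> \<le> hn X * hn (a * (adj a * X))" by (rule tr_adj_le)
    also have "\<dots> \<le> hn X * (nm a * hn (adj a * X))" by (intro mult_left_mono nm_bd) simp
    finally have "hn (adj a * X) * hn (adj a * X) \<le> nm a * hn X * hn (adj a * X)" by (simp add: mult_ac)
    then show "hn (adj a * X) \<le> nm a * hn X"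
      by (cases "hn (adj a * X) = 0") (auto simp: less_le)
  qed simp
  from this[of a] this[of "adj a"] show ?thesis by simp
qed

text \<open>The C*-identity; the nontrivial inequality is Cauchy-Schwarz for the trace form.\<close>

lemma nm_star: "nm (adj a * a) = nm a * nm a"
proof (rule antisym)
  show "nm (adj a * a) \<le> nm a * nm a" using nm_mult[of "adj a" a] by simp
  have "nm a \<le> sqrt (nm (adj a * a))"
  proof (rule nm_le)
    fix X
    have "hs (a * X) = cmod (tr (adj X * (adj a * a * X)))" using tr_hs[of "a * X"] by (simp add: mult.assoc)
    also have "\<dots> \<le> hn X * hn (adj a * a * X)" by (rule tr_adj_le)
    also have "\<dots> \<le> hn X * (nm (adj a * a) * hn X)" by (intro mult_left_mono nm_bd) simp
    also have "\<dots> = nm (adj a * a) * hs X" by (simp add: hn_sq[symmetric])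
    finally have "sqrt (hs (a * X)) \<le> sqrt (nm (adj a * a) * hs X)" by simp
    then show "hn (a * X) \<le> sqrt (nm (adj a * a)) * hn X" by (simp add: hn_def real_sqrt_mult)
  qed simp
  then have "nm a * nm a \<le> sqrt (nm (adj a * a)) * sqrt (nm (adj a * a))" by (intro mult_mono) auto
  then show "nm a * nm a \<le> nm (adj a * a)" by simp
qed

lemma nm_pj_le: "pj p \<Longrightarrow> nm p \<le> 1"
  using nm_star[of p] by (cases "nm p = 0") (auto simp: pj_def)

lemma nm_pj_ge: "pj p \<Longrightarrow> p \<noteq> 0 \<Longrightarrow> 1 \<le> nm p"
  using nm_bd[of p p] by (auto simp: pj_def less_le)

lemma nm_mu: "nm (mu x y) \<le> 1"
proof -
  have "pj (mu y y)" by (simp add: pj_def mu_mult)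
  from nm_pj_le[OF this] show ?thesis using nm_star[of "mu x y"] abs_square_le_1[of "nm (mu x y)"] by (simp add: mu_mult power2_eq_square)
qed

lemma ent_nm: "cmod (ent a x y) \<le> nm a"
proof -
  have h: "hn (mu z 0) = 1" for z using tr_hs[of "mu z 0"] by (simp add: hn_def mu_mult tr_mu)
  have "ent a x y = tr (adj (mu x 0) * (a * mu y 0))"
    using mu_sandwich[of 0 x a y 0] by (simp add: tr_mu mult.assoc)
  also have "cmod \<dots> \<le> hn (mu x 0) * hn (a * mu y 0)" by (rule tr_adj_le)
  also have "\<dots> \<le> nm a" using nm_bd[of a "mu y 0"] by (simp add: h)
  finally show ?thesis .
qed

text \<open>Contractivity without spectral theory. Finite dimension gives a bound with some constant
  \<open>K\<close>. For selfadjoint \<open>h\<close> the C*-identity turns squaring into squaring of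
  the norm of the image, so a ratio \<open>r > 1\<close> of \<open>nm (\<psi> h)\<close> to
  \<open>nm h\<close> would exceed \<open>K\<close> after repeated squaring. The general case is
  reduced to \<open>adj a * a\<close>.\<close>

lemma SH_contract:
  assumes \<psi>: "SH A B \<psi>" and a: "a \<in> FM A"
  shows "nm (\<psi> a) \<le> nm a"
proof -
  note S = SHD[OF \<psi>]
  define n where "n = msize A"
  have muF: "mu x y \<in> FM A" if "x < n" "y < n" for x y using that by (simp add: FM_def n_def bnd_mu)
  define K where "K = (\<Sum>x<n. \<Sum>y<n. nm (\<psi> (mu x y)))"
  have K: "nm (\<psi> b) \<le> K * nm b" if b: "b \<in> FM A" for b
  proof -
    have "\<psi> b = \<psi> (\<Sum>x<n. \<Sum>y<n. ent b x y \<odot> mu x y)"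
      using fmat_expand[of n b] b by (simp add: FM_def n_def)
    also have "\<dots> = (\<Sum>x<n. \<psi> (\<Sum>y<n. ent b x y \<odot> mu x y))" by (rule SH_sum[OF \<psi>]) (auto intro!: FM_sum simp: muF)
    also have "\<dots> = (\<Sum>x<n. \<Sum>y<n. \<psi> (ent b x y \<odot> mu x y))"
      by (intro sum.cong refl SH_sum[OF \<psi>]) (simp add: muF)
    also have "\<dots> = (\<Sum>x<n. \<Sum>y<n. ent b x y \<odot> \<psi> (mu x y))"
      by (intro sum.cong refl S(4)) (simp add: muF)
    finally have "\<psi> b = (\<Sum>x<n. \<Sum>y<n. ent b x y \<odot> \<psi> (mu x y))" .
    then have "nm (\<psi> b) \<le> (\<Sum>x<n. \<Sum>y<n. nm (ent b x y \<odot> \<psi> (mu x y)))"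
      by (auto intro: order_trans[OF nm_sum] sum_mono nm_sum)
    also have "\<dots> \<le> (\<Sum>x<n. \<Sum>y<n. nm (\<psi> (mu x y)) * nm b)"
      by (intro sum_mono order_trans[OF nm_scl]) (subst mult.commute, intro mult_left_mono ent_nm nm_ge_0)
    finally show ?thesis by (simp add: K_def sum_distrib_right)
  qed
  have sa: "nm (\<psi> h) \<le> nm h" if h: "h \<in> FM A" "adj h = h" for h
  proof (rule ccontr)
    assume "\<not> nm (\<psi> h) \<le> nm h"
    then have lt: "nm h < nm (\<psi> h)" by simp
    have pos: "0 < nm h" using K[OF h(1)] lt by (cases "nm h = 0") (auto simp: less_le)
    define q where "q k = ((\<lambda>x. x * x) ^^ k) h" for k
    have q0: "q 0 = h" and qS: "q (Suc k) = q k * q k" for k by (simp_all add: q_def)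
    have q: "q k \<in> FM A \<and> adj (q k) = q k \<and> nm (q k) \<le> nm h ^ 2 ^ k \<and> nm (\<psi> (q k)) = nm (\<psi> h) ^ 2 ^ k" for k
    proof (induction k)
      case (Suc k)
      have "nm (q (Suc k)) \<le> nm (q k) * nm (q k)" by (simp add: qS nm_mult)
      also have "\<dots> \<le> nm h ^ 2 ^ k * nm h ^ 2 ^ k" using Suc by (intro mult_mono) auto
      finally have 1: "nm (q (Suc k)) \<le> nm h ^ 2 ^ Suc k" by (simp add: power_add[symmetric] mult_2)
      have "adj (\<psi> (q k)) = \<psi> (q k)" using S(5)[of "q k"] Suc by simp
      then have "nm (\<psi> (q (Suc k))) = nm (\<psi> h) ^ 2 ^ Suc k"
        using nm_star[of "\<psi> (q k)"] Suc S(3)[of "q k" "q k"] by (simp add: qS power_add[symmetric] mult_2)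
      then show ?case using 1 Suc by (simp add: qS)
    qed (use h in \<open>simp add: q0\<close>)
    define r where "r = nm (\<psi> h) / nm h"
    have r: "r > 1" using lt pos by (simp add: r_def)
    obtain m where m: "K < r ^ m" using real_arch_pow[OF r] by blast
    have "r ^ m \<le> r ^ 2 ^ m" using r by (intro power_increasing) (auto simp: less_imp_le)
    also have "\<dots> = nm (\<psi> (q m)) / nm h ^ 2 ^ m" using q[of m] by (simp add: r_def power_divide)
    also have "\<dots> \<le> K"
    proof -
      have "nm (\<psi> (q m)) \<le> K * nm (q m)" using K q by blast
      also have "\<dots> \<le> K * nm h ^ 2 ^ m" using q[of m] by (intro mult_left_mono) (auto simp: K_def intro!: sum_nonneg)
      finally show ?thesis using pos by (simp add: divide_le_eq)
    qed
    finally show False using m by simp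
  qed
  have "nm (\<psi> a) * nm (\<psi> a) = nm (\<psi> (adj a * a))" using nm_star[of "\<psi> a"] S(3)[of "adj a" a] S(5)[of a] a by simp
  also have "\<dots> \<le> nm (adj a * a)" using a by (intro sa) auto
  also have "\<dots> = nm a * nm a" by (rule nm_star)
  finally show ?thesis using nm_ge_0[of a] nm_ge_0[of "\<psi> a"] by (metis abs_le_square_iff abs_of_nonneg power2_eq_square)
qed

text \<open>A weak form of the fact that nonzero star homomorphisms of a simple algebra are
  isometric. Matrix units, of norm at most 1, bring the entry to position \<open>(0, 0)\<close>,
  where it multiplies the image \<open>p\<close> of a minimal projection; \<open>p\<close> is
  nonzero, hence of norm at least 1.\<close>

lemma SH_ent_le:
  assumes N: "is_nest A" and \<psi>: "SH A B \<psi>" and u: "\<psi> (uno A) \<noteq> 0" and b: "b \<in> FM A"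
  shows "cmod (ent b x y) \<le> nm (\<psi> b)"
proof (cases "x < msize A \<and> y < msize A")
  case True
  note S = SHD[OF \<psi>]
  have n: "0 < msize A" using N by (simp add: is_nest_def)
  have muF: "mu x y \<in> FM A" if "x < msize A" "y < msize A" for x y using that by (simp add: FM_def bnd_mu)
  define p where "p = \<psi> (mu 0 0)"
  have pjp: "pj p" unfolding p_def by (rule SH_pj[OF \<psi> muF[OF n n]]) (simp add: pj_def mu_mult)
  have "p \<noteq> 0"
  proof
    assume p0: "p = 0"
    have "\<psi> (mu z z) = 0" if z: "z < msize A" for z
    proof -
      have "mu z z = mu z 0 * mu 0 0 * mu 0 z" by (simp add: mu_mult)
      then have "\<psi> (mu z z) = \<psi> (mu z 0) * p * \<psi> (mu 0 z)"
        using muF z n S(3) by (simp add: p_def)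
      then show ?thesis using p0 by simp
    qed
    moreover have "uno A = (\<Sum>z<msize A. mu z z)"
      by (rule fmat_eqI) (auto simp: un_def ent_sum ent_simps em.rep_eq sum.delta if_distrib cong: if_cong conj_cong)
    ultimately have "\<psi> (uno A) = 0" using SH_sum[OF \<psi>, of "{..<msize A}" "\<lambda>z. mu z z"] muF by simp
    then show False using u by simp
  qed
  then have p1: "1 \<le> nm p" by (rule nm_pj_ge[OF pjp])
  have e: "ent b x y \<odot> p = \<psi> (mu 0 x) * \<psi> b * \<psi> (mu y 0)"
    using muF True n b S(4)[of "mu 0 0" "ent b x y"] S(3)[of "mu 0 x * b" "mu y 0"] S(3)[of "mu 0 x" b]
    by (simp add: p_def mu_sandwich)
  have "cmod (ent b x y) \<le> cmod (ent b x y) * nm p" using p1 mult_left_mono[of 1 "nm p" "cmod (ent b x y)"] by simp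
  also have "\<dots> \<le> nm (ent b x y \<odot> p)"
    using nm_scl[of "inverse (ent b x y)" "ent b x y \<odot> p"] by (cases "ent b x y = 0") (auto simp: norm_inverse norm_divide field_simps)
  also have "\<dots> \<le> nm (\<psi> (mu 0 x) * \<psi> b) * nm (\<psi> (mu y 0))" unfolding e by (rule nm_mult)
  also have "\<dots> \<le> (nm (\<psi> (mu 0 x)) * nm (\<psi> b)) * nm (\<psi> (mu y 0))" by (intro mult_right_mono nm_mult) simp
  also have "\<dots> \<le> (1 * nm (\<psi> b)) * 1"
    using SH_contract[OF \<psi> muF[OF n conjunct1[OF True]]] SH_contract[OF \<psi> muF[OF conjunct2[OF True] n]] nm_mu
    by (intro mult_mono) (auto intro: order_trans)
  finally show ?thesis by simp
next
  case False
  then have "ent b x y = 0" using b by (auto simp: FM_def bnd_def not_less)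
  then show ?thesis by simp
qed

text \<open>\<open>opnorm\<close> tests column vectors and \<open>nm\<close> tests matrices. A
  vector is embedded as a single column by \<open>cv\<close>; conversely a matrix is tested column
  by column.\<close>

lemma opnorm_nm:
  assumes a: "a \<in> carrier_mat n n"
  shows "opnorm a = nm (em a)"
proof -
  define cv where "cv x = em (mat n 1 (\<lambda>(i, _). x $ i))" for x :: "complex vec"
  let ?V = "{l2norm (a *\<^sub>v x) | x. x \<in> carrier_vec (dim_col a) \<and> l2norm x \<le> 1}"
  have hcv: "hn (cv x) = l2norm x" if x: "x \<in> carrier_vec n" for x
  proof -
    have b: "bnd (Suc n) (cv x)" by (auto simp: bnd_def cv_def em.rep_eq)
    have "hs (cv x) = (\<Sum>j<Suc n. if j = 0 then (\<Sum>i<n. (cmod (x $ i))\<^sup>2) else 0)"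
      unfolding hs_bnd[OF b] by (intro sum.cong refl) (auto simp: cv_def em.rep_eq)
    then show ?thesis using x by (simp add: hn_def l2norm_def sum.delta)
  qed
  have acv: "em a * cv x = cv (a *\<^sub>v x)" if x: "x \<in> carrier_vec n" for x
  proof -
    have "a * mat n 1 (\<lambda>(i, _). x $ i) = mat n 1 (\<lambda>(i, _). (a *\<^sub>v x) $ i)"
      by (rule eq_matI) (use a x in \<open>auto simp: scalar_prod_def intro!: sum.cong\<close>)
    then show ?thesis using em_mult[OF a, of "mat n 1 (\<lambda>(i, _). x $ i)" 1] by (simp add: cv_def)
  qed
  have sub: "?V \<subseteq> {hn (em a * X) | X. hn X \<le> 1}"
  proof
    fix r assume "r \<in> ?V"
    then obtain x where x: "r = l2norm (a *\<^sub>v x)" "x \<in> carrier_vec n" "l2norm x \<le> 1" using a by auto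
    then have "r = hn (em a * cv x)" "hn (cv x) \<le> 1" using acv hcv[of "a *\<^sub>v x"] hcv[of x] a by auto
    then show "r \<in> {hn (em a * X) | X. hn X \<le> 1}" by blast
  qed
  have l0: "l2norm (0\<^sub>v n) = 0" by (simp add: l2norm_def)
  have ne: "?V \<noteq> {}" using a l0 by (auto intro!: exI[of _ "0\<^sub>v n"])
  have bdd: "bdd_above ?V" by (rule bdd_above_mono[OF nm_bdd sub])
  have up: "l2norm (a *\<^sub>v x) \<le> opnorm a" if "x \<in> carrier_vec n" "l2norm x \<le> 1" for x
    unfolding opnorm_def using that a by (intro cSup_upper bdd) auto
  have lnn: "0 \<le> l2norm x" for x by (simp add: l2norm_def sum_nonneg)
  have o0: "0 \<le> opnorm a" using up[of "0\<^sub>v n"] lnn[of "a *\<^sub>v 0\<^sub>v n"] l0 by simp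
  have lsc: "l2norm (c \<cdot>\<^sub>v x) = cmod c * l2norm x" for c x
    by (simp add: l2norm_def norm_mult power_mult_distrib sum_distrib_left[symmetric] real_sqrt_mult)
  have vb: "l2norm (a *\<^sub>v x) \<le> opnorm a * l2norm x" if x: "x \<in> carrier_vec n" for x
  proof (cases "l2norm x = 0")
    case True
    then have "cv x = 0" using hcv[OF x] by simp
    then have "cv (a *\<^sub>v x) = 0" using acv[OF x] by simp
    then have "l2norm (a *\<^sub>v x) = 0" using hcv[of "a *\<^sub>v x"] a x by simp
    then show ?thesis using True by simp
  next
    case False
    then have p: "l2norm x > 0" using lnn[of x] by simp
    define c where "c = complex_of_real (1 / l2norm x)"
    have "l2norm (a *\<^sub>v (c \<cdot>\<^sub>v x)) \<le> opnorm a" using p x by (intro up) (auto simp: lsc c_def norm_divide)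
    moreover have "a *\<^sub>v (c \<cdot>\<^sub>v x) = c \<cdot>\<^sub>v (a *\<^sub>v x)" using a x by (rule mult_mat_vec)
    ultimately show ?thesis using p by (simp add: lsc c_def norm_divide field_simps)
  qed
  have "nm (em a) \<le> opnorm a"
  proof (rule nm_le[OF o0])
    fix X
    obtain M0 where "bnd M0 X" using bnd_ex by blast
    then obtain M where M: "bnd M X" "n \<le> M" using bnd_mono[of M0 X "max M0 n"] by (meson max.cobounded1 max.cobounded2)
    define c where "c j = vec n (\<lambda>i. ent X i j)" for j
    have ae: "bnd n (em a)" using a by (rule em_bnd)
    have en: "ent (em a * X) i j = (if i < n then (a *\<^sub>v c j) $ i else 0)" for i j
      unfolding ent_mult[OF ae] using a by (auto simp: em.rep_eq scalar_prod_def c_def atLeast0LessThan intro!: sum.cong)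
    have spl: "(\<Sum>i<M. (cmod (if i < n then g i else 0))\<^sup>2) = (\<Sum>i<n. (cmod (g i))\<^sup>2)" for g :: "nat \<Rightarrow> complex"
      using M(2) by (intro sum.mono_neutral_cong_right) auto
    have "hs (em a * X) = (\<Sum>j<M. (l2norm (a *\<^sub>v c j))\<^sup>2)"
      unfolding hs_bnd[OF bnd_mult[OF bnd_mono[OF ae M(2)] M(1)]] en spl using a by (simp add: l2norm_def sum_nonneg)
    also have "\<dots> \<le> (\<Sum>j<M. (opnorm a * l2norm (c j))\<^sup>2)"
      by (intro sum_mono power_mono vb lnn) (simp add: c_def)
    also have "\<dots> = (opnorm a)\<^sup>2 * (\<Sum>j<M. \<Sum>i<n. (cmod (ent X i j))\<^sup>2)"
      by (simp add: power_mult_distrib sum_distrib_left[symmetric] l2norm_def sum_nonneg c_def)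
    also have "\<dots> \<le> (opnorm a)\<^sup>2 * hs X" unfolding hs_bnd[OF M(1)]
      using M(2) by (intro mult_left_mono sum_mono sum_mono2) auto
    finally have "sqrt (hs (em a * X)) \<le> sqrt ((opnorm a)\<^sup>2 * hs X)" by simp
    then show "hn (em a * X) \<le> opnorm a * hn X" using o0 by (simp add: hn_def real_sqrt_mult)
  qed
  moreover have "opnorm a \<le> nm (em a)" unfolding opnorm_def nm_def by (rule cSup_subset_mono[OF ne nm_bdd sub])
  ultimately show ?thesis by simp
qed

section \<open>The limit C*-algebra\<close>

lemma nest_alg_ops:
  assumes N: "is_nest A" and a: "a \<in> nest_alg A" and b: "b \<in> nest_alg A"
  shows "a + b \<in> nest_alg A" "a * b \<in> nest_alg A" "c \<cdot>\<^sub>m a \<in> nest_alg A" "em (a + b) = em a + em b" "em (a * b) = em a * em b"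
proof -
  have F: "a \<in> full A" "b \<in> full A" using a b by (auto simp: nest_alg_def)
  then show em: "em (a + b) = em a + em b" "em (a * b) = em a * em b" by (auto simp: em_add em_mult)
  have "em a \<in> NA A" "em b \<in> NA A" using a b nest_alg_iff[OF N] F by auto
  then show "a + b \<in> nest_alg A" "a * b \<in> nest_alg A" "c \<cdot>\<^sub>m a \<in> nest_alg A" using F
    by (auto simp: nest_alg_iff[OF N] em em_smult NA_closed NA_mult[OF N] mult_carrier_mat[of _ "msize A" "msize A"])
qed

lemma me_SH:
  assumes N: "is_nest A" "is_nest B" and S: "SH A B \<psi>" and ab: "a \<in> nest_alg A" "b \<in> nest_alg A"
  defines "m \<equiv> \<lambda>x. me (msize B) (\<psi> (em x))"
  shows "m a \<in> nest_alg B" "em (m a) = \<psi> (em a)" "m (a + b) = m a + m b" "m (a * b) = m a * m b" "m (c \<cdot>\<^sub>m a) = c \<cdot>\<^sub>m m a"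
proof -
  have NAi: "em x \<in> NA A" if "x \<in> nest_alg A" for x using that nest_alg_em[OF N(1)] by blast
  have na: "m x \<in> nest_alg B" "em (m x) = \<psi> (em x)" if "x \<in> nest_alg A" for x
    using SHD(6)[OF S NAi[OF that]] by (simp_all add: m_def me_nest_alg[OF N(2)] FM_me NA_FM)
  then show "m a \<in> nest_alg B" "em (m a) = \<psi> (em a)" using ab by auto
  have inj: "x = y" if "x \<in> nest_alg B" "y \<in> nest_alg B" "em x = em y" for x y
    using that em_inj[of x "msize B" "msize B" y] by (simp add: nest_alg_def)
  note o = nest_alg_ops[OF N(1) ab] and p = nest_alg_ops[OF N(2) na(1)[OF ab(1)] na(1)[OF ab(2)]]
  note F = ab[THEN NAi, THEN NA_FM]
  show "m (a + b) = m a + m b" by (rule inj[OF na(1)[OF o(1)] p(1)]) (simp add: na o p ab SHD(2)[OF S] F)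
  show "m (a * b) = m a * m b" by (rule inj[OF na(1)[OF o(2)] p(2)]) (simp add: na o p ab SHD(3)[OF S] F)
  show "m (c \<cdot>\<^sub>m a) = c \<cdot>\<^sub>m m a" by (rule inj[OF na(1)[OF o(3)] p(3)]) (simp add: na o p ab SHD(4)[OF S] F em_smult)
qed

section \<open>Null sequences in operator norm\<close>

definition nul :: "(nat \<Rightarrow> fmat) \<Rightarrow> bool" where
  "nul w \<longleftrightarrow> (\<lambda>n. nm (w n)) \<longlonglongrightarrow> 0"

lemma nul_iff: "nul w \<longleftrightarrow> (\<forall>\<epsilon>>0. \<forall>\<^sub>F n in sequentially. nm (w n) \<le> \<epsilon>)"
proof
  assume "nul w"
  then have "\<forall>\<^sub>F n in sequentially. nm (w n) < \<epsilon>" if "\<epsilon> > 0" for \<epsilon>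
    using tendstoD[of "\<lambda>n. nm (w n)" 0 sequentially \<epsilon>] that by (simp add: nul_def dist_real_def)
  then show "\<forall>\<epsilon>>0. \<forall>\<^sub>F n in sequentially. nm (w n) \<le> \<epsilon>" by (meson eventually_mono less_imp_le)
next
  assume *: "\<forall>\<epsilon>>0. \<forall>\<^sub>F n in sequentially. nm (w n) \<le> \<epsilon>"
  show "nul w" unfolding nul_def
  proof (rule tendstoI)
    fix e :: real assume "0 < e"
    then have "\<forall>\<^sub>F n in sequentially. nm (w n) \<le> e / 2" using *[rule_format, of "e / 2"] by simp
    then show "\<forall>\<^sub>F n in sequentially. dist (nm (w n)) 0 < e"
      by eventually_elim (use \<open>0 < e\<close> in \<open>simp add: dist_real_def\<close>)
  qed
qed

lemma nul_le: "\<forall>\<^sub>F n in sequentially. nm (w n) \<le> g n \<Longrightarrow> g \<longlonglongrightarrow> 0 \<Longrightarrow> nul w"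
  unfolding nul_def by (rule tendsto_sandwich[of "\<lambda>_. 0"]) simp_all

lemma nul_add: "nul v \<Longrightarrow> nul w \<Longrightarrow> nul (\<lambda>n. v n + w n)"
  using nul_le[of "\<lambda>n. v n + w n" "\<lambda>n. nm (v n) + nm (w n)"] tendsto_add_zero[of "\<lambda>n. nm (v n)" _ "\<lambda>n. nm (w n)"]
  by (simp add: nul_def nm_add)

lemma nul_comm: "nul (\<lambda>n. v n - w n) \<Longrightarrow> nul (\<lambda>n. w n - v n)"
  by (simp add: nul_def nm_diff_comm)

lemma nul_trans: "nul (\<lambda>n. u n - v n) \<Longrightarrow> nul (\<lambda>n. v n - w n) \<Longrightarrow> nul (\<lambda>n. u n - w n)"
  using nul_add[of "\<lambda>n. u n - v n" "\<lambda>n. v n - w n"] by simp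

lemma nul_eventually_eq: "\<forall>\<^sub>F n in sequentially. v n = w n \<Longrightarrow> nul (\<lambda>n. v n - w n)"
  by (rule nul_le[of _ "\<lambda>_. 0"]) (auto elim: eventually_mono)

lemma nul_bdd:
  assumes "\<forall>\<^sub>F n in sequentially. nm (w n) \<le> K * nm (v n)" "nul v"
  shows "nul w"
  using assms(2) by (intro nul_le[OF assms(1)] tendsto_mult_right_zero) (simp add: nul_def)

section \<open>Approximately coherent sequences modulo null sequences\<close>

context osys
begin

definition AC :: "(nat \<Rightarrow> fmat) set" where
  "AC = {y. (\<forall>n. y n \<in> FM (A n)) \<and> (\<forall>\<epsilon>>0. \<exists>k. \<exists>a\<in>FM (A k). \<forall>\<^sub>F n in sequentially. nm (y n - SS k n a) \<le> \<epsilon>)}"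

definition sm :: "(nat \<Rightarrow> fmat) \<Rightarrow> nat \<Rightarrow> complex mat" where
  "sm y n = me (msize (A n)) (y n)"

lemma AC_FM: "y \<in> AC \<Longrightarrow> y n \<in> FM (A n)" by (simp add: AC_def)

lemma AC_approx: "y \<in> AC \<Longrightarrow> \<epsilon> > 0 \<Longrightarrow> \<exists>k. \<exists>a\<in>FM (A k). \<forall>\<^sub>F n in sequentially. nm (y n - SS k n a) \<le> \<epsilon>"
  by (simp add: AC_def)

lemma ACI: "(\<And>n. y n \<in> FM (A n)) \<Longrightarrow>
    (\<And>\<epsilon>. \<epsilon> > 0 \<Longrightarrow> \<exists>k. \<exists>a\<in>FM (A k). \<forall>\<^sub>F n in sequentially. nm (y n - SS k n a) \<le> \<epsilon>) \<Longrightarrow> y \<in> AC"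
  by (simp add: AC_def)

lemma SS_nm: "k \<le> n \<Longrightarrow> a \<in> FM (A k) \<Longrightarrow> nm (SS k n a) \<le> nm a"
  by (rule SH_contract[OF SS_SH])

lemma SS_inj: "k \<le> n \<Longrightarrow> a \<in> FM (A k) \<Longrightarrow> SS k n a = 0 \<Longrightarrow> a = 0"
proof (induction n rule: dec_induct)
  case (step n)
  then have b: "SS k n a \<in> FM (A n)" "S n (SS k n a) = 0" by (auto simp: SS_FM SS_Suc)
  have "ent (SS k n a) x y = 0" for x y using SH_ent_le[OF N S_SH S_inj b(1), of x y] b(2) by simp
  then have "SS k n a = 0" by (intro fmat_eqI) (simp add: ent_simps)
  then show ?case using step by simp
qed simp

lemma uno_ne_0: "SS k n (uno (A k)) \<noteq> 0" if "k \<le> n"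
proof
  assume "SS k n (uno (A k)) = 0"
  then have "uno (A k) = 0" using SS_inj[OF that] by simp
  then show False using S_inj[of k] SHD(7)[OF S_SH] by simp
qed

lemma AC_common:
  assumes y: "y \<in> AC" and z: "z \<in> AC" and e: "\<epsilon> > 0" "\<delta> > 0"
  shows "\<exists>k. \<exists>a\<in>FM (A k). \<exists>b\<in>FM (A k). \<forall>\<^sub>F n in sequentially. k \<le> n \<and> nm (y n - SS k n a) \<le> \<epsilon> \<and> nm (z n - SS k n b) \<le> \<delta>"
proof -
  obtain k a where a: "a \<in> FM (A k)" "\<forall>\<^sub>F n in sequentially. nm (y n - SS k n a) \<le> \<epsilon>" using AC_approx[OF y e(1)] by blast
  obtain m b where b: "b \<in> FM (A m)" "\<forall>\<^sub>F n in sequentially. nm (z n - SS m n b) \<le> \<delta>" using AC_approx[OF z e(2)] by blast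
  define l where "l = max k m"
  have "\<forall>\<^sub>F n in sequentially. l \<le> n \<and> nm (y n - SS l n (SS k l a)) \<le> \<epsilon> \<and> nm (z n - SS l n (SS m l b)) \<le> \<delta>"
    using a(2) b(2) eventually_ge_at_top[of l] by eventually_elim (simp add: SS_comp l_def)
  then show ?thesis using SS_FM[OF _ a(1), of l] SS_FM[OF _ b(1), of l]
    by (intro exI[of _ l] bexI[of _ "SS k l a"] bexI[of _ "SS m l b"]) (simp_all add: l_def)
qed

lemma AC_bdd: "y \<in> AC \<Longrightarrow> \<exists>K>0. \<forall>\<^sub>F n in sequentially. nm (y n) \<le> K"
proof -
  assume "y \<in> AC"
  from AC_approx[OF this, of 1] obtain k a where a: "a \<in> FM (A k)" "\<forall>\<^sub>F n in sequentially. nm (y n - SS k n a) \<le> 1" by auto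
  have "\<forall>\<^sub>F n in sequentially. nm (y n) \<le> nm a + 1"
    using a(2) eventually_ge_at_top[of k]
  proof eventually_elim
    case (elim n)
    then show ?case using nm_add[of "y n - SS k n a" "SS k n a"] SS_nm[OF elim(2) a(1)] by simp
  qed
  then show ?thesis by (intro exI[of _ "nm a + 1"]) (simp add: add_nonneg_pos)
qed

lemma AC_add: "y \<in> AC \<Longrightarrow> z \<in> AC \<Longrightarrow> (\<lambda>n. y n + z n) \<in> AC"
proof (rule ACI)
  fix \<epsilon> :: real assume yz: "y \<in> AC" "z \<in> AC" and e: "\<epsilon> > 0"
  obtain k a b where k: "a \<in> FM (A k)" "b \<in> FM (A k)"
    "\<forall>\<^sub>F n in sequentially. k \<le> n \<and> nm (y n - SS k n a) \<le> \<epsilon> / 2 \<and> nm (z n - SS k n b) \<le> \<epsilon> / 2"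
    using AC_common[OF yz, of "\<epsilon> / 2" "\<epsilon> / 2"] e by auto
  have "\<forall>\<^sub>F n in sequentially. nm (y n + z n - SS k n (a + b)) \<le> \<epsilon>"
    using k(3)
  proof eventually_elim
    case (elim n)
    have e: "y n + z n - SS k n (a + b) = (y n - SS k n a) + (z n - SS k n b)"
      using SHD(2)[OF SS_SH k(1,2), of n] elim by simp
    show ?case unfolding e using nm_add[of "y n - SS k n a" "z n - SS k n b"] elim by simp
  qed
  then show "\<exists>k. \<exists>a\<in>FM (A k). \<forall>\<^sub>F n in sequentially. nm (y n + z n - SS k n a) \<le> \<epsilon>" using k by (meson FM_simps(4))
qed (simp add: AC_FM)

lemma AC_mult: "y \<in> AC \<Longrightarrow> z \<in> AC \<Longrightarrow> (\<lambda>n. y n * z n) \<in> AC"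
proof (rule ACI)
  fix \<epsilon> :: real assume yz: "y \<in> AC" "z \<in> AC" and e: "\<epsilon> > 0"
  obtain K where K: "K > 0" "\<forall>\<^sub>F n in sequentially. nm (y n) \<le> K" using AC_bdd[OF yz(1)] by blast
  obtain L where L: "L > 0" "\<forall>\<^sub>F n in sequentially. nm (z n) \<le> L" using AC_bdd[OF yz(2)] by blast
  \<comment> \<open>The bound 1 keeps the approximant of \<open>z\<close> below \<open>L + 1\<close>
    in norm; the other bound makes its share of the error at most half of
    \<open>\<epsilon>\<close>.\<close>
  define \<delta> where "\<delta> = min 1 (\<epsilon> / (2 * K))"
  have d: "\<delta> > 0" "\<delta> \<le> 1" "K * \<delta> \<le> \<epsilon> / 2" using K e by (auto simp: \<delta>_def min_def field_simps)
  obtain k a b where k: "a \<in> FM (A k)" "b \<in> FM (A k)"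
    "\<forall>\<^sub>F n in sequentially. k \<le> n \<and> nm (y n - SS k n a) \<le> \<epsilon> / (2 * (L + 1)) \<and> nm (z n - SS k n b) \<le> \<delta>"
    using AC_common[OF yz, of "\<epsilon> / (2 * (L + 1))" \<delta>] e d(1) L by auto
  have "\<forall>\<^sub>F n in sequentially. nm (y n * z n - SS k n (a * b)) \<le> \<epsilon>"
    using k(3) K(2) L(2)
  proof eventually_elim
    case (elim n)
    have "y n * z n - SS k n (a * b) = y n * (z n - SS k n b) + (y n - SS k n a) * SS k n b"
      using SHD(3)[OF SS_SH k(1,2), of n] elim by (simp add: algebra_simps)
    then have "nm (y n * z n - SS k n (a * b)) \<le> nm (y n * (z n - SS k n b)) + nm ((y n - SS k n a) * SS k n b)"
      using nm_add by simp
    also have "\<dots> \<le> nm (y n) * nm (z n - SS k n b) + nm (y n - SS k n a) * nm (SS k n b)" by (intro add_mono nm_mult)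
    also have "\<dots> \<le> K * \<delta> + \<epsilon> / (2 * (L + 1)) * (L + 1)"
    proof (intro add_mono mult_mono)
      have "SS k n b = z n - (z n - SS k n b)" by simp
      then show "nm (SS k n b) \<le> L + 1" using nm_diff[of "z n" "z n - SS k n b"] elim d by simp
    qed (use elim K L e in auto)
    also have "\<dots> \<le> \<epsilon> / 2 + \<epsilon> / 2" using d L by (intro add_mono) (auto simp: field_simps)
    finally show ?case by simp
  qed
  then show "\<exists>k. \<exists>a\<in>FM (A k). \<forall>\<^sub>F n in sequentially. nm (y n * z n - SS k n a) \<le> \<epsilon>" using k by (meson FM_simps(6))
qed (simp add: AC_FM)

lemma AC_scl: "y \<in> AC \<Longrightarrow> (\<lambda>n. c \<odot> y n) \<in> AC"
proof (rule ACI)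
  fix \<epsilon> :: real assume y: "y \<in> AC" and e: "\<epsilon> > 0"
  have p: "0 < cmod c + 1" by (simp add: add_nonneg_pos)
  obtain k a where k: "a \<in> FM (A k)" "\<forall>\<^sub>F n in sequentially. nm (y n - SS k n a) \<le> \<epsilon> / (cmod c + 1)"
    using AC_approx[OF y, of "\<epsilon> / (cmod c + 1)"] e p by auto
  have "\<forall>\<^sub>F n in sequentially. nm (c \<odot> y n - SS k n (c \<odot> a)) \<le> \<epsilon>"
    using k(2) eventually_ge_at_top[of k]
  proof eventually_elim
    case (elim n)
    have "c \<odot> y n - SS k n (c \<odot> a) = c \<odot> (y n - SS k n a)" using SHD(4)[OF SS_SH k(1), of n c] elim by (simp add: scl_diff)
    then have "nm (c \<odot> y n - SS k n (c \<odot> a)) \<le> cmod c * nm (y n - SS k n a)" using nm_scl by simp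
    also have "\<dots> \<le> (cmod c + 1) * (\<epsilon> / (cmod c + 1))" using elim e by (intro mult_mono) auto
    finally show ?case using p by simp
  qed
  then show "\<exists>k. \<exists>a\<in>FM (A k). \<forall>\<^sub>F n in sequentially. nm (c \<odot> y n - SS k n a) \<le> \<epsilon>" using k by (meson FM_simps(7))
qed (simp add: AC_FM)

lemma AC_adj: "y \<in> AC \<Longrightarrow> (\<lambda>n. adj (y n)) \<in> AC"
proof (rule ACI)
  fix \<epsilon> :: real assume y: "y \<in> AC" and e: "\<epsilon> > 0"
  obtain k a where k: "a \<in> FM (A k)" "\<forall>\<^sub>F n in sequentially. nm (y n - SS k n a) \<le> \<epsilon>" using AC_approx[OF y e] by blast
  have "\<forall>\<^sub>F n in sequentially. nm (adj (y n) - SS k n (adj a)) \<le> \<epsilon>"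
    using k(2) eventually_ge_at_top[of k]
    by eventually_elim (simp add: SHD(5)[OF SS_SH k(1)] adj_diff[symmetric] del: adj_diff)
  then show "\<exists>k. \<exists>a\<in>FM (A k). \<forall>\<^sub>F n in sequentially. nm (adj (y n) - SS k n a) \<le> \<epsilon>" using k(1) by (meson FM_simps(3))
qed (simp add: AC_FM)

lemma em_sm [simp]: "y \<in> AC \<Longrightarrow> em (sm y n) = y n"
  by (simp add: sm_def AC_FM FM_me)

lemma sm_em: "(\<And>n. x n \<in> full (A n)) \<Longrightarrow> sm (\<lambda>n. em (x n)) = x"
  by (simp add: sm_def fun_eq_iff)

lemma opnorm_em: "a \<in> full (A n) \<Longrightarrow> b \<in> full (A n) \<Longrightarrow> opnorm (a - b) = nm (em a - em b)"
  by (simp add: opnorm_nm[of _ "msize (A n)"] minus_carrier_mat em_diff[of _ "msize (A n)" "msize (A n)"])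

lemma ac_iff: "x \<in> approx_coherent A \<alpha> \<longleftrightarrow> (\<forall>n. x n \<in> full (A n)) \<and> (\<lambda>n. em (x n)) \<in> AC"
proof (cases "\<forall>n. x n \<in> full (A n)")
  case True
  have ev: "(\<forall>\<^sub>F n in sequentially. opnorm (x n - sys_map (star_maps A \<alpha>) k n a) \<le> \<epsilon>) \<longleftrightarrow>
     (\<forall>\<^sub>F n in sequentially. nm (em (x n) - SS k n (em a)) \<le> \<epsilon>)" if a: "a \<in> full (A k)" for k a \<epsilon>
  proof (rule eventually_cong[OF eventually_ge_at_top[of k]])
    fix n assume "k \<le> n"
    then show "(opnorm (x n - sys_map (star_maps A \<alpha>) k n a) \<le> \<epsilon>) = (nm (em (x n) - SS k n (em a)) \<le> \<epsilon>)"
      using em_sys_star[of k n a] a True opnorm_em[of "x n" n] by simp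
  qed
  have "(\<exists>a\<in>full (A k). \<forall>\<^sub>F n in sequentially. opnorm (x n - sys_map (star_maps A \<alpha>) k n a) \<le> \<epsilon>) \<longleftrightarrow>
    (\<exists>a\<in>FM (A k). \<forall>\<^sub>F n in sequentially. nm (em (x n) - SS k n a) \<le> \<epsilon>)" for k \<epsilon>
  proof safe
    fix a assume "a \<in> full (A k)" "\<forall>\<^sub>F n in sequentially. opnorm (x n - sys_map (star_maps A \<alpha>) k n a) \<le> \<epsilon>"
    then show "\<exists>a\<in>FM (A k). \<forall>\<^sub>F n in sequentially. nm (em (x n) - SS k n a) \<le> \<epsilon>" using ev full_em by blast
  next
    fix a assume "a \<in> FM (A k)" "\<forall>\<^sub>F n in sequentially. nm (em (x n) - SS k n a) \<le> \<epsilon>"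
    then show "\<exists>a\<in>full (A k). \<forall>\<^sub>F n in sequentially. opnorm (x n - sys_map (star_maps A \<alpha>) k n a) \<le> \<epsilon>"
      using ev[of "me (msize (A k)) a" k] by (intro bexI[of _ "me (msize (A k)) a"]) (simp_all add: FM_me)
  qed
  then show ?thesis using True by (simp add: approx_coherent_def AC_def full_em)
qed (auto simp: approx_coherent_def)

lemma asymp_iff: "(x, y) \<in> asymp_eq A \<alpha> \<longleftrightarrow> x \<in> approx_coherent A \<alpha> \<and> y \<in> approx_coherent A \<alpha> \<and> nul (\<lambda>n. em (x n) - em (y n))"
proof (cases "x \<in> approx_coherent A \<alpha> \<and> y \<in> approx_coherent A \<alpha>")
  case True
  then have "opnorm (x n - y n) = nm (em (x n) - em (y n))" for n by (intro opnorm_em) (auto simp: ac_iff)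
  then show ?thesis by (simp add: asymp_eq_def nul_def)
qed (auto simp: asymp_eq_def)

lemma asymp_equiv: "equiv (approx_coherent A \<alpha>) (asymp_eq A \<alpha>)"
proof (rule equivI)
  show "refl_on (approx_coherent A \<alpha>) (asymp_eq A \<alpha>)"
    by (auto simp: refl_on_def asymp_iff nul_def)
  show "sym (asymp_eq A \<alpha>)" by (auto simp: sym_def asymp_iff nul_comm)
  show "trans (asymp_eq A \<alpha>)"
  proof (rule transI)
    fix x y z assume "(x, y) \<in> asymp_eq A \<alpha>" "(y, z) \<in> asymp_eq A \<alpha>"
    then show "(x, z) \<in> asymp_eq A \<alpha>"
      using nul_trans[of "\<lambda>n. em (x n)" "\<lambda>n. em (y n)" "\<lambda>n. em (z n)"] by (simp add: asymp_iff)
  qed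
qed (auto simp: asymp_iff)

definition Q :: "(nat \<Rightarrow> fmat) \<Rightarrow> (nat \<Rightarrow> complex mat) set" where
  "Q y = asymp_eq A \<alpha> `` {sm y}"

lemma sm_ac: "y \<in> AC \<Longrightarrow> sm y \<in> approx_coherent A \<alpha>"
  by (simp add: ac_iff) (simp add: sm_def)

lemma Q_eq: "y \<in> AC \<Longrightarrow> z \<in> AC \<Longrightarrow> Q y = Q z \<longleftrightarrow> nul (\<lambda>n. y n - z n)"
  unfolding Q_def using eq_equiv_class_iff[OF asymp_equiv sm_ac sm_ac] by (simp add: asymp_iff sm_ac)

lemma Q_mem: "y \<in> AC \<Longrightarrow> x \<in> Q y \<Longrightarrow> \<exists>z\<in>AC. x = sm z \<and> Q z = Q y"
proof -
  assume y: "y \<in> AC" and x: "x \<in> Q y"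
  then have 1: "x \<in> approx_coherent A \<alpha>" "nul (\<lambda>n. y n - em (x n))" by (auto simp: Q_def asymp_iff)
  then have z: "(\<lambda>n. em (x n)) \<in> AC" "sm (\<lambda>n. em (x n)) = x" by (auto simp: ac_iff intro!: sm_em)
  then show ?thesis using 1 Q_eq[OF y z(1)] by metis
qed

lemma Q_self: "y \<in> AC \<Longrightarrow> sm y \<in> Q y"
  by (simp add: Q_def asymp_iff sm_ac nul_def)

lemma cstar_carrier: "acarrier Cst = Q ` AC"
proof -
  have "\<exists>y\<in>AC. x = sm y" if "x \<in> approx_coherent A \<alpha>" for x
    using that sm_em[of x] by (auto simp: ac_iff intro!: bexI[of _ "\<lambda>n. em (x n)"])
  then show ?thesis using sm_ac by (auto simp: lim_cstar_def quotient_def Q_def)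
qed

lemma Un2_const: "X \<noteq> {} \<Longrightarrow> Y \<noteq> {} \<Longrightarrow> (\<And>x y. x \<in> X \<Longrightarrow> y \<in> Y \<Longrightarrow> f x y = c) \<Longrightarrow> (\<Union>x\<in>X. \<Union>y\<in>Y. f x y) = c"
  by auto

lemma Q_add: "y \<in> AC \<Longrightarrow> z \<in> AC \<Longrightarrow> aplus Cst (Q y) (Q z) = Q (\<lambda>n. y n + z n)"
proof -
  assume y: "y \<in> AC" and z: "z \<in> AC"
  have "asymp_eq A \<alpha> `` {\<lambda>n. x n + x' n} = Q (\<lambda>n. y n + z n)" if x: "x \<in> Q y" "x' \<in> Q z" for x x'
  proof -
    obtain u v where u: "u \<in> AC" "x = sm u" "Q u = Q y" and v: "v \<in> AC" "x' = sm v" "Q v = Q z" using Q_mem y z x by metis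
    have "(\<lambda>n. x n + x' n) = sm (\<lambda>n. u n + v n)"
      unfolding u v by (rule HOL.ext, rule eq_matI) (auto simp: sm_def me_def ent_simps)
    moreover have "Q (\<lambda>n. u n + v n) = Q (\<lambda>n. y n + z n)"
      using nul_add[of "\<lambda>n. u n - y n" "\<lambda>n. v n - z n"] u v y z by (subst Q_eq) (auto simp: Q_eq AC_add algebra_simps)
    ultimately show ?thesis by (simp add: Q_def)
  qed
  moreover have "Q y \<noteq> {}" "Q z \<noteq> {}" using y z Q_self by blast+
  ultimately show ?thesis unfolding lim_cstar_def star_calgebra.simps calgebra.simps by (intro Un2_const) auto
qed

lemma Q_mult: "y \<in> AC \<Longrightarrow> z \<in> AC \<Longrightarrow> atimes Cst (Q y) (Q z) = Q (\<lambda>n. y n * z n)"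
proof -
  assume y: "y \<in> AC" and z: "z \<in> AC"
  have "asymp_eq A \<alpha> `` {\<lambda>n. x n * x' n} = Q (\<lambda>n. y n * z n)" if x: "x \<in> Q y" "x' \<in> Q z" for x x'
  proof -
    obtain u v where u: "u \<in> AC" "x = sm u" "Q u = Q y" and v: "v \<in> AC" "x' = sm v" "Q v = Q z" using Q_mem y z x by metis
    have "sm u n * sm v n = sm (\<lambda>n. u n * v n) n" for n
    proof (rule em_inj)
      show "em (sm u n * sm v n) = em (sm (\<lambda>n. u n * v n) n)" using u v AC_mult[OF u(1) v(1)]
        by (subst em_mult[of _ "msize (A n)" "msize (A n)" _ "msize (A n)"]) (simp_all, simp_all add: sm_def)
      show "sm (\<lambda>n. u n * v n) n \<in> carrier_mat (msize (A n)) (msize (A n))"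
        "sm u n * sm v n \<in> carrier_mat (msize (A n)) (msize (A n))"
        by (auto simp: sm_def intro: mult_carrier_mat[of _ "msize (A n)" "msize (A n)"])
    qed
    then have 1: "(\<lambda>n. x n * x' n) = sm (\<lambda>n. u n * v n)" unfolding u v by auto
    obtain K where K: "K > 0" "\<forall>\<^sub>F n in sequentially. nm (u n) \<le> K" using AC_bdd[OF u(1)] by blast
    obtain L where L: "L > 0" "\<forall>\<^sub>F n in sequentially. nm (z n) \<le> L" using AC_bdd[OF z] by blast
    have "nul (\<lambda>n. u n * (v n - z n))"
    proof (rule nul_bdd[of _ K])
      show "\<forall>\<^sub>F n in sequentially. nm (u n * (v n - z n)) \<le> K * nm (v n - z n)"
        using K(2) by eventually_elim (meson mult_right_mono nm_ge_0 nm_mult order_trans)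
    qed (use v z in \<open>simp add: Q_eq\<close>)
    moreover have "nul (\<lambda>n. (u n - y n) * z n)"
    proof (rule nul_bdd[of _ L])
      show "\<forall>\<^sub>F n in sequentially. nm ((u n - y n) * z n) \<le> L * nm (u n - y n)"
        using L(2) by eventually_elim (metis mult.commute mult_right_mono nm_ge_0 nm_mult order_trans)
    qed (use u y in \<open>simp add: Q_eq\<close>)
    ultimately have "nul (\<lambda>n. u n * v n - y n * z n)" using nul_add by (fastforce simp: algebra_simps)
    then have "Q (\<lambda>n. u n * v n) = Q (\<lambda>n. y n * z n)" using u v y z by (simp add: Q_eq AC_mult)
    then show ?thesis using 1 by (simp add: Q_def)
  qed
  moreover have "Q y \<noteq> {}" "Q z \<noteq> {}" using y z Q_self by blast+
  ultimately show ?thesis unfolding lim_cstar_def star_calgebra.simps calgebra.simps by (intro Un2_const) auto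
qed

lemma Q_scl: "y \<in> AC \<Longrightarrow> ascale Cst c (Q y) = Q (\<lambda>n. c \<odot> y n)"
proof -
  assume y: "y \<in> AC"
  have "asymp_eq A \<alpha> `` {\<lambda>n. c \<cdot>\<^sub>m x n} = Q (\<lambda>n. c \<odot> y n)" if x: "x \<in> Q y" for x
  proof -
    obtain u where u: "u \<in> AC" "x = sm u" "Q u = Q y" using Q_mem y x by metis
    have "(\<lambda>n. c \<cdot>\<^sub>m x n) = sm (\<lambda>n. c \<odot> u n)"
      unfolding u by (rule HOL.ext, rule eq_matI) (auto simp: sm_def me_def ent_simps)
    moreover have "nul (\<lambda>n. c \<odot> u n - c \<odot> y n)"
    proof (rule nul_bdd[of _ "cmod c" "\<lambda>n. u n - y n"])
      show "nul (\<lambda>n. u n - y n)" using u(3) Q_eq[OF u(1) y] by simp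
      show "\<forall>\<^sub>F n in sequentially. nm (c \<odot> u n - c \<odot> y n) \<le> cmod c * nm (u n - y n)"
        unfolding scl_diff[symmetric] by (intro always_eventually allI nm_scl)
    qed
    ultimately show ?thesis using Q_eq[OF AC_scl AC_scl, of u y c c] u y by (simp add: Q_def)
  qed
  moreover have "Q y \<noteq> {}" using y Q_self by blast
  ultimately show ?thesis by (auto simp: lim_cstar_def)
qed

lemma Q_adj: "y \<in> AC \<Longrightarrow> astar Cst (Q y) = Q (\<lambda>n. adj (y n))"
proof -
  assume y: "y \<in> AC"
  have "asymp_eq A \<alpha> `` {\<lambda>n. mat_adjoint (x n)} = Q (\<lambda>n. adj (y n))" if x: "x \<in> Q y" for x
  proof -
    obtain u where u: "u \<in> AC" "x = sm u" "Q u = Q y" using Q_mem y x by metis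
    have "(\<lambda>n. mat_adjoint (x n)) = sm (\<lambda>n. adj (u n))"
      unfolding u by (rule HOL.ext, rule eq_matI) (auto simp: sm_def me_def ent_simps mat_adjoint_index)
    moreover have "nul (\<lambda>n. adj (u n) - adj (y n))"
      using u y by (simp add: Q_eq nul_def adj_diff[symmetric] del: adj_diff)
    ultimately show ?thesis using Q_eq[OF AC_adj AC_adj, of u y] u y by (simp add: Q_def)
  qed
  moreover have "Q y \<noteq> {}" using y Q_self by blast
  ultimately show ?thesis by (auto simp: lim_cstar_def)
qed

section \<open>Coherent sequences and the embedding of the algebraic limit\<close>

definition coh :: "nat \<Rightarrow> fmat \<Rightarrow> nat \<Rightarrow> fmat" where
  "coh k a n = (if n < k then 0 else SS k n a)"

definition E :: "nat \<Rightarrow> fmat \<Rightarrow> (nat \<Rightarrow> complex mat) set" where "E k a = Q (coh k a)"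

lemma coh_AC: "a \<in> FM (A k) \<Longrightarrow> coh k a \<in> AC"
proof (rule ACI)
  fix \<epsilon> :: real assume a: "a \<in> FM (A k)" and e: "\<epsilon> > 0"
  have "\<forall>\<^sub>F n in sequentially. nm (coh k a n - SS k n a) \<le> \<epsilon>"
    using eventually_ge_at_top[of k] by eventually_elim (use e in \<open>simp add: coh_def\<close>)
  then show "\<exists>k'. \<exists>b\<in>FM (A k'). \<forall>\<^sub>F n in sequentially. nm (coh k a n - SS k' n b) \<le> \<epsilon>" using a by blast
qed (simp add: coh_def SS_FM)

lemma E_in: "a \<in> FM (A k) \<Longrightarrow> E k a \<in> acarrier Cst"
  by (simp add: E_def cstar_carrier coh_AC)

lemma coh_ops: "a \<in> FM (A k) \<Longrightarrow> b \<in> FM (A k) \<Longrightarrow> (\<lambda>n. coh k a n + coh k b n) = coh k (a + b)"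
  "a \<in> FM (A k) \<Longrightarrow> b \<in> FM (A k) \<Longrightarrow> (\<lambda>n. coh k a n * coh k b n) = coh k (a * b)"
  "a \<in> FM (A k) \<Longrightarrow> (\<lambda>n. c \<odot> coh k a n) = coh k (c \<odot> a)" "a \<in> FM (A k) \<Longrightarrow> (\<lambda>n. adj (coh k a n)) = coh k (adj a)"
  using SHD(2-5)[OF SS_SH] by (auto simp: coh_def)

lemma E_ops:
  "a \<in> FM (A k) \<Longrightarrow> b \<in> FM (A k) \<Longrightarrow> aplus Cst (E k a) (E k b) = E k (a + b)"
  "a \<in> FM (A k) \<Longrightarrow> b \<in> FM (A k) \<Longrightarrow> atimes Cst (E k a) (E k b) = E k (a * b)"
  "a \<in> FM (A k) \<Longrightarrow> ascale Cst c (E k a) = E k (c \<odot> a)"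
  "a \<in> FM (A k) \<Longrightarrow> astar Cst (E k a) = E k (adj a)"
  by (simp_all add: E_def Q_add Q_mult Q_scl Q_adj coh_AC coh_ops)

lemma E_shift: "a \<in> FM (A k) \<Longrightarrow> k \<le> n \<Longrightarrow> E n (SS k n a) = E k a"
proof -
  assume a: "a \<in> FM (A k)" and n: "k \<le> n"
  have "\<forall>\<^sub>F l in sequentially. coh n (SS k n a) l = coh k a l"
    using eventually_ge_at_top[of n] by eventually_elim (use n in \<open>simp add: coh_def SS_comp\<close>)
  then show ?thesis unfolding E_def using a n by (simp add: Q_eq coh_AC SS_FM nul_eventually_eq)
qed

text \<open>The bound of \<open>SH_ent_le\<close> is uniform in the level, so a difference whose
  images tend to 0 is 0 already at level \<open>k\<close>.\<close>

lemma E_inj: "a \<in> FM (A k) \<Longrightarrow> b \<in> FM (A k) \<Longrightarrow> E k a = E k b \<Longrightarrow> a = b"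
proof -
  assume a: "a \<in> FM (A k)" and b: "b \<in> FM (A k)" and "E k a = E k b"
  then have nu: "(\<lambda>n. nm (coh k a n - coh k b n)) \<longlonglongrightarrow> 0" by (simp add: E_def Q_eq coh_AC nul_def)
  have "cmod (ent (a - b) x y) \<le> 0" for x y
  proof (rule LIMSEQ_le_const[OF nu], intro exI allI impI)
    fix n assume n: "k \<le> n"
    have "cmod (ent (a - b) x y) \<le> nm (SS k n (a - b))"
      using a b by (intro SH_ent_le[OF N SS_SH uno_ne_0]) (auto simp: n)
    then show "cmod (ent (a - b) x y) \<le> nm (coh k a n - coh k b n)"
      using n SHD(8)[OF SS_SH[OF n] a b] by (simp add: coh_def)
  qed
  then have "a - b = 0" by (intro fmat_eqI) (simp add: ent_simps)
  then show "a = b" by simp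
qed

lemma lim_embed_lc: "a \<in> nest_alg (A k) \<Longrightarrow> lim_embed A \<alpha> (lc k a) = E k (em a)"
proof -
  assume a: "a \<in> nest_alg (A k)"
  have "asymp_eq A \<alpha> `` {\<lambda>n. if n < m then 0\<^sub>m (msize (A n)) (msize (A n)) else sys_map (star_maps A \<alpha>) m n b} = E k (em a)"
    if mb: "(m, b) \<in> lc k a" for m b
  proof -
    have b: "b \<in> nest_alg (A m)" "lc m b = lc k a" using L.cls_mem[OF mb] by auto
    have F: "em a \<in> FM (A k)" "em b \<in> FM (A m)" using a b nest_alg_full full_em by blast+
    have "(\<lambda>n. if n < m then 0\<^sub>m (msize (A n)) (msize (A n)) else sys_map (star_maps A \<alpha>) m n b) = sm (coh m (em b))"
    proof
      fix n
      show "(if n < m then 0\<^sub>m (msize (A n)) (msize (A n)) else sys_map (star_maps A \<alpha>) m n b) = sm (coh m (em b)) n"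
      proof (cases "n < m")
        case True
        then show ?thesis by (auto simp: sm_def coh_def me_def ent_simps intro!: eq_matI)
      next
        case False
        then show ?thesis using em_sys_star[of m n b] nest_alg_full[OF b(1)] by (simp add: sm_def coh_def) (metis me_em)
      qed
    qed
    moreover have "E m (em b) = E k (em a)"
    proof -
      obtain n where n: "n \<ge> max m k" "sys_map \<alpha> m n b = sys_map \<alpha> k n a" using L.cls_eq_iff[OF b(1) a] b(2) by blast
      then have "SS m n (em b) = SS k n (em a)"
        using em_sys_alpha[of m n b] em_sys_alpha[of k n a] a b(1) by (metis max.bounded_iff)
      then show ?thesis using n(1) E_shift[OF F(1), of n] E_shift[OF F(2), of n] by simp
    qed
    ultimately show ?thesis by (simp add: E_def Q_def)
  qed
  moreover have "lc k a \<noteq> {}" using L.cls_self[OF a] by blast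
  ultimately show ?thesis unfolding lim_embed_def by (auto split: prod.splits)
qed

lemma lim_alg_lc:
  assumes a: "a \<in> nest_alg (A k)"
  shows "b \<in> nest_alg (A k) \<Longrightarrow> aplus Alg (lc k a) (lc k b) = lc k (a + b)"
    "b \<in> nest_alg (A k) \<Longrightarrow> atimes Alg (lc k a) (lc k b) = lc k (a * b)"
    "ascale Alg c (lc k a) = lc k (c \<cdot>\<^sub>m a)"
proof -
  note cl = nest_alg_ops(1-3)[OF N]
  have e: "\<alpha> k x = me (msize (A (Suc k))) (S k (em x))" if "x \<in> nest_alg (A k)" for k x
    using em_alpha[OF that] me_em[OF nest_alg_full[OF alpha_in[OF that]]] by simp
  have al: "\<alpha> k (a + b) = \<alpha> k a + \<alpha> k b" "\<alpha> k (a * b) = \<alpha> k a * \<alpha> k b" "\<alpha> k (c \<cdot>\<^sub>m a) = c \<cdot>\<^sub>m \<alpha> k a"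
    if ab: "a \<in> nest_alg (A k)" "b \<in> nest_alg (A k)" for k a b c
    using me_SH(3-5)[OF N N S_SH ab] cl[OF ab] ab by (simp_all add: e)
  show "b \<in> nest_alg (A k) \<Longrightarrow> aplus Alg (lc k a) (lc k b) = lc k (a + b)"
    unfolding lim_alg_def Let_def calgebra.simps by (rule L.dlim_map2_cls) (use a cl al in auto)
  show "b \<in> nest_alg (A k) \<Longrightarrow> atimes Alg (lc k a) (lc k b) = lc k (a * b)"
    unfolding lim_alg_def Let_def calgebra.simps by (rule L.dlim_map2_cls) (use a cl al in auto)
  show "ascale Alg c (lc k a) = lc k (c \<cdot>\<^sub>m a)"
    unfolding lim_alg_def Let_def calgebra.simps by (rule L.dlim_map_cls) (use a cl al in auto)
qed

lemma lim_alg_carrier: "acarrier Alg = dlim (\<lambda>k. nest_alg (A k)) \<alpha>"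
  by (simp add: lim_alg_def Let_def)

end

section \<open>Star extendible isomorphism and intertwined systems\<close>

context twin
begin

text \<open>An intertwining shifts levels, so entry \<open>n\<close> of a transported sequence is
  computed from the latest entry whose image lives at a level up to \<open>n\<close>. The clause
  \<open>k \<le> n\<close> keeps the set finite.\<close>

definition kap :: "nat \<Rightarrow> nat" where "kap n = Max {k. k \<le> n \<and> \<mu> k \<le> n}"

lemma kap: "\<mu> 0 \<le> n \<Longrightarrow> \<mu> (kap n) \<le> n" "l \<le> n \<Longrightarrow> \<mu> l \<le> n \<Longrightarrow> l \<le> kap n"
proof -
  have f: "finite {k. k \<le> n \<and> \<mu> k \<le> n}" by (rule finite_subset[of _ "{..n}"]) auto
  show "\<mu> (kap n) \<le> n" if "\<mu> 0 \<le> n" using Max_in[OF f] that unfolding kap_def by blast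
  show "l \<le> kap n" if "l \<le> n" "\<mu> l \<le> n" unfolding kap_def by (rule Max_ge[OF f]) (use that in simp)
qed

lemma kap_at_top: "filterlim kap at_top sequentially"
  unfolding filterlim_at_top eventually_sequentially
proof
  fix l show "\<exists>N. \<forall>n\<ge>N. l \<le> kap n" by (rule exI[of _ "max l (\<mu> l)"]) (simp add: kap(2))
qed

lemma ev_kap: "eventually P sequentially \<Longrightarrow> \<forall>\<^sub>F n in sequentially. P (kap n)"
  by (rule eventually_compose_filterlim[OF _ kap_at_top])

text \<open>Below \<open>\<mu> 0\<close> no entry can be used and 0 is inserted; the C*-limit
  ignores finitely many entries.\<close>

definition T :: "(nat \<Rightarrow> fmat) \<Rightarrow> nat \<Rightarrow> fmat" where
  "T y n = (if n < \<mu> 0 then 0 else psi (kap n) n (y (kap n)))"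

lemma T_SH: "\<mu> 0 \<le> n \<Longrightarrow> SH (A (kap n)) (A' n) (psi (kap n) n)"
  by (rule psi_SH[OF kap(1)])

text \<open>Contractivity of the level maps is what lets them act on norm limits.\<close>

lemma T_diff: "u \<in> X.AC \<Longrightarrow> v \<in> X.AC \<Longrightarrow> nm (T u n - T v n) \<le> nm (u (kap n) - v (kap n))"
proof (cases "n < \<mu> 0")
  case False
  assume uv: "u \<in> X.AC" "v \<in> X.AC"
  have "SH (A (kap n)) (A' n) (psi (kap n) n)" using False by (intro T_SH) simp
  from SHD(8)[OF this] SH_contract[OF this, of "u (kap n) - v (kap n)"] show ?thesis
    using False uv[THEN X.AC_FM] by (simp add: T_def)
qed (simp add: T_def)

lemma T_coh:
  assumes a: "a \<in> FM (A k)"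
  shows "\<forall>\<^sub>F n in sequentially. T (X.coh k a) n = Y.coh (\<mu> k) (\<theta> k a) n"
  using ev_kap[OF eventually_ge_at_top[of k]] eventually_ge_at_top[of "\<mu> 0"]
proof eventually_elim
  case (elim n)
  have "\<mu> k \<le> \<mu> (kap n)" "\<mu> (kap n) \<le> n" using elim mono_mu kap(1) by auto
  then show ?case using elim theta_nat[OF elim(1) a]
    by (simp add: T_def X.coh_def Y.coh_def psi_def theta_nat[OF elim(1) a, symmetric] Y.SS_comp)
qed

lemma T_AC: "y \<in> X.AC \<Longrightarrow> T y \<in> Y.AC"
proof (rule Y.ACI)
  assume y: "y \<in> X.AC"
  fix n show "T y n \<in> FM (A' n)" using SHD(1)[OF T_SH, of n] X.AC_FM[OF y] by (simp add: T_def)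
next
  fix \<epsilon> :: real assume y: "y \<in> X.AC" and e: "\<epsilon> > 0"
  obtain k a where a: "a \<in> FM (A k)" "\<forall>\<^sub>F n in sequentially. nm (y n - X.SS k n a) \<le> \<epsilon>" using X.AC_approx[OF y e] by blast
  have "\<forall>\<^sub>F n in sequentially. nm (T y n - Y.SS (\<mu> k) n (\<theta> k a)) \<le> \<epsilon>"
    using ev_kap[OF a(2)] ev_kap[OF eventually_ge_at_top[of k]] T_coh[OF a(1)] eventually_ge_at_top[of "\<mu> k"]
  proof eventually_elim
    case (elim n)
    have "nm (T y n - T (X.coh k a) n) \<le> nm (y (kap n) - X.coh k a (kap n))" by (rule T_diff[OF y X.coh_AC[OF a(1)]])
    then show ?case using elim by (simp add: X.coh_def Y.coh_def)
  qed
  then show "\<exists>k. \<exists>a\<in>FM (A' k). \<forall>\<^sub>F n in sequentially. nm (T y n - Y.SS k n a) \<le> \<epsilon>"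
    using SHD(1)[OF theta_SH a(1)] by blast
qed

lemma T_nul: "u \<in> X.AC \<Longrightarrow> v \<in> X.AC \<Longrightarrow> nul (\<lambda>n. u n - v n) \<Longrightarrow> nul (\<lambda>n. T u n - T v n)"
proof -
  assume uv: "u \<in> X.AC" "v \<in> X.AC" and "nul (\<lambda>n. u n - v n)"
  then have "(\<lambda>n. nm (u (kap n) - v (kap n))) \<longlonglongrightarrow> 0"
    unfolding nul_def using filterlim_compose[OF _ kap_at_top] by blast
  then show ?thesis by (intro nul_le[of "\<lambda>n. T u n - T v n" "\<lambda>n. nm (u (kap n) - v (kap n))"]) (simp_all add: T_diff uv)
qed

definition Psi :: "(nat \<Rightarrow> complex mat) set \<Rightarrow> (nat \<Rightarrow> complex mat) set" where
  "Psi X = Y.Q (T (SOME y. y \<in> X.AC \<and> X = X.Q y))"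

lemma Psi_Q: "y \<in> X.AC \<Longrightarrow> Psi (X.Q y) = Y.Q (T y)"
proof -
  assume y: "y \<in> X.AC"
  define z where "z = (SOME z. z \<in> X.AC \<and> X.Q y = X.Q z)"
  have "z \<in> X.AC \<and> X.Q y = X.Q z" unfolding z_def by (rule someI[of _ y]) (use y in simp)
  then have z: "z \<in> X.AC" "nul (\<lambda>n. z n - y n)" using X.Q_eq[of z y] y by auto
  then show ?thesis using T_nul[OF z(1) y z(2)] unfolding Psi_def z_def[symmetric] by (simp add: Y.Q_eq T_AC y)
qed

lemma Psi_E: "a \<in> FM (A k) \<Longrightarrow> Psi (X.E k a) = Y.E (\<mu> k) (\<theta> k a)"
  unfolding X.E_def Y.E_def using SHD(1)[OF theta_SH, of a k]
  by (simp add: Psi_Q X.coh_AC Y.Q_eq T_AC Y.coh_AC nul_eventually_eq T_coh)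

lemma T_ops:
  assumes u: "u \<in> X.AC"
  shows "v \<in> X.AC \<Longrightarrow> T (\<lambda>n. u n + v n) = (\<lambda>n. T u n + T v n)"
    "v \<in> X.AC \<Longrightarrow> T (\<lambda>n. u n * v n) = (\<lambda>n. T u n * T v n)"
    "T (\<lambda>n. c \<odot> u n) = (\<lambda>n. c \<odot> T u n)" "T (\<lambda>n. adj (u n)) = (\<lambda>n. adj (T u n))"
  using SHD(2-5)[OF T_SH] u[THEN X.AC_FM] X.AC_FM[of v] by (simp_all add: T_def fun_eq_iff)

lemma Psi_hom:
  assumes x: "x \<in> acarrier X.Cst"
  shows "Psi x \<in> acarrier Y.Cst"
    "y \<in> acarrier X.Cst \<Longrightarrow> Psi (aplus X.Cst x y) = aplus Y.Cst (Psi x) (Psi y)"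
    "y \<in> acarrier X.Cst \<Longrightarrow> Psi (atimes X.Cst x y) = atimes Y.Cst (Psi x) (Psi y)"
    "Psi (ascale X.Cst c x) = ascale Y.Cst c (Psi x)"
    "Psi (astar X.Cst x) = astar Y.Cst (Psi x)"
  using x unfolding X.cstar_carrier Y.cstar_carrier
  by (auto simp: Psi_Q T_AC X.Q_add X.Q_mult X.Q_scl X.Q_adj Y.Q_add Y.Q_mult Y.Q_scl Y.Q_adj
    X.AC_add X.AC_mult X.AC_scl X.AC_adj T_ops)

definition Phi0 :: "nat \<Rightarrow> complex mat \<Rightarrow> (nat \<times> complex mat) set" where
  "Phi0 k a = Y.lc (\<mu> k) (me (msize (A' (\<mu> k))) (\<theta> k (em a)))"

lemma Phi0_mem:
  assumes a: "a \<in> nest_alg (A k)"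
  shows "me (msize (A' (\<mu> k))) (\<theta> k (em a)) \<in> nest_alg (A' (\<mu> k))" "em (me (msize (A' (\<mu> k))) (\<theta> k (em a))) = \<theta> k (em a)"
  by (rule me_SH(1,2)[OF X.N Y.N theta_SH a a])+

lemma Phi_ex: "\<exists>\<Phi>. \<forall>k. \<forall>a\<in>nest_alg (A k). \<Phi> (X.lc k a) = Phi0 k a"
proof (rule X.L.dlim_desc)
  fix k a assume a: "a \<in> nest_alg (A k)"
  let ?m = "me (msize (A' (\<mu> k))) (\<theta> k (em a))"
  have s: "sys_map \<alpha>' (\<mu> k) (\<mu> (Suc k)) ?m \<in> nest_alg (A' (\<mu> (Suc k))) \<and> em (sys_map \<alpha>' (\<mu> k) (\<mu> (Suc k)) ?m) = Y.SS (\<mu> k) (\<mu> (Suc k)) (\<theta> k (em a))"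
    using Y.em_sys_alpha[OF mono_mu[of k "Suc k"] Phi0_mem(1)[OF a]] Phi0_mem(2)[OF a] by simp
  have "em a \<in> FM (A k)" using a X.nest_alg_full full_em by blast
  then have "Y.SS (\<mu> k) (\<mu> (Suc k)) (\<theta> k (em a)) = \<theta> (Suc k) (em (\<alpha> k a))"
    using theta_nat[of k "Suc k"] a by (simp add: X.SS_one X.em_alpha)
  then have "sys_map \<alpha>' (\<mu> k) (\<mu> (Suc k)) ?m = me (msize (A' (\<mu> (Suc k)))) (\<theta> (Suc k) (em (\<alpha> k a)))"
    using s Y.nest_alg_full me_em by metis
  then show "Phi0 (Suc k) (\<alpha> k a) = Phi0 k a"
    using Y.L.cls_shift[OF Phi0_mem(1)[OF a] mono_mu[of k "Suc k"]] by (simp add: Phi0_def)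
qed

lemma Phi_props:
  assumes P: "\<And>k a. a \<in> nest_alg (A k) \<Longrightarrow> \<Phi> (X.lc k a) = Phi0 k a" and x: "x \<in> acarrier X.Alg"
  shows "\<Phi> x \<in> acarrier Y.Alg" "Psi (lim_embed A \<alpha> x) = lim_embed A' \<alpha>' (\<Phi> x)"
    "y \<in> acarrier X.Alg \<Longrightarrow> \<Phi> (aplus X.Alg x y) = aplus Y.Alg (\<Phi> x) (\<Phi> y)"
    "y \<in> acarrier X.Alg \<Longrightarrow> \<Phi> (atimes X.Alg x y) = atimes Y.Alg (\<Phi> x) (\<Phi> y)"
    "\<Phi> (ascale X.Alg c x) = ascale Y.Alg c (\<Phi> x)"
proof -
  have F: "em a \<in> FM (A k)" if "a \<in> nest_alg (A k)" for k a using that X.nest_alg_full full_em by blast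
  obtain k a where a: "a \<in> nest_alg (A k)" "x = X.lc k a" using X.L.dlim_cases x unfolding X.lim_alg_carrier by metis
  show "\<Phi> x \<in> acarrier Y.Alg" using a by (simp add: P Phi0_def Y.lim_alg_carrier Y.L.cls_in Phi0_mem)
  show "Psi (lim_embed A \<alpha> x) = lim_embed A' \<alpha>' (\<Phi> x)"
    using a F by (simp add: X.lim_embed_lc P Phi0_def Y.lim_embed_lc Phi0_mem Psi_E)
  note th = me_SH(3-5)[OF X.N Y.N theta_SH] and cl = nest_alg_ops(1-3)[OF X.N]
  show "\<Phi> (ascale X.Alg c x) = ascale Y.Alg c (\<Phi> x)"
    using a th[OF a(1) a(1)] cl[OF a(1) a(1)] Phi0_mem(1)[OF a(1)] by (simp add: X.lim_alg_lc P Phi0_def Y.lim_alg_lc)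
  assume y: "y \<in> acarrier X.Alg"
  obtain k a b where ab: "a \<in> nest_alg (A k)" "b \<in> nest_alg (A k)" "x = X.lc k a" "y = X.lc k b"
    using X.L.common2 x y unfolding X.lim_alg_carrier by metis
  show "\<Phi> (aplus X.Alg x y) = aplus Y.Alg (\<Phi> x) (\<Phi> y)"
    "\<Phi> (atimes X.Alg x y) = atimes Y.Alg (\<Phi> x) (\<Phi> y)"
    using ab th[OF ab(1,2)] cl[OF ab(1,2)] Phi0_mem(1)[OF ab(1)] Phi0_mem(1)[OF ab(2)]
    by (simp_all add: X.lim_alg_lc P Phi0_def Y.lim_alg_lc)
qed

end

text \<open>On coherent sequences the round trip is a system map, hence trivial in the limit; by
  contractivity this extends to everything that coherent sequences approximate. As with
  \<open>gamma_inverse\<close>, both orders of the systems are needed.\<close>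

lemma twin_inverse:
  assumes tw: "twin A \<alpha> A' \<alpha>' \<mu> \<nu> \<theta> \<eta>" and tw': "twin A' \<alpha>' A \<alpha> \<nu> \<mu> \<eta> \<theta>"
    and P: "\<And>k a. a \<in> nest_alg (A k) \<Longrightarrow> \<Phi> (dlim_in (\<lambda>k. nest_alg (A k)) \<alpha> k a) = twin.Phi0 A' \<alpha>' \<mu> \<theta> k a"
    and P': "\<And>k a. a \<in> nest_alg (A' k) \<Longrightarrow> \<Phi>' (dlim_in (\<lambda>k. nest_alg (A' k)) \<alpha>' k a) = twin.Phi0 A \<alpha> \<nu> \<eta> k a"
  shows "x \<in> acarrier (lim_alg A \<alpha>) \<Longrightarrow> \<Phi>' (\<Phi> x) = x"
    "z \<in> acarrier (lim_cstar A \<alpha>) \<Longrightarrow> twin.Psi A' \<alpha>' A \<alpha> \<nu> \<eta> (twin.Psi A \<alpha> A' \<alpha>' \<mu> \<theta> z) = z"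
proof -
  interpret T: twin A \<alpha> A' \<alpha>' \<mu> \<nu> \<theta> \<eta> by (rule tw)
  interpret T': twin A' \<alpha>' A \<alpha> \<nu> \<mu> \<eta> \<theta> by (rule tw')
  show "\<Phi>' (\<Phi> x) = x" if "x \<in> acarrier (lim_alg A \<alpha>)"
  proof -
    obtain k a where a: "a \<in> nest_alg (A k)" "x = T.X.lc k a"
      using T.X.L.dlim_cases \<open>x \<in> _\<close> unfolding T.X.lim_alg_carrier by metis
    have F: "em a \<in> FM (A k)" using a T.X.nest_alg_full full_em by blast
    have le: "k \<le> \<nu> (\<mu> k)" using T.grow(1)[of k] by simp
    have "\<Phi>' (\<Phi> x) = T.X.lc (\<nu> (\<mu> k)) (me (msize (A (\<nu> (\<mu> k)))) (T.X.SS k (\<nu> (\<mu> k)) (em a)))"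
      using a by (simp add: P T.Phi0_def P' T.Phi0_mem T'.Phi0_def T.eta_theta[OF F])
    also have "me (msize (A (\<nu> (\<mu> k)))) (T.X.SS k (\<nu> (\<mu> k)) (em a)) = sys_map \<alpha> k (\<nu> (\<mu> k)) a"
      using T.X.em_sys_alpha[OF le a(1)] T.X.nest_alg_full me_em by metis
    finally show ?thesis using T.X.L.cls_shift[OF a(1) le] a(2) by simp
  qed
  show "T'.Psi (T.Psi z) = z" if "z \<in> acarrier (lim_cstar A \<alpha>)"
  proof -
    obtain y where y: "y \<in> T.X.AC" "z = T.X.Q y" using \<open>z \<in> _\<close> unfolding T.X.cstar_carrier by blast
    have "nul (\<lambda>n. T'.T (T.T y) n - y n)" unfolding nul_iff
    proof (intro allI impI)
      fix \<epsilon> :: real assume e: "\<epsilon> > 0"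
      obtain k a where a: "a \<in> FM (A k)" "\<forall>\<^sub>F n in sequentially. nm (y n - T.X.SS k n a) \<le> \<epsilon> / 3"
        using T.X.AC_approx[OF y(1), of "\<epsilon> / 3"] e by auto
      let ?c = "T.X.coh k a"
      note c = T.X.coh_AC[OF a(1)]
      have yc: "\<forall>\<^sub>F n in sequentially. nm (y n - ?c n) \<le> \<epsilon> / 3"
        using a(2) eventually_ge_at_top[of k] by eventually_elim (simp add: T.X.coh_def)
      have cc: "nul (\<lambda>n. T'.T (T.T ?c) n - ?c n)"
      proof -
        have "T'.Psi (T.Psi (T.X.E k a)) = T.X.E (\<nu> (\<mu> k)) (T.X.SS k (\<nu> (\<mu> k)) a)"
          using a(1) SHD(1)[OF T.theta_SH] by (simp add: T.Psi_E T'.Psi_E T.eta_theta)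
        also have "\<dots> = T.X.E k a" using T.X.E_shift[OF a(1)] T.grow(1)[of k] by simp
        finally show ?thesis unfolding T.X.E_def using c by (simp add: T.Psi_Q T'.Psi_Q T.T_AC T'.T_AC T.X.Q_eq)
      qed
      have "\<forall>\<^sub>F n in sequentially. nm (T'.T (T.T ?c) n - ?c n) \<le> \<epsilon> / 3"
        using cc[unfolded nul_iff, rule_format, of "\<epsilon> / 3"] e by simp
      then show "\<forall>\<^sub>F n in sequentially. nm (T'.T (T.T y) n - y n) \<le> \<epsilon>"
        using yc T'.ev_kap[OF T.ev_kap[OF yc]]
      proof eventually_elim
        case (elim n)
        have "nm (T'.T (T.T y) n - T'.T (T.T ?c) n) \<le> nm (T.T y (T'.kap n) - T.T ?c (T'.kap n))"
          by (rule T'.T_diff[OF T.T_AC[OF y(1)] T.T_AC[OF c]])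
        also have "\<dots> \<le> nm (y (T.kap (T'.kap n)) - ?c (T.kap (T'.kap n)))" by (rule T.T_diff[OF y(1) c])
        finally have "nm (T'.T (T.T y) n - T'.T (T.T ?c) n) \<le> \<epsilon> / 3" using elim(3) by simp
        moreover have "nm (T'.T (T.T y) n - y n) \<le> nm (T'.T (T.T y) n - T'.T (T.T ?c) n) + nm (T'.T (T.T ?c) n - y n)"
          by (rule nm_triangle)
        moreover have "nm (T'.T (T.T ?c) n - y n) \<le> nm (T'.T (T.T ?c) n - ?c n) + nm (?c n - y n)" by (rule nm_triangle)
        ultimately show ?case using elim(1,2) nm_diff_comm[of "y n" "?c n"] by simp
      qed
    qed
    then show ?thesis using y by (simp add: T.Psi_Q T'.Psi_Q T.T_AC T'.T_AC T.X.Q_eq)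
  qed
qed

lemma (in twin) twin_SEI: "star_extendibly_isomorphic A \<alpha> A' \<alpha>'"
proof -
  interpret T': twin A' \<alpha>' A \<alpha> \<nu> \<mu> \<eta> \<theta> by (rule swap)
  obtain \<Phi> where P: "\<And>k a. a \<in> nest_alg (A k) \<Longrightarrow> \<Phi> (X.lc k a) = Phi0 k a" using Phi_ex by blast
  obtain \<Phi>' where P': "\<And>k a. a \<in> nest_alg (A' k) \<Longrightarrow> \<Phi>' (Y.lc k a) = T'.Phi0 k a" using T'.Phi_ex by blast
  note i = twin_inverse[OF twin_axioms T'.twin_axioms P P'] twin_inverse[OF T'.twin_axioms twin_axioms P' P]
  note p = Phi_props[OF P] T'.Phi_props[OF P']
  have "bij_betw \<Phi> (acarrier (lim_alg A \<alpha>)) (acarrier (lim_alg A' \<alpha>'))"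
    by (rule bij_betw_byWitness[where f' = \<Phi>']) (use i(1,3) p(1,6) in auto)
  then have a: "alg_iso (lim_alg A \<alpha>) (lim_alg A' \<alpha>') \<Phi>" by (simp add: alg_iso_def p)
  have "bij_betw Psi (acarrier (lim_cstar A \<alpha>)) (acarrier (lim_cstar A' \<alpha>'))"
    by (rule bij_betw_byWitness[where f' = T'.Psi]) (use i(2,4) Psi_hom(1) T'.Psi_hom(1) in auto)
  then have "star_alg_iso (lim_cstar A \<alpha>) (lim_cstar A' \<alpha>') Psi"
    by (simp add: star_alg_iso_def alg_iso_def Psi_hom)
  then show ?thesis unfolding star_extendibly_isomorphic_def using a p(2) by blast
qed

text \<open>\<open>R k a m b\<close> stands for: the isomorphism of the limits sends the class of
  \<open>a\<close> at level \<open>k\<close> to the class of \<open>b\<close> at level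
  \<open>m\<close>. The axioms are symmetric under exchange of the systems, so one construction
  yields both families of an intertwining.\<close>

locale correspondence = X: osys A \<alpha> + Y: osys A' \<alpha>' for A \<alpha> A' \<alpha>' +
  fixes R :: "nat \<Rightarrow> fmat \<Rightarrow> nat \<Rightarrow> fmat \<Rightarrow> bool"
  assumes R_FM: "R k a m b \<Longrightarrow> a \<in> FM (A k) \<and> b \<in> FM (A' m)"
    and R_0: "R k 0 m 0"
    and R_add: "R k a m b \<Longrightarrow> R k a' m b' \<Longrightarrow> R k (a + a') m (b + b')"
    and R_mult: "R k a m b \<Longrightarrow> R k a' m b' \<Longrightarrow> R k (a * a') m (b * b')"
    and R_scl: "R k a m b \<Longrightarrow> R k (c \<odot> a) m (c \<odot> b)"
    and R_adj: "R k a m b \<Longrightarrow> R k (adj a) m (adj b)"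
    and R_shift: "R k a m b \<Longrightarrow> k \<le> k' \<Longrightarrow> m \<le> m' \<Longrightarrow> R k' (X.SS k k' a) m' (Y.SS m m' b)"
    and R_fun: "R k a m b \<Longrightarrow> R k a m b' \<Longrightarrow> b = b'"
    and R_inj: "R k a m b \<Longrightarrow> R k a' m b \<Longrightarrow> a = a'"
    and R_tot: "a \<in> NA (A k) \<Longrightarrow> \<exists>m. \<exists>b\<in>NA (A' m). R k a m b"
    and R_onto: "b \<in> NA (A' m) \<Longrightarrow> \<exists>k. \<exists>a\<in>NA (A k). R k a m b"
begin

lemma R_shift2: "R k a m b \<Longrightarrow> m \<le> m' \<Longrightarrow> R k a m' (Y.SS m m' b)"
  using R_shift[of k a m b k m'] by simp

lemma R_sum: "(\<And>x. x \<in> F \<Longrightarrow> R k (f x) m (g x)) \<Longrightarrow> R k (sum f F) m (sum g F)"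
  by (induction F rule: infinite_finite_induct) (auto simp: R_0 R_add)

text \<open>The axioms provide partners for nest algebra elements; a matrix unit outside is split by
  \<open>FM_split\<close> into such an element and the adjoint of another.\<close>

lemma unit_level:
  assumes "unit_sys (A k) X e" "x \<in> X" "y \<in> X"
  shows "\<exists>m b. R k (e x y) m b \<and> (e x y \<in> NA (A k) \<longrightarrow> b \<in> NA (A' m))"
proof (cases "e x y \<in> NA (A k)")
  case False
  have "e x y \<in> FM (A k)" using unit_sysD(9)[OF X.N] assms by blast
  then obtain b c where bc: "b \<in> NA (A k)" "c \<in> NA (A k)" "e x y = b + adj c" using FM_split[OF X.N] by metis
  obtain m b' where b': "R k b m b'" using R_tot[OF bc(1)] by blast
  obtain n c' where c': "R k c n c'" using R_tot[OF bc(2)] by blast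
  have "R k (e x y) (max m n) (Y.SS m (max m n) b' + adj (Y.SS n (max m n) c'))"
    unfolding bc(3) by (intro R_add R_adj R_shift2 b' c') auto
  then show ?thesis using False by blast
qed (use R_tot in blast)

text \<open>Partners for the finitely many matrix units, moved to a common level, determine partners
  for all elements. Triangularity survives because an element of \<open>NA\<close> has only matrix
  units from \<open>NA\<close> in its expansion.\<close>

lemma level: "\<exists>M. \<forall>m\<ge>M. (\<forall>a\<in>FM (A k). \<exists>b. R k a m b) \<and> (\<forall>a\<in>NA (A k). \<exists>b\<in>NA (A' m). R k a m b)"
proof -
  obtain X e where X: "unit_sys (A k) X e" using unit_sys_ex[OF X.N] by blast
  note u = unit_sysD[OF X.N X]
  obtain l h where h: "\<And>x y. x \<in> X \<Longrightarrow> y \<in> X \<Longrightarrow> R k (e x y) (l x y) (h x y) \<and> (e x y \<in> NA (A k) \<longrightarrow> h x y \<in> NA (A' (l x y)))"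
    using unit_level[OF X] by metis
  define M where "M = (\<Sum>x\<in>X. \<Sum>y\<in>X. l x y)"
  have le: "l x y \<le> M" if "x \<in> X" "y \<in> X" for x y unfolding M_def by (rule le_sum2[OF u(1,1) that])
  have "(\<forall>a\<in>FM (A k). \<exists>b. R k a m b) \<and> (\<forall>a\<in>NA (A k). \<exists>b\<in>NA (A' m). R k a m b)" if m: "m \<ge> M" for m
  proof -
    define g where "g x y = Y.SS (l x y) m (h x y)" for x y
    have lm: "l x y \<le> m" if "x \<in> X" "y \<in> X" for x y using le[OF that] m by simp
    have g: "R k (e x y) m (g x y)" "e x y \<in> NA (A k) \<Longrightarrow> g x y \<in> NA (A' m)" if "x \<in> X" "y \<in> X" for x y
      using h[OF that] R_shift2[OF _ lm[OF that]] SHD(6)[OF Y.SS_SH[OF lm[OF that]]] by (auto simp: g_def)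
    have r: "R k a m (\<Sum>x\<in>X. \<Sum>y\<in>X. tr (a * e y x) \<odot> g x y)" if "a \<in> FM (A k)" for a
      by (subst (1) unit_sys_expand[OF X.N X that]) (intro R_sum R_scl g)
    have n: "(\<Sum>x\<in>X. \<Sum>y\<in>X. tr (a * e y x) \<odot> g x y) \<in> NA (A' m)" if a: "a \<in> NA (A k)" for a
    proof (intro NA_sum)
      fix x y assume xy: "x \<in> X" "y \<in> X"
      let ?c = "tr (a * e y x)"
      have "e x x \<in> NA (A k)" "e y y \<in> NA (A k)" using blk_DA[OF X.N] u(6) xy DA_NA by blast+
      then have "?c \<odot> e x y \<in> NA (A k)" using a by (simp add: NA_mult[OF X.N] unit_sys_cut[OF X.N X xy, symmetric])
      then have "(1 / ?c) \<odot> (?c \<odot> e x y) \<in> NA (A k)" by (rule NA_closed)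
      then show "?c \<odot> g x y \<in> NA (A' m)" using g(2)[OF xy] by (cases "?c = 0") (auto simp: NA_closed)
    qed
    show ?thesis using r n NA_FM by blast
  qed
  then show ?thesis by blast
qed

lemma levelwise:
  "\<exists>\<mu> \<theta>. mono \<mu> \<and> (\<forall>k. k < \<mu> k) \<and> (\<forall>k. SH (A k) (A' (\<mu> k)) (\<theta> k)) \<and> (\<forall>k. \<forall>a\<in>FM (A k). R k a (\<mu> k) (\<theta> k a))"
proof -
  obtain M where M: "\<And>k m. M k \<le> m \<Longrightarrow> (\<forall>a\<in>FM (A k). \<exists>b. R k a m b) \<and> (\<forall>a\<in>NA (A k). \<exists>b\<in>NA (A' m). R k a m b)"
    using level by metis
  \<comment> \<open>Adding all earlier bounds makes \<open>\<mu>\<close> monotone, and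
    \<open>Suc k\<close> makes it exceed \<open>k\<close>.\<close>
  define \<mu> where "\<mu> k = Suc k + sum M {..k}" for k
  have "M k \<le> \<mu> k" for k using member_le_sum[of k "{..k}" M] by (simp add: \<mu>_def)
  note M' = M[OF this]
  then obtain \<theta> where th: "\<And>k a. a \<in> FM (A k) \<Longrightarrow> R k a (\<mu> k) (\<theta> k a)" by metis
  have "mono \<mu>" by (rule monoI, unfold \<mu>_def, intro add_mono sum_mono2) auto
  moreover have "SH (A k) (A' (\<mu> k)) (\<theta> k)" for k unfolding SH_def
  proof (intro conjI ballI allI)
    fix a assume a: "a \<in> FM (A k)"
    note t = th[OF a]
    show "\<theta> k a \<in> FM (A' (\<mu> k))" using R_FM[OF t] by blast
    show "\<theta> k (c \<odot> a) = c \<odot> \<theta> k a" for c by (rule R_fun[OF th R_scl[OF t]]) (simp add: a)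
    show "\<theta> k (adj a) = adj (\<theta> k a)" by (rule R_fun[OF th R_adj[OF t]]) (simp add: a)
    show "\<theta> k (a + b) = \<theta> k a + \<theta> k b" "\<theta> k (a * b) = \<theta> k a * \<theta> k b" if b: "b \<in> FM (A k)" for b
      by (rule R_fun[OF th R_add[OF t th[OF b]]], simp add: a b, rule R_fun[OF th R_mult[OF t th[OF b]]], simp add: a b)
  next
    fix a assume a: "a \<in> NA (A k)"
    then obtain b where "b \<in> NA (A' (\<mu> k))" "R k a (\<mu> k) b" using M' by blast
    then show "\<theta> k a \<in> NA (A' (\<mu> k))" using R_fun[OF th[OF NA_FM[OF a]]] by metis
  qed
  moreover have "k < \<mu> k" for k by (simp add: \<mu>_def)
  ultimately show ?thesis using th by blast
qed

end

text \<open>All squares and triangles commute by uniqueness of partners: both sides are related to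
  the same element.\<close>

lemma correspondence_twine:
  assumes "correspondence A \<alpha> A' \<alpha>' R"
  shows "\<exists>\<mu> \<nu> \<theta> \<eta>. twine A \<alpha> A' \<alpha>' \<mu> \<nu> \<theta> \<eta>"
proof -
  interpret C: correspondence A \<alpha> A' \<alpha>' R by (rule assms)
  interpret C': correspondence A' \<alpha>' A \<alpha> "\<lambda>m b k a. R k a m b"
    by (intro correspondence.intro C.Y.osys_axioms C.X.osys_axioms correspondence_axioms.intro)
      (use C.R_FM in blast, rule C.R_0, erule (1) C.R_add, erule (1) C.R_mult, erule C.R_scl, erule C.R_adj,
        rule C.R_shift, assumption+, erule (1) C.R_inj, erule (1) C.R_fun, erule C.R_onto, erule C.R_tot)
  obtain \<mu> \<theta> where m: "mono \<mu>" "\<And>k. k < \<mu> k" "\<And>k. SH (A k) (A' (\<mu> k)) (\<theta> k)" "\<And>k a. a \<in> FM (A k) \<Longrightarrow> R k a (\<mu> k) (\<theta> k a)"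
    using C.levelwise by blast
  obtain \<nu> \<eta> where n: "mono \<nu>" "\<And>k. k < \<nu> k" "\<And>k. SH (A' k) (A (\<nu> k)) (\<eta> k)" "\<And>k a. a \<in> FM (A' k) \<Longrightarrow> R (\<nu> k) (\<eta> k a) k a"
    using C'.levelwise by blast
  have "twine A \<alpha> A' \<alpha>' \<mu> \<nu> \<theta> \<eta>" unfolding twine_def
  proof (intro conjI allI ballI m(1,3) n(1,3))
    show l: "k < \<nu> (\<mu> k)" for k using m(2)[of k] n(2)[of "\<mu> k"] by simp
    show r: "k < \<mu> (\<nu> k)" for k using n(2)[of k] m(2)[of "\<nu> k"] by simp
    fix k a
    {
      assume a: "a \<in> FM (A k)"
      have "R (Suc k) (C.X.S k a) (\<mu> (Suc k)) (C.Y.SS (\<mu> k) (\<mu> (Suc k)) (\<theta> k a))"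
        using C.R_shift[OF m(4)[OF a], of "Suc k" "\<mu> (Suc k)"] m(1) by (simp add: mono_def C.X.SS_one)
      then show "C.Y.SS (\<mu> k) (\<mu> (Suc k)) (\<theta> k a) = \<theta> (Suc k) (C.X.S k a)"
        by (rule C.R_fun) (rule m(4)[OF SHD(1)[OF C.X.S_SH a]])
      have "R (\<nu> (\<mu> k)) (C.X.SS k (\<nu> (\<mu> k)) a) (\<mu> k) (\<theta> k a)"
        using C.R_shift[OF m(4)[OF a], of "\<nu> (\<mu> k)" "\<mu> k"] l[of k] by simp
      then show "\<eta> (\<mu> k) (\<theta> k a) = C.X.SS k (\<nu> (\<mu> k)) a"
        using C.R_inj n(4)[OF SHD(1)[OF m(3) a]] by blast
    }
    {
      assume a: "a \<in> FM (A' k)"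
      have "R (\<nu> (Suc k)) (C.X.SS (\<nu> k) (\<nu> (Suc k)) (\<eta> k a)) (Suc k) (C.Y.S k a)"
        using C.R_shift[OF n(4)[OF a], of "\<nu> (Suc k)" "Suc k"] n(1) by (simp add: mono_def C.Y.SS_one)
      then show "C.X.SS (\<nu> k) (\<nu> (Suc k)) (\<eta> k a) = \<eta> (Suc k) (C.Y.S k a)"
        by (rule C.R_inj) (rule n(4)[OF SHD(1)[OF C.Y.S_SH a]])
      have "R (\<nu> k) (\<eta> k a) (\<mu> (\<nu> k)) (C.Y.SS k (\<mu> (\<nu> k)) a)"
        using C.R_shift[OF n(4)[OF a], of "\<nu> k" "\<mu> (\<nu> k)"] r[of k] by simp
      then show "\<theta> (\<nu> k) (\<eta> k a) = C.Y.SS k (\<mu> (\<nu> k)) a"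
        using C.R_fun m(4)[OF SHD(1)[OF n(3) a]] by blast
    }
  qed
  then show ?thesis by blast
qed

text \<open>Partners exist for nest algebra elements because \<open>\<Psi>\<close> extends the
  isomorphism \<open>\<Phi>\<close> of the algebraic limits, whose elements live at finite levels.
  They are unique since each level embeds injectively into the C*-limit.\<close>

lemma SEI_twine:
  assumes oX: "osys A \<alpha>" and oY: "osys A' \<alpha>'" and sei: "star_extendibly_isomorphic A \<alpha> A' \<alpha>'"
  shows "\<exists>\<mu> \<nu> \<theta> \<eta>. twine A \<alpha> A' \<alpha>' \<mu> \<nu> \<theta> \<eta>"
proof -
  interpret X: osys A \<alpha> by (rule oX)
  interpret Y: osys A' \<alpha>' by (rule oY)
  obtain \<Phi> \<Psi> where P: "alg_iso X.Alg Y.Alg \<Phi>" "star_alg_iso X.Cst Y.Cst \<Psi>"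
    "\<And>x. x \<in> acarrier X.Alg \<Longrightarrow> \<Psi> (lim_embed A \<alpha> x) = lim_embed A' \<alpha>' (\<Phi> x)"
    using sei unfolding star_extendibly_isomorphic_def by blast
  have psi: "\<And>x. x \<in> acarrier X.Cst \<Longrightarrow> \<Psi> x \<in> acarrier Y.Cst"
    "inj_on \<Psi> (acarrier X.Cst)"
    "\<And>x y. x \<in> acarrier X.Cst \<Longrightarrow> y \<in> acarrier X.Cst \<Longrightarrow>
      \<Psi> (aplus X.Cst x y) = aplus Y.Cst (\<Psi> x) (\<Psi> y)"
    "\<And>x y. x \<in> acarrier X.Cst \<Longrightarrow> y \<in> acarrier X.Cst \<Longrightarrow>
      \<Psi> (atimes X.Cst x y) = atimes Y.Cst (\<Psi> x) (\<Psi> y)"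
    "\<And>x c. x \<in> acarrier X.Cst \<Longrightarrow> \<Psi> (ascale X.Cst c x) = ascale Y.Cst c (\<Psi> x)"
    "\<And>x. x \<in> acarrier X.Cst \<Longrightarrow> \<Psi> (astar X.Cst x) = astar Y.Cst (\<Psi> x)"
    using P(2) unfolding star_alg_iso_def alg_iso_def bij_betw_def by blast+
  define R where "R k a m b \<longleftrightarrow> a \<in> FM (A k) \<and> b \<in> FM (A' m) \<and> \<Psi> (X.E k a) = Y.E m b" for k a m b
  have rel0: "a \<in> FM (A k) \<and> b \<in> FM (A' m)" if "R k a m b" for k a m b using that by (simp add: R_def)
  have rel1: "R k 0 m 0" for k m
  proof -
    obtain y where y: "y \<in> Y.AC" "\<Psi> (X.E k 0) = Y.Q y" using psi(1)[OF X.E_in[of 0 k]] by (auto simp: Y.cstar_carrier)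
    \<comment> \<open>\<open>\<Psi>\<close> is only known to respect the operations, so the zero
      class is recognised as a multiple by the scalar 0.\<close>
    have "X.E k 0 = ascale X.Cst 0 (X.E k 0)" by (simp add: X.E_ops)
    then have "\<Psi> (X.E k 0) = ascale Y.Cst 0 (Y.Q y)" using psi(5)[OF X.E_in[of 0 k], of 0] y by simp
    also have "\<dots> = Y.Q (\<lambda>n. 0)" using Y.Q_scl[OF y(1), of 0] by simp
    also have "\<dots> = Y.E m 0" unfolding Y.E_def using SHD(7)[OF Y.SS_SH]
      by (intro arg_cong[of _ _ Y.Q]) (auto simp: Y.coh_def)
    finally show ?thesis by (simp add: R_def)
  qed
  have rel2: "\<exists>m. \<exists>b\<in>NA (A' m). R k a m b" if a: "a \<in> NA (A k)" for k a
  proof -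
    let ?a = "me (msize (A k)) a"
    have m: "?a \<in> nest_alg (A k)" "em ?a = a" using a by (auto simp: me_nest_alg[OF X.N] FM_me NA_FM)
    then have x: "X.lc k ?a \<in> acarrier X.Alg" by (simp add: X.lim_alg_carrier X.L.cls_in)
    then have "\<Phi> (X.lc k ?a) \<in> acarrier Y.Alg" using P(1) unfolding alg_iso_def by (meson bij_betw_apply)
    then obtain n b where b: "b \<in> nest_alg (A' n)" "\<Phi> (X.lc k ?a) = Y.lc n b"
      unfolding Y.lim_alg_carrier using Y.L.dlim_cases by metis
    have "em b \<in> NA (A' n)" using b nest_alg_iff[OF Y.N] Y.nest_alg_full by blast
    moreover have "R k a n (em b)" using P(3)[OF x] b m a calculation
      by (simp add: R_def X.lim_embed_lc Y.lim_embed_lc NA_FM)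
    ultimately show ?thesis by blast
  qed
  have rel3: "\<exists>k. \<exists>a\<in>NA (A k). R k a m b" if b: "b \<in> NA (A' m)" for m b
  proof -
    let ?b = "me (msize (A' m)) b"
    have m: "?b \<in> nest_alg (A' m)" "em ?b = b" using b by (auto simp: me_nest_alg[OF Y.N] FM_me NA_FM)
    then have "Y.lc m ?b \<in> acarrier Y.Alg" by (simp add: Y.lim_alg_carrier Y.L.cls_in)
    then have "Y.lc m ?b \<in> \<Phi> ` acarrier X.Alg" using P(1) by (simp add: alg_iso_def bij_betw_def)
    then obtain x where x: "x \<in> acarrier X.Alg" "\<Phi> x = Y.lc m ?b" by (metis imageE)
    then obtain k a where a: "a \<in> nest_alg (A k)" "x = X.lc k a"
      unfolding X.lim_alg_carrier using X.L.dlim_cases by metis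
    have "em a \<in> NA (A k)" using a nest_alg_iff[OF X.N] X.nest_alg_full by blast
    moreover have "R k (em a) m b" using P(3)[OF x(1)] x(2) a m b calculation
      by (simp add: R_def X.lim_embed_lc Y.lim_embed_lc NA_FM)
    ultimately show ?thesis by blast
  qed
  have rel4: "R k' (X.SS k k' a) m' (Y.SS m m' b)" if "R k a m b" "k \<le> k'" "m \<le> m'" for k a m b k' m'
    using that by (simp add: R_def X.SS_FM Y.SS_FM X.E_shift Y.E_shift)
  have rel5: "b = b'" if "R k a m b" "R k a m b'" for k a m b b'
    using that Y.E_inj[of b m b'] by (simp add: R_def)
  have rel6: "a = a'" if "R k a m b" "R k a' m b" for k a a' m b
    using that X.E_inj[of a k a'] inj_onD[OF psi(2), of "X.E k a" "X.E k a'"] by (simp add: R_def X.E_in)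
  have rel7: "R k (a + a') m (b + b')" "R k (a * a') m (b * b')" if "R k a m b" "R k a' m b'" for k a a' m b b'
    using that psi(3,4)[of "X.E k a" "X.E k a'"] by (simp_all add: R_def X.E_in X.E_ops Y.E_ops)
  have rel8: "R k (c \<odot> a) m (c \<odot> b)" "R k (adj a) m (adj b)" if "R k a m b" for k a m b c
    using that psi(5,6)[of "X.E k a"] by (simp_all add: R_def X.E_in X.E_ops Y.E_ops)
  have "correspondence A \<alpha> A' \<alpha>' R"
    by (intro correspondence.intro oX oY correspondence_axioms.intro) (fact rel0 rel1 rel2 rel3 rel4 rel5 rel6 rel7 rel8)+
  then show ?thesis by (rule correspondence_twine)
qed

theorem theorem5p11:
  fixes A A' :: "nat \<Rightarrow> nest"
    and \<alpha> \<alpha>' :: "nat \<Rightarrow> complex mat \<Rightarrow> complex mat"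
  assumes "order_preserving_system A \<alpha>" and "order_preserving_system A' \<alpha>'"
  shows "star_extendibly_isomorphic A \<alpha> A' \<alpha>' \<longleftrightarrow>
    (\<exists>\<gamma>. Inv_iso A \<alpha> A' \<alpha>' \<gamma> \<and> \<gamma> ` lim_Sigma_op A \<alpha> = lim_Sigma_op A' \<alpha>')"
proof -
  have o: "osys A \<alpha>" "osys A' \<alpha>'" using assms by (auto intro: osys.intro)
  note tw = twin.intro[OF o twin_axioms.intro]
  show ?thesis
  proof
    assume "star_extendibly_isomorphic A \<alpha> A' \<alpha>'"
    from SEI_twine[OF o this] show "\<exists>\<gamma>. Inv_iso A \<alpha> A' \<alpha>' \<gamma> \<and> \<gamma> ` lim_Sigma_op A \<alpha> = lim_Sigma_op A' \<alpha>'"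
      using twin.twin_Inv_iso[OF tw] by blast
  next
    assume "\<exists>\<gamma>. Inv_iso A \<alpha> A' \<alpha>' \<gamma> \<and> \<gamma> ` lim_Sigma_op A \<alpha> = lim_Sigma_op A' \<alpha>'"
    then obtain \<gamma> where "gam A \<alpha> A' \<alpha>' \<gamma>" using o by (auto intro: gam.intro gam_axioms.intro)
    from gam_twine[OF this] show "star_extendibly_isomorphic A \<alpha> A' \<alpha>'"
      using twin.twin_SEI[OF tw] by blast
  qed
qed

end
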